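(* Let $n\ge 2$ and, for real $m\ge 1/2$, let $E_{2m}=\{z\in\mathbb{C}^n: |z_1|^{2m}+|z_2|^2+\dots+|z_n|^2<1\}$ and $Z=E_{2m}\cap\{z_1=0\}$. (i) Let $1/2<m<1$. Then $\partial E_{2m}$ is $C^1$-smooth but not $C^2$-smooth. The Wu metric on $E_{2m}$ is a $C^1$-smooth Hermitian metric which is real analytic on $E_{2m}\setminus Z$. At points of $Z$, the Wu metric is of class $C^{1,2m-1}$ but not of class $C^2$. (ii) For $m=1/2$, the Wu metric on $E_{2m}$ is a continuous Hermitian metric which is real analytic on $E_{2m}\setminus Z$. (iii) For $1/2\le m<1$, the Wu metric on $E_{2m}$ is nowhere Kähler, and its holomorphic curvature is bounded above, in the sense of currents, by a negative constant independent of $m$.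
   Context: Kobayashi metric: $K_{E_{2m}}(p,v)$ is the infinitesimal Kobayashi metric, normalized so that on the unit disc it is $|v|/(1-|z|^2)$. Wu metric: the (Hermitian) metric whose unit ball in each tangent space $T_pE_{2m}\cong\mathbb{C}^n$ is the ellipsoid centred at the origin (image of the Euclidean unit ball of $\mathbb{C}^n$ under a complex linear automorphism) of minimal volume containing the Kobayashi unit ball $\{v: K_{E_{2m}}(p,v)<1\}$. Smoothness of a Hermitian metric $\sum h_{i\bar j}\,dz_i\otimes d\bar z_j$ refers to smoothness of the coefficient functions $h_{i\bar j}$; "class $C^{1,\alpha}$ at points of $Z$" means in a neighbourhood of each point of $Z$. "Nowhere Kähler" means that the metric is not Kähler on any nonempty open subset. Holomorphic curvature means holomorphic sectional curvature. For a continuous Hermitian metric $h$, the holomorphic curvature is said to be bounded above by $-c$ (with $c>0$) in the sense of currents if for every embedded Riemann surface (one-dimensional complex submanifold), with local coordinate $\zeta$ and induced metric $\lambda\,d\zeta\otimes d\bar\zeta$, one has $\partial^2\log\lambda/\partial\zeta\,\partial\bar\zeta\ge c\,\lambda$ in the sense of distributions. *)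

theory Defs
  imports "HOL-Analysis.Analysis"
begin

section \<open>Regularity of functions of several real variables\<close>

text \<open>Only meant for open sets \<open>U\<close>. In finite dimension, continuity of all iterated directional
  derivatives is continuity of the iterated Frechet derivatives.\<close>

primrec Ck_on :: "nat \<Rightarrow> ('a::real_normed_vector \<Rightarrow> 'b::real_normed_vector) \<Rightarrow> 'a set \<Rightarrow> bool" where
  "Ck_on 0 f U \<longleftrightarrow> continuous_on U f"
| "Ck_on (Suc k) f U \<longleftrightarrow>
     (\<forall>x\<in>U. f differentiable (at x)) \<and> (\<forall>v. Ck_on k (\<lambda>x. frechet_derivative f (at x) v) U)"

definition C1_holder_on :: "real \<Rightarrow> ('a::real_normed_vector \<Rightarrow> 'b::real_normed_vector) \<Rightarrow> 'a set \<Rightarrow> bool" where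
  "C1_holder_on \<alpha> f U \<longleftrightarrow> Ck_on 1 f U \<and>
     (\<forall>v. \<exists>C. \<forall>x\<in>U. \<forall>y\<in>U.
        norm (frechet_derivative f (at x) v - frechet_derivative f (at y) v) \<le> C * dist x y powr \<alpha>)"

text \<open>Local expansion in an (unconditionally, hence absolutely) convergent power series; the
  multi-indices are the functions \<open>\<alpha> \<in> Basis \<rightarrow>\<^sub>E UNIV\<close>.\<close>

definition real_analytic_on :: "('a::euclidean_space \<Rightarrow> 'b::real_normed_vector) \<Rightarrow> 'a set \<Rightarrow> bool" where
  "real_analytic_on f U \<longleftrightarrow>
     (\<forall>x0\<in>U. \<exists>r>0. \<exists>c :: ('a \<Rightarrow> nat) \<Rightarrow> 'b. \<forall>x\<in>ball x0 r.
        ((\<lambda>\<alpha>. (\<Prod>b\<in>Basis. ((x - x0) \<bullet> b) ^ \<alpha> b) *\<^sub>R c \<alpha>) has_sum f x) (Basis \<rightarrow>\<^sub>E UNIV))"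

definition has_Ck_boundary :: "nat \<Rightarrow> 'a::real_normed_vector set \<Rightarrow> bool" where
  "has_Ck_boundary k D \<longleftrightarrow>
     (\<forall>p\<in>frontier D. \<exists>U r. open U \<and> p \<in> U \<and> Ck_on k (r :: 'a \<Rightarrow> real) U \<and>
        D \<inter> U = {x \<in> U. r x < 0} \<and> frontier D \<inter> U = {x \<in> U. r x = 0} \<and>
        (\<forall>x\<in>frontier D \<inter> U. \<exists>v. frechet_derivative r (at x) v \<noteq> 0))"


section \<open>The domains\<close>

text \<open>The index \<open>a\<close> plays the role of the first coordinate.\<close>

definition egg :: "'n::finite \<Rightarrow> real \<Rightarrow> (complex ^ 'n) set" where
  "egg a m = {z. cmod (z $ a) powr (2 * m) + (\<Sum>j\<in>UNIV - {a}. (cmod (z $ j))\<^sup>2) < 1}"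

definition egg_Z :: "'n::finite \<Rightarrow> real \<Rightarrow> (complex ^ 'n) set" where
  "egg_Z a m = egg a m \<inter> {z. z $ a = 0}"


section \<open>The Kobayashi metric and the Wu metric\<close>

definition vderiv :: "(complex \<Rightarrow> complex ^ 'n) \<Rightarrow> complex \<Rightarrow> complex ^ 'n" where
  "vderiv f \<zeta> = (\<chi> j. deriv (\<lambda>w. f w $ j) \<zeta>)"

definition holomorphic_map_on :: "(complex \<Rightarrow> complex ^ 'n) \<Rightarrow> complex set \<Rightarrow> bool" where
  "holomorphic_map_on f V \<longleftrightarrow> (\<forall>j. (\<lambda>w. f w $ j) holomorphic_on V)"

text \<open>By the Schwarz-Pick lemma this is \<open>|v| / (1 - |z|\<^sup>2)\<close> on the unit disc.\<close>

definition kobayashi :: "(complex ^ 'n::finite) set \<Rightarrow> complex ^ 'n \<Rightarrow> complex ^ 'n \<Rightarrow> real" where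
  "kobayashi D p v =
     Inf {cmod t | t. \<exists>f. holomorphic_map_on f (ball 0 1) \<and> f ` ball 0 1 \<subseteq> D \<and> f 0 = p \<and>
                          t *s vderiv f 0 = v}"

definition ellipsoid :: "(complex ^ 'n::finite) set \<Rightarrow> bool" where
  "ellipsoid S \<longleftrightarrow> (\<exists>A :: complex ^ 'n ^ 'n. invertible A \<and> S = (*v) A ` ball 0 1)"

definition min_ellipsoid :: "(complex ^ 'n::finite) set \<Rightarrow> (complex ^ 'n) set \<Rightarrow> bool" where
  "min_ellipsoid K S \<longleftrightarrow> ellipsoid S \<and> K \<subseteq> S \<and>
     (\<forall>T. ellipsoid T \<and> K \<subseteq> T \<longrightarrow> measure lborel S \<le> measure lborel T)"

text \<open>The entry \<open>H $ i $ j\<close> is the coefficient of \<open>dz\<^sub>i \<otimes> d(cnj z\<^sub>j)\<close>.\<close>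

definition herm_form :: "complex ^ 'n ^ 'n \<Rightarrow> complex ^ 'n::finite \<Rightarrow> complex ^ 'n \<Rightarrow> complex" where
  "herm_form H u v = (\<Sum>i\<in>UNIV. \<Sum>j\<in>UNIV. H $ i $ j * u $ i * cnj (v $ j))"

definition pos_hermitian :: "complex ^ 'n ^ 'n::finite \<Rightarrow> bool" where
  "pos_hermitian H \<longleftrightarrow> (\<forall>i j. H $ j $ i = cnj (H $ i $ j)) \<and> (\<forall>v. v \<noteq> 0 \<longrightarrow> Re (herm_form H v v) > 0)"

definition wu_metric :: "(complex ^ 'n::finite) set \<Rightarrow> complex ^ 'n \<Rightarrow> complex ^ 'n ^ 'n" where
  "wu_metric D p =
     (THE H. pos_hermitian H \<and>
             min_ellipsoid {v. kobayashi D p v < 1} {v. Re (herm_form H v v) < 1})"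


section \<open>Hermitian metrics\<close>

definition hermitian_metric_on ::
    "(complex ^ 'n \<Rightarrow> complex ^ 'n ^ 'n) \<Rightarrow> (complex ^ 'n::finite) set \<Rightarrow> bool" where
  "hermitian_metric_on h U \<longleftrightarrow> (\<forall>p\<in>U. pos_hermitian (h p))"

definition metric_continuous_on ::
    "(complex ^ 'n \<Rightarrow> complex ^ 'n ^ 'n) \<Rightarrow> (complex ^ 'n::finite) set \<Rightarrow> bool" where
  "metric_continuous_on h U \<longleftrightarrow> (\<forall>i j. continuous_on U (\<lambda>p. h p $ i $ j))"

definition metric_Ck_on ::
    "nat \<Rightarrow> (complex ^ 'n \<Rightarrow> complex ^ 'n ^ 'n) \<Rightarrow> (complex ^ 'n::finite) set \<Rightarrow> bool" where
  "metric_Ck_on k h U \<longleftrightarrow> (\<forall>i j. Ck_on k (\<lambda>p. h p $ i $ j) U)"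

definition metric_C1_holder_on ::
    "real \<Rightarrow> (complex ^ 'n \<Rightarrow> complex ^ 'n ^ 'n) \<Rightarrow> (complex ^ 'n::finite) set \<Rightarrow> bool" where
  "metric_C1_holder_on \<alpha> h U \<longleftrightarrow> (\<forall>i j. C1_holder_on \<alpha> (\<lambda>p. h p $ i $ j) U)"

definition metric_real_analytic_on ::
    "(complex ^ 'n \<Rightarrow> complex ^ 'n ^ 'n) \<Rightarrow> (complex ^ 'n::finite) set \<Rightarrow> bool" where
  "metric_real_analytic_on h U \<longleftrightarrow> (\<forall>i j. real_analytic_on (\<lambda>p. h p $ i $ j) U)"

text \<open>The fundamental form is \<open>\<omega>(u, v) = g(J u, v)\<close> with \<open>g = Re h\<close>; its exterior derivative is
  evaluated on constant vector fields.\<close>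

definition fundamental_form ::
    "(complex ^ 'n \<Rightarrow> complex ^ 'n ^ 'n) \<Rightarrow> complex ^ 'n \<Rightarrow> complex ^ 'n \<Rightarrow> complex ^ 'n::finite \<Rightarrow> real" where
  "fundamental_form h p u v = Re (herm_form (h p) (\<i> *s u) v)"

definition ext_deriv2 ::
    "('a::real_normed_vector \<Rightarrow> 'a \<Rightarrow> 'a \<Rightarrow> real) \<Rightarrow> 'a \<Rightarrow> 'a \<Rightarrow> 'a \<Rightarrow> 'a \<Rightarrow> real" where
  "ext_deriv2 \<omega> p u v w =
     frechet_derivative (\<lambda>q. \<omega> q v w) (at p) u
   - frechet_derivative (\<lambda>q. \<omega> q u w) (at p) v
   + frechet_derivative (\<lambda>q. \<omega> q u v) (at p) w"

definition kahler_on ::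
    "(complex ^ 'n \<Rightarrow> complex ^ 'n ^ 'n) \<Rightarrow> (complex ^ 'n::finite) set \<Rightarrow> bool" where
  "kahler_on h U \<longleftrightarrow> hermitian_metric_on h U \<and> metric_Ck_on 1 h U \<and>
     (\<forall>p\<in>U. \<forall>u v w. ext_deriv2 (fundamental_form h) p u v w = 0)"

definition nowhere_kahler_on ::
    "(complex ^ 'n \<Rightarrow> complex ^ 'n ^ 'n) \<Rightarrow> (complex ^ 'n::finite) set \<Rightarrow> bool" where
  "nowhere_kahler_on h D \<longleftrightarrow> (\<forall>U. open U \<and> U \<noteq> {} \<and> U \<subseteq> D \<longrightarrow> \<not> kahler_on h U)"


section \<open>Holomorphic curvature in the sense of currents\<close>

text \<open>\<open>\<phi>\<close> is the inverse of a local coordinate \<open>\<zeta>\<close> of \<open>S\<close>, with values in the open set \<open>V\<close>.\<close>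

definition local_param :: "(complex ^ 'n::finite) set \<Rightarrow> complex set \<Rightarrow> (complex \<Rightarrow> complex ^ 'n) \<Rightarrow> bool" where
  "local_param S V \<phi> \<longleftrightarrow> open V \<and> holomorphic_map_on \<phi> V \<and> (\<forall>\<zeta>\<in>V. vderiv \<phi> \<zeta> \<noteq> 0) \<and>
     (\<exists>W \<psi>. open W \<and> homeomorphism V (S \<inter> W) \<phi> \<psi>)"

definition embedded_riemann_surface :: "(complex ^ 'n::finite) set \<Rightarrow> bool" where
  "embedded_riemann_surface S \<longleftrightarrow> (\<forall>p\<in>S. \<exists>V \<phi>. local_param S V \<phi> \<and> p \<in> \<phi> ` V)"

definition induced_metric ::
    "(complex ^ 'n \<Rightarrow> complex ^ 'n ^ 'n) \<Rightarrow> (complex \<Rightarrow> complex ^ 'n::finite) \<Rightarrow> complex \<Rightarrow> real" where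
  "induced_metric h \<phi> \<zeta> = Re (herm_form (h (\<phi> \<zeta>)) (vderiv \<phi> \<zeta>) (vderiv \<phi> \<zeta>))"

definition d_z :: "(complex \<Rightarrow> complex) \<Rightarrow> complex \<Rightarrow> complex" where
  "d_z f \<zeta> = (frechet_derivative f (at \<zeta>) 1 - \<i> * frechet_derivative f (at \<zeta>) \<i>) / 2"

definition d_zbar :: "(complex \<Rightarrow> complex) \<Rightarrow> complex \<Rightarrow> complex" where
  "d_zbar f \<zeta> = (frechet_derivative f (at \<zeta>) 1 + \<i> * frechet_derivative f (at \<zeta>) \<i>) / 2"

definition test_function :: "complex set \<Rightarrow> (complex \<Rightarrow> real) \<Rightarrow> bool" where
  "test_function V \<eta> \<longleftrightarrow> (\<forall>k. Ck_on k \<eta> UNIV) \<and> compact (closure {x. \<eta> x \<noteq> 0}) \<and> closure {x. \<eta> x \<noteq> 0} \<subseteq> V"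

text \<open>The inequality \<open>\<partial>\<^sup>2u/\<partial>\<zeta>\<partial>(cnj \<zeta>) \<ge> w\<close> between distributions on \<open>V\<close>, for continuous \<open>u\<close> and \<open>w\<close>.\<close>

definition ddbar_ge_distr :: "complex set \<Rightarrow> (complex \<Rightarrow> real) \<Rightarrow> (complex \<Rightarrow> real) \<Rightarrow> bool" where
  "ddbar_ge_distr V u w \<longleftrightarrow>
     (\<forall>\<eta>. test_function V \<eta> \<and> (\<forall>\<zeta>. \<eta> \<zeta> \<ge> 0) \<longrightarrow>
        (LINT \<zeta>:V|lborel. u \<zeta> * Re (d_z (d_zbar (\<lambda>x. complex_of_real (\<eta> x))) \<zeta>))
          \<ge> (LINT \<zeta>:V|lborel. w \<zeta> * \<eta> \<zeta>))"

text \<open>The holomorphic curvature of \<open>h\<close> on \<open>D\<close> is at most \<open>-c\<close>.\<close>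

definition hol_curvature_bounded_by_neg ::
    "(complex ^ 'n \<Rightarrow> complex ^ 'n ^ 'n) \<Rightarrow> (complex ^ 'n::finite) set \<Rightarrow> real \<Rightarrow> bool" where
  "hol_curvature_bounded_by_neg h D c \<longleftrightarrow>
     (\<forall>S V \<phi>. embedded_riemann_surface S \<and> S \<subseteq> D \<and> local_param S V \<phi> \<longrightarrow>
        ddbar_ge_distr V (\<lambda>\<zeta>. ln (induced_metric h \<phi> \<zeta>)) (\<lambda>\<zeta>. c * induced_metric h \<phi> \<zeta>))"

end

theory Submission
  imports Defs "HOL-Complex_Analysis.Conformal_Mappings"
begin

text \<open>Automorphisms of the egg move every point to a point \<open>(p, 0, \<dots>, 0)\<close>. There a Schwarz
  lemma for holomorphic discs, obtained from the maximum principle, places the Kobayashi ball inside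
  an explicit ellipsoid that it touches along the first axis and along the orthogonal complement of
  that axis; an ellipsoid with these contacts has the smallest volume, so the Wu metric is an explicit
  Hermitian form. Its coefficients are real analytic functions of \<open>z\<close>, \<open>cnj z\<close> and
  \<open>cmod z\<^sub>1 powr (2 * m)\<close>, which gives the regularity statements, and its exterior derivative is computed.

  For the curvature, let \<open>\<lambda>\<close> be the induced metric of a disc \<open>\<phi>\<close>. A covector \<open>D\<close> with dual norm \<open>N\<close> gives
  \<open>ln \<lambda> \<ge> ln (cmod (D \<phi>'))\<^sup>2 - ln N(\<phi>)\<close>, with equality at one chosen point for a suitable constant \<open>D\<close>.
  The first term on the right is harmonic near that point, and the convexity of \<open>x powr (2 * m)\<close> bounds
  \<open>N(\<phi>)\<close> from above by a smooth function even where the metric is not \<open>C\<^sup>2\<close>. Expanding this function to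
  second order bounds the means of \<open>ln \<lambda>\<close> over four points from below, with errors that are locally
  uniform, and this is enough for the inequality between distributions.\<close>

section \<open>The egg and its automorphisms\<close>

text \<open>The Kobayashi metric is never computed. Its unit ball is bounded from outside by the
  ellipsoid and met from inside by discs in two mutually orthogonal sets of directions only;
  reflection in the axis shows that this partial contact already excludes a smaller ellipsoid. The
  outer bound rests on \<open>m < 1\<close>: a suitable power of \<open>x\<close> times
  \<open>(1 - x powr m) / (1 - x)\<close> is largest at a prescribed point, and that power becomes a
  weight in the maximum principle.

  The obstacle for the curvature is \<open>cmod (z$a) powr (2*m)\<close>, which is not twice
  differentiable where \<open>z$a = 0\<close>, and for \<open>m = 1/2\<close> not even once. Only
  its convexity is used there, which is where \<open>2*m \<ge> 1\<close> matters. A bound at single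
  points would not pass to distributions, so all error constants depend only on a radius, a distance
  from the boundary and a lower bound for the speed, quantities that automorphisms respect. The
  curvature constant 1/2 is uniform because, after normalisation, the estimate compares two cubic
  forms in two nonnegative numbers coefficient by coefficient.\<close>

definition hin :: "'n::finite \<Rightarrow> complex^'n \<Rightarrow> complex^'n \<Rightarrow> complex" where
  "hin a u v = (\<Sum>j\<in>UNIV-{a}. u$j * cnj (v$j))"

definition nsq :: "'n::finite \<Rightarrow> complex^'n \<Rightarrow> real" where
  "nsq a u = (\<Sum>j\<in>UNIV-{a}. (cmod (u$j))\<^sup>2)"

section \<open>The Hermitian product of the components other than \<open>a\<close>\<close>

lemma hin_self: "hin a u u = of_real (nsq a u)"
  by (simp add: hin_def nsq_def complex_mult_cnj cmod_power2 flip: complex_norm_square)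

lemma cnj_hin: "cnj (hin a u v) = hin a v u"
  by (simp add: hin_def mult.commute)

lemma hin_add_left: "hin a (u+v) w = hin a u w + hin a v w"
  and hin_diff_left: "hin a (u-v) w = hin a u w - hin a v w"
  and hin_add_right: "hin a w (u+v) = hin a w u + hin a w v"
  and hin_diff_right: "hin a w (u-v) = hin a w u - hin a w v"
  and hin_scale_left: "hin a (c *s u) w = c * hin a u w"
  and hin_scale_right: "hin a w (c *s u) = cnj c * hin a w u"
  and hin_zero_left [simp]: "hin a 0 w = 0"
  and hin_zero_right [simp]: "hin a w 0 = 0"
  and hin_minus_right [simp]: "hin a w (-u) = - hin a w u"
  by (simp_all add: hin_def algebra_simps sum.distrib sum_subtractf sum_distrib_left sum_negf)

lemma nsq_nonneg [simp]: "nsq a u \<ge> 0"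
  by (simp add: nsq_def sum_nonneg)

lemma nsq_minus [simp]: "nsq a (-u) = nsq a u"
  by (simp add: nsq_def)

lemma nsq_scale: "nsq a (c *s u) = (cmod c)\<^sup>2 * nsq a u"
  by (simp add: nsq_def sum_distrib_left norm_mult power_mult_distrib)

lemma nsq_add: "nsq a (u+v) = nsq a u + nsq a v + 2 * Re (hin a u v)"
proof -
  have "complex_of_real (nsq a (u+v)) = of_real (nsq a u + nsq a v + 2 * Re (hin a u v))"
    unfolding hin_self[symmetric] hin_add_left hin_add_right of_real_add of_real_mult
    by (simp add: cnj_hin[of a u v, symmetric] complex_eq_iff)
  then show ?thesis by (metis of_real_eq_iff)
qed

lemma hin_Cauchy_Schwarz: "(cmod (hin a u v))\<^sup>2 \<le> nsq a u * nsq a v"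
proof -
  have "cmod (hin a u v) \<le> (\<Sum>j\<in>UNIV-{a}. cmod (u$j) * cmod (v$j))"
    unfolding hin_def by (rule order_trans[OF norm_sum]) (simp add: norm_mult)
  then have "(cmod (hin a u v))\<^sup>2 \<le> (\<Sum>j\<in>UNIV-{a}. cmod (u$j) * cmod (v$j))\<^sup>2"
    by (intro power_mono) auto
  also have "\<dots> \<le> nsq a u * nsq a v"
    unfolding nsq_def by (rule Cauchy_Schwarz_ineq_sum)
  finally show ?thesis .
qed

lemma norm_sq_vec: "(norm (u::complex^'n::finite))\<^sup>2 = (cmod (u$a))\<^sup>2 + nsq a u"
  by (simp add: norm_vec_def L2_set_def nsq_def sum_nonneg sum.remove[of UNIV a])

lemma nsq_eq_0: "nsq a u = 0 \<longleftrightarrow> (\<forall>j. j \<noteq> a \<longrightarrow> u$j = 0)"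
  unfolding nsq_def by (subst sum_nonneg_eq_0_iff) auto

lemma hin_cong: "(\<And>j. j \<noteq> a \<Longrightarrow> u$j = u'$j) \<Longrightarrow> (\<And>j. j \<noteq> a \<Longrightarrow> v$j = v'$j) \<Longrightarrow> hin a u v = hin a u' v'"
  unfolding hin_def by (rule sum.cong) auto

lemma nsq_cong: "(\<And>j. j \<noteq> a \<Longrightarrow> u$j = u'$j) \<Longrightarrow> nsq a u = nsq a u'"
  unfolding nsq_def by (rule sum.cong) auto

text \<open>Overwriting one entry of a full vector stands for the splitting into the axis and the
  other coordinates, so that no second index type occurs.\<close>

definition join :: "'n::finite \<Rightarrow> complex \<Rightarrow> complex^'n \<Rightarrow> complex^'n" where
  "join a c u = (\<chi> j. if j = a then c else u$j)"

lemma join_nth [simp]: "join a c u $ a = c" "j \<noteq> a \<Longrightarrow> join a c u $ j = u $ j"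
  by (simp_all add: join_def)

lemma hin_join [simp]: "hin a (join a c u) v = hin a u v" "hin a v (join a c u) = hin a v u"
  by (auto intro!: hin_cong)

lemma nsq_join [simp]: "nsq a (join a c u) = nsq a u"
  by (auto intro!: nsq_cong)

lemma cmod_sq_cnj: "(complex_of_real (cmod z))\<^sup>2 = z * cnj z"
  by (metis complex_norm_square of_real_power)

lemma complex_norm_sq_diff: "(cmod (x-y))\<^sup>2 = (cmod x)\<^sup>2 + (cmod y)\<^sup>2 - 2 * Re (x * cnj y)"
  unfolding cmod_power2 by (simp add: power2_eq_square algebra_simps)

section \<open>The egg and the candidate for its Wu metric\<close>

locale egg_dom =
  fixes a :: "'n::finite" and m :: real
  assumes m_ge: "1/2 \<le> m" and m_lt: "m < 1"
begin

abbreviation "ip \<equiv> hin a"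
abbreviation "nq \<equiv> nsq a"
abbreviation "jn \<equiv> join a"

lemma m_pos [simp]: "m > 0" "m \<noteq> 0" "m \<ge> 0"
  using m_ge by auto

definition sg :: "complex^'n \<Rightarrow> real" where "sg z = 1 - nq z"
text \<open>The squared radius of the disc in which \<open>z$a\<close> may move while the other
  coordinates are fixed. Thus \<open>tt\<close> is the squared position of \<open>z$a\<close>
  relative to that disc.\<close>

definition AA :: "complex^'n \<Rightarrow> real" where "AA z = sg z powr (1/m)"
definition tt :: "complex^'n \<Rightarrow> real" where "tt z = (cmod (z$a))\<^sup>2 / AA z"
text \<open>The square of the Kobayashi metric of the unit ball in the coordinates other than
  \<open>a\<close>.\<close>

definition BB :: "complex^'n \<Rightarrow> complex^'n \<Rightarrow> real" where
  "BB z v = nq v / sg z + (cmod (ip v z))\<^sup>2 / (sg z)\<^sup>2"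

text \<open>The Wu metric, see \<open>wu_metric_egg\<close> below. At \<open>z = (p, 0, \<dots>, 0)\<close> it is diagonal, and elsewhere it
  is the pullback under the automorphism \<open>psi z\<close>; \<open>tt\<close> is invariant under automorphisms.\<close>

definition wuQ :: "complex^'n \<Rightarrow> complex^'n \<Rightarrow> real" where
  "wuQ z v = (cmod (v$a + z$a * ip v z / of_real (m * sg z)))\<^sup>2 / (AA z * (1 - tt z)\<^sup>2)
     + BB z v / (1 - tt z powr m)"

lemma nq_eq: "nq z = 1 - sg z" by (simp add: sg_def)
lemma ip_self: "ip z z = 1 - of_real (sg z)" by (simp add: hin_self sg_def)

lemma egg_iff: "z \<in> egg a m \<longleftrightarrow> cmod (z$a) powr (2*m) < sg z"
  by (auto simp: egg_def sg_def nsq_def)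

lemma egg_sg: "z \<in> egg a m \<Longrightarrow> sg z > 0"
  unfolding egg_iff by (smt (verit) powr_ge_zero)

lemma sg_le1: "sg z \<le> 1" by (simp add: sg_def)

lemma AA_pos: "sg z > 0 \<Longrightarrow> AA z > 0" by (simp add: AA_def)

lemma cmod_sq_powr: "(cmod c)\<^sup>2 powr e = cmod c powr (2*e)"
  by (cases "c = 0") (simp_all add: powr_powr flip: powr_numeral)

lemma tt_nonneg: "sg z > 0 \<Longrightarrow> tt z \<ge> 0" by (simp add: tt_def AA_def)

lemma tt_powr: "sg z > 0 \<Longrightarrow> tt z powr m = cmod (z$a) powr (2*m) / sg z"
  by (simp add: tt_def powr_divide AA_def powr_powr cmod_sq_powr)

lemma egg_iff_tt: "z \<in> egg a m \<longleftrightarrow> sg z > 0 \<and> tt z < 1"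
proof -
  have "tt z < 1 \<longleftrightarrow> tt z powr m < 1" if "sg z > 0"
    using tt_nonneg[OF that] by (smt (verit) m_pos(1) powr_less_mono2 powr_one_eq_one)
  then show ?thesis using egg_sg[of z] by (auto simp: egg_iff tt_powr)
qed

lemma egg_tt: "z \<in> egg a m \<Longrightarrow> tt z < 1" by (simp add: egg_iff_tt)

lemma egg_ttm: "z \<in> egg a m \<Longrightarrow> tt z powr m < 1"
  using egg_sg[of z] by (simp add: egg_iff tt_powr)

lemma egg_nq: "z \<in> egg a m \<Longrightarrow> nq z < 1"
  using egg_sg[of z] by (simp add: sg_def)

lemma egg_cmod_a: "z \<in> egg a m \<Longrightarrow> cmod (z$a) < 1"
proof (rule ccontr)
  assume z: "z \<in> egg a m" and "\<not> cmod (z$a) < 1"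
  then have "1 \<le> cmod (z$a) powr (2*m)" by (intro ge_one_powr_ge_zero) auto
  with z sg_le1[of z] show False by (simp add: egg_iff)
qed

text \<open>With \<open>s = sqrt (sg b)\<close> this is \<open>P + s Q\<close>, where
  \<open>P\<close> projects orthogonally onto the line of \<open>b\<close> and \<open>Q\<close> is
  the complementary projection. Since the squared length of \<open>b\<close> is
  \<open>(1 - s) * (1 + s)\<close>, the denominator \<open>1 + s\<close> replaces a division by that
  length and keeps \<open>b = 0\<close> regular.\<close>

definition TT :: "complex^'n \<Rightarrow> complex^'n \<Rightarrow> complex^'n" where
  "TT b u = of_real (sqrt (sg b)) *s u + (ip u b / of_real (1 + sqrt (sg b))) *s b"

text \<open>In the variables other than \<open>z$a\<close>, \<open>psi b\<close> is the automorphism of the unit ball that takes \<open>b\<close> to 0;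
  \<open>dpsi b z\<close> is its derivative at \<open>z\<close>.\<close>

definition psi :: "complex^'n \<Rightarrow> complex^'n \<Rightarrow> complex^'n" where
  "psi b z = jn (z$a * of_real (sg b powr (1/(2*m))) * (1 - ip z b) powr of_real (-1/m))
                ((1 / (1 - ip z b)) *s (TT b z - b))"

definition dpsi :: "complex^'n \<Rightarrow> complex^'n \<Rightarrow> complex^'n \<Rightarrow> complex^'n" where
  "dpsi b z v = jn ((v$a + z$a * ip v b / (of_real m * (1 - ip z b))) *
                    of_real (sg b powr (1/(2*m))) * (1 - ip z b) powr of_real (-1/m))
     ((1 / (1 - ip z b)) *s TT b v + (ip v b / (1 - ip z b)\<^sup>2) *s (TT b z - b))"

section \<open>Invariance under the automorphisms\<close>

lemma ip_TT_b:
  assumes "sg b > 0" shows "ip (TT b u) b = ip u b"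
proof -
  define s where "s = sqrt (sg b)"
  have s: "s > 0" "sg b = s * s" using assms by (simp_all add: s_def)
  have "s + (1 - sg b) / (1 + s) = 1" using s by (simp add: field_simps)
  then have "complex_of_real (s + (1 - sg b) / (1 + s)) = 1" by simp
  then have 1: "of_real s + (1 - complex_of_real (sg b)) / of_real (1 + s) = 1"
    unfolding of_real_add of_real_divide of_real_diff of_real_1 .
  have c: "x / y * (1 - w) = (1 - w) / y * x" for x y w :: complex by simp
  have "ip (TT b u) b = of_real s * ip u b + ip u b / of_real (1 + s) * (1 - of_real (sg b))"
    unfolding TT_def s_def[symmetric] hin_add_left hin_scale_left ip_self[of b] ..
  also have "\<dots> = (of_real s + (1 - complex_of_real (sg b)) / of_real (1 + s)) * ip u b"
    unfolding c distrib_right ..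
  finally show ?thesis unfolding 1 by simp
qed

lemma ip_b_TT: "sg b > 0 \<Longrightarrow> ip b (TT b u) = ip b u"
  by (metis cnj_hin ip_TT_b)

lemma ip_TT_TT:
  assumes "sg b > 0" shows "ip (TT b u) (TT b v) = of_real (sg b) * ip u v + ip u b * ip b v"
proof -
  let ?s = "complex_of_real (sqrt (sg b))"
  have nz: "1 + ?s \<noteq> 0"
    by (smt (verit, best) assms of_real_1 of_real_add of_real_eq_0_iff real_sqrt_gt_0_iff)
  have s2: "?s * ?s = of_real (sg b)" using assms by (simp flip: of_real_mult)
  have c1: "cnj (ip v b) = ip b v" by (rule cnj_hin)
  have "ip (TT b u) (TT b v) = ip (TT b u) (?s *s v) + cnj (ip v b / (1+?s)) * ip (TT b u) b"
    by (subst (2) TT_def) (simp add: hin_add_right hin_scale_right)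
  also have "\<dots> = ?s * (?s * ip u v + ip u b / (1+?s) * ip b v) + ip b v / (1+?s) * ip u b"
    unfolding ip_TT_b[OF assms] by (simp add: hin_scale_right c1) (simp add: TT_def hin_add_left hin_scale_left)
  also have "ip b v / (1+?s) * ip u b = ip u b / (1+?s) * ip b v" by simp
  also have "?s * (?s * ip u v + ip u b / (1+?s) * ip b v) + ip u b / (1+?s) * ip b v
     = ?s * ?s * ip u v + (?s + 1) * (ip u b / (1+?s) * ip b v)"
    by (simp only: distrib_left distrib_right mult.assoc add.assoc mult_1_left)
  also have "\<dots> = of_real (sg b) * ip u v + ip u b * ip b v"
    using nz by (simp add: s2 add.commute)
  finally show ?thesis .
qed

lemma cmod_ip_lt1: assumes "sg b > 0" "sg z > 0" shows "cmod (ip z b) < 1"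
proof -
  have "nq z * nq b < 1 * 1" using assms nsq_nonneg[of a z] nsq_nonneg[of a b]
    unfolding nq_eq by (intro mult_strict_mono) auto
  with hin_Cauchy_Schwarz[of a z b] have "(cmod (ip z b))\<^sup>2 < 1" by linarith
  then show ?thesis by (simp add: abs_square_less_1)
qed

lemma one_ip:
  assumes "sg b > 0" "sg z > 0"
  shows "Re (1 - ip z b) > 0" "1 - ip z b \<noteq> 0"
proof -
  show "Re (1 - ip z b) > 0" using cmod_ip_lt1[OF assms] complex_Re_le_cmod[of "ip z b"] by simp
  then show "1 - ip z b \<noteq> 0" by force
qed

lemma sg_psi:
  assumes "sg b > 0" "sg z > 0"
  shows "sg (psi b z) = sg b * sg z / (cmod (1 - ip z b))\<^sup>2"
proof -
  have nz: "cmod (1 - ip z b) \<noteq> 0" using one_ip[OF assms] by simp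
  have 1: "nq (TT b z) = sg b * nq z + (cmod (ip z b))\<^sup>2"
  proof -
    have "complex_of_real (nq (TT b z)) = of_real (sg b * nq z + (cmod (ip z b))\<^sup>2)"
      unfolding hin_self[symmetric] ip_TT_TT[OF assms(1)]
      by (simp add: cnj_hin[of a z b, symmetric] hin_self cmod_sq_cnj)
    then show ?thesis by (metis of_real_eq_iff)
  qed
  have 2: "nq (TT b z - b) = (cmod (1 - ip z b))\<^sup>2 - sg b * sg z"
    using nsq_add[of a "TT b z" "-b"]
    by (simp add: 1 ip_TT_b[OF assms(1)] complex_norm_sq_diff nq_eq[of b] nq_eq[of z] algebra_simps)
  have "nq (psi b z) = ((cmod (1 - ip z b))\<^sup>2 - sg b * sg z) / (cmod (1 - ip z b))\<^sup>2"
    unfolding psi_def nsq_join nsq_scale 2 by (simp add: norm_divide power_divide)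
  then show ?thesis using nz
    unfolding sg_def[of "psi b z"] by (simp add: diff_divide_distrib)
qed

lemma sg_psi_pos: "sg b > 0 \<Longrightarrow> sg z > 0 \<Longrightarrow> sg (psi b z) > 0"
  using one_ip[of b z] by (simp add: sg_psi)

lemma AA_psi:
  assumes "sg b > 0" "sg z > 0"
  shows "AA (psi b z) = AA z * (cmod (of_real (sg b powr (1/(2*m))) * (1 - ip z b) powr of_real (-1/m)))\<^sup>2"
proof -
  have nz: "cmod (1 - ip z b) > 0" using one_ip[OF assms] by simp
  have 1: "(sg b powr (1/(2*m)))\<^sup>2 = sg b powr (1/m)"
    using assms by (simp add: powr_powr flip: powr_numeral)
  have 2: "(cmod ((1 - ip z b) powr of_real (-1/m)))\<^sup>2 = ((cmod (1 - ip z b))\<^sup>2) powr (-1/m)"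
    using nz by (simp add: norm_powr_real_powr' powr_powr flip: powr_numeral)
  show ?thesis unfolding AA_def sg_psi[OF assms] norm_mult power_mult_distrib 2
    using assms nz by (simp add: powr_mult powr_divide 1 powr_minus_divide)
qed

text \<open>The factor of \<open>z$a\<close> in \<open>psi\<close> is an \<open>m\<close>-th root
  chosen so that its squared modulus is exactly the factor gained by \<open>AA\<close>, and the
  quotient does not change.\<close>

lemma tt_psi: assumes "sg b > 0" "sg z > 0" shows "tt (psi b z) = tt z"
proof -
  have "of_real (sg b powr (1/(2*m))) * (1 - ip z b) powr of_real (-1/m) \<noteq> 0"
    using one_ip[OF assms] assms by simp
  then show ?thesis unfolding tt_def AA_psi[OF assms]
    by (simp add: psi_def norm_mult power_mult_distrib)
qed

lemma psi_egg: "sg b > 0 \<Longrightarrow> z \<in> egg a m \<Longrightarrow> psi b z \<in> egg a m"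
  by (simp add: egg_iff_tt sg_psi_pos tt_psi)

text \<open>This is the logarithmic derivative of \<open>sg_psi\<close> in the holomorphic direction
  \<open>v\<close>: the derivative of \<open>ln (sg z)\<close> is \<open>- ip v z / sg z\<close>,
  and \<open>1 - ip z b\<close> contributes the last term.\<close>

lemma ip_dpsi:
  assumes "sg b > 0" "sg z > 0"
  shows "ip (dpsi b z v) (psi b z) / of_real (sg (psi b z)) = ip v z / of_real (sg z) - ip v b / (1 - ip z b)"
proof -
  define c where "c = 1 - ip z b"
  define be where "be = ip v b"
  have c: "c \<noteq> 0" using one_ip[OF assms] by (simp add: c_def)
  have cc: "cnj c = 1 - ip b z" by (simp add: c_def cnj_hin)
  have 1: "ip (TT b v) (TT b z - b) = of_real (sg b) * ip v z - be * cnj c"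
    by (simp add: hin_diff_right ip_TT_TT[OF assms(1)] ip_TT_b[OF assms(1)] cc be_def algebra_simps)
  have 2: "ip (TT b z - b) (TT b z - b) = c * cnj c - of_real (sg b) * of_real (sg z)"
    using ip_TT_b[OF assms(1), of z] ip_b_TT[OF assms(1), of z]
    by (simp add: hin_diff_right hin_diff_left ip_TT_TT[OF assms(1)] cnj_hin cc c_def ip_self[of b] ip_self[of z] algebra_simps)
  have 3: "of_real ((cmod c)\<^sup>2) = c * cnj c" by (simp add: cmod_sq_cnj)
  have "ip (dpsi b z v) (psi b z) = (1/c * (of_real (sg b) * ip v z - be * cnj c)
       + be / c\<^sup>2 * (c * cnj c - of_real (sg b) * of_real (sg z))) / cnj c"
    unfolding dpsi_def psi_def hin_join c_def[symmetric] be_def[symmetric] hin_add_left hin_scale_left hin_scale_right 1 2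
    by (simp add: add_divide_distrib)
  also have "\<dots> = (of_real (sg b) * (c * ip v z - be * of_real (sg z))) / (c\<^sup>2 * cnj c)"
    using c by (simp add: field_simps power2_eq_square)
  finally have 4: "ip (dpsi b z v) (psi b z) = \<dots>" .
  show ?thesis unfolding 4 sg_psi[OF assms] c_def[symmetric] be_def[symmetric] of_real_divide of_real_mult 3
    using c assms by (simp add: field_simps power2_eq_square)
qed

text \<open>Automorphisms of the ball are isometries of its invariant metric. The summand containing
  \<open>ip\<close> is known from \<open>ip_dpsi\<close>, so only \<open>nq (dpsi b z v)\<close> has
  to be expanded; what remains is the rational identity 7.\<close>

lemma BB_psi:
  assumes "sg b > 0" "sg z > 0"
  shows "BB (psi b z) (dpsi b z v) = BB z v"
proof -
  define c where "c = 1 - ip z b"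
  define be where "be = ip v b"
  define ga where "ga = ip v z"
  have c: "c \<noteq> 0" using one_ip[OF assms] by (simp add: c_def)
  have cc: "cnj c = 1 - ip b z" by (simp add: c_def cnj_hin)
  have 1: "ip (TT b v) (TT b z - b) = of_real (sg b) * ga - be * cnj c"
    by (simp add: hin_diff_right ip_TT_TT[OF assms(1)] ip_TT_b[OF assms(1)] cc be_def ga_def algebra_simps)
  have 2: "nq (TT b z - b) = (cmod c)\<^sup>2 - sg b * sg z"
  proof -
    have "complex_of_real (nq (TT b z - b)) = of_real ((cmod c)\<^sup>2 - sg b * sg z)"
      using ip_TT_b[OF assms(1), of z] ip_b_TT[OF assms(1), of z]
      by (simp add: hin_self[symmetric] hin_diff_right hin_diff_left ip_TT_TT[OF assms(1)] cnj_hin cc c_def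
          ip_self[of b] ip_self[of z] cmod_sq_cnj algebra_simps)
    then show ?thesis by (metis of_real_eq_iff)
  qed
  have 3: "nq (TT b v) = sg b * nq v + (cmod be)\<^sup>2"
  proof -
    have "complex_of_real (nq (TT b v)) = of_real (sg b * nq v + (cmod be)\<^sup>2)"
      unfolding hin_self[symmetric] ip_TT_TT[OF assms(1)] be_def
      by (simp add: cnj_hin[of a v b, symmetric] hin_self cmod_sq_cnj)
    then show ?thesis by (metis of_real_eq_iff)
  qed
  have e0: "nq (dpsi b z v) = nq ((1/c\<^sup>2) *s (c *s TT b v + be *s (TT b z - b)))"
    unfolding dpsi_def nsq_join c_def[symmetric] be_def[symmetric]
    by (rule arg_cong[where f=nq], simp add: vec_eq_iff c algebra_simps power2_eq_square add_divide_distrib diff_divide_distrib)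
  have r: "ip (c *s TT b v) (be *s (TT b z - b)) = c * cnj be * (of_real (sg b) * ga - be * cnj c)"
    unfolding hin_scale_left hin_scale_right 1 by simp
  note e0
  also have "nq ((1/c\<^sup>2) *s (c *s TT b v + be *s (TT b z - b)))
    = ((cmod c)\<^sup>2 * (sg b * nq v + (cmod be)\<^sup>2) + (cmod be)\<^sup>2 * ((cmod c)\<^sup>2 - sg b * sg z)
      + 2 * Re (c * cnj be * (of_real (sg b) * ga - be * cnj c))) / ((cmod c)\<^sup>2)\<^sup>2"
    unfolding nsq_scale nsq_add r 2 3
    by (simp only: norm_divide norm_power power_divide norm_one power_one) simp
  also have "Re (c * cnj be * (of_real (sg b) * ga - be * cnj c))
     = sg b * Re (c * cnj be * ga) - (cmod be)\<^sup>2 * (cmod c)\<^sup>2"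
  proof -
    have "c * cnj be * (of_real (sg b) * ga - be * cnj c) = of_real (sg b) * (c * cnj be * ga) - (be * cnj be) * (c * cnj c)"
      by (simp add: algebra_simps)
    then show ?thesis unfolding complex_norm_square[symmetric] by (simp flip: of_real_power)
  qed
  finally have 4: "nq (dpsi b z v) = sg b * ((cmod c)\<^sup>2 * nq v + 2 * Re (c * cnj be * ga) - (cmod be)\<^sup>2 * sg z) / ((cmod c)\<^sup>2)\<^sup>2"
    by (simp add: algebra_simps)
  have 5: "(cmod (ip (dpsi b z v) (psi b z)))\<^sup>2 / (sg (psi b z))\<^sup>2
     = (cmod (ga / of_real (sg z) - be / c))\<^sup>2"
    using arg_cong[OF ip_dpsi[OF assms, of v], of "\<lambda>x. (cmod x)\<^sup>2"]
    by (simp add: norm_divide power_divide ga_def be_def c_def)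
  have 6: "(cmod (ga / of_real (sg z) - be / c))\<^sup>2 = (cmod ga)\<^sup>2 / (sg z)\<^sup>2 + (cmod be)\<^sup>2 / (cmod c)\<^sup>2
     - 2 * Re (c * cnj be * ga) / (sg z * (cmod c)\<^sup>2)"
  proof -
    have "ga / of_real (sg z) * cnj (be / c) = of_real (1 / (sg z * (cmod c)\<^sup>2)) * (c * cnj be * ga)"
      using c assms by (simp add: complex_norm_square del: of_real_power)
    then show ?thesis unfolding complex_norm_sq_diff
      by (simp add: norm_divide power_divide)
  qed
  have 7: "s * (C * n + 2 * R - B * z) / C\<^sup>2 / (s * z / C) + (G / z\<^sup>2 + B / C - 2 * R / (z * C)) = n / z + G / z\<^sup>2"
    if "C > 0" "s > 0" "z > 0" for s C n R B z G :: real
    using that by (simp add: field_simps power2_eq_square)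
  have 8: "BB (psi b z) (dpsi b z v) = nq (dpsi b z v) / sg (psi b z) + (cmod (ga / of_real (sg z) - be / c))\<^sup>2"
    unfolding BB_def 5 ..
  show ?thesis unfolding 8 unfolding BB_def 4 6 sg_psi[OF assms] c_def[symmetric] ga_def[symmetric]
    by (intro 7) (use c assms in auto)
qed

text \<open>Where \<open>z$a\<close> is not zero, the linear form in the first summand of
  \<open>wuQ\<close> is \<open>z$a\<close> times the holomorphic derivative of
  \<open>ln (tt z)\<close>. As \<open>tt\<close> is invariant, the form is multiplied by the same
  factor \<open>k\<close> as \<open>z$a\<close>, and \<open>AA\<close> absorbs it.\<close>

lemma wuQ_psi:
  assumes "sg b > 0" "sg z > 0"
  shows "wuQ (psi b z) (dpsi b z v) = wuQ z v"
proof -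
  define k where "k = of_real (sg b powr (1/(2*m))) * (1 - ip z b) powr of_real (-1/m)"
  have k: "k \<noteq> 0" using one_ip[OF assms] assms by (simp add: k_def)
  obtain c where c: "1 - ip z b = c" by blast
  have "dpsi b z v $ a + psi b z $ a * ip (dpsi b z v) (psi b z) / of_real (m * sg (psi b z))
     = (v$a + z$a * ip v b / (of_real m * (1 - ip z b))) * k
       + z$a * k / of_real m * (ip (dpsi b z v) (psi b z) / of_real (sg (psi b z)))"
    by (simp add: dpsi_def psi_def k_def algebra_simps)
  also have "\<dots> = k * (v$a + z$a * ip v z / of_real (m * sg z))"
    unfolding ip_dpsi[OF assms] c by (simp add: divide_inverse algebra_simps)
  finally show ?thesis unfolding wuQ_def BB_psi[OF assms] tt_psi[OF assms] AA_psi[OF assms] k_def[symmetric]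
    using k by (simp add: norm_mult power_mult_distrib)
qed

lemma psi_self: "psi b b = jn (b$a * of_real (sg b powr (1/(2*m))) * (of_real (sg b)) powr of_real (-1/m)) 0"
  if "sg b > 0"
proof -
  define s where "s = sqrt (sg b)"
  have s: "s > 0" "sg b = s * s" using that by (simp_all add: s_def)
  have "(1 - sg b) / (1 + s) = 1 - s" using s by (simp add: field_simps)
  then have "s + (1 - sg b) / (1 + s) = 1" by simp
  then have "complex_of_real (s + (1 - sg b) / (1 + s)) = 1" by simp
  then have "of_real s + (1 - complex_of_real (sg b)) / of_real (1 + s) = 1"
    unfolding of_real_add of_real_divide of_real_diff of_real_1 .
  then have "TT b b = b"
    unfolding TT_def ip_self s_def[symmetric] vector_sadd_rdistrib[symmetric] by simp
  then show ?thesis unfolding psi_def by (simp only: diff_self vector_smult_rzero ip_self[of b]) simp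
qed

lemma wuQ_axis:
  assumes "z = jn p 0"
  shows "wuQ z v = (cmod (v$a))\<^sup>2 / (1 - (cmod p)\<^sup>2)\<^sup>2 + nq v / (1 - cmod p powr (2*m))"
proof -
  have "nq 0 = 0" by (simp add: nsq_def)
  then have "sg z = 1" by (simp add: sg_def assms)
  then show ?thesis by (simp add: wuQ_def assms AA_def tt_def BB_def cmod_sq_powr)
qed

lemma wuQ_scale: "wuQ z (c *s v) = (cmod c)\<^sup>2 * wuQ z v"
proof -
  have "(c *s v)$a + z$a * ip (c *s v) z / of_real (m * sg z) = c * (v$a + z$a * ip v z / of_real (m * sg z))"
    by (simp add: hin_scale_left algebra_simps)
  note e = this
  show ?thesis unfolding wuQ_def e norm_mult power_mult_distrib
    unfolding BB_def nsq_scale hin_scale_left norm_mult power_mult_distrib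
    by (simp add: norm_mult power_mult_distrib algebra_simps add_divide_distrib)
qed

lemma wuQ_pos:
  assumes "z \<in> egg a m" "v \<noteq> 0" shows "wuQ z v > 0"
proof -
  note sz = egg_sg[OF assms(1)] and t = egg_tt[OF assms(1)] egg_ttm[OF assms(1)]
  note A = AA_pos[OF sz]
  have B: "BB z v \<ge> 0" using sz by (simp add: BB_def)
  show ?thesis
  proof (cases "nq v = 0")
    case True
    then have *: "\<And>j. j \<noteq> a \<Longrightarrow> v$j = 0" by (simp add: nsq_eq_0)
    have "ip v z = 0" using hin_Cauchy_Schwarz[of a v z] True by simp
    moreover have "v$a \<noteq> 0" using * assms(2) by (metis vec_eq_iff zero_index)
    ultimately have "0 < (cmod (v$a + z$a * ip v z / of_real (m * sg z)))\<^sup>2 / (AA z * (1 - tt z)\<^sup>2)"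
      using A t by simp
    then show ?thesis unfolding wuQ_def using B t by (smt (verit) divide_nonneg_pos)
  next
    case False
    then have "nq v > 0" by (simp add: less_le)
    then have "BB z v > 0" using sz unfolding BB_def by (smt (verit) divide_pos_pos divide_nonneg_nonneg zero_le_power2)
    then have "BB z v / (1 - tt z powr m) > 0" using t by simp
    moreover have "0 \<le> (cmod (v$a + z$a * ip v z / of_real (m * sg z)))\<^sup>2 / (AA z * (1 - tt z)\<^sup>2)"
      using A by simp
    ultimately show ?thesis unfolding wuQ_def by linarith
  qed
qed

end

section \<open>The Schwarz lemma for discs in the egg\<close>

text \<open>The source of both uses of \<open>m < 1\<close> on the metric: it gives the convexity
  behind the Schwarz lemma and the strict inequality behind the failure of the Kaehler
  condition.\<close>

lemma sinh_mult_less: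
  fixes m v :: real
  assumes "0 < m" "m < 1" "0 < v" shows "sinh (m * v) < m * sinh v"
proof -
  have "(\<lambda>x. m * sinh x - sinh (m * x)) 0 < (\<lambda>x. m * sinh x - sinh (m * x)) v"
  proof (rule DERIV_pos_imp_increasing_open[where f="\<lambda>x. m * sinh x - sinh (m * x)"])
    fix x assume x: "0 < x" "x < v"
    have "((\<lambda>x. m * sinh x - sinh (m * x)) has_real_derivative m * cosh x - cosh (m * x) * m) (at x)"
      by (auto intro!: derivative_eq_intros)
    moreover have "cosh (m * x) < cosh x"
      using x assms by (intro cosh_real_strict_mono) auto
    ultimately show "\<exists>y. ((\<lambda>x. m * sinh x - sinh (m * x)) has_real_derivative y) (at x) \<and> 0 < y"
      using assms by (intro exI[of _ "m * cosh x - cosh (m * x) * m"]) auto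
  qed (use assms in \<open>auto intro!: continuous_intros\<close>)
  then show ?thesis by simp
qed

lemma one_minus_exp_sinh: "1 - exp (-2 * v) = 2 * exp (-v) * sinh (v::real)"
  by (simp add: sinh_field_def algebra_simps flip: exp_add)

text \<open>With \<open>x = exp (-2 * v)\<close> the quotient
  \<open>(1 - x powr m) * x powr k / (1 - x)\<close> is the exponential of a linear function of
  \<open>v\<close> minus \<open>g v\<close>. Since \<open>g\<close> is convex by
  \<open>sinh_mult_less\<close>, the quotient is largest at \<open>q\<close> once the slope of the
  linear function is the slope of \<open>g\<close> at \<open>v0\<close>.\<close>

lemma power_tangent:
  fixes m q :: real
  assumes m: "0 < m" "m < 1" and q: "0 < q" "q < 1"
  obtains k where "k \<ge> 0"
    "\<And>x. 0 < x \<Longrightarrow> x \<le> 1 \<Longrightarrow> (1 - x powr m) * x powr k \<le> (1 - q powr m) / (1 - q) * q powr k * (1 - x)"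
proof -
  define g where "g v = ln (sinh v) - ln (sinh (m * v))" for v :: real
  define g' where "g' v = cosh v / sinh v - m * cosh (m * v) / sinh (m * v)" for v :: real
  define g'' where "g'' v = m\<^sup>2 / (sinh (m * v))\<^sup>2 - 1 / (sinh v)\<^sup>2" for v :: real
  have sh: "sinh v > 0" "sinh (m * v) > 0" if "v > 0" for v using that m by auto
  have d1: "(g has_real_derivative g' v) (at v)" if "v \<in> {0<..}" for v
    unfolding g_def g'_def using that m
    by (auto intro!: derivative_eq_intros)
  have d2: "(g' has_real_derivative g'' v) (at v)" if "v \<in> {0<..}" for v
  proof -
    have "(cosh v)\<^sup>2 = 1 + (sinh v)\<^sup>2" "(cosh (m * v))\<^sup>2 = 1 + (sinh (m * v))\<^sup>2" by (simp_all add: cosh_square_eq)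
    then have c: "cosh v * cosh v = 1 + sinh v * sinh v" "cosh (m * v) * cosh (m * v) = 1 + sinh (m * v) * sinh (m * v)"
      by (simp_all add: power2_eq_square)
    have e: "(s * s - c * c) / (s * s) = - 1 / (s * s)" "(m * s * m * s - m * c * (c * m)) / (s * s) = - m * m / (s * s)"
      if "c * c = 1 + s * s" "s > 0" for s c :: real
    proof -
      have "m * s * m * s - m * c * (c * m) = m * m * (s * s - c * c)" by (simp add: algebra_simps)
      also have "s * s - c * c = -1" using that by simp
      finally show "(m * s * m * s - m * c * (c * m)) / (s * s) = - m * m / (s * s)" by simp
      show "(s * s - c * c) / (s * s) = - 1 / (s * s)" using that by simp
    qed
    have D1: "((\<lambda>v. cosh v / sinh v) has_real_derivative (sinh v * sinh v - cosh v * cosh v) / (sinh v * sinh v)) (at v)"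
      using that by (auto intro!: derivative_eq_intros)
    have D2: "((\<lambda>v. m * cosh (m * v) / sinh (m * v)) has_real_derivative
       (m * sinh (m * v) * m * sinh (m * v) - m * cosh (m * v) * (cosh (m * v) * m)) / (sinh (m * v) * sinh (m * v))) (at v)"
      using that m by (auto intro!: derivative_eq_intros)
    show ?thesis using DERIV_diff[OF D1 D2] sh[of v] that unfolding g'_def[abs_def] g''_def
      by (simp add: e[OF c(1)] e[OF c(2)] power2_eq_square)
  qed
  have d3: "g'' v \<ge> 0" if "v \<in> {0<..}" for v
  proof -
    have "v > 0" using that by simp
    then have "(sinh (m * v))\<^sup>2 \<le> (m * sinh v)\<^sup>2" using sh[of v] sinh_mult_less[OF m, of v]
      by (intro power_mono) auto
    moreover have "m\<^sup>2 / S - 1 / s \<ge> 0" if "S \<le> m\<^sup>2 * s" "S > 0" "s > 0" for S s :: real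
      using that by (simp add: field_simps)
    moreover have "(sinh (m * v))\<^sup>2 > 0" "(sinh v)\<^sup>2 > 0" using sh[OF \<open>v > 0\<close>] by (simp_all only: zero_less_power)
    ultimately show ?thesis unfolding g''_def by (simp only: power_mult_distrib)
  qed
  have conv: "convex_on {0<..} g"
    by (rule f''_ge0_imp_convex[OF _ d1 d2 d3]) auto
  define v0 where "v0 = - ln q / 2"
  have v0: "v0 > 0" "exp (-2 * v0) = q" using q by (simp_all add: v0_def)
  \<comment> \<open>The linear function has slope \<open>1 - m - 2 * k\<close>; this value makes it
    \<open>g' v0\<close>.\<close>
  define k where "k = (1 - m - g' v0) / 2"
  have tangent: "g' v0 * v - g v \<le> g' v0 * v0 - g v0" if "v > 0" for v
  proof -
    have "g v - g v0 \<ge> g' v0 * (v - v0)"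
      by (rule convex_on_imp_above_tangent[OF conv])
        (use v0 that d1[of v0] in \<open>auto simp: interior_open intro: has_field_derivative_at_within\<close>)
    then show ?thesis by (simp add: algebra_simps)
  qed
  have rep: "(1 - x powr m) * x powr k = (1 - x) * exp (g' v0 * v - g v)"
    if x: "v > 0" "x = exp (-2 * v)" for x v
  proof -
    have "x powr m = exp (-2 * (m * v))" "x powr k = exp (-2 * (k * v))"
      by (simp_all add: x powr_def)
    then have l: "(1 - x powr m) * x powr k = 2 * exp (-(m * v)) * sinh (m * v) * exp (-2 * (k * v))"
      by (simp only: one_minus_exp_sinh)
    have "exp (- g v) = sinh (m * v) / sinh v" using sh[OF x(1)] by (simp add: g_def exp_diff)
    then have "exp (g' v0 * v - g v) = exp (g' v0 * v) * (sinh (m * v) / sinh v)"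
      by (metis exp_add uminus_add_conv_diff add.commute)
    moreover have "1 - x = 2 * exp (-v) * sinh v" by (simp only: x one_minus_exp_sinh)
    ultimately have r: "(1 - x) * exp (g' v0 * v - g v) = 2 * exp (-v) * exp (g' v0 * v) * sinh (m * v)"
      using sh[OF x(1)] by simp
    have "exp (-(m * v)) * exp (-2 * (k * v)) = exp (-v) * exp (g' v0 * v)"
      unfolding exp_add[symmetric] k_def by (simp add: field_simps)
    then show ?thesis unfolding l r by (simp add: algebra_simps)
  qed
  show thesis
  proof
    \<comment> \<open>Nonnegativity of \<open>k\<close> means \<open>g' v0 \<le> 1 - m\<close>.
      Writing \<open>cosh\<close> and \<open>sinh\<close> through exponentials, this is convexity of
      \<open>exp\<close> between 0 and \<open>2 * v0\<close>, with weights \<open>1 - m\<close> and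
      \<open>m\<close>.\<close>
    have "exp ((1 - m) *\<^sub>R 0 + m *\<^sub>R (2 * v0)) \<le> (1 - m) * exp 0 + m * exp (2 * v0)"
      by (rule convex_onD[OF exp_convex]) (use m in auto)
    then have "exp (2 * (m * v0)) - 1 \<le> m * (exp (2 * v0) - 1)"
      by (simp add: algebra_simps)
    moreover have es: "exp (2 * x) - 1 = 2 * exp x * sinh x" for x :: real
      by (simp add: sinh_field_def right_diff_distrib exp_double power2_eq_square exp_minus_inverse)
    ultimately have *: "exp (m * v0) * sinh (m * v0) \<le> m * exp v0 * sinh v0" unfolding es by simp
    have "exp (m * v0) = cosh (m * v0) + sinh (m * v0)" "exp v0 = cosh v0 + sinh v0"
      by (simp_all only: cosh_plus_sinh)
    have "(cosh v0 - sinh v0) * sinh (m * v0) = exp (- v0 - m * v0) * (exp (m * v0) * sinh (m * v0))"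
      by (simp add: cosh_minus_sinh mult.assoc[symmetric] exp_add[symmetric])
    also have "\<dots> \<le> exp (- v0 - m * v0) * (m * exp v0 * sinh v0)"
      using * by (intro mult_left_mono) auto
    also have "\<dots> = m * (cosh (m * v0) - sinh (m * v0)) * sinh v0"
      by (simp add: cosh_minus_sinh mult.assoc[symmetric] mult.left_commute exp_add[symmetric])
    finally have "(cosh v0 - sinh v0) * sinh (m * v0) \<le> m * (cosh (m * v0) - sinh (m * v0)) * sinh v0" .
    moreover have "C / S - m * D / T \<le> 1 - m" if "(C - S) * T \<le> m * (D - T) * S" "S > 0" "T > 0" for C S D T :: real
    proof -
      have "(C - S) / S \<le> m * (D - T) / T"
        using divide_right_mono[OF that(1), of "S * T"] that(2,3) by simp
      then show ?thesis using that by (simp add: diff_divide_distrib right_diff_distrib)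
    qed
    ultimately have "g' v0 \<le> 1 - m" unfolding g'_def using sh[OF v0(1)] by blast
    then show "k \<ge> 0" by (simp add: k_def)
  next
    fix x :: real assume x: "0 < x" "x \<le> 1"
    show "(1 - x powr m) * x powr k \<le> (1 - q powr m) / (1 - q) * q powr k * (1 - x)"
    proof (cases "x = 1")
      case False
      define v where "v = - ln x / 2"
      have v: "v > 0" "x = exp (-2 * v)" using x False by (simp_all add: v_def)
      have "(1 - x powr m) * x powr k \<le> (1 - x) * exp (g' v0 * v0 - g v0)"
        unfolding rep[OF v] using tangent[OF v(1)] x by (intro mult_left_mono) auto
      also have "exp (g' v0 * v0 - g v0) = (1 - q powr m) * q powr k / (1 - q)"
        using rep[OF v0(1) v0(2)[symmetric]] q by simp
      finally show ?thesis by (simp add: mult_ac)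
    qed simp
  qed
qed

text \<open>Maximum principle for the logarithm of \<open>cmod N * cmod F powr k\<close>, applied to the holomorphic functions
  \<open>N ^ b * F ^ \<lceil>b k\<rceil>\<close> as \<open>b\<close> tends to infinity.\<close>

lemma max_principle_powr:
  fixes F N :: "complex \<Rightarrow> complex"
  assumes holF: "F holomorphic_on ball 0 1" and holN: "N holomorphic_on ball 0 1"
    and r: "0 < r" "r < 1" and F1: "\<And>z. cmod z < 1 \<Longrightarrow> cmod (F z) \<le> 1" and F0: "F 0 \<noteq> 0"
    and k: "k \<ge> 0" and D: "D \<ge> 0"
    and bd: "\<And>z. cmod z = r \<Longrightarrow> F z \<noteq> 0 \<Longrightarrow> cmod (N z) * cmod (F z) powr k \<le> D"
  shows "cmod (N 0) * cmod (F 0) powr k \<le> D"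
proof (rule ccontr)
  define X where "X = cmod (N 0) * cmod (F 0) powr k"
  define p where "p = cmod (F 0)"
  have p: "0 < p" "p \<le> 1" using F0 F1[of 0] by (simp_all add: p_def)
  assume "\<not> ?thesis"
  then have X: "X > D" by (simp add: X_def)
  then have "X > 0" using D by simp
  \<comment> \<open>Rounding \<open>b * k\<close> up to an integer costs at most two extra factors
    \<open>p\<close>. The power \<open>b\<close> is so large that the assumed gap between
    \<open>D\<close> and \<open>X\<close> outweighs this loss.\<close>
  obtain b where b: "(D / X) ^ b < p\<^sup>2"
    using real_arch_pow_inv[of "p\<^sup>2" "D / X"] p X D by (auto simp: field_simps)
  \<comment> \<open>The extra 1 makes the exponent positive, so that the product vanishes at zeros
    of \<open>F\<close>, where \<open>bd\<close> says nothing.\<close>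
  define e where "e = nat \<lceil>b * k\<rceil> + 1"
  have e: "b * k \<le> e" "e \<le> b * k + 2" using k by (simp_all add: e_def) linarith+
  have "cmod (N 0 ^ b * F 0 ^ e) \<le> D ^ b"
  proof (rule maximum_modulus_frontier[where S="cball 0 r" and f="\<lambda>z. N z ^ b * F z ^ e"])
    have sub: "cball 0 r \<subseteq> ball (0::complex) 1" using r by auto
    have hol: "(\<lambda>z. N z ^ b * F z ^ e) holomorphic_on ball 0 1"
      using holF holN by (intro holomorphic_intros)
    show "(\<lambda>z. N z ^ b * F z ^ e) holomorphic_on interior (cball 0 r)"
      by (rule holomorphic_on_subset[OF hol]) (use sub interior_subset in blast)
    show "continuous_on (closure (cball 0 r)) (\<lambda>z. N z ^ b * F z ^ e)"
      by (rule continuous_on_subset[OF holomorphic_on_imp_continuous_on[OF hol]]) (use sub in simp)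
    fix z :: complex assume "z \<in> frontier (cball 0 r)"
    then have z: "cmod z = r" using r by (simp add: frontier_cball)
    show "cmod (N z ^ b * F z ^ e) \<le> D ^ b"
    proof (cases "F z = 0")
      case False
      then have f: "0 < cmod (F z)" "cmod (F z) \<le> 1" using F1[of z] z r by auto
      have "cmod (F z) ^ e = cmod (F z) powr real e" using f by (simp add: powr_realpow)
      also have "\<dots> \<le> cmod (F z) powr (b * k)" using e f by (intro powr_mono') auto
      also have "\<dots> = (cmod (F z) powr k) ^ b" using f by (simp add: powr_powr mult.commute flip: powr_realpow)
      finally have "cmod (N z ^ b * F z ^ e) \<le> cmod (N z) ^ b * (cmod (F z) powr k) ^ b"
        by (simp add: norm_mult norm_power mult_left_mono)
      also have "\<dots> \<le> D ^ b" unfolding power_mult_distrib[symmetric]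
        using bd[OF z False] by (intro power_mono) auto
      finally show ?thesis .
    qed (use D e_def in simp)
  qed (use r in auto)
  moreover have "p ^ e \<ge> (p powr k) ^ b * p\<^sup>2"
  proof -
    have "p powr (b * k) = (p powr k) ^ b" using p by (simp add: powr_powr mult.commute flip: powr_realpow)
    then have "(p powr k) ^ b * p\<^sup>2 = p powr (b * k + 2)" using p by (simp add: powr_add)
    also have "\<dots> \<le> p powr real e" using e p by (intro powr_mono') auto
    finally show ?thesis using p by (simp add: powr_realpow)
  qed
  then have "cmod (N 0) ^ b * ((p powr k) ^ b * p\<^sup>2) \<le> cmod (N 0) ^ b * p ^ e"
    by (intro mult_left_mono) auto
  ultimately have "cmod (N 0) ^ b * ((p powr k) ^ b * p\<^sup>2) \<le> D ^ b"
    unfolding norm_mult norm_power p_def by (rule order_trans[rotated])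
  then have "X ^ b * p\<^sup>2 \<le> D ^ b"
    by (simp add: X_def p_def power_mult_distrib mult.assoc)
  then have "p\<^sup>2 \<le> (D / X) ^ b" using \<open>X > 0\<close> by (simp add: power_divide field_simps)
  with b show False by simp
qed

text \<open>Pairing the disc with the unit vector in the direction of its derivative gives, by
  Cauchy-Schwarz, a function into the unit disc whose derivative at 0 has the full length; the
  classical Schwarz lemma applies to it.\<close>

lemma Schwarz_ball2:
  fixes F g :: "complex \<Rightarrow> complex"
  assumes holF: "F holomorphic_on ball 0 1" and holg: "g holomorphic_on ball 0 1"
    and F0: "F 0 = 0" and g0: "g 0 = 0"
    and bd: "\<And>z. cmod z < 1 \<Longrightarrow> (cmod (F z))\<^sup>2 + (cmod (g z))\<^sup>2 < 1"
  shows "(cmod (deriv F 0))\<^sup>2 + (cmod (deriv g 0))\<^sup>2 \<le> 1"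
proof (cases "(cmod (deriv F 0))\<^sup>2 + (cmod (deriv g 0))\<^sup>2 = 0")
  case False
  define n where "n = sqrt ((cmod (deriv F 0))\<^sup>2 + (cmod (deriv g 0))\<^sup>2)"
  have n: "n > 0" "n\<^sup>2 = (cmod (deriv F 0))\<^sup>2 + (cmod (deriv g 0))\<^sup>2" using False
    by (auto simp: n_def less_le)
  define h where "h z = (cnj (deriv F 0) * F z + cnj (deriv g 0) * g z) / of_real n" for z
  have hol: "h holomorphic_on ball 0 1" unfolding h_def using holF holg n by (intro holomorphic_intros) auto
  have DF: "(F has_field_derivative deriv F 0) (at 0)" "(g has_field_derivative deriv g 0) (at 0)"
    using holF holg by (auto intro: holomorphic_derivI)
  have "(h has_field_derivative (cnj (deriv F 0) * deriv F 0 + cnj (deriv g 0) * deriv g 0) / of_real n) (at 0)"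
    unfolding h_def using n by (auto intro!: derivative_eq_intros DF)
  moreover have "cnj (deriv F 0) * deriv F 0 + cnj (deriv g 0) * deriv g 0 = of_real (n\<^sup>2)"
    by (simp add: n(2) cmod_sq_cnj mult.commute)
  ultimately have dh: "deriv h 0 = of_real n" using n by (auto simp: DERIV_imp_deriv power2_eq_square)
  have "cmod (deriv h 0) \<le> 1"
  proof (rule Schwarz_Lemma(2)[OF hol, of 0])
    fix z :: complex assume z: "cmod z < 1"
    have "cmod (cnj (deriv F 0) * F z + cnj (deriv g 0) * g z) \<le> cmod (deriv F 0) * cmod (F z) + cmod (deriv g 0) * cmod (g z)"
      by (rule order_trans[OF norm_triangle_ineq]) (simp add: norm_mult)
    also have "\<dots> \<le> sqrt ((cmod (deriv F 0))\<^sup>2 + (cmod (deriv g 0))\<^sup>2) * sqrt ((cmod (F z))\<^sup>2 + (cmod (g z))\<^sup>2)"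
    proof -
      have "(\<alpha> * \<beta> + \<gamma> * \<delta>)\<^sup>2 \<le> (\<alpha>\<^sup>2 + \<gamma>\<^sup>2) * (\<beta>\<^sup>2 + \<delta>\<^sup>2)" for \<alpha> \<beta> \<gamma> \<delta> :: real
        using zero_le_power2[of "\<alpha> * \<delta> - \<beta> * \<gamma>"] by (simp add: power2_eq_square algebra_simps)
      then show ?thesis unfolding real_sqrt_mult[symmetric] by (rule real_le_rsqrt)
    qed
    also have "\<dots> < n * 1" unfolding n_def[symmetric] using n bd[OF z] by (intro mult_strict_left_mono) auto
    finally show "cmod (h z) < 1" using n by (simp add: h_def norm_divide)
  qed (simp_all add: h_def F0 g0)
  then have "n \<le> 1" using n by (simp add: dh)
  then show ?thesis using n by (metis power_le_one less_imp_le)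
qed simp

text \<open>For a ball one moves \<open>(p, 0)\<close> to the origin and applies the Schwarz lemma.
  Here \<open>power_tangent\<close> turns the egg's bound for \<open>g\<close>, multiplied by a
  power of \<open>cmod F\<close>, into the ball's bound, with equality at modulus
  \<open>cmod p\<close>. The weight passes through the maximum principle, since
  \<open>ln (cmod F)\<close> is harmonic off the zeros of \<open>F\<close>, and it cancels at the
  origin because nothing was lost at that modulus.\<close>

lemma egg_schwarz2:
  fixes F g :: "complex \<Rightarrow> complex"
  assumes m: "1/2 \<le> m" "m < 1"
    and holF: "F holomorphic_on ball 0 1" and holg: "g holomorphic_on ball 0 1"
    and g0: "g 0 = 0"
    and bd: "\<And>z. cmod z < 1 \<Longrightarrow> cmod (F z) powr (2*m) + (cmod (g z))\<^sup>2 < 1"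
  shows "(cmod (deriv F 0))\<^sup>2 / (1 - (cmod (F 0))\<^sup>2)\<^sup>2 + (cmod (deriv g 0))\<^sup>2 / (1 - cmod (F 0) powr (2*m)) \<le> 1"
proof -
  have m0: "m > 0" using m by simp
  have F1: "cmod (F z) < 1" if "cmod z < 1" for z
  proof (rule ccontr)
    assume "\<not> cmod (F z) < 1"
    then have "1 \<le> cmod (F z) powr (2*m)" using m0 by (intro ge_one_powr_ge_zero) auto
    with bd[OF that] show False by (smt (verit) zero_le_power2)
  qed
  show ?thesis
  proof (cases "F 0 = 0")
    case True
    \<comment> \<open>At \<open>F 0 = 0\<close> the weight would vanish. There the inclusion of the
      egg in the unit ball is already sharp enough.\<close>
    have "(cmod (F z))\<^sup>2 + (cmod (g z))\<^sup>2 < 1" if z: "cmod z < 1" for z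
    proof -
      have "(cmod (F z))\<^sup>2 \<le> cmod (F z) powr (2*m)"
      proof (cases "F z = 0")
        case False
        then have "(cmod (F z))\<^sup>2 = cmod (F z) powr 2" by simp
        also have "\<dots> \<le> cmod (F z) powr (2*m)" using False F1[OF z] m by (intro powr_mono') auto
        finally show ?thesis .
      qed simp
      with bd[OF z] show ?thesis by simp
    qed
    from Schwarz_ball2[OF holF holg True g0 this] True show ?thesis by simp
  next
    case False
    define p where "p = F 0"
    define q where "q = (cmod p)\<^sup>2"
    have q: "0 < q" "q < 1" using False F1[of 0] by (auto simp: q_def p_def abs_square_less_1)
    have qm: "cmod (F 0) powr (2*m) = q powr m"
      using False by (simp add: q_def p_def powr_powr flip: powr_numeral)
    have qm1: "q powr m < 1" using q m0 powr_less_mono2[of m q 1] by simp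
    obtain k where k: "k \<ge> 0" and tang: "\<And>x. 0 < x \<Longrightarrow> x \<le> 1 \<Longrightarrow>
       (1 - x powr m) * x powr k \<le> (1 - q powr m) / (1 - q) * q powr k * (1 - x)"
      using power_tangent[OF m0 m(2) q] by blast
    have den: "1 - cnj p * F z \<noteq> 0" if "cmod z < 1" for z
    proof
      assume "1 - cnj p * F z = 0"
      then have "cmod (cnj p * F z) = 1" by (metis norm_one right_minus_eq)
      moreover have "cmod p * cmod (F z) < 1 * 1" using F1[OF that] F1[of 0]
        by (intro mult_strict_mono) (auto simp: p_def)
      ultimately show False by (simp add: norm_mult)
    qed
    \<comment> \<open>Up to the constant factor \<open>sqrt (1 - q)\<close> on the second component,
      \<open>(mu, g2)\<close> is the image of \<open>(F, g)\<close> under the automorphism of the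
      ball that sends \<open>(p, 0)\<close> to 0.\<close>
    define mu where "mu z = (F z - p) / (1 - cnj p * F z)" for z
    define g2 where "g2 z = g z / (1 - cnj p * F z)" for z
    have hmu: "mu holomorphic_on ball 0 1" and hg2: "g2 holomorphic_on ball 0 1"
      unfolding mu_def g2_def using holF holg den by (auto intro!: holomorphic_intros)
    have id: "(cmod (1 - cnj p * w))\<^sup>2 - (cmod (w - p))\<^sup>2 = (1 - q) * (1 - (cmod w)\<^sup>2)" for w
      unfolding q_def cmod_power2 by (simp add: power2_eq_square algebra_simps)
    have mu_sq: "1 - (cmod (mu z))\<^sup>2 = (1 - q) * (1 - (cmod (F z))\<^sup>2) / (cmod (1 - cnj p * F z))\<^sup>2" if "cmod z < 1" for z
      using den[OF that] id[of "F z"] by (simp add: mu_def norm_divide power_divide field_simps)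
    have mu1: "cmod (mu z) < 1" if "cmod z < 1" for z
    proof -
      have "1 - (cmod (mu z))\<^sup>2 > 0" unfolding mu_sq[OF that] using den[OF that] q F1[OF that]
        by (auto simp: abs_square_less_1)
      then show ?thesis by (simp add: abs_square_less_1)
    qed
    have mu0: "mu 0 = 0" "g2 0 = 0" by (simp_all add: mu_def g2_def p_def g0)
    obtain nu where nu: "nu holomorphic_on ball 0 1" "\<And>z. cmod z < 1 \<Longrightarrow> mu z = z * nu z" "deriv mu 0 = nu 0"
      using Schwarz3[OF hmu mu0(1)] by blast
    obtain g3 where g3: "g3 holomorphic_on ball 0 1" "\<And>z. cmod z < 1 \<Longrightarrow> g2 z = z * g3 z" "deriv g2 0 = g3 0"
      using Schwarz3[OF hg2 mu0(2)] by blast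
    define c where "c = nu 0"
    have c1: "cmod c \<le> 1" unfolding c_def nu(3)[symmetric]
      by (rule Schwarz_Lemma(2)[OF hmu mu0(1) mu1, of 0]) auto
    have nu1: "cmod (nu z) \<le> 1" if "cmod z < 1" for z
    proof (cases "z = 0")
      case False
      have "cmod z * cmod (nu z) \<le> cmod z"
        using Schwarz_Lemma(1)[OF hmu mu0(1) mu1 that] by (simp add: nu(2)[OF that] norm_mult)
      then show ?thesis using False by simp
    qed (use c1 c_def in simp)
    define C1 where "C1 = (1 - q powr m) / (1 - q)\<^sup>2"
    have C1: "C1 > 0" using q qm1 by (simp add: C1_def)
    have step: "(cmod (g3 0))\<^sup>2 * r\<^sup>2 \<le> C1 * (1 - r\<^sup>2 * (cmod c)\<^sup>2)" if r: "0 < r" "r < 1" for r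
    proof -
      \<comment> \<open>On the circle of radius \<open>r\<close> the bound for \<open>g3\<close>
        still contains \<open>1 - r\<^sup>2 * (cmod (nu z))\<^sup>2\<close>. Division by
        \<open>e\<close> makes it constant, because
        \<open>(1 - \<bar>a\<bar>\<^sup>2) * (1 - \<bar>b\<bar>\<^sup>2)\<close> is at most the
        squared modulus of \<open>1 - cnj a * b\<close>, used with \<open>a = r * c\<close> and
        \<open>b = r * nu z\<close>. At 0 the two sides of that inequality agree.\<close>
      define e where "e z = 1 - of_real (r\<^sup>2) * cnj c * nu z" for z
      define N where "N z = g3 z / e z" for z
      have r2: "r\<^sup>2 < 1" using r by (simp add: abs_square_less_1)
      have en: "e z \<noteq> 0" if "cmod z < 1" for z
      proof
        assume "e z = 0"
        then have "cmod (of_real (r\<^sup>2) * cnj c * nu z) = 1" unfolding e_def by (metis norm_one right_minus_eq)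
        moreover have "r\<^sup>2 * (cmod c * cmod (nu z)) \<le> r\<^sup>2 * (1 * 1)"
          using c1 nu1[OF that] by (intro mult_left_mono mult_mono) auto
        ultimately show False using r2 by (simp add: norm_mult norm_power)
      qed
      have hN: "N holomorphic_on ball 0 1" unfolding N_def e_def
        using g3(1) nu(1) en unfolding e_def by (auto intro!: holomorphic_intros)
      define D2 where "D2 = C1 * q powr k / (r\<^sup>2 * (1 - r\<^sup>2 * (cmod c)\<^sup>2))"
      have rc: "r\<^sup>2 * (cmod c)\<^sup>2 < 1"
        using r2 c1 mult_left_mono[of "(cmod c)\<^sup>2" 1 "r\<^sup>2"] by (simp add: abs_square_le_1)
      have D2: "D2 > 0" using C1 q r rc by (simp add: D2_def)
      have "cmod (N 0) * cmod (F 0) powr k \<le> sqrt D2"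
      proof (rule max_principle_powr[OF holF hN r _ False k])
        fix z assume z: "cmod z = r" and Fz: "F z \<noteq> 0"
        have z1: "cmod z < 1" using z r by simp
        define x where "x = (cmod (F z))\<^sup>2"
        have x: "0 < x" "x < 1" using Fz F1[OF z1] by (auto simp: x_def abs_square_less_1)
        have xm: "cmod (F z) powr (2*m) = x powr m" and xk: "(cmod (F z) powr k)\<^sup>2 = x powr k"
          using Fz by (simp_all add: x_def powr_powr mult.commute flip: powr_numeral)
        define d where "d = (cmod (1 - cnj p * F z))\<^sup>2"
        have d: "d > 0" using den[OF z1] by (simp add: d_def)
        have "(cmod (g z))\<^sup>2 * x powr k \<le> (1 - x powr m) * x powr k"
          using bd[OF z1] xm by (intro mult_right_mono) auto
        also have "\<dots> \<le> (1 - q powr m) / (1 - q) * q powr k * (1 - x)" using tang[of x] x by simp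
        also have "\<dots> = C1 * q powr k * ((1 - q) * (1 - x))" using q by (simp add: C1_def power2_eq_square)
        also have "(1 - q) * (1 - x) = (1 - (cmod (mu z))\<^sup>2) * d"
          using mu_sq[OF z1] d by (simp add: x_def d_def field_simps)
        finally have 1: "(cmod (g z))\<^sup>2 * x powr k \<le> C1 * q powr k * ((1 - (cmod (mu z))\<^sup>2) * d)" .
        have "(cmod (g z))\<^sup>2 = (cmod (g2 z))\<^sup>2 * d"
          using den[OF z1] by (simp add: g2_def d_def norm_divide power_divide)
        then have "(cmod (g2 z))\<^sup>2 * x powr k * d \<le> C1 * q powr k * (1 - (cmod (mu z))\<^sup>2) * d"
          using 1 by (simp add: mult_ac)
        then have "(cmod (g2 z))\<^sup>2 * x powr k \<le> C1 * q powr k * (1 - (cmod (mu z))\<^sup>2)" using d by simp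
        then have 2: "r\<^sup>2 * (cmod (g3 z))\<^sup>2 * x powr k \<le> C1 * q powr k * (1 - r\<^sup>2 * (cmod (nu z))\<^sup>2)"
          unfolding nu(2)[OF z1] g3(2)[OF z1] norm_mult z power_mult_distrib .
        have 3: "(1 - r\<^sup>2 * (cmod c)\<^sup>2) * (1 - r\<^sup>2 * (cmod (nu z))\<^sup>2) \<le> (cmod (e z))\<^sup>2"
        proof -
          have "(cmod (e z))\<^sup>2 - (1 - r\<^sup>2 * (cmod c)\<^sup>2) * (1 - r\<^sup>2 * (cmod (nu z))\<^sup>2) = r\<^sup>2 * (cmod (c - nu z))\<^sup>2"
            unfolding e_def cmod_power2 by (simp add: power2_eq_square algebra_simps)
          then show ?thesis by (smt (verit) zero_le_mult_iff zero_le_power2)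
        qed
        have "r\<^sup>2 * (1 - r\<^sup>2 * (cmod c)\<^sup>2) * ((cmod (g3 z))\<^sup>2 * x powr k)
          = (1 - r\<^sup>2 * (cmod c)\<^sup>2) * (r\<^sup>2 * (cmod (g3 z))\<^sup>2 * x powr k)" by simp
        also have "\<dots> \<le> (1 - r\<^sup>2 * (cmod c)\<^sup>2) * (C1 * q powr k * (1 - r\<^sup>2 * (cmod (nu z))\<^sup>2))"
          using 2 rc by (intro mult_left_mono) auto
        also have "\<dots> = C1 * q powr k * ((1 - r\<^sup>2 * (cmod c)\<^sup>2) * (1 - r\<^sup>2 * (cmod (nu z))\<^sup>2))" by simp
        also have "\<dots> \<le> C1 * q powr k * (cmod (e z))\<^sup>2" using 3 C1 by (intro mult_left_mono) auto
        finally have "(cmod (g3 z))\<^sup>2 * x powr k \<le> C1 * q powr k * (cmod (e z))\<^sup>2 / (r\<^sup>2 * (1 - r\<^sup>2 * (cmod c)\<^sup>2))"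
          using r rc by (subst pos_le_divide_eq) (auto simp: mult.commute)
        then have "(cmod (g3 z))\<^sup>2 * x powr k \<le> D2 * (cmod (e z))\<^sup>2"
          by (simp add: D2_def)
        then have "(cmod (g3 z))\<^sup>2 / (cmod (e z))\<^sup>2 * x powr k \<le> D2" using en[OF z1] by (simp add: field_simps)
        then have "(cmod (N z) * cmod (F z) powr k)\<^sup>2 \<le> D2"
          by (simp add: N_def power_mult_distrib norm_divide power_divide xk)
        then show "cmod (N z) * cmod (F z) powr k \<le> sqrt D2" by (rule real_le_rsqrt)
      qed (use F1 D2 in \<open>auto intro: less_imp_le\<close>)
      then have "(cmod (N 0) * cmod (F 0) powr k)\<^sup>2 \<le> D2"
        using D2 power_mono[of "cmod (N 0) * cmod (F 0) powr k" "sqrt D2" 2] by simp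
      moreover have "(cmod (F 0) powr k)\<^sup>2 = q powr k"
        using False by (simp add: q_def p_def powr_powr mult.commute flip: powr_numeral)
      ultimately have 4: "(cmod (N 0))\<^sup>2 * q powr k \<le> D2" by (simp add: power_mult_distrib)
      have "e 0 = of_real (1 - r\<^sup>2 * (cmod c)\<^sup>2)"
        by (simp add: e_def c_def cmod_sq_cnj mult_ac)
      then have "cmod (e 0) = 1 - r\<^sup>2 * (cmod c)\<^sup>2" using rc by (metis norm_of_real abs_of_pos diff_gt_0_iff_gt)
      then have "(cmod (g3 0))\<^sup>2 / (1 - r\<^sup>2 * (cmod c)\<^sup>2)\<^sup>2 * q powr k \<le> C1 * q powr k / (r\<^sup>2 * (1 - r\<^sup>2 * (cmod c)\<^sup>2))"
        using 4 by (simp add: N_def norm_divide power_divide D2_def)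
      moreover have "A \<le> C1 / Y" if "A * Q \<le> C1 * Q / Y" "Q > 0" for A Y Q :: real
      proof -
        have "A * Q \<le> C1 / Y * Q" using that(1) by simp
        then show ?thesis using that(2) by (simp only: mult_le_cancel_right_pos)
      qed
      ultimately have "(cmod (g3 0))\<^sup>2 / (1 - r\<^sup>2 * (cmod c)\<^sup>2)\<^sup>2 \<le> C1 / (r\<^sup>2 * (1 - r\<^sup>2 * (cmod c)\<^sup>2))"
        using q by simp
      moreover have "G * r\<^sup>2 \<le> C1 * T" if "G / T\<^sup>2 \<le> C1 / (r\<^sup>2 * T)" "T > 0" for G T
        using that r by (simp add: field_simps power2_eq_square)
      ultimately show ?thesis using rc by simp
    qed
    have lim: "(cmod (g3 0))\<^sup>2 * 1\<^sup>2 \<le> C1 * (1 - 1\<^sup>2 * (cmod c)\<^sup>2)"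
    proof (rule tendsto_le[of "at_left (1::real)"])
      show "((\<lambda>r. (cmod (g3 0))\<^sup>2 * r\<^sup>2) \<longlongrightarrow> (cmod (g3 0))\<^sup>2 * 1\<^sup>2) (at_left 1)" by (intro tendsto_intros)
      show "((\<lambda>r. C1 * (1 - r\<^sup>2 * (cmod c)\<^sup>2)) \<longlongrightarrow> C1 * (1 - 1\<^sup>2 * (cmod c)\<^sup>2)) (at_left 1)" by (intro tendsto_intros)
      show "\<forall>\<^sub>F r in at_left 1. (cmod (g3 0))\<^sup>2 * r\<^sup>2 \<le> C1 * (1 - r\<^sup>2 * (cmod c)\<^sup>2)"
        unfolding eventually_at_left_field by (rule exI[of _ 0]) (use step in auto)
    qed simp
    have DF: "(F has_field_derivative deriv F 0) (at 0)" "(g has_field_derivative deriv g 0) (at 0)"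
      using holF holg by (auto intro: holomorphic_derivI)
    have pp: "1 - cnj p * F 0 = of_real (1 - q)"
      by (simp add: q_def p_def cmod_sq_cnj mult.commute)
    have q0: "complex_of_real (1 - q) \<noteq> 0" using q by (simp del: of_real_diff)
    have "(mu has_field_derivative deriv F 0 / of_real (1 - q)) (at 0)"
    proof -
      have "(mu has_field_derivative (deriv F 0 * (1 - cnj p * F 0) - (F 0 - p) * (- (cnj p * deriv F 0))) /
          ((1 - cnj p * F 0) * (1 - cnj p * F 0))) (at 0)"
        unfolding mu_def by (rule DERIV_divide) (use den[of 0] in \<open>auto intro!: derivative_eq_intros DF\<close>)
      moreover have "F 0 - p = 0" by (simp add: p_def)
      ultimately show ?thesis unfolding pp using q0 by simp
    qed
    then have c: "c = deriv F 0 / of_real (1 - q)" using nu(3) by (simp add: c_def DERIV_imp_deriv)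
    have "(g2 has_field_derivative deriv g 0 / of_real (1 - q)) (at 0)"
    proof -
      have "(g2 has_field_derivative (deriv g 0 * (1 - cnj p * F 0) - g 0 * (- (cnj p * deriv F 0))) /
          ((1 - cnj p * F 0) * (1 - cnj p * F 0))) (at 0)"
        unfolding g2_def by (rule DERIV_divide) (use den[of 0] in \<open>auto intro!: derivative_eq_intros DF\<close>)
      then show ?thesis unfolding pp g0 using q0 by simp
    qed
    then have g: "g3 0 = deriv g 0 / of_real (1 - q)" using g3(3) by (simp add: DERIV_imp_deriv)
    have n1: "cmod (of_real (1 - q)) = 1 - q" by (metis abs_of_pos diff_gt_0_iff_gt norm_of_real q(2))
    have cs: "(cmod c)\<^sup>2 = (cmod (deriv F 0))\<^sup>2 / (1 - q)\<^sup>2" "(cmod (g3 0))\<^sup>2 = (cmod (deriv g 0))\<^sup>2 / (1 - q)\<^sup>2"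
      unfolding c g norm_divide n1 power_divide by auto
    have "(cmod (deriv g 0))\<^sup>2 / (1 - q)\<^sup>2 \<le> (1 - q powr m) / (1 - q)\<^sup>2 * (1 - (cmod (deriv F 0))\<^sup>2 / (1 - q)\<^sup>2)"
      using lim unfolding cs C1_def by simp
    moreover have "A / s + G / w \<le> 1" if "G / s \<le> w / s * (1 - A / s)" "s > 0" "w > 0" for A G s w :: real
    proof -
      have "G / s * s \<le> w / s * (1 - A / s) * s" using that by (intro mult_right_mono) auto
      then have "G \<le> (1 - A / s) * w" using that by (simp add: mult.commute)
      then have "G / w \<le> 1 - A / s" using that by (simp add: pos_divide_le_eq)
      then show ?thesis by simp
    qed
    moreover have "(1 - q)\<^sup>2 > 0" "1 - q powr m > 0" using q qm1 by simp_all
    ultimately show ?thesis unfolding qm unfolding p_def[symmetric] q_def[symmetric] by blast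
  qed
qed

section \<open>Discs in any dimension, and the extremal discs\<close>

lemma holomorphic_map_derivative:
  assumes "holomorphic_map_on f V" "open V" "\<zeta> \<in> V"
  shows "((\<lambda>w. f w $ j) has_field_derivative vderiv f \<zeta> $ j) (at \<zeta>)"
  using assms by (auto simp: holomorphic_map_on_def vderiv_def intro: holomorphic_derivI)

lemma hin_has_field_derivative:
  assumes "holomorphic_map_on f V" "open V" "\<zeta> \<in> V"
  shows "((\<lambda>w. hin a (f w) b) has_field_derivative hin a (vderiv f \<zeta>) b) (at \<zeta>)"
  unfolding hin_def by (auto intro!: derivative_eq_intros holomorphic_map_derivative[OF assms])

lemma holomorphic_mapI_deriv:
  assumes "open V" "\<And>\<zeta> j. \<zeta> \<in> V \<Longrightarrow> ((\<lambda>w. f w $ j) has_field_derivative f' \<zeta> $ j) (at \<zeta>)"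
  shows "holomorphic_map_on f V" "\<And>\<zeta>. \<zeta> \<in> V \<Longrightarrow> vderiv f \<zeta> = f' \<zeta>"
proof -
  show "holomorphic_map_on f V"
    unfolding holomorphic_map_on_def using assms by (metis holomorphic_on_open)
  show "vderiv f \<zeta> = f' \<zeta>" if "\<zeta> \<in> V" for \<zeta>
    using assms(2)[OF that] by (simp add: vderiv_def vec_eq_iff DERIV_imp_deriv)
qed

context egg_dom
begin

text \<open>Where \<open>sg\<close> is positive, \<open>1 - ip z b\<close> lies in the right half
  plane, so the principal power in \<open>psi\<close> is holomorphic along the disc.\<close>

lemma psi_has_derivative:
  assumes f: "holomorphic_map_on f V" "open V" "\<zeta> \<in> V"
    and sb: "sg b > 0" and sf: "sg (f \<zeta>) > 0"
  shows "((\<lambda>w. psi b (f w) $ j) has_field_derivative dpsi b (f \<zeta>) (vderiv f \<zeta>) $ j) (at \<zeta>)"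
proof -
  define v where "v = vderiv f \<zeta>"
  define c where "c = 1 - ip (f \<zeta>) b"
  have c: "c \<noteq> 0" "c \<notin> \<real>\<^sub>\<le>\<^sub>0" using one_ip[OF sb sf] by (auto simp: c_def complex_nonpos_Reals_iff)
  have D: "((\<lambda>w. 1 - ip (f w) b) has_field_derivative - ip v b) (at \<zeta>)"
    unfolding v_def by (auto intro!: derivative_eq_intros hin_has_field_derivative[OF f])
  show ?thesis
  proof (cases "j = a")
    case True
    let ?e = "complex_of_real (-1/m)" and ?k = "complex_of_real (sg b powr (1/(2*m)))"
    have P: "((\<lambda>w. (1 - ip (f w) b) powr ?e) has_field_derivative ?e * c powr (?e - 1) * - ip v b) (at \<zeta>)"
      using DERIV_chain2[OF has_field_derivative_powr[of "1 - ip (f \<zeta>) b" ?e] D] c by (simp add: c_def)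
    have "c powr (?e - 1) = c powr ?e / c" using c by (simp add: powr_diff)
    then have "((\<lambda>w. f w $ a * ?k * (1 - ip (f w) b) powr ?e) has_field_derivative
         v $ a * ?k * c powr ?e + (?e * (c powr ?e / c) * - ip v b) * (f \<zeta> $ a * ?k)) (at \<zeta>)"
      using DERIV_mult[OF DERIV_cmult_right[OF holomorphic_map_derivative[OF f, of a], of ?k] P]
      by (simp add: v_def c_def)
    also have "v $ a * ?k * c powr ?e + (?e * (c powr ?e / c) * - ip v b) * (f \<zeta> $ a * ?k)
       = (v $ a + f \<zeta> $ a * ip v b / (of_real m * c)) * ?k * c powr ?e"
      using c by (simp add: field_simps)
    finally show ?thesis by (simp add: True psi_def dpsi_def v_def c_def)
  next
    case False
    have T: "((\<lambda>w. TT b (f w) $ j) has_field_derivative TT b v $ j) (at \<zeta>)"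
    proof -
      have "((\<lambda>w. of_real (sqrt (sg b)) * f w $ j + ip (f w) b / of_real (1 + sqrt (sg b)) * b $ j) has_field_derivative
         (of_real (sqrt (sg b)) * v $ j + ip v b / of_real (1 + sqrt (sg b)) * b $ j)) (at \<zeta>)"
        unfolding v_def
        by (intro DERIV_add DERIV_cmult DERIV_cmult_right DERIV_cdivide hin_has_field_derivative[OF f] holomorphic_map_derivative[OF f])
      then show ?thesis by (simp add: TT_def)
    qed
    have "((\<lambda>w. (TT b (f w) $ j - b $ j) / (1 - ip (f w) b)) has_field_derivative
        ((TT b v $ j - 0) * c - (TT b (f \<zeta>) $ j - b $ j) * (- ip v b)) / (c * c)) (at \<zeta>)"
      unfolding c_def by (intro DERIV_divide DERIV_diff T DERIV_const D) (use c c_def in auto)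
    also have "((TT b v $ j - 0) * c - (TT b (f \<zeta>) $ j - b $ j) * (- ip v b)) / (c * c)
       = 1 / c * TT b v $ j + ip v b / c\<^sup>2 * (TT b (f \<zeta>) $ j - b $ j)"
      using c by (simp add: add_divide_distrib power2_eq_square mult.commute)
    finally show ?thesis using False by (simp add: psi_def dpsi_def v_def c_def diff_divide_distrib right_diff_distrib)
  qed
qed

lemma psi_comp:
  assumes f: "holomorphic_map_on f V" "open V"
    and sb: "sg b > 0" and sf: "\<And>\<zeta>. \<zeta> \<in> V \<Longrightarrow> sg (f \<zeta>) > 0"
  shows "holomorphic_map_on (\<lambda>\<zeta>. psi b (f \<zeta>)) V"
    "\<And>\<zeta>. \<zeta> \<in> V \<Longrightarrow> vderiv (\<lambda>\<zeta>. psi b (f \<zeta>)) \<zeta> = dpsi b (f \<zeta>) (vderiv f \<zeta>)"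
  using holomorphic_mapI_deriv[OF f(2), of "\<lambda>\<zeta>. psi b (f \<zeta>)" "\<lambda>\<zeta>. dpsi b (f \<zeta>) (vderiv f \<zeta>)"]
    psi_has_derivative[OF f _ sb sf] by auto

text \<open>Pairing the components other than \<open>a\<close> with the unit vector \<open>u\<close>
  along those of the derivative reduces the problem to two dimensions. Cauchy-Schwarz keeps the
  paired disc in a two-dimensional egg, and at 0 the pairing loses no length.\<close>

lemma axis_disc_wuQ_le:
  assumes f: "holomorphic_map_on f (ball 0 1)" "f ` ball 0 1 \<subseteq> egg a m" and f0: "f 0 = jn p 0"
  shows "wuQ (f 0) (vderiv f 0) \<le> 1"
proof -
  define v where "v = vderiv f 0"
  define N where "N = sqrt (nq v)"
  define u where "u = (if N = 0 then 0 else (1 / of_real N) *s v)"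
  have N2: "N * N = nq v" by (simp add: N_def)
  have u1: "nq u \<le> 1"
  proof (cases "N = 0")
    case False
    then have "nq u = nq v / N\<^sup>2" by (simp add: u_def nsq_scale norm_divide power_divide)
    then show ?thesis using N2 by (simp add: power2_eq_square)
  qed (simp add: u_def nsq_def)
  have vu: "ip v u = of_real N"
  proof (cases "N = 0")
    case False
    then have "ip v u = of_real (nq v) / of_real N" by (simp add: u_def hin_scale_right hin_self)
    then show ?thesis using False by (simp flip: N2)
  next
    case True
    then show ?thesis by (simp add: u_def)
  qed
  have in0: "(0::complex) \<in> ball 0 1" by simp
  have Dg: "((\<lambda>w. ip (f w) u) has_field_derivative ip (vderiv f \<zeta>) u) (at \<zeta>)" if "\<zeta> \<in> ball 0 1" for \<zeta>
    using hin_has_field_derivative[OF f(1) open_ball that] .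
  have dg: "deriv (\<lambda>w. ip (f w) u) 0 = of_real N"
    using Dg[OF in0] by (simp add: DERIV_imp_deriv vu v_def[symmetric])
  have "(cmod (deriv (\<lambda>w. f w $ a) 0))\<^sup>2 / (1 - (cmod (f 0 $ a))\<^sup>2)\<^sup>2
     + (cmod (deriv (\<lambda>w. ip (f w) u) 0))\<^sup>2 / (1 - cmod (f 0 $ a) powr (2*m)) \<le> 1"
  proof (rule egg_schwarz2[OF m_ge m_lt])
    show "(\<lambda>w. f w $ a) holomorphic_on ball 0 1" using f(1) by (simp add: holomorphic_map_on_def)
    show "(\<lambda>w. ip (f w) u) holomorphic_on ball 0 1" using Dg by (metis holomorphic_on_open open_ball)
    show "ip (f 0) u = 0" by (simp add: f0)
    fix z :: complex assume "cmod z < 1"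
    then have e: "f z \<in> egg a m" using f(2) by auto
    have "(cmod (ip (f z) u))\<^sup>2 \<le> nq (f z) * 1"
      by (rule order_trans[OF hin_Cauchy_Schwarz]) (intro mult_left_mono u1 nsq_nonneg)
    then show "cmod (f z $ a) powr (2*m) + (cmod (ip (f z) u))\<^sup>2 < 1"
      using e by (simp add: egg_iff sg_def)
  qed
  then show ?thesis unfolding wuQ_axis[OF f0] dg
    by (simp add: f0 vderiv_def N2 power2_eq_square v_def)
qed

lemma sg_psi_self: "sg b > 0 \<Longrightarrow> \<exists>p. psi b b = jn p 0"
  using psi_self by blast

lemma disc_wuQ_le:
  assumes f: "holomorphic_map_on f (ball 0 1)" "f ` ball 0 1 \<subseteq> egg a m"
  shows "wuQ (f 0) (vderiv f 0) \<le> 1"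
proof -
  have sgf: "sg (f \<zeta>) > 0" if "\<zeta> \<in> ball 0 1" for \<zeta> using f(2) that egg_sg by blast
  define b where "b = f 0"
  have sb: "sg b > 0" using sgf by (simp add: b_def)
  obtain p where p: "psi b (f 0) = jn p 0" using sg_psi_self[OF sb] by (auto simp: b_def)
  have "wuQ (psi b (f 0)) (vderiv (\<lambda>\<zeta>. psi b (f \<zeta>)) 0) \<le> 1"
    by (rule axis_disc_wuQ_le[where f="\<lambda>\<zeta>. psi b (f \<zeta>)"])
      (use psi_comp(1)[OF f(1) open_ball sb sgf] f(2) psi_egg[OF sb] p in auto)
  then show ?thesis using psi_comp(2)[OF f(1) open_ball sb sgf, of 0]
    by (simp add: wuQ_psi[OF sb] sb b_def[symmetric])
qed

lemma dpsi_linear: "Vector_Spaces.linear (*s) (*s) (dpsi b z)"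
proof (unfold_locales; rule vec_eq_iff[THEN iffD2]; rule allI)
  fix x y :: "complex^'n" and c :: complex and i
  have T: "TT b (x + y) $ i = TT b x $ i + TT b y $ i" "TT b (c *s x) $ i = c * TT b x $ i"
    by (simp_all add: TT_def hin_add_left hin_scale_left algebra_simps add_divide_distrib)
  show "dpsi b z (x + y) $ i = (dpsi b z x + dpsi b z y) $ i"
    by (cases "i = a") (simp_all add: dpsi_def hin_add_left T algebra_simps add_divide_distrib)
  show "dpsi b z (c *s x) $ i = (c *s dpsi b z x) $ i"
    by (cases "i = a") (simp_all add: dpsi_def hin_scale_left T algebra_simps)
qed

text \<open>\<open>W\<close> is an isometry from the Euclidean norm to \<open>wuQ z\<close>. At a
  point of the axis the direction of the axis is realised by the unit disc itself after a Moebius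
  reparametrisation, and the orthogonal directions by affine discs with constant \<open>z$a\<close>.
  \<open>W\<close> scales by the two speeds and transports the discs with the derivative of an
  automorphism.\<close>

lemma egg_frame:
  assumes z: "z \<in> egg a m"
  obtains W :: "complex^'n^'n" where "\<And>v. wuQ z (W *v v) = (norm v)\<^sup>2"
    "\<And>u. norm u = 1 \<Longrightarrow> u = axis a 1 \<or> u $ a = 0 \<Longrightarrow>
       \<exists>f. holomorphic_map_on f (ball 0 1) \<and> f ` ball 0 1 \<subseteq> egg a m \<and> f 0 = z \<and> vderiv f 0 = W *v u"
proof -
  \<comment> \<open>\<open>psi (- z)\<close> acts as the inverse of \<open>psi z\<close>; the value
    of \<open>p\<close> compensates its factor on \<open>z$a\<close>, so that the axis point
    \<open>P\<close> is sent to \<open>z\<close>.\<close>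
  define b where "b = - z"
  have sz: "sg z > 0" and sb: "sg b > 0" using egg_sg[OF z] by (simp_all add: b_def sg_def)
  define p where "p = z $ a / of_real (sg z powr (1/(2*m)))"
  define P where "P = jn p 0"
  have sP: "sg P = 1" by (simp add: P_def sg_def nsq_def)
  have psiP: "psi b P = z"
  proof -
    have i: "ip P b = 0" and ni: "sg b = sg z" by (simp_all add: P_def b_def sg_def)
    show ?thesis
    proof (rule vec_eq_iff[THEN iffD2], rule allI)
      fix j show "psi b P $ j = z $ j"
        unfolding psi_def i ni using sz
        by (cases "j = a") (simp_all add: TT_def i, simp_all add: P_def p_def b_def)
    qed
  qed
  have "tt P = tt z" using tt_psi[of b P] sb sP psiP by simp
  then have Pe: "P \<in> egg a m" using z sP by (simp add: egg_iff_tt)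
  then have p1: "cmod p < 1" using egg_cmod_a[OF Pe] by (simp add: P_def)
  have pm: "cmod p powr (2*m) < 1" using Pe by (simp add: egg_iff sP) (simp add: P_def)
  define al where "al = 1 - (cmod p)\<^sup>2"
  define be where "be = sqrt (1 - cmod p powr (2*m))"
  have al: "al > 0" using p1 by (simp add: al_def abs_square_less_1)
  have be: "be > 0" "be\<^sup>2 = 1 - cmod p powr (2*m)" using pm by (simp_all add: be_def)
  define sc where "sc v = jn (of_real al * v $ a) (of_real be *s v)" for v :: "complex^'n"
  define L where "L v = dpsi b P (sc v)" for v
  have "Vector_Spaces.linear (*s) (*s) sc"
    by unfold_locales (simp_all add: sc_def vec_eq_iff join_def algebra_simps)
  then have "Vector_Spaces.linear (*s) (*s) L" unfolding L_def
    using Vector_Spaces.linear_compose[OF _ dpsi_linear[of b P], of "(*s)" sc] by (simp add: o_def)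
  then have W: "matrix L *v v = L v" for v by (rule matrix_works)
  have norm: "wuQ z (matrix L *v v) = (norm v)\<^sup>2" for v
  proof -
    have "wuQ z (L v) = wuQ P (sc v)" using wuQ_psi[of b P "sc v"] sb sP by (simp add: psiP L_def)
    also have "\<dots> = (cmod (v$a))\<^sup>2 + nq v"
      unfolding wuQ_axis[OF P_def] using al be pm by (simp add: sc_def nsq_scale norm_mult power_mult_distrib al_def[symmetric])
    finally show ?thesis by (simp add: W norm_sq_vec[of _ a])
  qed
  have discs: "\<exists>f. holomorphic_map_on f (ball 0 1) \<and> f ` ball 0 1 \<subseteq> egg a m \<and> f 0 = z \<and> vderiv f 0 = matrix L *v u"
    if g: "holomorphic_map_on g (ball 0 1)" "g ` ball 0 1 \<subseteq> egg a m" "g 0 = P" "vderiv g 0 = sc u" for g u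
  proof -
    have sgg: "sg (g \<zeta>) > 0" if "\<zeta> \<in> ball 0 1" for \<zeta> using g(2) that egg_sg by blast
    show ?thesis
      using psi_comp[OF g(1) open_ball sb sgg] g psi_egg[OF sb] psiP
      by (intro exI[of _ "\<lambda>\<zeta>. psi b (g \<zeta>)"]) (auto simp: W L_def)
  qed
  show thesis
  proof (rule that[of "matrix L", OF norm])
    fix u :: "complex^'n" assume u: "norm u = 1" "u = axis a 1 \<or> u $ a = 0"
    have un: "(cmod (u$a))\<^sup>2 + nq u = 1" using u(1) norm_sq_vec[of u a] by simp
    show "\<exists>f. holomorphic_map_on f (ball 0 1) \<and> f ` ball 0 1 \<subseteq> egg a m \<and> f 0 = z \<and> vderiv f 0 = matrix L *v u"
    proof (cases "u $ a = 0")
      case True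
      define g where "g \<zeta> = jn p ((\<zeta> * of_real be) *s u)" for \<zeta>
      have D: "((\<lambda>w. g w $ j) has_field_derivative jn 0 (of_real be *s u) $ j) (at \<zeta>)" for \<zeta> j
        by (cases "j = a") (auto simp: g_def intro!: derivative_eq_intros)
      show ?thesis
      proof (rule discs)
        show "holomorphic_map_on g (ball 0 1)" "vderiv g 0 = sc u"
          using holomorphic_mapI_deriv[OF open_ball, of 0 1 g "\<lambda>_. jn 0 (of_real be *s u)"] D True
          by (auto simp: sc_def)
        show "g 0 = P" by (simp add: g_def P_def)
        show "g ` ball 0 1 \<subseteq> egg a m"
        proof clarify
          fix \<zeta> :: complex assume "\<zeta> \<in> ball 0 1"
          then have "(cmod \<zeta>)\<^sup>2 < 1" by (simp add: abs_square_less_1)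
          then have "(cmod \<zeta>)\<^sup>2 * be\<^sup>2 < 1 * be\<^sup>2" using be(1) by (intro mult_strict_right_mono) auto
          moreover have "nq (g \<zeta>) = (cmod \<zeta>)\<^sup>2 * be\<^sup>2"
            using un True be by (simp add: g_def nsq_scale norm_mult power_mult_distrib)
          moreover have "g \<zeta> $ a = p" by (simp add: g_def)
          ultimately show "g \<zeta> \<in> egg a m" using be unfolding egg_iff sg_def by simp
        qed
      qed
    next
      case False
      with u have ua: "u = axis a 1" by auto
      have den: "1 + cnj p * \<zeta> \<noteq> 0" if "cmod \<zeta> < 1" for \<zeta>
      proof
        assume "1 + cnj p * \<zeta> = 0"
        then have "cmod (cnj p * \<zeta>) = 1" by (metis add_eq_0_iff norm_minus_cancel norm_one)
        moreover have "cmod p * cmod \<zeta> < 1 * 1" using p1 that by (intro mult_strict_mono) auto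
        ultimately show False by (simp add: norm_mult)
      qed
      define g where "g \<zeta> = jn ((\<zeta> + p) / (1 + cnj p * \<zeta>)) 0" for \<zeta>
      have D: "((\<lambda>w. g w $ j) has_field_derivative
          jn ((1 * (1 + cnj p * \<zeta>) - (\<zeta> + p) * cnj p) / ((1 + cnj p * \<zeta>) * (1 + cnj p * \<zeta>))) 0 $ j) (at \<zeta>)"
        if "\<zeta> \<in> ball 0 1" for \<zeta> j
      proof (cases "j = a")
        case True
        have "((\<lambda>w. (w + p) / (1 + cnj p * w)) has_field_derivative
          (1 * (1 + cnj p * \<zeta>) - (\<zeta> + p) * cnj p) / ((1 + cnj p * \<zeta>) * (1 + cnj p * \<zeta>))) (at \<zeta>)"
          by (rule DERIV_divide) (use den that in \<open>auto intro!: derivative_eq_intros\<close>)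
        then show ?thesis by (simp add: g_def True)
      qed (simp add: g_def)
      show ?thesis
      proof (rule discs)
        note H = holomorphic_mapI_deriv[OF open_ball, of 0 1 g, OF D]
        show "holomorphic_map_on g (ball 0 1)" by (rule H)
        have "vderiv g 0 = jn (1 - p * cnj p) 0" by (subst H(2)) auto
        then show "vderiv g 0 = sc u"
          by (simp add: sc_def ua vec_eq_iff join_def al_def cmod_sq_cnj axis_def)
        show "g 0 = P" by (simp add: g_def P_def)
        show "g ` ball 0 1 \<subseteq> egg a m"
        proof clarify
          fix \<zeta> :: complex assume z: "\<zeta> \<in> ball 0 1"
          have "(cmod (1 + cnj p * \<zeta>))\<^sup>2 - (cmod (\<zeta> + p))\<^sup>2 = al * (1 - (cmod \<zeta>)\<^sup>2)"
            unfolding al_def cmod_power2 by (simp add: power2_eq_square algebra_simps)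
          moreover have "al * (1 - (cmod \<zeta>)\<^sup>2) > 0" using al z by (simp add: abs_square_less_1)
          ultimately have "(cmod (\<zeta> + p))\<^sup>2 < (cmod (1 + cnj p * \<zeta>))\<^sup>2" by linarith
          then have "cmod (\<zeta> + p) < cmod (1 + cnj p * \<zeta>)" by (rule power_less_imp_less_base) simp
          then have lt: "cmod ((\<zeta> + p) / (1 + cnj p * \<zeta>)) < 1" using den z by (auto simp: norm_divide)
          have "sg (g \<zeta>) = 1" by (simp add: sg_def g_def nsq_def)
          then show "g \<zeta> \<in> egg a m" using lt by (simp add: egg_iff_tt tt_def AA_def abs_square_less_1) (simp add: g_def abs_square_less_1)
        qed
      qed
    qed
  qed
qed

end

section \<open>Ellipsoids of minimal volume\<close>

lemma linear_matrix_vec: "linear (\<lambda>x. (A::complex^'n::finite^'n) *v x)"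
proof (rule linearI)
  show "A *v (x + y) = A *v x + A *v y" for x y by (rule matrix_vector_right_distrib)
  show "A *v (c *\<^sub>R x) = c *\<^sub>R (A *v x)" for c x
    by (simp add: vec_eq_iff matrix_vector_mult_def scaleR_sum_right)
qed

lemma DIM_complex_vec: "DIM(complex^'n::finite) = CARD('n bit0)"
  by simp

text \<open>Change of variables is available for \<open>real ^ 'k\<close> with a well-ordered index type only, so
  \<open>complex ^ 'n\<close> is identified with \<open>real ^ ('n bit0)\<close>.\<close>

lemma lborel_linear:
  fixes f :: "complex^'n::finite \<Rightarrow> complex^'n"
  assumes f: "linear f" "inj f"
  obtains c where "c > 0" "lborel = density (distr lborel borel f) (\<lambda>_. ennreal c)"
proof -
  obtain h where h: "bij_betw h (UNIV :: 'n bit0 set) (Basis :: (complex^'n) set)"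
    using finite_same_card_bij[of "UNIV :: 'n bit0 set" "Basis :: (complex^'n) set"] DIM_complex_vec[where 'n='n] by auto
  define J :: "complex^'n \<Rightarrow> real^('n bit0)" where "J x = (\<chi> i. x \<bullet> h i)" for x
  define K :: "real^('n bit0) \<Rightarrow> complex^'n" where "K y = (\<Sum>i\<in>UNIV. y $ i *\<^sub>R h i)" for y
  have hB: "h i \<in> Basis" for i using h by (auto simp: bij_betw_def)
  have hi: "h i = h j \<longleftrightarrow> i = j" for i j using h by (auto simp: bij_betw_def inj_on_def)
  have i: "K y \<bullet> h i = y $ i" for y i
    by (simp add: K_def inner_sum_left inner_Basis hB hi if_distrib cong: if_cong)
  have JK: "J (K y) = y" for y
    by (rule vec_eq_iff[THEN iffD2]) (simp add: J_def i)
  have KJ: "K (J x) = x" for x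
  proof -
    have "K (J x) = (\<Sum>b\<in>Basis. (x \<bullet> b) *\<^sub>R b)"
      unfolding K_def J_def by (simp add: sum.reindex_bij_betw[OF h, where g="\<lambda>b. (x \<bullet> b) *\<^sub>R b"])
    then show ?thesis by (simp add: euclidean_representation)
  qed
  have lJ: "linear J" by (intro linearI; rule vec_eq_iff[THEN iffD2]) (simp_all add: J_def inner_add_left)
  have lK: "linear K" by (intro linearI) (simp_all add: K_def scaleR_add_left sum.distrib scaleR_sum_right)
  note lin_cont = linear_continuous_on[OF linear_conv_bounded_linear[THEN iffD1]]
  have cJ: "continuous_on A J" and cK: "continuous_on B K" for A B
    by (rule lin_cont[OF lJ], rule lin_cont[OF lK])
  have Bh: "Basis = range h" using h by (simp add: bij_betw_def)
  have mJ: "J \<in> borel_measurable borel" by (intro borel_measurable_continuous_onI cJ)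
  have boxJ: "J -` box l u = box (K l) (K u)" for l u
    by (simp add: set_eq_iff mem_box_cart(1) mem_box(1) Bh J_def i)
  have distrJ: "distr lborel borel J = lborel"
  proof (rule lborel_eqI[symmetric])
    fix l u :: "real^('n bit0)" assume lu: "\<And>b. b \<in> Basis \<Longrightarrow> l \<bullet> b \<le> u \<bullet> b"
    have lu': "l $ i \<le> u $ i" for i using lu[of "axis i 1"] by (simp add: inner_axis)
    have lu'': "K l \<bullet> b \<le> K u \<bullet> b" if "b \<in> Basis" for b
      using that lu' by (auto simp: Bh i)
    have "emeasure (distr lborel borel J) (box l u) = emeasure lborel (box (K l) (K u))"
      by (subst emeasure_distr) (use mJ in \<open>auto simp: boxJ\<close>)
    also have "\<dots> = ennreal (\<Prod>b\<in>Basis. (K u - K l) \<bullet> b)" by (rule emeasure_lborel_box) (rule lu'')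
    also have "(\<Prod>b\<in>Basis. (K u - K l) \<bullet> b) = (\<Prod>i\<in>UNIV. (K u - K l) \<bullet> h i)"
      by (rule prod.reindex_bij_betw[OF h, symmetric])
    also have "\<dots> = (\<Prod>i\<in>UNIV. u $ i - l $ i)" by (simp add: inner_diff_left i)
    also have "\<dots> = (\<Prod>b\<in>Basis. (u - l) \<bullet> b)"
    proof -
      have B: "(Basis :: (real^('n bit0)) set) = (\<lambda>i. axis i 1) ` UNIV" by (auto simp: Basis_vec_def)
      show ?thesis unfolding B by (subst prod.reindex) (auto simp: inj_on_def axis_eq_axis inner_axis)
    qed
    finally show "emeasure (distr lborel borel J) (box l u) = (\<Prod>b\<in>Basis. (u - l) \<bullet> b)" .
  qed simp
  have emJ: "emeasure lborel (J -` T) = emeasure lborel T" if "T \<in> sets borel" for T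
    using that by (subst distrJ[symmetric], subst emeasure_distr) (use mJ in auto)
  obtain g where g: "linear g" "\<And>x. g (f x) = x" using linear_injective_left_inverse[OF f] by (metis comp_apply id_apply)
  have fg: "f (g x) = x" for x
    using linear_inj_imp_surj[OF f] g by (metis surj_def)
  \<comment> \<open>The inverse of \<open>f\<close> in real coordinates: preimages of boxes under
    \<open>f\<close> become images under \<open>F\<close>, whose measure the determinant
    gives.\<close>
  define F where "F = J \<circ> g \<circ> K"
  have lF: "linear F" unfolding F_def by (intro linear_compose lK g lJ)
  define d where "d = \<bar>det (matrix F)\<bar>"
  have mf: "f \<in> borel_measurable borel"
    by (intro borel_measurable_continuous_onI linear_continuous_on) (use f in \<open>simp add: linear_conv_bounded_linear[symmetric]\<close>)
  have em: "emeasure lborel (f -` box l u) = ennreal d * emeasure lborel (box l u)" for l u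
  proof -
    define S where "S = J ` box l u"
    have S: "S = box (J l) (J u)"
    proof -
      have "J -` box (J l) (J u) = box l u" by (simp add: boxJ KJ)
      then show ?thesis unfolding S_def by (metis JK image_vimage_eq surj_def inf_top_right Int_UNIV_right)
    qed
    have "f -` box l u = J -` (F ` S)"
      unfolding S_def F_def using g fg KJ JK by (auto simp: image_iff) (metis)+
    moreover have Fl: "F ` S \<in> lmeasurable" and "measure lebesgue (F ` S) = d * measure lebesgue S"
      unfolding d_def using lF S by (simp_all add: measurable_linear_image measure_linear_image)
    moreover have bF: "F ` S \<in> sets borel"
    proof -
      have "F ` S = (K -` (f -` box l u))"
        unfolding S_def F_def using g fg KJ JK by (auto simp: image_iff) (metis)+
      moreover have "open (K -` (f -` box l u))"
        by (intro open_vimage open_box) (use cK lin_cont[OF f(1)] in auto)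
      ultimately show ?thesis by simp
    qed
    ultimately have "emeasure lborel (f -` box l u) = emeasure lborel (F ` S)" using emJ by simp
    also have "\<dots> = emeasure lebesgue (F ` S)" using bF by simp
    also have "\<dots> = ennreal (measure lebesgue (F ` S))" using Fl by (rule emeasure_eq_measure2[OF _])
    also have "\<dots> = ennreal d * ennreal (measure lebesgue S)"
      using \<open>measure lebesgue (F ` S) = _\<close> by (simp add: ennreal_mult d_def)
    also have "ennreal (measure lebesgue S) = emeasure lebesgue S"
      unfolding S by (rule emeasure_eq_measure2[symmetric]) simp
    also have "\<dots> = emeasure lborel (J -` S)" unfolding S by (simp add: emJ)
    also have "J -` S = box l u" unfolding S by (simp add: boxJ KJ)
    finally show ?thesis .
  qed
  \<comment> \<open>Otherwise the preimage of an open box, a nonempty open set, would be a null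
    set.\<close>
  have "d \<noteq> 0"
  proof
    assume "d = 0"
    then have "emeasure lborel (f -` box 0 One) = 0" using em by simp
    moreover have "open (f -` box 0 One)"
      by (intro open_vimage open_box) (use lin_cont[OF f(1)] in auto)
    moreover have "f -` box 0 One \<noteq> {}"
    proof -
      have "(1/2) *\<^sub>R One \<in> box 0 (One :: complex^'n)" by (simp add: mem_box)
      then have "g ((1/2) *\<^sub>R One) \<in> f -` box 0 One" by (simp add: fg)
      then show ?thesis by blast
    qed
    ultimately show False using open_not_negligible[of "f -` box 0 One"]
      by (auto simp: negligible_iff_null_sets null_sets_def)
  qed
  then have d: "d > 0" by (simp add: d_def)
  have "lborel = density (distr lborel borel f) (\<lambda>_. ennreal (1/d))"
  proof (rule lborel_eqI)
    fix l u :: "complex^'n" assume lu: "\<And>b. b \<in> Basis \<Longrightarrow> l \<bullet> b \<le> u \<bullet> b"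
    have "emeasure (density (distr lborel borel f) (\<lambda>_. ennreal (1/d))) (box l u)
       = ennreal (1/d) * emeasure lborel (f -` box l u)"
      by (subst emeasure_density_const, simp, subst emeasure_distr) (use mf in auto)
    also have "\<dots> = emeasure lborel (box l u)"
      unfolding em mult.assoc[symmetric] using d by (simp flip: ennreal_mult)
    also have "\<dots> = ennreal (\<Prod>b\<in>Basis. (u - l) \<bullet> b)" by (rule emeasure_lborel_box) (rule lu)
    finally show "emeasure (density (distr lborel borel f) (\<lambda>_. ennreal (1/d))) (box l u) = (\<Prod>b\<in>Basis. (u - l) \<bullet> b)" .
  qed simp
  then show thesis using d by (intro that[of "1/d"]) auto
qed

lemma linear_change_of_variables:
  fixes f :: "complex^'n::finite \<Rightarrow> complex^'n"
  assumes f: "linear f" "inj f"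
  obtains c where "c > 0"
    "\<And>k :: complex^'n \<Rightarrow> real. k \<in> borel_measurable borel \<Longrightarrow> integrable lborel k \<Longrightarrow> integrable lborel (\<lambda>x. k (f x))"
    "\<And>k :: complex^'n \<Rightarrow> real. k \<in> borel_measurable borel \<Longrightarrow> (LINT x|lborel. k x) = c * (LINT x|lborel. k (f x))"
    "\<And>S. S \<in> sets borel \<Longrightarrow> measure lborel S = c * measure lborel (f -` S)"
proof -
  obtain c where c: "c > 0" and L: "lborel = density (distr lborel borel f) (\<lambda>_. ennreal c)"
    using lborel_linear[OF f] by blast
  have mf: "f \<in> borel_measurable borel"
    by (intro borel_measurable_continuous_onI linear_continuous_on) (use f in \<open>simp add: linear_conv_bounded_linear[symmetric]\<close>)
  have I: "(LINT x|lborel. k x) = c * (LINT x|lborel. k (f x))" if k: "k \<in> borel_measurable borel" for k :: "complex^'n \<Rightarrow> real"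
    by (subst L, subst integral_density) (use k c mf in \<open>auto simp: integral_distr\<close>)
  show thesis
  proof (rule that[OF c])
    fix k :: "complex^'n \<Rightarrow> real" assume k: "k \<in> borel_measurable borel"
    show "(LINT x|lborel. k x) = c * (LINT x|lborel. k (f x))" by (rule I[OF k])
    assume i: "integrable lborel k"
    have "integrable (density (distr lborel borel f) (\<lambda>_. ennreal c)) k" using i by (subst L[symmetric])
    then have "integrable (distr lborel borel f) (\<lambda>x. c *\<^sub>R k x)"
      by (subst (asm) integrable_density) (use k c in auto)
    then show "integrable lborel (\<lambda>x. k (f x))"
      using c k mf by (auto simp: integrable_distr_eq)
  next
    fix S :: "(complex^'n) set" assume S: "S \<in> sets borel"
    have fS: "f -` S \<in> sets borel" using measurable_sets[OF mf S] by simp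
    have "(LINT x|lborel. indicator S x) = c * (LINT x|lborel. indicator S (f x) :: real)"
      by (rule I) (use S in auto)
    moreover have "(\<lambda>x. indicator S (f x) :: real) = indicator (f -` S)" by (auto simp: indicator_def)
    ultimately show "measure lborel S = c * measure lborel (f -` S)" using S fS by simp
  qed
qed

section \<open>Comparison of volumes\<close>

lemma continuous_integral_eq_0:
  fixes k :: "'a::euclidean_space \<Rightarrow> real"
  assumes c: "continuous_on UNIV k" and "\<And>x. k x \<ge> 0" and "integrable lborel k" "(LINT x|lborel. k x) = 0"
  shows "k x = 0"
proof (rule ccontr)
  assume "k x \<noteq> 0"
  have "AE x in lborel. k x = 0" using assms(2-4) by (subst (asm) integral_nonneg_eq_0_iff_AE) auto
  moreover have op: "open {x. k x \<noteq> 0}" using c by (intro open_Collect_neq) auto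
  moreover have "{x. k x \<noteq> 0} \<in> sets lborel" using op by simp
  ultimately have "{x. k x \<noteq> 0} \<in> null_sets lborel"
    by (subst AE_iff_null_sets) auto
  then show False using op open_not_negligible[of "{x. k x \<noteq> 0}"] \<open>k x \<noteq> 0\<close>
    by (auto simp: negligible_iff_null_sets null_sets_completionI)
qed

definition tent :: "complex^'n::finite \<Rightarrow> real" where "tent x = max 0 (1 - (norm x)\<^sup>2)"

lemma tent_props:
  fixes x :: "complex^'n::finite"
  shows "continuous_on A (tent :: complex^'n \<Rightarrow> real)" "(tent :: complex^'n \<Rightarrow> real) \<in> borel_measurable borel"
  "integrable lborel (tent :: complex^'n \<Rightarrow> real)" "tent x \<ge> 0"
proof -
  have c: "continuous_on B (tent :: complex^'n \<Rightarrow> real)" for B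
    unfolding tent_def by (intro continuous_intros)
  then show "continuous_on A (tent :: complex^'n \<Rightarrow> real)" .
  from c show "(tent :: complex^'n \<Rightarrow> real) \<in> borel_measurable borel" by (rule borel_measurable_continuous_onI)
  have "integrable lborel (\<lambda>x::complex^'n. indicator (cball 0 1) x *\<^sub>R tent x)"
    by (rule borel_integrable_compact) (auto intro: c)
  moreover have "(\<lambda>x::complex^'n. indicator (cball 0 1) x *\<^sub>R tent x) = tent"
  proof
    fix x :: "complex^'n"
    have "\<not> norm x \<le> 1 \<Longrightarrow> (norm x)\<^sup>2 > 1" by (simp add: one_less_power)
    then show "indicator (cball 0 1) x *\<^sub>R tent x = tent x" by (auto simp: tent_def indicator_def)
  qed
  ultimately show "integrable lborel (tent :: complex^'n \<Rightarrow> real)" by simp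
qed (simp add: tent_def)

text \<open>Averaging \<open>M\<close> over the reflection \<open>R\<close> removes the cross terms between the axis \<open>a\<close> and its
  complement; \<open>tent\<close> is used because it is convex in the quadratic form.\<close>

lemma ellipsoid_volume:
  fixes M :: "complex^'n::finite \<Rightarrow> complex^'n"
  assumes M: "linear M" "inj M"
    and Ma: "\<And>c. norm (M (axis a c)) \<le> cmod c" and Mu: "\<And>u. u $ a = 0 \<Longrightarrow> norm (M u) \<le> norm u"
  shows "measure lborel (ball (0::complex^'n) 1) \<le> measure lborel {w. norm (M w) < 1}" (is ?le)
    and "measure lborel {w. norm (M w) < 1} = measure lborel (ball (0::complex^'n) 1) \<Longrightarrow> norm (M w) = norm w"
proof -
  define R where "R w = w - 2 *\<^sub>R axis a (w $ a)" for w :: "complex^'n"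
  have lR: "linear R"
    by (intro linearI; rule vec_eq_iff[THEN iffD2]) (auto simp: R_def axis_def algebra_simps)
  have RR: "R (R w) = w" for w by (simp add: R_def vec_eq_iff axis_def scaleR_2)
  have iR: "inj R" by (metis RR injI)
  have nsq: "(norm (axis a (w $ a)))\<^sup>2 + (norm (w - axis a (w $ a)))\<^sup>2 = (norm w)\<^sup>2" for w :: "complex^'n"
    unfolding norm_sq_vec[of _ a] using nsq_cong[of a "w - axis a (w$a)" w]
    by (simp add: axis_def nsq_def)
  have nR: "norm (R w) = norm w" for w
  proof -
    have "(norm (R w))\<^sup>2 = (norm w)\<^sup>2"
    proof -
      have "R w $ a = - w $ a" "\<And>j. j \<noteq> a \<Longrightarrow> R w $ j = w $ j" by (simp_all add: R_def axis_def scaleR_2)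
      then show ?thesis unfolding norm_sq_vec[of _ a] using nsq_cong[of a "R w" w] by simp
    qed
    then show ?thesis by simp
  qed
  have par: "(norm (M w))\<^sup>2 + (norm (M (R w)))\<^sup>2 \<le> 2 * (norm w)\<^sup>2" for w
  proof -
    let ?x = "M (axis a (w $ a))" and ?y = "M (w - axis a (w $ a))"
    have e: "M w = ?x + ?y" "M (R w) = ?y - ?x"
      by (simp_all flip: linear_add[OF M(1)] linear_diff[OF M(1)] add: R_def scaleR_2 diff_diff_eq)
    have "(norm (M w))\<^sup>2 + (norm (M (R w)))\<^sup>2 = 2 * (norm ?x)\<^sup>2 + 2 * (norm ?y)\<^sup>2"
      unfolding e power2_norm_eq_inner by (simp add: algebra_simps inner_commute)
    moreover have "(norm ?x)\<^sup>2 \<le> (norm (axis a (w $ a)))\<^sup>2" "(norm ?y)\<^sup>2 \<le> (norm (w - axis a (w $ a)))\<^sup>2"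
    proof -
      have "(norm (axis a (w $ a)))\<^sup>2 = (cmod (w $ a))\<^sup>2"
        unfolding norm_sq_vec[of _ a] by (simp add: nsq_def axis_def)
      then show "(norm ?x)\<^sup>2 \<le> (norm (axis a (w $ a)))\<^sup>2" using Ma[of "w$a"] by (simp add: power_mono)
      show "(norm ?y)\<^sup>2 \<le> (norm (w - axis a (w $ a)))\<^sup>2"
        using Mu[of "w - axis a (w$a)"] by (intro power_mono) (simp_all add: axis_def)
    qed
    ultimately show ?thesis using nsq[of w] by linarith
  qed
  \<comment> \<open>Nonnegative: by \<open>par\<close> the mean of the two squared norms is at most
    \<open>(norm w)\<^sup>2\<close>, and \<open>max 0 (1 - t)\<close> is decreasing and convex in
    \<open>t\<close>. Its integral is \<open>TM - T\<close>, because \<open>R\<close> preserves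
    volume.\<close>
  define d where "d w = 1/2 * (tent (M w) + tent (M (R w))) - tent w" for w
  have d0: "d w \<ge> 0" for w using par[of w] by (simp add: d_def tent_def max_def)
  obtain cR where cR: "cR > 0"
    "\<And>k :: complex^'n \<Rightarrow> real. k \<in> borel_measurable borel \<Longrightarrow> integrable lborel k \<Longrightarrow> integrable lborel (\<lambda>x. k (R x))"
    "\<And>k :: complex^'n \<Rightarrow> real. k \<in> borel_measurable borel \<Longrightarrow> (LINT x|lborel. k x) = cR * (LINT x|lborel. k (R x))"
    "\<And>S. S \<in> sets borel \<Longrightarrow> measure lborel S = cR * measure lborel (R -` S)"
    using linear_change_of_variables[OF lR iR] by blast
  obtain cM where cM: "cM > 0"
    "\<And>k :: complex^'n \<Rightarrow> real. k \<in> borel_measurable borel \<Longrightarrow> integrable lborel k \<Longrightarrow> integrable lborel (\<lambda>x. k (M x))"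
    "\<And>k :: complex^'n \<Rightarrow> real. k \<in> borel_measurable borel \<Longrightarrow> (LINT x|lborel. k x) = cM * (LINT x|lborel. k (M x))"
    "\<And>S. S \<in> sets borel \<Longrightarrow> measure lborel S = cM * measure lborel (M -` S)"
    using linear_change_of_variables[OF M] by blast
  have vb: "measure lborel (ball (0::complex^'n) 1) > 0" by (rule content_ball_pos) simp
  have "R -` ball 0 1 = ball 0 1" using nR by auto
  then have cR1: "cR = 1" using cR(4)[of "ball 0 1"] vb by simp
  have M1: "M -` ball 0 1 = {w. norm (M w) < 1}" by auto
  have vM: "measure lborel (ball (0::complex^'n) 1) = cM * measure lborel {w. norm (M w) < 1}"
    using cM(4)[of "ball 0 1"] by (simp add: M1)
  note lin_cont = linear_continuous_on[OF linear_conv_bounded_linear[THEN iffD1]]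
  have contM: "continuous_on UNIV (\<lambda>w. tent (M w))"
    by (rule continuous_on_compose2[OF tent_props(1)[of UNIV] lin_cont[OF M(1)]]) auto
  have contMR: "continuous_on UNIV (\<lambda>w. tent (M (R w)))"
    by (rule continuous_on_compose2[OF contM lin_cont[OF lR]]) auto
  have iM: "integrable lborel (\<lambda>w. tent (M w))" by (rule cM(2)[OF tent_props(2,3)])
  have iMR: "integrable lborel (\<lambda>w. tent (M (R w)))"
    by (rule cR(2)[OF borel_measurable_continuous_onI[OF contM] iM])
  have eqMR: "(LINT w|lborel. tent (M (R w))) = (LINT w|lborel. tent (M w))"
    using cR(3)[OF borel_measurable_continuous_onI[OF contM]] by (simp add: cR1)
  have id: "integrable lborel d" unfolding d_def using iM iMR tent_props(3) by auto
  define T where "T = (LINT w|lborel. tent (w :: complex^'n))"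
  define TM where "TM = (LINT w|lborel. tent (M w))"
  have Id: "(LINT w|lborel. d w) = TM - T"
  proof -
    have i3: "integrable lborel (\<lambda>w. tent (M w) + tent (M (R w)))" by (rule Bochner_Integration.integrable_add[OF iM iMR])
    then have "integrable lborel (\<lambda>w. 1/2 * (tent (M w) + tent (M (R w))))" by (rule integrable_mult_right)
    then have "(LINT w|lborel. d w) = (LINT w|lborel. 1/2 * (tent (M w) + tent (M (R w)))) - T"
      unfolding d_def T_def by (rule Bochner_Integration.integral_diff[OF _ tent_props(3)])
    also have "(LINT w|lborel. 1/2 * (tent (M w) + tent (M (R w)))) = 1/2 * (LINT w|lborel. tent (M w) + tent (M (R w)))"
      by (rule integral_mult_right_zero)
    also have "(LINT w|lborel. tent (M w) + tent (M (R w))) = TM + TM"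
      unfolding Bochner_Integration.integral_add[OF iM iMR] eqMR TM_def ..
    finally show ?thesis by simp
  qed
  have Tc: "T = cM * TM" unfolding T_def TM_def by (rule cM(3)[OF tent_props(2)])
  have T0: "T > 0"
  proof -
    have "T \<ge> 0" unfolding T_def by (intro Bochner_Integration.integral_nonneg) (auto simp: tent_def)
    moreover have "T \<noteq> 0"
    proof
      assume "T = 0"
      then have "tent (0::complex^'n) = 0" unfolding T_def by (rule continuous_integral_eq_0[OF tent_props(1,4,3)])
      then show False by (simp add: tent_def)
    qed
    ultimately show ?thesis by simp
  qed
  have TM: "TM \<ge> T" using Id Bochner_Integration.integral_nonneg[of lborel d] d0 by simp
  \<comment> \<open>\<open>cM\<close> is the quotient of the two volumes to be compared, and
    \<open>T = cM * TM\<close> with \<open>TM \<ge> T > 0\<close> leaves no room for a value above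
    1.\<close>
  have cM1: "cM \<le> 1"
  proof (rule ccontr)
    assume "\<not> cM \<le> 1"
    then have "1 * TM < cM * TM" using T0 TM by (intro mult_strict_right_mono) auto
    then show False using Tc TM by simp
  qed
  show ?le unfolding vM using cM1 cM(1) by (simp add: mult_left_le_one_le)
  assume "measure lborel {w. norm (M w) < 1} = measure lborel (ball (0::complex^'n) 1)"
  then have "cM * measure lborel (ball (0::complex^'n) 1) = measure lborel (ball (0::complex^'n) 1)" using vM by metis
  then have "cM = 1" using vb by simp
  then have I0: "(LINT w|lborel. d w) = 0" using Id Tc by simp
  have dz: "d w = 0" for w
    by (rule continuous_integral_eq_0[OF _ d0 id I0])
      (unfold d_def, intro continuous_intros contM contMR tent_props(1))
  \<comment> \<open>For equal volumes \<open>d\<close> vanishes identically. Hence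
    \<open>tent (M w)\<close> vanishes with \<open>tent w\<close> on the unit sphere, and
    \<open>M\<close> maps no unit vector into the open ball. Together with \<open>par\<close> this
    makes \<open>M\<close> an isometry.\<close>
  have ge1: "norm (M w) \<ge> 1" if "norm w = 1" for w
  proof -
    have "tent w = 0" using that by (simp add: tent_def)
    then have "tent (M w) = 0" using dz[of w] tent_props(4)[of "M w"] tent_props(4)[of "M (R w)"] by (simp add: d_def)
    then have "(norm (M w))\<^sup>2 \<ge> 1" by (simp add: tent_def max_def split: if_splits)
    then show ?thesis by (intro power2_le_imp_le[of 1]) simp_all
  qed
  have ge: "norm (M w) \<ge> norm w" for w
  proof (cases "w = 0")
    case False
    then have "norm (M ((1 / norm w) *\<^sub>R w)) \<ge> 1" by (intro ge1) simp
    then show ?thesis using False by (simp add: linear_cmul[OF M(1)] field_simps)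
  qed (simp add: linear_0[OF M(1)])
  have "(norm (M w))\<^sup>2 \<ge> (norm w)\<^sup>2" "(norm (M (R w)))\<^sup>2 \<ge> (norm w)\<^sup>2"
    using ge[of w] ge[of "R w"] nR[of w] by (auto intro: power_mono)
  then have "(norm (M w))\<^sup>2 = (norm w)\<^sup>2" using par[of w] by linarith
  then show "norm (M w) = norm w" by simp
qed

section \<open>Recognising the Wu metric\<close>

lemma herm_form_simps:
  "herm_form H (u + v) w = herm_form H u w + herm_form H v w"
  "herm_form H w (u + v) = herm_form H w u + herm_form H w v"
  "herm_form H (c *s u) w = c * herm_form H u w"
  "herm_form H w (c *s u) = cnj c * herm_form H w u"
  by (simp_all add: herm_form_def algebra_simps sum.distrib sum_distrib_left)

lemma herm_form_axis: "herm_form H (axis i x) (axis j y) = H $ i $ j * x * cnj y"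
proof -
  have e: "axis i x $ k = (if k = i then x else 0)" "cnj (axis j y $ l) = (if l = j then cnj y else 0)" for k l
    by (simp_all add: axis_def)
  have "(\<Sum>l\<in>UNIV. H $ k $ l * axis i x $ k * cnj (axis j y $ l))
     = (\<Sum>l\<in>UNIV. if l = j then H $ k $ j * axis i x $ k * cnj y else 0)" for k
    unfolding e by (rule sum.cong) auto
  then have "(\<Sum>l\<in>UNIV. H $ k $ l * axis i x $ k * cnj (axis j y $ l)) = (if k = i then H $ i $ j * x * cnj y else 0)" for k
    by (simp add: e(1))
  then show ?thesis by (simp add: herm_form_def)
qed

text \<open>Polarisation: the values on \<open>axis i 1 + axis j c\<close> determine the real part
  of \<open>H $ i $ j * cnj c\<close>, and \<open>c = 1\<close> and \<open>c = \<i>\<close> give the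
  entry.\<close>

lemma hermitian_eqI:
  assumes h: "\<And>i j. H $ j $ i = cnj (H $ i $ j)" and h': "\<And>i j. H' $ j $ i = cnj (H' $ i $ j)"
    and q: "\<And>v. Re (herm_form H v v) = Re (herm_form H' v v)"
  shows "H = (H' :: complex^'n::finite^'n)"
proof -
  have d: "Re (H $ i $ i) = Re (H' $ i $ i)" for i
    using q[of "axis i 1"] by (simp add: herm_form_axis)
  have o: "Re (H $ i $ j * cnj c) = Re (H' $ i $ j * cnj c)" for i j c
  proof -
    have e: "Re (herm_form G (axis i 1 + axis j c) (axis i 1 + axis j c))
      = Re (G $ i $ i) + Re (G $ j $ j) * (cmod c)\<^sup>2 + 2 * Re (G $ i $ j * cnj c)"
      if "G $ j $ i = cnj (G $ i $ j)" "G $ j $ j = cnj (G $ j $ j)" for G :: "complex^'n^'n"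
    proof -
      have "Im (G $ j $ j) = 0" using arg_cong[OF that(2), of Im] by simp
      then show ?thesis
        unfolding herm_form_simps herm_form_axis that(1) cmod_power2
        by (simp add: algebra_simps power2_eq_square)
    qed
    show ?thesis using q[of "axis i 1 + axis j c"] e[OF h h] e[OF h' h'] d[of i] d[of j] by simp
  qed
  have "H $ i $ j = H' $ i $ j" for i j
    using o[of i j 1] o[of i j \<i>] by (simp add: complex_eq_iff)
  then show ?thesis by (simp add: vec_eq_iff)
qed

lemma norm_vector_smult: "norm (k *s v) = cmod k * norm (v :: complex^'n::finite)"
proof -
  have "(norm (k *s v))\<^sup>2 = (cmod k * norm v)\<^sup>2"
    unfolding power_mult_distrib norm_sq_vec[of _ undefined] nsq_scale by (simp add: norm_mult power_mult_distrib algebra_simps)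
  then show ?thesis by simp
qed

text \<open>In the coordinates given by \<open>W\<close> the proposed ellipsoid is the Euclidean
  unit ball. A competing ellipsoid that contains the Kobayashi ball must contain the directions in
  \<open>low\<close>, which is precisely what \<open>ellipsoid_volume\<close> asks of it; the
  equality case there yields uniqueness.\<close>

lemma wu_metric_eqI:
  fixes D :: "(complex^'n::finite) set" and W H :: "complex^'n^'n"
  assumes D: "open D" "p \<in> D"
    and h: "\<And>i j. H $ j $ i = cnj (H $ i $ j)"
    and W: "\<And>v. Re (herm_form H (W *v v) (W *v v)) = (norm v)\<^sup>2"
    and up: "\<And>f. holomorphic_map_on f (ball 0 1) \<Longrightarrow> f ` ball 0 1 \<subseteq> D \<Longrightarrow> f 0 = p \<Longrightarrow>
        Re (herm_form H (vderiv f 0) (vderiv f 0)) \<le> 1"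
    and low: "\<And>u. norm u = 1 \<Longrightarrow> u = axis a 1 \<or> u $ a = 0 \<Longrightarrow>
       \<exists>f. holomorphic_map_on f (ball 0 1) \<and> f ` ball 0 1 \<subseteq> D \<and> f 0 = p \<and> vderiv f 0 = W *v u"
  shows "wu_metric D p = H" "pos_hermitian H"
proof -
  define q where "q v = Re (herm_form H v v)" for v
  have qs: "q (c *s v) = (cmod c)\<^sup>2 * q v" for c v
    unfolding q_def herm_form_simps mult.assoc[symmetric]
    by (simp add: cmod_power2) (simp add: algebra_simps power2_eq_square)
  have Wz: "W *v v = 0 \<Longrightarrow> v = 0" for v using W[of v] by (simp add: herm_form_def)
  have Winj: "inj ((*v) W)"
  proof (rule injI)
    fix x y assume "W *v x = W *v y"
    then have "W *v (x - y) = 0" by (simp add: matrix_vector_mult_diff_distrib)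
    then show "x = y" using Wz by fastforce
  qed
  then obtain V where V: "V ** W = mat 1" using matrix_left_invertible_injective by blast
  then have V': "W ** V = mat 1" by (simp add: matrix_left_right_inverse)
  have invW: "invertible W" unfolding invertible_def using V V' by blast
  have WV: "W *v (V *v v) = v" "V *v (W *v v) = v" for v
    by (simp_all add: matrix_vector_mul_assoc V V')
  have qV: "q v = (norm (V *v v))\<^sup>2" for v using W[of "V *v v"] by (simp add: q_def WV)
  have pos: "q v > 0" if "v \<noteq> 0" for v
  proof -
    have "V *v v \<noteq> 0" using that WV(1)[of v] by auto
    then show ?thesis by (simp add: qV)
  qed
  show ph: "pos_hermitian H" unfolding pos_hermitian_def q_def[symmetric]
    by (intro conjI allI impI pos) (rule h)
  define K where "K = {v. kobayashi D p v < 1}"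
  define KS where "KS v = {cmod t | t. \<exists>f. holomorphic_map_on f (ball 0 1) \<and> f ` ball 0 1 \<subseteq> D \<and> f 0 = p \<and>
                          t *s vderiv f 0 = v}" for v
  have KS: "kobayashi D p v = Inf (KS v)" for v by (simp add: kobayashi_def KS_def)
  \<comment> \<open>Small affine discs in direction \<open>v\<close> show that the set is not empty;
    for an empty set \<open>Inf\<close> would carry no information, and an infimum below 1 would not
    produce a disc.\<close>
  have KSne: "KS v \<noteq> {}" for v
  proof -
    obtain e where e: "e > 0" "ball p e \<subseteq> D" using D open_contains_ball by blast
    define c where "c = complex_of_real (e / (norm v + 1))"
    have c: "c \<noteq> 0" using e by (simp add: c_def) (smt (verit) norm_ge_zero of_real_eq_0_iff of_real_add of_real_1)
    define f where "f \<zeta> = p + (\<zeta> * c) *s v" for \<zeta>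
    have df: "((\<lambda>w. f w $ j) has_field_derivative (c *s v) $ j) (at \<zeta>)" for \<zeta> j
      by (auto simp: f_def intro!: derivative_eq_intros)
    have "f ` ball 0 1 \<subseteq> D"
    proof clarify
      fix \<zeta> :: complex assume z: "\<zeta> \<in> ball 0 1"
      have "norm ((\<zeta> * c) *s v) \<le> 1 * (e * (norm v / (norm v + 1)))"
      proof -
        have "cmod c = e / (norm v + 1)" unfolding c_def norm_of_real using e by (intro abs_of_nonneg) simp
        then have "cmod c * norm v = e * (norm v / (norm v + 1))" by simp
        then show ?thesis unfolding norm_vector_smult norm_mult mult.assoc using z e by (simp only:) (intro mult_right_mono, auto)
      qed
      also have "\<dots> < e * 1" using e by (simp add: divide_simps) (smt (verit) norm_ge_zero)
      finally have "f \<zeta> \<in> ball p e" by (simp add: f_def dist_norm)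
      then show "f \<zeta> \<in> D" using e by blast
    qed
    moreover have "(1 / c) *s vderiv f 0 = v" "holomorphic_map_on f (ball 0 1)"
      using holomorphic_mapI_deriv[OF open_ball, of 0 1 f "\<lambda>_. c *s v"] df c by auto
    moreover have "f 0 = p" by (simp add: f_def)
    ultimately have "cmod (1 / c) \<in> KS v" unfolding KS_def by blast
    then show ?thesis by blast
  qed
  have K1: "q v < 1" if "v \<in> K" for v
  proof -
    have "\<exists>x\<in>KS v. x < 1"
    proof -
      have "Inf (KS v) < 1" using that by (simp add: K_def KS)
      from cInf_lessD[OF KSne this] show ?thesis .
    qed
    then obtain t f where t: "cmod t < 1" and f: "holomorphic_map_on f (ball 0 1)" "f ` ball 0 1 \<subseteq> D" "f 0 = p" "t *s vderiv f 0 = v"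
      unfolding KS_def by blast
    have "q v = (cmod t)\<^sup>2 * q (vderiv f 0)" using qs f(4) by metis
    also have "\<dots> \<le> (cmod t)\<^sup>2 * 1" using up[OF f(1-3)] by (intro mult_left_mono) (auto simp: q_def)
    also have "\<dots> < 1" using t by (simp add: abs_square_less_1)
    finally show ?thesis .
  qed
  have K2: "t *s (W *v u) \<in> K" if t: "cmod t < 1" and u: "norm u = 1" "u = axis a 1 \<or> u $ a = 0" for t u
  proof -
    obtain f where "holomorphic_map_on f (ball 0 1)" "f ` ball 0 1 \<subseteq> D" "f 0 = p" "vderiv f 0 = W *v u"
      using low[OF u] by blast
    then have "cmod t \<in> KS (t *s (W *v u))" unfolding KS_def by (intro CollectI exI[of _ t] exI[of _ f] conjI refl) simp_all
    moreover have "bdd_below (KS v)" for v by (rule bdd_belowI[of _ 0]) (auto simp: KS_def)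
    ultimately have "Inf (KS (t *s (W *v u))) \<le> cmod t" by (intro cInf_lower) auto
    then show ?thesis using t by (simp add: K_def KS)
  qed
  define S0 where "S0 = {v. q v < 1}"
  have S0: "S0 = (*v) W ` ball 0 1"
  proof -
    have "v \<in> S0 \<longleftrightarrow> V *v v \<in> ball 0 1" for v by (simp add: S0_def qV abs_square_less_1)
    moreover have "V *v v \<in> ball 0 1 \<longleftrightarrow> v \<in> (*v) W ` ball 0 1" for v
      using WV image_eqI[of v "(*v) W" "V *v v" "ball 0 1"] by auto
    ultimately show ?thesis by blast
  qed
  have ell0: "ellipsoid S0" unfolding ellipsoid_def by (rule exI[of _ W]) (use invW S0 in simp)
  have KS0: "K \<subseteq> S0" using K1 by (auto simp: S0_def)
  obtain c where c: "c > 0" "\<And>S. S \<in> sets borel \<Longrightarrow> measure lborel S = c * measure lborel ((*v) W -` S)"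
    by (rule linear_change_of_variables[OF linear_matrix_vec Winj], rule that)
  have W0: "(*v) W -` S0 = ball 0 1" unfolding S0 using Winj by (auto simp: inj_def)
  have comp: "measure lborel S0 \<le> measure lborel T" "measure lborel T = measure lborel S0 \<Longrightarrow> T = S0"
    if T: "ellipsoid T" "K \<subseteq> T" for T
  proof -
    obtain A :: "complex^'n^'n" where A: "invertible A" "T = (*v) A ` ball 0 1" using T(1) by (auto simp: ellipsoid_def)
    then obtain B where B: "A ** B = mat 1" "B ** A = mat 1" unfolding invertible_def by blast
    have AB: "A *v (B *v v) = v" "B *v (A *v v) = v" for v by (simp_all add: matrix_vector_mul_assoc B)
    have Tm: "v \<in> T \<longleftrightarrow> norm (B *v v) < 1" for v unfolding A(2)
      using AB image_eqI[of v "(*v) A" "B *v v" "ball 0 1"] by auto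
    define M where "M v = (B ** W) *v v" for v
    have Mdef: "M v = B *v (W *v v)" for v by (simp add: M_def matrix_vector_mul_assoc)
    have Ml: "linear M" using linear_matrix_vec[of "B ** W"] by (simp add: M_def[abs_def])
    have Mi: "inj M" by (rule injI) (metis Mdef AB(1) WV(2))
    have Ms: "M (k *s v) = k *s M v" for k v by (simp add: M_def matrix_vector_mult_def vec_eq_iff sum_distrib_left mult.left_commute)
    \<comment> \<open>If \<open>M u\<close> were longer than 1, scaling \<open>u\<close> by
      \<open>1 / norm (M u)\<close> would give a point of the Kobayashi ball on the boundary of
      \<open>T\<close>, which is open.\<close>
    have M1: "norm (M u) \<le> 1" if u: "norm u = 1" "u = axis a 1 \<or> u $ a = 0" for u
    proof (rule ccontr)
      assume n: "\<not> norm (M u) \<le> 1"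
      define t where "t = complex_of_real (1 / norm (M u))"
      have "cmod t < 1" unfolding t_def norm_of_real using n by (simp add: divide_less_eq)
      then have "norm (B *v (t *s (W *v u))) < 1" using K2[OF _ u] T(2) Tm by blast
      moreover have "B *v (t *s (W *v u)) = M (t *s u)"
        by (simp add: Mdef matrix_vector_mult_def vec_eq_iff sum_distrib_left mult.left_commute)
      ultimately have "cmod t * norm (M u) < 1" by (simp add: Ms norm_vector_smult)
      then show False using n unfolding t_def norm_of_real by (simp split: if_splits)
    qed
    have Ma: "norm (M (axis a k)) \<le> cmod k" for k
    proof -
      have "axis a k = k *s axis a 1" by (simp add: vec_eq_iff axis_def)
      then have "norm (M (axis a k)) = cmod k * norm (M (axis a 1))" by (simp add: Ms norm_vector_smult)
      also have "\<dots> \<le> cmod k * 1" using M1[of "axis a 1"] by (intro mult_left_mono) (auto simp: norm_axis_1)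
      finally show ?thesis by simp
    qed
    have Mu: "norm (M u) \<le> norm u" if "u $ a = 0" for u
    proof (cases "u = 0")
      case False
      have "norm (M (complex_of_real (1 / norm u) *s u)) \<le> 1"
        using False that by (intro M1) (auto simp: norm_vector_smult norm_divide)
      then have "1 / norm u * norm (M u) \<le> 1" unfolding Ms norm_vector_smult norm_of_real by simp
      then show ?thesis using False by (simp add: field_simps)
    qed (simp add: linear_0[OF Ml])
    have WT: "(*v) W -` T = {w. norm (M w) < 1}" by (auto simp: Tm Mdef)
    have "open S0" "open T"
    proof -
      have "open {v. norm (C *v v) < 1}" for C :: "complex^'n^'n"
        by (intro open_Collect_less continuous_intros linear_continuous_on linear_conv_bounded_linear[THEN iffD1] linear_matrix_vec)
      moreover have "T = {v. norm (B *v v) < 1}" "S0 = {v. norm (V *v v) < 1}"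
        by (auto simp: Tm S0_def qV abs_square_less_1)
      ultimately show "open S0" "open T" by metis+
    qed
    then have mT: "measure lborel T = c * measure lborel {w. norm (M w) < 1}"
      and mS: "measure lborel S0 = c * measure lborel (ball (0::complex^'n) 1)"
      using c(2)[of T] c(2)[of S0] by (simp_all add: WT W0)
    show "measure lborel S0 \<le> measure lborel T"
      unfolding mT mS using ellipsoid_volume(1)[of M a, OF Ml Mi Ma Mu] c(1) by simp
    assume "measure lborel T = measure lborel S0"
    then have iso: "norm (M w) = norm w" for w
      using ellipsoid_volume(2)[of M a, OF Ml Mi Ma Mu] c(1) by (simp add: mT mS)
    have "v \<in> T \<longleftrightarrow> v \<in> S0" for v
    proof -
      have "norm (B *v v) = norm (V *v v)" using iso[of "V *v v"] by (simp add: Mdef WV)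
      then show ?thesis by (simp add: Tm S0_def qV abs_square_less_1)
    qed
    then show "T = S0" by blast
  qed
  have min0: "min_ellipsoid K S0" unfolding min_ellipsoid_def using ell0 KS0 comp(1) by blast
  show "wu_metric D p = H" unfolding wu_metric_def K_def[symmetric]
  proof (rule the_equality)
    show "pos_hermitian H \<and> min_ellipsoid K {v. Re (herm_form H v v) < 1}"
      using ph min0 by (simp add: S0_def q_def)
    fix H' assume H': "pos_hermitian H' \<and> min_ellipsoid K {v. Re (herm_form H' v v) < 1}"
    define S' where "S' = {v. Re (herm_form H' v v) < 1}"
    have m': "min_ellipsoid K S'" using H' by (simp add: S'_def)
    then have "S' = S0" using comp[of S'] ell0 KS0 unfolding min_ellipsoid_def by (meson order_antisym)
    then have eq: "Re (herm_form H' v v) < 1 \<longleftrightarrow> q v < 1" for v by (auto simp: S'_def S0_def)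
    define q' where "q' v = Re (herm_form H' v v)" for v
    have qs': "q' (of_real r *s v) = r\<^sup>2 * q' v" for r v
      unfolding q'_def herm_form_simps by (simp add: power2_eq_square)
    have pos': "q' v > 0" if "v \<noteq> 0" for v using H' that by (simp add: pos_hermitian_def q'_def)
    have "q' v = q v" for v
    proof (cases "v = 0")
      case False
      note p = pos[OF False] pos'[OF False]
      \<comment> \<open>Scaling by \<open>r\<close> multiplies both forms by the reciprocal of their
        mean value at \<open>v\<close>. If the values differed, 1 would separate the scaled ones,
        although the unit balls agree.\<close>
      define r where "r = 1 / sqrt ((q v + q' v) / 2)"
      have r2: "r\<^sup>2 = 2 / (q v + q' v)" using p by (simp add: r_def power_divide)
      have "r\<^sup>2 * q' v < 1 \<longleftrightarrow> r\<^sup>2 * q v < 1"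
        using eq[of "of_real r *s v"] qs[of "of_real r" v] qs'[of r v] by (simp add: q'_def)
      then have "q' v < q v \<longleftrightarrow> q v < q' v" unfolding r2 using p by (simp add: field_simps)
      then show ?thesis by linarith
    qed (simp add: q_def q'_def herm_form_def)
    then have "Re (herm_form H' v v) = Re (herm_form H v v)" for v unfolding q_def q'_def .
    moreover have "H' $ j $ i = cnj (H' $ i $ j)" for i j using H' unfolding pos_hermitian_def by blast
    ultimately show "H' = H" using h by (rule_tac hermitian_eqI)
  qed
qed

section \<open>Real analytic functions\<close>

abbreviation multi_index :: "('a::euclidean_space \<Rightarrow> nat) set" where
  "multi_index \<equiv> Basis \<rightarrow>\<^sub>E UNIV"

definition monomial :: "('a::euclidean_space \<Rightarrow> nat) \<Rightarrow> 'a \<Rightarrow> real" where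
  "monomial \<alpha> x = (\<Prod>b\<in>Basis. (x \<bullet> b) ^ \<alpha> b)"

definition mdeg :: "('a::euclidean_space \<Rightarrow> nat) \<Rightarrow> nat" where
  "mdeg \<alpha> = (\<Sum>b\<in>Basis. \<alpha> b)"

lemma monomial_le: "norm x \<le> r \<Longrightarrow> \<bar>monomial \<alpha> x\<bar> \<le> r ^ mdeg \<alpha>"
proof -
  assume "norm x \<le> r"
  then have "\<bar>x \<bullet> b\<bar> \<le> r" if "b \<in> Basis" for b using Basis_le_norm[OF that, of x] by simp
  then have "(\<Prod>b\<in>Basis. \<bar>x \<bullet> b\<bar> ^ \<alpha> b) \<le> (\<Prod>b\<in>Basis. r ^ \<alpha> b)"
    by (intro prod_mono conjI power_mono) auto
  then show ?thesis by (simp add: monomial_def mdeg_def abs_prod power_abs power_sum)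
qed

text \<open>Convergent power series at \<open>x0\<close> as a normed algebra: \<open>N\<close> bounds the weighted sum of the coefficients.\<close>

definition pseries :: "'a::euclidean_space \<Rightarrow> real \<Rightarrow> real \<Rightarrow> ('a \<Rightarrow> complex) \<Rightarrow> bool" where
  "pseries x0 r N f \<longleftrightarrow> r > 0 \<and> (\<exists>c.
     (\<forall>F. finite F \<longrightarrow> F \<subseteq> multi_index \<longrightarrow> (\<Sum>\<alpha>\<in>F. cmod (c \<alpha>) * r ^ mdeg \<alpha>) \<le> N) \<and>
     (\<forall>x. norm x < r \<longrightarrow> ((\<lambda>\<alpha>. monomial \<alpha> x *\<^sub>R c \<alpha>) has_sum f (x0 + x)) multi_index))"

text \<open>Products and compositions produce monomials indexed by pairs, with many indices for the
  same exponent. Absolute summability permits grouping along the fibres of the exponent map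
  \<open>e\<close>, and the bound \<open>N\<close> survives the grouping.\<close>

lemma pseriesI:
  fixes e :: "'i \<Rightarrow> 'a::euclidean_space \<Rightarrow> nat" and c :: "'i \<Rightarrow> complex"
  assumes r: "r > 0" and e: "\<And>i. i \<in> I \<Longrightarrow> e i \<in> multi_index"
    and bd: "\<And>F. finite F \<Longrightarrow> F \<subseteq> I \<Longrightarrow> (\<Sum>i\<in>F. cmod (c i) * r ^ mdeg (e i)) \<le> N"
    and hs: "\<And>x. norm x < r \<Longrightarrow> ((\<lambda>i. monomial (e i) x *\<^sub>R c i) has_sum f (x0 + x)) I"
  shows "pseries x0 r N f"
proof -
  define fib where "fib \<alpha> = {i \<in> I. e i = \<alpha>}" for \<alpha>
  define w where "w i = cmod (c i) * r ^ mdeg (e i)" for i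
  have w0: "w i \<ge> 0" for i using r by (simp add: w_def)
  have wI: "w summable_on I"
    by (rule nonneg_bdd_above_summable_on[OF w0]) (use bd in \<open>auto simp: w_def intro!: bdd_aboveI2[of _ _ N]\<close>)
  have bij: "bij_betw snd (Sigma multi_index fib) I"
    using e by (auto simp: bij_betw_def inj_on_def fib_def image_iff)
  have fibI: "fib \<alpha> \<subseteq> I" for \<alpha> by (auto simp: fib_def)
  have cf: "(\<lambda>i. cmod (c i)) summable_on fib \<alpha>" for \<alpha>
  proof -
    have "(\<lambda>i. w i * (1 / r ^ mdeg \<alpha>)) summable_on fib \<alpha>"
      by (intro summable_on_cmult_left summable_on_subset_banach[OF wI fibI])
    then show ?thesis by (rule summable_on_cong[THEN iffD1, rotated]) (use r in \<open>auto simp: w_def fib_def\<close>)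
  qed
  define d where "d \<alpha> = infsum c (fib \<alpha>)" for \<alpha>
  define W where "W \<alpha> = infsum w (fib \<alpha>)" for \<alpha>
  obtain T where T: "(w has_sum T) I" using wI by (auto simp: summable_on_def)
  have TN: "T \<le> N" by (rule has_sum_le_finite_sums[OF T]) (use bd in \<open>auto simp: w_def\<close>)
  have WT: "(W has_sum T) multi_index"
  proof (rule has_sum_SigmaD[where f="\<lambda>x. w (snd x)" and B=fib])
    show "((\<lambda>x. w (snd x)) has_sum T) (Sigma multi_index fib)"
      using T has_sum_reindex_bij_betw[OF bij, of w T] by simp
    show "((\<lambda>y. w (snd (\<alpha>, y))) has_sum W \<alpha>) (fib \<alpha>)" for \<alpha>
      unfolding W_def using summable_on_subset_banach[OF wI fibI] by simp
  qed
  have dW: "cmod (d \<alpha>) * r ^ mdeg \<alpha> \<le> W \<alpha>" for \<alpha>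
  proof -
    have "cmod (d \<alpha>) * r ^ mdeg \<alpha> \<le> infsum (\<lambda>i. cmod (c i)) (fib \<alpha>) * r ^ mdeg \<alpha>"
      unfolding d_def using r by (intro mult_right_mono norm_infsum_bound cf) auto
    also have "\<dots> = infsum (\<lambda>i. cmod (c i) * r ^ mdeg \<alpha>) (fib \<alpha>)"
      by (rule infsum_cmult_left[symmetric]) (use cf in auto)
    also have "\<dots> = W \<alpha>" unfolding W_def by (rule infsum_cong) (auto simp: w_def fib_def)
    finally show ?thesis .
  qed
  show ?thesis unfolding pseries_def
  proof (intro conjI r exI[of _ d] allI impI)
    fix F :: "('a \<Rightarrow> nat) set" assume F: "finite F" "F \<subseteq> multi_index"
    have "(\<Sum>\<alpha>\<in>F. cmod (d \<alpha>) * r ^ mdeg \<alpha>) \<le> sum W F" by (intro sum_mono dW)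
    also have "\<dots> \<le> T"
      by (rule finite_sum_le_has_sum[OF WT F]) (auto simp: W_def intro: infsum_nonneg w0)
    finally show "(\<Sum>\<alpha>\<in>F. cmod (d \<alpha>) * r ^ mdeg \<alpha>) \<le> N" using TN by simp
  next
    fix x :: 'a assume x: "norm x < r"
    show "((\<lambda>\<alpha>. monomial \<alpha> x *\<^sub>R d \<alpha>) has_sum f (x0 + x)) multi_index"
    proof (rule has_sum_SigmaD[where f="\<lambda>y. monomial (e (snd y)) x *\<^sub>R c (snd y)" and B=fib])
      show "((\<lambda>y. monomial (e (snd y)) x *\<^sub>R c (snd y)) has_sum f (x0 + x)) (Sigma multi_index fib)"
        using hs[OF x] has_sum_reindex_bij_betw[OF bij, of "\<lambda>i. monomial (e i) x *\<^sub>R c i" "f (x0 + x)"] by simp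
      fix \<alpha> :: "'a \<Rightarrow> nat"
      have "(c has_sum d \<alpha>) (fib \<alpha>)" unfolding d_def using abs_summable_summable[OF cf] by simp
      then have "((\<lambda>i. monomial \<alpha> x *\<^sub>R c i) has_sum monomial \<alpha> x *\<^sub>R d \<alpha>) (fib \<alpha>)"
        by (rule has_sum_scaleR)
      then show "((\<lambda>y. monomial (e (snd (\<alpha>, y))) x *\<^sub>R c (snd (\<alpha>, y))) has_sum monomial \<alpha> x *\<^sub>R d \<alpha>) (fib \<alpha>)"
        by (rule has_sum_cong[THEN iffD1, rotated]) (auto simp: fib_def)
    qed
  qed
qed

lemma pseriesD:
  assumes "pseries x0 r N f" shows "r > 0" "N \<ge> 0" "norm x < r \<Longrightarrow> cmod (f (x0 + x)) \<le> N"
proof -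
  obtain c where r: "r > 0" and c: "\<And>F. finite F \<Longrightarrow> F \<subseteq> multi_index \<Longrightarrow> (\<Sum>\<alpha>\<in>F. cmod (c \<alpha>) * r ^ mdeg \<alpha>) \<le> N"
     "\<And>x. norm x < r \<Longrightarrow> ((\<lambda>\<alpha>. monomial \<alpha> x *\<^sub>R c \<alpha>) has_sum f (x0 + x)) multi_index"
    using assms by (auto simp: pseries_def)
  show "r > 0" by (rule r)
  show "N \<ge> 0" using c(1)[of "{}"] by simp
  assume x: "norm x < r"
  show "cmod (f (x0 + x)) \<le> N"
  proof (rule Lim_norm_ubound[OF _ c(2)[OF x, unfolded has_sum_def]])
    show "\<forall>\<^sub>F F in finite_subsets_at_top multi_index. cmod (\<Sum>\<alpha>\<in>F. monomial \<alpha> x *\<^sub>R c \<alpha>) \<le> N"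
    proof (rule eventually_finite_subsets_at_top_weakI)
      fix F :: "('a \<Rightarrow> nat) set" assume F: "finite F" "F \<subseteq> multi_index"
      have "cmod (\<Sum>\<alpha>\<in>F. monomial \<alpha> x *\<^sub>R c \<alpha>) \<le> (\<Sum>\<alpha>\<in>F. cmod (c \<alpha>) * r ^ mdeg \<alpha>)"
        using monomial_le[of x r] x by (intro order_trans[OF norm_sum] sum_mono) (auto simp: mult.commute intro!: mult_left_mono)
      with c(1)[OF F] show "cmod (\<Sum>\<alpha>\<in>F. monomial \<alpha> x *\<^sub>R c \<alpha>) \<le> N" by linarith
    qed
  qed simp
qed

lemma pseries_const: "r > 0 \<Longrightarrow> pseries x0 r (cmod k) (\<lambda>_. k)"
  by (rule pseriesI[where I="{()}" and e="\<lambda>_. \<lambda>b\<in>Basis. 0" and c="\<lambda>_. k"])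
    (auto simp: mdeg_def monomial_def subset_singleton_iff intro!: has_sum_finiteI)

lemma pseries_coord:
  assumes r: "r > 0" and b: "b \<in> Basis"
  shows "pseries x0 r r (\<lambda>x. of_real ((x - x0) \<bullet> b))"
proof (rule pseriesI[where I="{()}" and e="\<lambda>_. \<lambda>b'\<in>Basis. if b' = b then 1 else 0" and c="\<lambda>_. 1"])
  have m: "monomial (\<lambda>b'\<in>Basis. if b' = b then 1 else 0) x = x \<bullet> b" for x
    unfolding monomial_def using b by (simp add: if_distrib[of "\<lambda>n. _ ^ n"] cong: if_cong)
  show "((\<lambda>i. monomial (\<lambda>b'\<in>Basis. if b' = b then 1 else 0) x *\<^sub>R 1) has_sum of_real ((x0 + x - x0) \<bullet> b)) {()}" for x :: 'a
    by (auto simp: m of_real_def intro!: has_sum_finiteI)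
qed (use r b in \<open>auto simp: mdeg_def subset_singleton_iff\<close>)

lemma pseries_add:
  assumes "pseries x0 r N f" "pseries x0 r M g" shows "pseries x0 r (N + M) (\<lambda>x. f x + g x)"
proof -
  obtain c where r: "r > 0" and c: "\<And>F. finite F \<Longrightarrow> F \<subseteq> multi_index \<Longrightarrow> (\<Sum>\<alpha>\<in>F. cmod (c \<alpha>) * r ^ mdeg \<alpha>) \<le> N"
     "\<And>x. norm x < r \<Longrightarrow> ((\<lambda>\<alpha>. monomial \<alpha> x *\<^sub>R c \<alpha>) has_sum f (x0 + x)) multi_index"
    using assms by (auto simp: pseries_def)
  obtain d where d: "\<And>F. finite F \<Longrightarrow> F \<subseteq> multi_index \<Longrightarrow> (\<Sum>\<alpha>\<in>F. cmod (d \<alpha>) * r ^ mdeg \<alpha>) \<le> M"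
     "\<And>x. norm x < r \<Longrightarrow> ((\<lambda>\<alpha>. monomial \<alpha> x *\<^sub>R d \<alpha>) has_sum g (x0 + x)) multi_index"
    using assms by (auto simp: pseries_def)
  show ?thesis
  proof (rule pseriesI[where I=multi_index and e="\<lambda>\<alpha>. \<alpha>" and c="\<lambda>\<alpha>. c \<alpha> + d \<alpha>", OF r])
    fix F :: "('a \<Rightarrow> nat) set" assume F: "finite F" "F \<subseteq> multi_index"
    have "(\<Sum>\<alpha>\<in>F. cmod (c \<alpha> + d \<alpha>) * r ^ mdeg \<alpha>) \<le> (\<Sum>\<alpha>\<in>F. cmod (c \<alpha>) * r ^ mdeg \<alpha> + cmod (d \<alpha>) * r ^ mdeg \<alpha>)"
      unfolding distrib_right[symmetric] using r by (intro sum_mono mult_right_mono norm_triangle_ineq) auto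
    then show "(\<Sum>\<alpha>\<in>F. cmod (c \<alpha> + d \<alpha>) * r ^ mdeg \<alpha>) \<le> N + M"
      using c(1)[OF F] d(1)[OF F] by (simp add: sum.distrib)
  qed (auto simp: scaleR_add_right intro!: has_sum_add c(2) d(2))
qed

lemma monomial_add: "\<alpha> \<in> multi_index \<Longrightarrow> \<beta> \<in> multi_index \<Longrightarrow> monomial (\<lambda>b\<in>Basis. \<alpha> b + \<beta> b) x = monomial \<alpha> x * monomial \<beta> x"
  by (simp add: monomial_def power_add prod.distrib)

lemma mdeg_add: "mdeg (\<lambda>b\<in>Basis. \<alpha> b + \<beta> b) = mdeg \<alpha> + mdeg \<beta>"
  by (simp add: mdeg_def sum.distrib)

lemma pseries_mult:
  assumes "pseries x0 r N f" "pseries x0 r M g" shows "pseries x0 r (N * M) (\<lambda>x. f x * g x)"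
proof -
  obtain c where r: "r > 0" and c: "\<And>F. finite F \<Longrightarrow> F \<subseteq> multi_index \<Longrightarrow> (\<Sum>\<alpha>\<in>F. cmod (c \<alpha>) * r ^ mdeg \<alpha>) \<le> N"
     "\<And>x. norm x < r \<Longrightarrow> ((\<lambda>\<alpha>. monomial \<alpha> x *\<^sub>R c \<alpha>) has_sum f (x0 + x)) multi_index"
    using assms by (auto simp: pseries_def)
  obtain d where d: "\<And>F. finite F \<Longrightarrow> F \<subseteq> multi_index \<Longrightarrow> (\<Sum>\<alpha>\<in>F. cmod (d \<alpha>) * r ^ mdeg \<alpha>) \<le> M"
     "\<And>x. norm x < r \<Longrightarrow> ((\<lambda>\<alpha>. monomial \<alpha> x *\<^sub>R d \<alpha>) has_sum g (x0 + x)) multi_index"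
    using assms by (auto simp: pseries_def)
  define k where "k p = c (fst p) * d (snd p)" for p
  define e :: "('a \<Rightarrow> nat) \<times> ('a \<Rightarrow> nat) \<Rightarrow> 'a \<Rightarrow> nat" where "e p = (\<lambda>b\<in>Basis. fst p b + snd p b)" for p
  have bd: "(\<Sum>p\<in>F. cmod (k p) * r ^ mdeg (e p)) \<le> N * M" if F: "finite F" "F \<subseteq> multi_index \<times> multi_index" for F
  proof -
    have "(\<Sum>p\<in>F. cmod (k p) * r ^ mdeg (e p)) \<le> (\<Sum>p\<in>fst ` F \<times> snd ` F. cmod (k p) * r ^ mdeg (e p))"
      using F r by (intro sum_mono2) (auto intro: rev_image_eqI)
    also have "\<dots> = (\<Sum>\<alpha>\<in>fst ` F. \<Sum>\<beta>\<in>snd ` F. (cmod (c \<alpha>) * r ^ mdeg \<alpha>) * (cmod (d \<beta>) * r ^ mdeg \<beta>))"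
      unfolding sum.cartesian_product by (intro sum.cong refl) (auto simp: k_def e_def mdeg_add norm_mult power_add)
    also have "\<dots> = (\<Sum>\<alpha>\<in>fst ` F. cmod (c \<alpha>) * r ^ mdeg \<alpha>) * (\<Sum>\<beta>\<in>snd ` F. cmod (d \<beta>) * r ^ mdeg \<beta>)"
      by (simp only: sum_product)
    also have "\<dots> \<le> N * M"
    proof -
      have "finite (fst ` F)" "finite (snd ` F)" "fst ` F \<subseteq> multi_index" "snd ` F \<subseteq> multi_index" using F by force+
      then show ?thesis using r pseriesD(2)[OF assms(1)] by (intro mult_mono c(1) d(1) sum_nonneg) auto
    qed
    finally show ?thesis .
  qed
  show ?thesis
  proof (rule pseriesI[where I="multi_index \<times> multi_index" and e=e and c=k, OF r _ bd])
    fix x :: 'a assume x: "norm x < r"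
    let ?h = "\<lambda>p. monomial (e p) x *\<^sub>R k p"
    have h: "?h (\<alpha>, \<beta>) = (monomial \<alpha> x *\<^sub>R c \<alpha>) * (monomial \<beta> x *\<^sub>R d \<beta>)"
      if "\<alpha> \<in> multi_index" "\<beta> \<in> multi_index" for \<alpha> \<beta>
      using that by (simp add: e_def k_def monomial_add)
    show "(?h has_sum f (x0 + x) * g (x0 + x)) (multi_index \<times> multi_index)"
    proof (rule has_sum_SigmaI)
      show "((\<lambda>\<beta>. ?h (\<alpha>, \<beta>)) has_sum (monomial \<alpha> x *\<^sub>R c \<alpha>) * g (x0 + x)) multi_index"
        if "\<alpha> \<in> multi_index" for \<alpha>
        by (subst has_sum_cong[OF h[OF that]], assumption, rule has_sum_cmult_right, rule d(2)[OF x])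
      show "((\<lambda>\<alpha>. (monomial \<alpha> x *\<^sub>R c \<alpha>) * g (x0 + x)) has_sum f (x0 + x) * g (x0 + x)) multi_index"
        by (intro has_sum_cmult_left c(2) x)
      have "(\<lambda>p. norm (?h p)) summable_on (multi_index \<times> multi_index)"
      proof (rule nonneg_bdd_above_summable_on)
        have "(\<Sum>p\<in>F. norm (?h p)) \<le> N * M" if F: "finite F" "F \<subseteq> multi_index \<times> multi_index" for F
        proof -
          have "(\<Sum>p\<in>F. norm (?h p)) \<le> (\<Sum>p\<in>F. cmod (k p) * r ^ mdeg (e p))"
            using monomial_le[of x r] x by (intro sum_mono) (auto simp: mult.commute intro!: mult_left_mono)
          with bd[OF F] show ?thesis by linarith
        qed
        then show "bdd_above (sum (\<lambda>p. norm (?h p)) ` {F. F \<subseteq> multi_index \<times> multi_index \<and> finite F})"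
          by (intro bdd_aboveI2[of _ _ "N * M"]) auto
      qed simp
      then show "?h summable_on (multi_index \<times> multi_index)" by (rule abs_summable_summable)
    qed
  qed (auto simp: e_def)
qed

lemma pseries_power: "pseries x0 r N f \<Longrightarrow> pseries x0 r (N ^ k) (\<lambda>x. f x ^ k)"
proof (induction k)
  case 0
  from pseries_const[OF pseriesD(1)[OF 0], of x0 1] show ?case by simp
next
  case (Suc k)
  then show ?case using pseries_mult[of x0 r N f "N ^ k" "\<lambda>x. f x ^ k"] by simp
qed

text \<open>Submultiplicativity bounds the weighted coefficient sum of the \<open>k\<close>-th power
  of \<open>f x - w\<close> by \<open>s ^ k\<close>. Since \<open>s\<close> is less than the radius
  of convergence of \<open>\<Phi>\<close>, the family over \<open>k\<close> and the multi-index
  together is absolutely summable.\<close>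

lemma pseries_compose:
  assumes g: "pseries x0 r s (\<lambda>x. f x - w)" and s: "s < \<rho>" and hol: "\<Phi> holomorphic_on ball w \<rho>"
  shows "\<exists>N. pseries x0 r N (\<lambda>x. \<Phi> (f x))"
proof -
  note r = pseriesD(1)[OF g] and s0 = pseriesD(2)[OF g]
  define a where "a k = (deriv ^^ k) \<Phi> w / fact k" for k
  have pw: "(\<lambda>k. a k * (z - w) ^ k) sums \<Phi> z" if "z \<in> ball w \<rho>" for z
    using holomorphic_power_series[OF hol that] by (simp add: a_def)
  have asum: "summable (\<lambda>k. cmod (a k) * t ^ k)" if t: "0 \<le> t" "t < \<rho>" for t
  proof -
    obtain u where u: "t < u" "u < \<rho>" using dense[OF t(2)] by blast
    have "w + of_real u \<in> ball w \<rho>" using u t by (simp add: dist_norm)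
    then have "summable (\<lambda>k. a k * (of_real u) ^ k)" using pw[of "w + of_real u"] by (simp add: sums_iff)
    then have "summable (\<lambda>k. norm (a k * (of_real t) ^ k))"
      by (rule powser_insidea) (use u t in simp)
    then show ?thesis using t by (simp add: norm_mult norm_power)
  qed
  \<comment> \<open>The double sum needs one choice of coefficients for every power, so they are
    selected as a function of \<open>k\<close>.\<close>
  define Q where "Q k d \<longleftrightarrow> (\<forall>F. finite F \<longrightarrow> F \<subseteq> multi_index \<longrightarrow> (\<Sum>\<alpha>\<in>F. cmod (d \<alpha>) * r ^ mdeg \<alpha>) \<le> s ^ k) \<and>
     (\<forall>x. norm x < r \<longrightarrow> ((\<lambda>\<alpha>. monomial \<alpha> x *\<^sub>R d \<alpha>) has_sum (f (x0 + x) - w) ^ k) multi_index)"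
    for k and d :: "('a \<Rightarrow> nat) \<Rightarrow> complex"
  define d where "d k = (SOME d. Q k d)" for k
  have "\<exists>d. Q k d" for k using pseries_power[OF g, of k] by (simp add: pseries_def Q_def)
  then have Q: "Q k (d k)" for k unfolding d_def by (rule someI_ex)
  have d: "\<And>k F. finite F \<Longrightarrow> F \<subseteq> multi_index \<Longrightarrow> (\<Sum>\<alpha>\<in>F. cmod (d k \<alpha>) * r ^ mdeg \<alpha>) \<le> s ^ k"
    "\<And>k x. norm x < r \<Longrightarrow> ((\<lambda>\<alpha>. monomial \<alpha> x *\<^sub>R d k \<alpha>) has_sum (f (x0 + x) - w) ^ k) multi_index"
    using Q unfolding Q_def by blast+
  define M where "M = (\<Sum>k. cmod (a k) * s ^ k)"
  define c where "c p = a (fst p) * d (fst p) (snd p)" for p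
  let ?I = "Sigma (UNIV::nat set) (\<lambda>_. multi_index :: ('a \<Rightarrow> nat) set)"
  have bd: "(\<Sum>p\<in>F. cmod (c p) * r ^ mdeg (snd p)) \<le> M" if F: "finite F" "F \<subseteq> ?I" for F
  proof -
    have "(\<Sum>p\<in>F. cmod (c p) * r ^ mdeg (snd p)) \<le> (\<Sum>p\<in>fst ` F \<times> snd ` F. cmod (c p) * r ^ mdeg (snd p))"
      using F r by (intro sum_mono2) (auto intro: rev_image_eqI)
    also have "\<dots> = (\<Sum>k\<in>fst ` F. cmod (a k) * (\<Sum>\<alpha>\<in>snd ` F. cmod (d k \<alpha>) * r ^ mdeg \<alpha>))"
      unfolding sum_distrib_left sum.cartesian_product by (intro sum.cong refl) (auto simp: c_def norm_mult)
    also have "\<dots> \<le> (\<Sum>k\<in>fst ` F. cmod (a k) * s ^ k)"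
    proof -
      have "finite (snd ` F)" "snd ` F \<subseteq> multi_index" using F by force+
      then show ?thesis by (intro sum_mono mult_left_mono d(1)) auto
    qed
    also have "\<dots> \<le> M" unfolding M_def using F s0 asum[OF s0 s] by (intro sum_le_suminf) auto
    finally show ?thesis .
  qed
  have "pseries x0 r M (\<lambda>x. \<Phi> (f x))"
  proof (rule pseriesI[where I="?I" and e=snd and c=c, OF r _ bd])
    fix x :: 'a assume x: "norm x < r"
    let ?h = "\<lambda>p. monomial (snd p) x *\<^sub>R c p" and ?u = "f (x0 + x) - w"
    have u: "cmod ?u \<le> s" by (rule pseriesD(3)[OF g x])
    show "(?h has_sum \<Phi> (f (x0 + x))) ?I"
    proof (rule has_sum_SigmaI)
      show "((\<lambda>\<alpha>. ?h (k, \<alpha>)) has_sum a k * ?u ^ k) multi_index" for k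
        using has_sum_cmult_right[OF d(2)[OF x, of k], of "a k"] by (simp add: c_def)
      have "f (x0 + x) \<in> ball w \<rho>" using u s by (simp add: dist_norm norm_minus_commute)
      from pw[OF this] show "((\<lambda>k. a k * ?u ^ k) has_sum \<Phi> (f (x0 + x))) UNIV"
        by (rule norm_summable_imp_has_sum[rotated]) (use asum[of "cmod ?u"] u s in \<open>simp add: norm_mult norm_power\<close>)
      have "(\<lambda>p. norm (?h p)) summable_on ?I"
      proof (rule nonneg_bdd_above_summable_on)
        have "(\<Sum>p\<in>F. norm (?h p)) \<le> M" if F: "finite F" "F \<subseteq> ?I" for F
        proof -
          have "(\<Sum>p\<in>F. norm (?h p)) \<le> (\<Sum>p\<in>F. cmod (c p) * r ^ mdeg (snd p))"
            using monomial_le[of x r] x by (intro sum_mono) (auto simp: mult.commute intro!: mult_left_mono)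
          with bd[OF F] show ?thesis by linarith
        qed
        then show "bdd_above (sum (\<lambda>p. norm (?h p)) ` {F. F \<subseteq> ?I \<and> finite F})"
          by (intro bdd_aboveI2[of _ _ M]) auto
      qed simp
      then show "?h summable_on ?I" by (rule abs_summable_summable)
    qed
  qed auto
  then show ?thesis by blast
qed

text \<open>If the constant term vanishes, every remaining monomial has degree at least 1 and gains
  a factor \<open>r' / r\<close>. This makes the norm as small as a composition requires.\<close>

lemma pseries_shrink:
  assumes "pseries x0 r N f" "0 < r'" "r' \<le> r"
  shows "pseries x0 r' N f" and "f x0 = 0 \<Longrightarrow> pseries x0 r' (N * (r' / r)) f"
proof -
  obtain c where r: "r > 0" and c: "\<And>F. finite F \<Longrightarrow> F \<subseteq> multi_index \<Longrightarrow> (\<Sum>\<alpha>\<in>F. cmod (c \<alpha>) * r ^ mdeg \<alpha>) \<le> N"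
     "\<And>x. norm x < r \<Longrightarrow> ((\<lambda>\<alpha>. monomial \<alpha> x *\<^sub>R c \<alpha>) has_sum f (x0 + x)) multi_index"
    using assms by (auto simp: pseries_def)
  show "pseries x0 r' N f"
  proof (rule pseriesI[where I=multi_index and e="\<lambda>\<alpha>. \<alpha>" and c=c, OF assms(2)])
    fix F :: "('a \<Rightarrow> nat) set" assume F: "finite F" "F \<subseteq> multi_index"
    have "(\<Sum>\<alpha>\<in>F. cmod (c \<alpha>) * r' ^ mdeg \<alpha>) \<le> (\<Sum>\<alpha>\<in>F. cmod (c \<alpha>) * r ^ mdeg \<alpha>)"
      using assms by (intro sum_mono mult_left_mono power_mono) auto
    then show "(\<Sum>\<alpha>\<in>F. cmod (c \<alpha>) * r' ^ mdeg \<alpha>) \<le> N" using c(1)[OF F] by simp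
  qed (use c(2) assms in auto)
  assume f0: "f x0 = 0"
  define z :: "'a \<Rightarrow> nat" where "z = (\<lambda>b\<in>Basis. 0)"
  have m0: "monomial \<alpha> (0::'a) = (if \<alpha> = z then 1 else 0)" if "\<alpha> \<in> multi_index" for \<alpha>
  proof (cases "\<alpha> = z")
    case False
    then obtain b where b: "\<alpha> b \<noteq> z b" by (auto simp: fun_eq_iff)
    have "b \<in> Basis" using b that by (auto simp: z_def PiE_def extensional_def split: if_splits)
    moreover have "\<alpha> b \<noteq> 0" using b \<open>b \<in> Basis\<close> by (simp add: z_def)
    ultimately show ?thesis using False by (auto simp: monomial_def)
  qed (simp add: monomial_def z_def)
  have zm: "z \<in> multi_index" by (simp add: z_def)
  have "((\<lambda>\<alpha>. monomial \<alpha> 0 *\<^sub>R c \<alpha>) has_sum 0) multi_index" using c(2)[of 0] r f0 by simp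
  moreover have "((\<lambda>\<alpha>. monomial \<alpha> 0 *\<^sub>R c \<alpha>) has_sum c z) multi_index"
    by (rule has_sum_cong_neutral[THEN iffD1, of "multi_index" "{z}" _ "\<lambda>\<alpha>. monomial \<alpha> 0 *\<^sub>R c \<alpha>"])
      (use zm m0 in \<open>auto intro!: has_sum_finiteI\<close>)
  ultimately have cz: "c z = 0" by (metis has_sum_unique)
  show "pseries x0 r' (N * (r' / r)) f"
  proof (rule pseriesI[where I=multi_index and e="\<lambda>\<alpha>. \<alpha>" and c=c, OF assms(2)])
    fix F :: "('a \<Rightarrow> nat) set" assume F: "finite F" "F \<subseteq> multi_index"
    have q: "0 \<le> r' / r" "r' / r \<le> 1" using assms r by auto
    have "cmod (c \<alpha>) * r' ^ mdeg \<alpha> \<le> cmod (c \<alpha>) * r ^ mdeg \<alpha> * (r' / r)" if "\<alpha> \<in> F" for \<alpha>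
    proof (cases "\<alpha> = z")
      case False
      have "mdeg \<alpha> \<noteq> 0"
      proof
        assume "mdeg \<alpha> = 0"
        then have "\<alpha> = z" using that F by (auto simp: mdeg_def z_def fun_eq_iff PiE_def extensional_def)
        then show False using False by simp
      qed
      then have "(r' / r) ^ mdeg \<alpha> \<le> (r' / r) ^ 1" using q by (intro power_decreasing) auto
      then have "cmod (c \<alpha>) * r ^ mdeg \<alpha> * (r' / r) ^ mdeg \<alpha> \<le> cmod (c \<alpha>) * r ^ mdeg \<alpha> * (r' / r)"
        using r by (intro mult_left_mono) auto
      then show ?thesis using r by (simp add: power_divide)
    qed (simp add: cz)
    then have "(\<Sum>\<alpha>\<in>F. cmod (c \<alpha>) * r' ^ mdeg \<alpha>) \<le> (\<Sum>\<alpha>\<in>F. cmod (c \<alpha>) * r ^ mdeg \<alpha>) * (r' / r)"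
      unfolding sum_distrib_right by (rule sum_mono)
    also have "\<dots> \<le> N * (r' / r)" using q by (intro mult_right_mono c(1) F)
    finally show "(\<Sum>\<alpha>\<in>F. cmod (c \<alpha>) * r' ^ mdeg \<alpha>) \<le> N * (r' / r)" .
  qed (use c(2) assms in auto)
qed

definition analytic_at_pt :: "'a::euclidean_space \<Rightarrow> ('a \<Rightarrow> complex) \<Rightarrow> bool" where
  "analytic_at_pt x0 f \<longleftrightarrow> (\<exists>r N. pseries x0 r N f)"

lemma analytic_at_pt_const: "analytic_at_pt x0 (\<lambda>_. k)"
  unfolding analytic_at_pt_def using pseries_const[of 1] zero_less_one by blast

lemma analytic_at_pt_add: "analytic_at_pt x0 f \<Longrightarrow> analytic_at_pt x0 g \<Longrightarrow> analytic_at_pt x0 (\<lambda>x. f x + g x)"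
  and analytic_at_pt_mult: "analytic_at_pt x0 f \<Longrightarrow> analytic_at_pt x0 g \<Longrightarrow> analytic_at_pt x0 (\<lambda>x. f x * g x)"
proof -
  assume "analytic_at_pt x0 f" "analytic_at_pt x0 g"
  then obtain r N r' M where *: "pseries x0 r N f" "pseries x0 r' M g" by (auto simp: analytic_at_pt_def)
  define q where "q = min r r'"
  have "pseries x0 q N f" "pseries x0 q M g"
    using *[THEN pseriesD(1)] by (auto simp: q_def intro: pseries_shrink(1)[OF *(1)] pseries_shrink(1)[OF *(2)])
  then show "analytic_at_pt x0 (\<lambda>x. f x + g x)" "analytic_at_pt x0 (\<lambda>x. f x * g x)"
    unfolding analytic_at_pt_def using pseries_add pseries_mult by blast+
qed

lemma analytic_at_pt_coord:
  assumes "b \<in> Basis" shows "analytic_at_pt x0 (\<lambda>x. of_real (x \<bullet> b))"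
proof -
  have "analytic_at_pt x0 (\<lambda>x. of_real ((x - x0) \<bullet> b))"
    unfolding analytic_at_pt_def using pseries_coord[OF zero_less_one assms] by blast
  from analytic_at_pt_add[OF this analytic_at_pt_const[of x0 "of_real (x0 \<bullet> b)"]]
  show ?thesis by (simp add: inner_diff_left)
qed

lemma analytic_at_pt_compose:
  assumes f: "analytic_at_pt x0 f" and hol: "\<Phi> holomorphic_on V" "open V" "f x0 \<in> V"
  shows "analytic_at_pt x0 (\<lambda>x. \<Phi> (f x))"
proof -
  obtain \<rho> where \<rho>: "\<rho> > 0" "ball (f x0) \<rho> \<subseteq> V" using hol(2,3) open_contains_ball by blast
  have "analytic_at_pt x0 (\<lambda>x. f x - f x0)"
    using analytic_at_pt_add[OF f analytic_at_pt_const[of x0 "- f x0"]] by simp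
  then obtain r N where g: "pseries x0 r N (\<lambda>x. f x - f x0)" by (auto simp: analytic_at_pt_def)
  note r = pseriesD(1)[OF g] and N = pseriesD(2)[OF g]
  \<comment> \<open>The new norm is at most \<open>N * \<rho> / (2 * (N + 1))\<close>, below
    \<open>\<rho>\<close>; adding 1 to \<open>N\<close> covers \<open>N = 0\<close>.\<close>
  define r' where "r' = min r (r * \<rho> / (2 * (N + 1)))"
  have r': "0 < r'" "r' \<le> r" using r N \<rho> by (auto simp: r'_def)
  have "r' / r \<le> r * \<rho> / (2 * (N + 1)) / r" using r by (intro divide_right_mono) (auto simp: r'_def)
  then have "r' / r \<le> \<rho> / (2 * (N + 1))" using r by simp
  then have "N * (r' / r) \<le> N * (\<rho> / (2 * (N + 1)))" by (rule mult_left_mono[OF _ N])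
  also have "\<dots> < \<rho>" using \<rho> N by (simp add: field_simps) (smt (verit) mult_nonneg_nonneg)
  finally have lt: "N * (r' / r) < \<rho>" .
  have "pseries x0 r' (N * (r' / r)) (\<lambda>x. f x - f x0)" by (rule pseries_shrink(2)[OF g r']) simp
  from pseries_compose[OF this lt holomorphic_on_subset[OF hol(1) \<rho>(2)]]
  have "\<exists>N. pseries x0 r' N (\<lambda>x. \<Phi> (f x))" .
  then show ?thesis by (auto simp: analytic_at_pt_def)
qed

lemma analytic_at_pt_cong:
  assumes f: "analytic_at_pt x0 f" and ev: "\<forall>\<^sub>F x in nhds x0. f x = g x"
  shows "analytic_at_pt x0 g"
proof -
  obtain r N where g: "pseries x0 r N f" using f by (auto simp: analytic_at_pt_def)
  obtain e where e: "e > 0" "\<And>x. dist x x0 < e \<Longrightarrow> f x = g x" using ev by (auto simp: eventually_nhds_metric)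
  define q where "q = min r e"
  have q: "0 < q" "q \<le> r" "q \<le> e" using pseriesD(1)[OF g] e by (auto simp: q_def)
  have "pseries x0 q N f" by (rule pseries_shrink(1)[OF g q(1,2)])
  moreover have "f (x0 + x) = g (x0 + x)" if "norm x < q" for x using that q e(2) by (simp add: dist_norm)
  ultimately have "pseries x0 q N g" unfolding pseries_def by simp
  then show ?thesis by (auto simp: analytic_at_pt_def)
qed

lemma analytic_at_pt_imp_real_analytic_on:
  assumes "\<And>x. x \<in> U \<Longrightarrow> analytic_at_pt x f" shows "real_analytic_on f U"
  unfolding real_analytic_on_def
proof
  fix x0 assume "x0 \<in> U"
  then obtain r N c where r: "r > 0" and
     c: "\<And>x. norm x < r \<Longrightarrow> ((\<lambda>\<alpha>. monomial \<alpha> x *\<^sub>R c \<alpha>) has_sum f (x0 + x)) multi_index"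
    using assms by (auto simp: pseries_def analytic_at_pt_def) metis
  show "\<exists>r>0. \<exists>c. \<forall>x\<in>ball x0 r.
        ((\<lambda>\<alpha>. (\<Prod>b\<in>Basis. ((x - x0) \<bullet> b) ^ \<alpha> b) *\<^sub>R c \<alpha>) has_sum f x) multi_index"
  proof (intro exI[of _ r] exI[of _ c] conjI r ballI)
    fix x assume "x \<in> ball x0 r"
    then show "((\<lambda>\<alpha>. (\<Prod>b\<in>Basis. ((x - x0) \<bullet> b) ^ \<alpha> b) *\<^sub>R c \<alpha>) has_sum f x) multi_index"
      using c[of "x - x0"] by (simp add: dist_norm norm_minus_commute monomial_def)
  qed
qed

section \<open>The coefficient matrix of the Wu metric\<close>

context egg_dom
begin

text \<open>The weights in \<open>wuQ\<close>, written without \<open>tt\<close> so that their only singular ingredient is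
  \<open>cmod (z$a) powr (2 * m)\<close> in \<open>QQ\<close>.\<close>

definition PP :: "complex^'n \<Rightarrow> real" where "PP z = AA z / (AA z - (cmod (z$a))\<^sup>2)\<^sup>2"
definition QQ :: "complex^'n \<Rightarrow> real" where "QQ z = 1 / (sg z - cmod (z$a) powr (2*m))"
text \<open>Coefficients of the linear form in the first summand of \<open>wuQ\<close>. They exhibit
  that summand as a matrix of rank one.\<close>

definition ell :: "complex^'n \<Rightarrow> 'n \<Rightarrow> complex" where
  "ell z i = (if i = a then 1 else z$a * cnj (z$i) / of_real (m * sg z))"

definition wuH :: "complex^'n \<Rightarrow> complex^'n^'n" where
  "wuH z = (\<chi> i j. of_real (PP z) * ell z i * cnj (ell z j)
     + (if i = a \<or> j = a then 0 else of_real (QQ z) * ((if i = j then 1 else 0) + cnj (z$i) * z$j / of_real (sg z))))"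

lemma wuH_hermitian: "wuH z $ j $ i = cnj (wuH z $ i $ j)"
  by (auto simp: wuH_def mult_ac)

lemma sum_if_a: "(\<Sum>i\<in>UNIV. if i = a then 0 else f i) = (\<Sum>i\<in>UNIV-{a}. f i :: complex)"
  by (subst sum.remove[of UNIV a]) (auto intro!: sum.cong)

lemma wuH_form:
  assumes z: "z \<in> egg a m"
  shows "Re (herm_form (wuH z) v v) = wuQ z v"
proof -
  note sz = egg_sg[OF z]
  define S where "S = (\<Sum>i\<in>UNIV. ell z i * v$i)"
  have S: "S = v$a + z$a * ip v z / of_real (m * sg z)"
    unfolding S_def by (subst sum.remove[of UNIV a])
      (auto simp: ell_def hin_def sum_distrib_left sum_divide_distrib mult_ac intro!: sum.cong)
  have e: "wuH z $ i $ j * v$i * cnj (v$j) = of_real (PP z) * (ell z i * v$i) * cnj (ell z j * v$j)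
     + (if i = a then 0 else if j = a then 0 else of_real (QQ z) * ((if j = i then v$i * cnj (v$i) else 0)
          + (v$i * cnj (z$i)) * (z$j * cnj (v$j)) / of_real (sg z)))" for i j
    by (auto simp: wuH_def algebra_simps)
  have "herm_form (wuH z) v v = (\<Sum>i\<in>UNIV. \<Sum>j\<in>UNIV. of_real (PP z) * (ell z i * v$i) * cnj (ell z j * v$j))
     + (\<Sum>i\<in>UNIV. \<Sum>j\<in>UNIV. (if i = a then 0 else if j = a then 0 else of_real (QQ z) * ((if j = i then v$i * cnj (v$i) else 0)
          + (v$i * cnj (z$i)) * (z$j * cnj (v$j)) / of_real (sg z))))"
    unfolding herm_form_def e sum.distrib ..
  also have "(\<Sum>i\<in>UNIV. \<Sum>j\<in>UNIV. of_real (PP z) * (ell z i * v$i) * cnj (ell z j * v$j)) = of_real (PP z) * (S * cnj S)"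
    unfolding S_def cnj_sum sum_product by (simp add: sum_distrib_left mult.assoc)
  also have "(\<Sum>i\<in>UNIV. \<Sum>j\<in>UNIV. (if i = a then 0 else if j = a then 0 else of_real (QQ z) * ((if j = i then v$i * cnj (v$i) else 0)
          + (v$i * cnj (z$i)) * (z$j * cnj (v$j)) / of_real (sg z))))
     = (\<Sum>i\<in>UNIV-{a}. \<Sum>j\<in>UNIV-{a}. of_real (QQ z) * ((if j = i then v$i * cnj (v$i) else 0)
          + (v$i * cnj (z$i)) * (z$j * cnj (v$j)) / of_real (sg z)))"
    unfolding sum_if_a[symmetric] by (intro sum.cong refl) auto
  also have "\<dots> = of_real (QQ z) * (of_real (nq v) + ip v z * cnj (ip v z) / of_real (sg z))"
  proof -
    have "(\<Sum>j\<in>UNIV-{a}. if j = i then v$i * cnj (v$i) else 0) = v$i * cnj (v$i)" if "i \<in> UNIV-{a}" for i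
      using that by simp
    moreover have "ip v z * cnj (ip v z) / of_real (sg z) = (\<Sum>i\<in>UNIV-{a}. \<Sum>j\<in>UNIV-{a}. (v$i * cnj (z$i)) * (z$j * cnj (v$j)) / of_real (sg z))"
      unfolding hin_def cnj_sum sum_product sum_divide_distrib by (simp add: mult_ac)
    moreover have "of_real (nq v) = (\<Sum>i\<in>UNIV-{a}. v$i * cnj (v$i))"
      by (simp add: nsq_def complex_norm_square del: of_real_power)
    ultimately show ?thesis by (simp add: sum_distrib_left[symmetric] sum.distrib cong: sum.cong_simp)
  qed
  also have "of_real (PP z) * (S * cnj S) + of_real (QQ z) * (of_real (nq v) + ip v z * cnj (ip v z) / of_real (sg z))
    = of_real (PP z * (cmod S)\<^sup>2 + QQ z * (nq v + (cmod (ip v z))\<^sup>2 / sg z))"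
    by (simp add: cmod_sq_cnj)
  finally have "Re (herm_form (wuH z) v v) = PP z * (cmod S)\<^sup>2 + QQ z * (nq v + (cmod (ip v z))\<^sup>2 / sg z)"
    by (simp only: Re_complex_of_real)
  moreover have "PP z * (cmod S)\<^sup>2 = (cmod S)\<^sup>2 / (AA z * (1 - tt z)\<^sup>2)"
  proof -
    have "AA z * (1 - tt z) = AA z - (cmod (z$a))\<^sup>2" using AA_pos[OF sz] by (simp add: tt_def field_simps)
    then have "PP z = AA z / (AA z * (1 - tt z))\<^sup>2" by (simp add: PP_def)
    then show ?thesis using AA_pos[OF sz] by (simp add: power2_eq_square)
  qed
  moreover have "QQ z * (nq v + (cmod (ip v z))\<^sup>2 / sg z) = BB z v / (1 - tt z powr m)"
  proof -
    have "sg z - cmod (z$a) powr (2*m) = sg z * (1 - tt z powr m)" using sz by (simp add: tt_powr field_simps)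
    then have "QQ z = 1 / (sg z * (1 - tt z powr m))" by (simp add: QQ_def)
    moreover have "nq v + (cmod (ip v z))\<^sup>2 / sg z = sg z * BB z v" using sz by (simp add: BB_def power2_eq_square field_simps)
    ultimately show ?thesis using sz by simp
  qed
  ultimately show ?thesis by (simp add: wuQ_def S)
qed

lemma open_egg: "open (egg a m)"
proof -
  have "open {z::complex^'n. cmod (z$a) powr (2*m) + (\<Sum>j\<in>UNIV-{a}. (cmod (z$j))\<^sup>2) < 1}"
    by (intro open_Collect_less continuous_intros continuous_on_powr') auto
  then show ?thesis by (simp add: egg_def)
qed

lemma wu_metric_egg:
  assumes z: "z \<in> egg a m"
  shows "wu_metric (egg a m) z = wuH z" "pos_hermitian (wuH z)"
proof -
  obtain W :: "complex^'n^'n" where W: "\<And>v. wuQ z (W *v v) = (norm v)\<^sup>2"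
    "\<And>u. norm u = 1 \<Longrightarrow> u = axis a 1 \<or> u $ a = 0 \<Longrightarrow>
       \<exists>f. holomorphic_map_on f (ball 0 1) \<and> f ` ball 0 1 \<subseteq> egg a m \<and> f 0 = z \<and> vderiv f 0 = W *v u"
    by (rule egg_frame[OF z]) (rule that; blast)
  have up: "Re (herm_form (wuH z) (vderiv f 0) (vderiv f 0)) \<le> 1"
    if "holomorphic_map_on f (ball 0 1)" "f ` ball 0 1 \<subseteq> egg a m" "f 0 = z" for f
    using disc_wuQ_le[OF that(1,2)] that(3) by (simp add: wuH_form[OF z])
  have W1: "Re (herm_form (wuH z) (W *v v) (W *v v)) = (norm v)\<^sup>2" for v
    by (simp add: wuH_form[OF z] W(1))
  show "wu_metric (egg a m) z = wuH z" "pos_hermitian (wuH z)"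
    using wu_metric_eqI[OF open_egg z wuH_hermitian W1 up W(2)] by blast+
qed

end

section \<open>Regularity of the Wu metric\<close>

text \<open>Closure properties shared by continuity, analyticity and \<open>C\<^sup>1\<close> Hoelder regularity at a point: the
  coefficients of the metric have each of these properties wherever \<open>cmod (z$a) powr (2 * m)\<close> has it.\<close>

locale regularity_class =
  fixes R :: "((complex^'n::finite) \<Rightarrow> complex) \<Rightarrow> bool" and x0 :: "complex^'n"
  assumes const: "R (\<lambda>_. k)" and coord: "R (\<lambda>z. z $ i)" and cnj_coord: "R (\<lambda>z. cnj (z $ i))"
    and add: "R f \<Longrightarrow> R g \<Longrightarrow> R (\<lambda>z. f z + g z)" and mult: "R f \<Longrightarrow> R g \<Longrightarrow> R (\<lambda>z. f z * g z)"
    and compose: "R f \<Longrightarrow> \<Phi> holomorphic_on V \<Longrightarrow> open V \<Longrightarrow> f x0 \<in> V \<Longrightarrow> R (\<lambda>z. \<Phi> (f z))"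
    and cong: "R f \<Longrightarrow> \<forall>\<^sub>F z in nhds x0. f z = g z \<Longrightarrow> R g"
begin

lemma diff: "R f \<Longrightarrow> R g \<Longrightarrow> R (\<lambda>z. f z - g z)"
  using add[of f "\<lambda>z. (-1) * g z"] mult[OF const[of "-1"], of g] by simp

lemma sum: "finite A \<Longrightarrow> (\<And>i. i \<in> A \<Longrightarrow> R (f i)) \<Longrightarrow> R (\<lambda>z. \<Sum>i\<in>A. f i z)"
  by (induction A rule: finite_induct) (auto intro: const add)

lemma inverse: "R f \<Longrightarrow> f x0 \<noteq> 0 \<Longrightarrow> R (\<lambda>z. inverse (f z))"
  by (rule compose[where V="-{0}"]) (auto intro!: holomorphic_intros)

text \<open>The class is closed only under composition with holomorphic functions, so the real power
  is read as the principal complex power near a positive value.\<close>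

lemma powr:
  assumes "R (\<lambda>z. of_real (g z))" "\<forall>\<^sub>F z in nhds x0. g z > 0"
  shows "R (\<lambda>z. of_real (g z powr e))"
proof -
  have "g x0 > 0" using assms(2) by (rule eventually_nhds_x_imp_x)
  then have "R (\<lambda>z. of_real (g z) powr of_real e)"
    by (intro compose[OF assms(1), where V="- \<real>\<^sub>\<le>\<^sub>0" and \<Phi>="\<lambda>w. w powr of_real e"])
      (auto intro!: holomorphic_intros simp: open_Compl)
  then show ?thesis
    by (rule cong) (use assms(2) in \<open>auto elim!: eventually_mono simp: powr_of_real\<close>)
qed

end

context egg_dom
begin

lemma wuH_regular:
  assumes R: "regularity_class R x0" and x0: "x0 \<in> egg a m"
    and u: "R (\<lambda>z. of_real (cmod (z$a) powr (2*m)))"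
  shows "R (\<lambda>z. wuH z $ i $ j)"
proof -
  interpret regularity_class R x0 by (rule R)
  have ev: "\<forall>\<^sub>F z in nhds x0. z \<in> egg a m" using x0 open_egg by (rule eventually_nhds_in_open[rotated])
  have y: "R (\<lambda>z. of_real ((cmod (z$a))\<^sup>2))"
    using mult[OF coord[of a] cnj_coord[of a]] by (simp add: cmod_sq_cnj)
  have s: "R (\<lambda>z. of_real (sg z))"
  proof -
    have "R (\<lambda>z. 1 - (\<Sum>j\<in>UNIV-{a}. z$j * cnj (z$j)))"
      by (intro diff const sum mult coord cnj_coord) auto
    then show ?thesis by (simp add: sg_def nsq_def cmod_sq_cnj)
  qed
  have A: "R (\<lambda>z. of_real (AA z))" unfolding AA_def
    by (rule powr[OF s]) (use ev egg_sg in \<open>auto elim: eventually_mono\<close>)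
  note sx = egg_sg[OF x0] and Ax = AA_pos[OF egg_sg[OF x0]]
  have Ay: "AA x0 - (cmod (x0$a))\<^sup>2 \<noteq> 0" using egg_tt[OF x0] Ax by (simp add: tt_def field_simps)
  have P: "R (\<lambda>z. of_real (PP z))"
  proof -
    have "R (\<lambda>z. of_real (AA z) * (inverse (of_real (AA z) - of_real ((cmod (z$a))\<^sup>2))
        * inverse (of_real (AA z) - of_real ((cmod (z$a))\<^sup>2))))"
      by (intro mult A inverse diff y) (use Ay in \<open>simp_all flip: of_real_diff of_real_power\<close>)
    then show ?thesis by (simp add: PP_def power2_eq_square divide_inverse)
  qed
  have Q: "R (\<lambda>z. of_real (QQ z))"
  proof -
    have "R (\<lambda>z. inverse (of_real (sg z) - of_real (cmod (z$a) powr (2*m))))"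
      by (intro inverse diff s u) (use x0 in \<open>auto simp: egg_iff simp flip: of_real_diff\<close>)
    then show ?thesis by (simp add: QQ_def divide_inverse)
  qed
  have si: "R (\<lambda>z. inverse (of_real (sg z)))" using sx by (intro inverse s) simp
  have l: "R (\<lambda>z. ell z i)" for i
  proof -
    have "R (\<lambda>z. z$a * cnj (z$i) * (of_real (1/m) * inverse (of_real (sg z))))"
      by (intro mult coord cnj_coord const si)
    then have "R (\<lambda>z. z$a * cnj (z$i) / of_real (m * sg z))" by (simp add: divide_inverse mult.commute)
    then show ?thesis unfolding ell_def using const[of 1] by (cases "i = a") auto
  qed
  have l': "R (\<lambda>z. cnj (ell z i))" for i
  proof -
    have "R (\<lambda>z. cnj (z$a) * z$i * (of_real (1/m) * inverse (of_real (sg z))))"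
      by (intro mult coord cnj_coord const si)
    then have "R (\<lambda>z. cnj (z$a * cnj (z$i) / of_real (m * sg z)))" by (simp add: divide_inverse mult.commute)
    then show ?thesis unfolding ell_def using const[of 1] by (cases "i = a") auto
  qed
  have 1: "R (\<lambda>z. of_real (PP z) * ell z i * cnj (ell z j))" by (intro mult P l l')
  have 2: "R (\<lambda>z. of_real (QQ z) * ((if i = j then 1 else 0) + cnj (z$i) * z$j * inverse (of_real (sg z))))"
    by (intro mult Q add const coord cnj_coord si)
  show ?thesis unfolding wuH_def
    using 1 add[OF 1 2] by (cases "i = a \<or> j = a") (auto simp: divide_inverse)
qed

end

lemma regularity_isCont: "regularity_class (\<lambda>f. isCont f x0) x0"
proof
  fix f g :: "complex^'a \<Rightarrow> complex" and \<Phi> V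
  assume "isCont f x0" "\<Phi> holomorphic_on V" "open V" "f x0 \<in> V"
  then show "isCont (\<lambda>z. \<Phi> (f z)) x0"
    by (intro isCont_o2[of x0 f \<Phi>]) (auto simp: continuous_on_eq_continuous_at dest: holomorphic_on_imp_continuous_on)
next
  fix f g :: "complex^'a \<Rightarrow> complex"
  assume "isCont f x0" "\<forall>\<^sub>F z in nhds x0. f z = g z"
  then show "isCont g x0" using isCont_cong by blast
qed (auto intro!: continuous_intros)

lemma regularity_analytic: "regularity_class (analytic_at_pt x0) x0"
proof
  fix i :: 'a
  have B: "axis i 1 \<in> (Basis :: (complex^'a) set)" "axis i \<i> \<in> (Basis :: (complex^'a) set)"
    by (auto simp: Basis_vec_def Basis_complex_def)
  have re: "z $ i = of_real (z \<bullet> axis i 1) + \<i> * of_real (z \<bullet> axis i \<i>)" for z :: "complex^'a"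
    by (simp add: inner_axis inner_complex_def complex_eq_iff)
  have im: "cnj (z $ i) = of_real (z \<bullet> axis i 1) + (-\<i>) * of_real (z \<bullet> axis i \<i>)" for z :: "complex^'a"
    by (simp add: inner_axis inner_complex_def complex_eq_iff)
  show "analytic_at_pt x0 (\<lambda>z. z $ i)" unfolding re
    by (intro analytic_at_pt_add analytic_at_pt_mult analytic_at_pt_const analytic_at_pt_coord B)
  show "analytic_at_pt x0 (\<lambda>z. cnj (z $ i))" unfolding im
    by (intro analytic_at_pt_add analytic_at_pt_mult analytic_at_pt_const analytic_at_pt_coord B)
qed (fact analytic_at_pt_const analytic_at_pt_add analytic_at_pt_mult analytic_at_pt_compose analytic_at_pt_cong)+

text \<open>The derivative is carried as a witness \<open>f'\<close>, with a constant linear in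
  \<open>norm v\<close>, so that sums, products and compositions can be estimated by hand.
  \<open>C1_holder_at_imp_on\<close> returns to \<open>frechet_derivative\<close>.\<close>

definition C1_holder_at :: "real \<Rightarrow> 'a::real_normed_vector \<Rightarrow> ('a \<Rightarrow> complex) \<Rightarrow> bool" where
  "C1_holder_at \<alpha> x0 f \<longleftrightarrow> (\<exists>e>0. \<exists>C\<ge>0. \<exists>f'. \<forall>x\<in>ball x0 e. (f has_derivative f' x) (at x) \<and>
      (\<forall>y\<in>ball x0 e. \<forall>v. norm (f' x v - f' y v) \<le> C * norm v * dist x y powr \<alpha>))"

section \<open>Calculus of the first-order Hoelder class\<close>

lemma powr_le1_mono: "0 \<le> d \<Longrightarrow> d \<le> 1 \<Longrightarrow> \<alpha> \<le> 1 \<Longrightarrow> d \<le> d powr \<alpha>" for d :: real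
  using powr_mono'[of \<alpha> 1 d] by (cases "d = 0") auto

text \<open>One constant for the function, its derivative and their moduli of continuity. The radius
  is at most 1/2, so distances stay below 1 and a Lipschitz bound is also a Hoelder bound.\<close>

lemma C1_holder_atE:
  assumes f: "C1_holder_at \<alpha> x0 f" and \<alpha>: "0 < \<alpha>" "\<alpha> \<le> 1"
  obtains e C f' where "0 < e" "e \<le> 1/2" "C \<ge> 0"
    "\<And>x. x \<in> ball x0 e \<Longrightarrow> (f has_derivative f' x) (at x)"
    "\<And>x y v. x \<in> ball x0 e \<Longrightarrow> y \<in> ball x0 e \<Longrightarrow> norm (f' x v - f' y v) \<le> C * norm v * dist x y powr \<alpha>"
    "\<And>x v. x \<in> ball x0 e \<Longrightarrow> norm (f' x v) \<le> C * norm v"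
    "\<And>x. x \<in> ball x0 e \<Longrightarrow> norm (f x) \<le> C"
    "\<And>x y. x \<in> ball x0 e \<Longrightarrow> y \<in> ball x0 e \<Longrightarrow> norm (f x - f y) \<le> C * dist x y powr \<alpha>"
proof -
  obtain e0 C0 f' where e0: "e0 > 0" "C0 \<ge> 0" and
    f': "\<And>x. x \<in> ball x0 e0 \<Longrightarrow> (f has_derivative f' x) (at x)"
    "\<And>x y v. x \<in> ball x0 e0 \<Longrightarrow> y \<in> ball x0 e0 \<Longrightarrow> norm (f' x v - f' y v) \<le> C0 * norm v * dist x y powr \<alpha>"
    using f unfolding C1_holder_at_def by blast
  define e where "e = min e0 (1/2)"
  have e: "0 < e" "e \<le> 1/2" "ball x0 e \<subseteq> ball x0 e0" using e0 by (auto simp: e_def)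
  have x0e: "x0 \<in> ball x0 e0" using e0 by simp
  obtain K where K: "K > 0" "\<And>v. norm (f' x0 v) \<le> norm v * K"
    using bounded_linear.pos_bounded[OF has_derivative_bounded_linear[OF f'(1)[OF x0e]]] by blast
  define B where "B = K + C0"
  have dd: "dist x y \<le> 1" if "x \<in> ball x0 e" "y \<in> ball x0 e" for x y
    using that e(2) dist_triangle[of x y x0] by (simp add: dist_commute)
  have d1: "dist x y powr \<alpha> \<le> 1" if "x \<in> ball x0 e" "y \<in> ball x0 e" for x y
    using dd[OF that] \<alpha> powr_mono2[of \<alpha> "dist x y" 1] by simp
  have B: "norm (f' x v) \<le> B * norm v" if x: "x \<in> ball x0 e" for x v
  proof -
    have "norm (f' x v) \<le> norm (f' x0 v) + norm (f' x v - f' x0 v)" by norm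
    also have "norm (f' x v - f' x0 v) \<le> C0 * norm v * dist x x0 powr \<alpha>"
      by (rule f'(2)[OF subsetD[OF e(3) x] x0e])
    also have "\<dots> \<le> C0 * norm v * 1" using d1[of x x0] x e e0 by (intro mult_left_mono) auto
    finally show ?thesis using K(2)[of v] by (simp add: B_def algebra_simps)
  qed
  have B0: "B \<ge> 0" using K e0 by (simp add: B_def)
  have lip: "norm (f x - f y) \<le> B * norm (x - y)" if "x \<in> ball x0 e" "y \<in> ball x0 e" for x y
    by (rule differentiable_bound[OF convex_ball has_derivative_at_withinI[OF f'(1)[OF subsetD[OF e(3)]]] onorm_bound[OF B0 B] that])
  define C where "C = B + C0 + norm (f x0) + B"
  have C: "C \<ge> B" "C \<ge> C0" "C \<ge> norm (f x0) + B" "C \<ge> 0" using e0 B0 by (auto simp: C_def)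
  show thesis
  proof (rule that[OF e(1,2) C(4)])
    fix x assume x: "x \<in> ball x0 e"
    show "(f has_derivative f' x) (at x)" using f'(1) x e by blast
    show "norm (f' x v) \<le> C * norm v" for v using B[OF x, of v] mult_right_mono[OF C(1), of "norm v"] by simp
    have "norm (f x - f x0) \<le> B * 1"
      by (rule order_trans[OF lip[OF x, of x0]]) (use e mult_left_mono[OF dd[OF x, of x0] B0] in \<open>auto simp: dist_norm\<close>)
    then show "norm (f x) \<le> C" using C(3) norm_triangle_sub[of "f x" "f x0"] by simp
    fix y assume y: "y \<in> ball x0 e"
    have "norm (f' x v - f' y v) \<le> C0 * (norm v * dist x y powr \<alpha>)" for v
      using f'(2)[OF subsetD[OF e(3) x] subsetD[OF e(3) y], of v] by (simp add: mult.assoc)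
    moreover have "C0 * (norm v * dist x y powr \<alpha>) \<le> C * (norm v * dist x y powr \<alpha>)" for v
      by (intro mult_right_mono C) auto
    ultimately show "norm (f' x v - f' y v) \<le> C * norm v * dist x y powr \<alpha>" for v
      unfolding mult.assoc using order_trans by blast
    have "norm (f x - f y) \<le> B * dist x y" using lip[OF x y] by (simp add: dist_norm)
    also have "\<dots> \<le> C * dist x y powr \<alpha>"
      using C(1) B0 dd[OF x y] \<alpha> by (intro mult_mono powr_le1_mono) auto
    finally show "norm (f x - f y) \<le> C * dist x y powr \<alpha>" .
  qed
qed

lemma C1_holder_atI:
  assumes "e > 0" "C \<ge> 0" "\<And>x. x \<in> ball x0 e \<Longrightarrow> (f has_derivative f' x) (at x)"
    "\<And>x y v. x \<in> ball x0 e \<Longrightarrow> y \<in> ball x0 e \<Longrightarrow> norm (f' x v - f' y v) \<le> C * norm v * dist x y powr \<alpha>"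
  shows "C1_holder_at \<alpha> x0 f"
  unfolding C1_holder_at_def using assms by blast

lemma C1_holder_at_bounded_linear:
  assumes "bounded_linear f" shows "C1_holder_at \<alpha> x0 (\<lambda>x. f x + k)"
  by (rule C1_holder_atI[of 1 0 _ _ "\<lambda>_. f"])
    (use assms in \<open>auto intro!: has_derivative_eq_rhs[OF has_derivative_add[OF bounded_linear_imp_has_derivative has_derivative_const]]\<close>)

lemma C1_holder_at_add:
  assumes "C1_holder_at \<alpha> x0 f" "C1_holder_at \<alpha> x0 g" "0 < \<alpha>" "\<alpha> \<le> 1"
  shows "C1_holder_at \<alpha> x0 (\<lambda>x. f x + g x)"
proof -
  obtain e C f' where f: "0 < e" "C \<ge> 0"
    "\<And>x. x \<in> ball x0 e \<Longrightarrow> (f has_derivative f' x) (at x)"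
    "\<And>x y v. x \<in> ball x0 e \<Longrightarrow> y \<in> ball x0 e \<Longrightarrow> norm (f' x v - f' y v) \<le> C * norm v * dist x y powr \<alpha>"
    by (rule C1_holder_atE[OF assms(1,3,4)]) blast
  obtain d D g' where g: "0 < d" "D \<ge> 0"
    "\<And>x. x \<in> ball x0 d \<Longrightarrow> (g has_derivative g' x) (at x)"
    "\<And>x y v. x \<in> ball x0 d \<Longrightarrow> y \<in> ball x0 d \<Longrightarrow> norm (g' x v - g' y v) \<le> D * norm v * dist x y powr \<alpha>"
    by (rule C1_holder_atE[OF assms(2,3,4)]) blast
  show ?thesis
  proof (rule C1_holder_atI[of "min e d" "C + D" _ _ "\<lambda>x v. f' x v + g' x v"])
    show "((\<lambda>x. f x + g x) has_derivative (\<lambda>v. f' x v + g' x v)) (at x)" if "x \<in> ball x0 (min e d)" for x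
      using that f(3) g(3) by (intro has_derivative_add) auto
    show "norm (f' x v + g' x v - (f' y v + g' y v)) \<le> (C + D) * norm v * dist x y powr \<alpha>"
      if "x \<in> ball x0 (min e d)" "y \<in> ball x0 (min e d)" for x y v
      using norm_triangle_le[OF add_mono[OF f(4)[of x y v] g(4)[of x y v]]] that by (simp add: algebra_simps)
  qed (use f g in auto)
qed

lemma C1_holder_at_mult:
  assumes "C1_holder_at \<alpha> x0 f" "C1_holder_at \<alpha> x0 g" and \<alpha>: "0 < \<alpha>" "\<alpha> \<le> 1"
  shows "C1_holder_at \<alpha> x0 (\<lambda>x. f x * g x)"
proof -
  obtain e C f' where f: "0 < e" "e \<le> 1/2" "C \<ge> 0"
    "\<And>x. x \<in> ball x0 e \<Longrightarrow> (f has_derivative f' x) (at x)"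
    "\<And>x y v. x \<in> ball x0 e \<Longrightarrow> y \<in> ball x0 e \<Longrightarrow> norm (f' x v - f' y v) \<le> C * norm v * dist x y powr \<alpha>"
    "\<And>x v. x \<in> ball x0 e \<Longrightarrow> norm (f' x v) \<le> C * norm v"
    "\<And>x. x \<in> ball x0 e \<Longrightarrow> norm (f x) \<le> C"
    "\<And>x y. x \<in> ball x0 e \<Longrightarrow> y \<in> ball x0 e \<Longrightarrow> norm (f x - f y) \<le> C * dist x y powr \<alpha>"
    by (rule C1_holder_atE[OF assms(1) \<alpha>]) (rule that; assumption)
  obtain d D g' where g: "0 < d" "d \<le> 1/2" "D \<ge> 0"
    "\<And>x. x \<in> ball x0 d \<Longrightarrow> (g has_derivative g' x) (at x)"
    "\<And>x y v. x \<in> ball x0 d \<Longrightarrow> y \<in> ball x0 d \<Longrightarrow> norm (g' x v - g' y v) \<le> D * norm v * dist x y powr \<alpha>"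
    "\<And>x v. x \<in> ball x0 d \<Longrightarrow> norm (g' x v) \<le> D * norm v"
    "\<And>x. x \<in> ball x0 d \<Longrightarrow> norm (g x) \<le> D"
    "\<And>x y. x \<in> ball x0 d \<Longrightarrow> y \<in> ball x0 d \<Longrightarrow> norm (g x - g y) \<le> D * dist x y powr \<alpha>"
    by (rule C1_holder_atE[OF assms(2) \<alpha>]) (rule that; assumption)
  show ?thesis
  proof (rule C1_holder_atI[of "min e d" "4 * C * D" _ _ "\<lambda>x v. f x * g' x v + f' x v * g x"])
    show "((\<lambda>x. f x * g x) has_derivative (\<lambda>v. f x * g' x v + f' x v * g x)) (at x)" if "x \<in> ball x0 (min e d)" for x
      using that f(4) g(4) by (intro has_derivative_mult) auto
    fix x y :: 'a and v assume "x \<in> ball x0 (min e d)" "y \<in> ball x0 (min e d)"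
    then have x: "x \<in> ball x0 e" "x \<in> ball x0 d" and y: "y \<in> ball x0 e" "y \<in> ball x0 d" by auto
    let ?p = "dist x y powr \<alpha>"
    have eq: "f x * g' x v + f' x v * g x - (f y * g' y v + f' y v * g y)
      = (f x * (g' x v - g' y v) + (f x - f y) * g' y v) + (f' x v * (g x - g y) + (f' x v - f' y v) * g y)"
      by (simp add: algebra_simps)
    have 1: "norm (f x * (g' x v - g' y v)) \<le> C * (D * norm v * ?p)"
      unfolding norm_mult using f(7)[OF x(1)] g(5)[OF x(2) y(2), of v] f(3) by (intro mult_mono) auto
    have 2: "norm ((f x - f y) * g' y v) \<le> (C * ?p) * (D * norm v)"
      unfolding norm_mult using f(8)[OF x(1) y(1)] g(6)[OF y(2), of v] f(3) by (intro mult_mono) auto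
    have 3: "norm (f' x v * (g x - g y)) \<le> (C * norm v) * (D * ?p)"
      unfolding norm_mult using f(6)[OF x(1), of v] g(8)[OF x(2) y(2)] f(3) by (intro mult_mono) auto
    have 4: "norm ((f' x v - f' y v) * g y) \<le> (C * norm v * ?p) * D"
      unfolding norm_mult using f(5)[OF x(1) y(1), of v] g(7)[OF y(2)] f(3) by (intro mult_mono) auto
    show "norm (f x * g' x v + f' x v * g x - (f y * g' y v + f' y v * g y)) \<le> 4 * C * D * norm v * ?p"
      unfolding eq
      by (rule order_trans[OF norm_triangle_ineq], rule order_trans[OF add_mono[OF norm_triangle_ineq norm_triangle_ineq]],
          rule order_trans[OF add_mono[OF add_mono[OF 1 2] add_mono[OF 3 4]]]) (simp add: algebra_simps)
  qed (use f g in auto)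
qed

lemma C1_holder_at_compose:
  assumes "C1_holder_at \<alpha> x0 f" and \<alpha>: "0 < \<alpha>" "\<alpha> \<le> 1" and hol: "\<Phi> holomorphic_on V" "open V" "f x0 \<in> V"
  shows "C1_holder_at \<alpha> x0 (\<lambda>x. \<Phi> (f x))"
proof -
  obtain e C f' where f: "0 < e" "e \<le> 1/2" "C \<ge> 0"
    "\<And>x. x \<in> ball x0 e \<Longrightarrow> (f has_derivative f' x) (at x)"
    "\<And>x y v. x \<in> ball x0 e \<Longrightarrow> y \<in> ball x0 e \<Longrightarrow> norm (f' x v - f' y v) \<le> C * norm v * dist x y powr \<alpha>"
    "\<And>x v. x \<in> ball x0 e \<Longrightarrow> norm (f' x v) \<le> C * norm v"
    "\<And>x. x \<in> ball x0 e \<Longrightarrow> norm (f x) \<le> C"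
    "\<And>x y. x \<in> ball x0 e \<Longrightarrow> y \<in> ball x0 e \<Longrightarrow> norm (f x - f y) \<le> C * dist x y powr \<alpha>"
    by (rule C1_holder_atE[OF assms(1) \<alpha>]) (rule that; assumption)
  obtain \<rho> where \<rho>: "\<rho> > 0" "cball (f x0) \<rho> \<subseteq> V" using hol(2,3) open_contains_cball by blast
  have h1: "deriv \<Phi> holomorphic_on V" and h2: "deriv (deriv \<Phi>) holomorphic_on V"
    using hol by (auto intro: holomorphic_deriv)
  have "bounded (deriv \<Phi> ` cball (f x0) \<rho>)" "bounded (deriv (deriv \<Phi>) ` cball (f x0) \<rho>)"
    using \<rho> h1 h2 by (auto intro!: compact_imp_bounded compact_continuous_image
        intro: continuous_on_subset holomorphic_on_imp_continuous_on)
  then obtain K1 K2 where K12: "\<forall>w\<in>cball (f x0) \<rho>. cmod (deriv \<Phi> w) \<le> K1" "\<forall>w\<in>cball (f x0) \<rho>. cmod (deriv (deriv \<Phi>) w) \<le> K2"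
    unfolding bounded_iff ball_simps by blast
  define K where "K = max 0 (max K1 K2)"
  have K: "K \<ge> 0" "\<And>w. w \<in> cball (f x0) \<rho> \<Longrightarrow> cmod (deriv \<Phi> w) \<le> K" "\<And>w. w \<in> cball (f x0) \<rho> \<Longrightarrow> cmod (deriv (deriv \<Phi>) w) \<le> K"
    using K12 unfolding K_def by (auto simp: le_max_iff_disj simp del: mem_cball)
  have lip: "cmod (deriv \<Phi> w - deriv \<Phi> z) \<le> K * cmod (w - z)" if "w \<in> cball (f x0) \<rho>" "z \<in> cball (f x0) \<rho>" for w z
    by (rule field_differentiable_bound[OF convex_cball _ K(3) that])
      (use \<rho> holomorphic_derivI[OF h1 hol(2)] in \<open>auto intro: has_field_derivative_at_within\<close>)
  have x0e: "x0 \<in> ball x0 e" using f by simp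
  have "isCont f x0" using f(4)[OF x0e] has_derivative_continuous by blast
  then obtain d where d: "d > 0" "\<And>x. dist x x0 < d \<Longrightarrow> dist (f x) (f x0) < \<rho>"
    using \<rho> unfolding continuous_at_eps_delta by blast
  show ?thesis
  proof (rule C1_holder_atI[of "min e d" "2 * K * (C * C + C)" _ _ "\<lambda>x v. f' x v * deriv \<Phi> (f x)"])
    fix x assume "x \<in> ball x0 (min e d)"
    then have x: "x \<in> ball x0 e" "f x \<in> cball (f x0) \<rho>" using d(2)[of x] by (auto simp: dist_commute)
    have "(\<Phi> has_field_derivative deriv \<Phi> (f x)) (at (f x))"
      using x \<rho> by (intro holomorphic_derivI[OF hol(1,2)]) auto
    then have "(\<Phi> has_derivative (*) (deriv \<Phi> (f x))) (at (f x))" by (simp add: has_field_derivative_def)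
    from has_derivative_compose[OF f(4)[OF x(1)] this]
    show "((\<lambda>x. \<Phi> (f x)) has_derivative (\<lambda>v. f' x v * deriv \<Phi> (f x))) (at x)" by (simp add: mult.commute)
    fix y v assume "y \<in> ball x0 (min e d)"
    then have y: "y \<in> ball x0 e" "f y \<in> cball (f x0) \<rho>" using d(2)[of y] by (auto simp: dist_commute)
    let ?p = "dist x y powr \<alpha>"
    have eq: "f' x v * deriv \<Phi> (f x) - f' y v * deriv \<Phi> (f y) =
      f' x v * (deriv \<Phi> (f x) - deriv \<Phi> (f y)) + (f' x v - f' y v) * deriv \<Phi> (f y)" by (simp add: algebra_simps)
    have "cmod (deriv \<Phi> (f x) - deriv \<Phi> (f y)) \<le> K * (C * ?p)"
      by (rule order_trans[OF lip[OF x(2) y(2)]]) (use K f(8)[OF x(1) y(1)] in \<open>auto intro!: mult_left_mono\<close>)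
    then have 1: "norm (f' x v * (deriv \<Phi> (f x) - deriv \<Phi> (f y))) \<le> (C * norm v) * (K * (C * ?p))"
      unfolding norm_mult using f(6)[OF x(1), of v] f(3) by (intro mult_mono) auto
    have 2: "norm ((f' x v - f' y v) * deriv \<Phi> (f y)) \<le> (C * norm v * ?p) * K"
      unfolding norm_mult using f(5)[OF x(1) y(1), of v] K(2)[OF y(2)] f(3) by (intro mult_mono) auto
    have 3: "0 \<le> K * (C * C + C) * norm v * ?p" using K f(3) by simp
    show "norm (f' x v * deriv \<Phi> (f x) - f' y v * deriv \<Phi> (f y)) \<le> 2 * K * (C * C + C) * norm v * ?p"
      unfolding eq using norm_triangle_le[OF add_mono[OF 1 2]] 3 by (simp add: algebra_simps)
  qed (use f d K in auto)
qed

lemma C1_holder_at_cong: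
  assumes f: "C1_holder_at \<alpha> x0 f" and ev: "\<forall>\<^sub>F x in nhds x0. f x = g x"
  shows "C1_holder_at \<alpha> x0 g"
proof -
  obtain e C f' where f: "e > 0" "C \<ge> 0" and
    f': "\<And>x. x \<in> ball x0 e \<Longrightarrow> (f has_derivative f' x) (at x)"
    "\<And>x y v. x \<in> ball x0 e \<Longrightarrow> y \<in> ball x0 e \<Longrightarrow> norm (f' x v - f' y v) \<le> C * norm v * dist x y powr \<alpha>"
    using f unfolding C1_holder_at_def by blast
  obtain d where d: "d > 0" "\<And>x. dist x x0 < d \<Longrightarrow> f x = g x" using ev by (auto simp: eventually_nhds_metric)
  show ?thesis
  proof (rule C1_holder_atI[of "min e d" C _ _ f'])
    show "(g has_derivative f' x) (at x)" if "x \<in> ball x0 (min e d)" for x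
    proof (rule has_derivative_transform_within_open[OF f'(1)])
      show "x \<in> ball x0 e" "open (ball x0 d)" "x \<in> ball x0 d" using that by auto
      show "\<And>x. x \<in> ball x0 d \<Longrightarrow> f x = g x" using d(2) by (simp add: dist_commute)
    qed
    show "norm (f' x v - f' y v) \<le> C * norm v * dist x y powr \<alpha>"
      if "x \<in> ball x0 (min e d)" "y \<in> ball x0 (min e d)" for x y v
      using f'(2)[of x y v] that by simp
  qed (use f d in auto)
qed

lemma regularity_C1_holder:
  assumes "0 < \<alpha>" "\<alpha> \<le> 1" shows "regularity_class (C1_holder_at \<alpha> x0) x0"
proof
  show "C1_holder_at \<alpha> x0 (\<lambda>_. k)" for k using C1_holder_at_bounded_linear[OF bounded_linear_zero] by simp
  show "C1_holder_at \<alpha> x0 (\<lambda>z. z $ i)" for i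
    using C1_holder_at_bounded_linear[OF bounded_linear_vec_nth, where k=0] by simp
  show "C1_holder_at \<alpha> x0 (\<lambda>z. cnj (z $ i))" for i
    using C1_holder_at_bounded_linear[OF bounded_linear_compose[OF bounded_linear_cnj bounded_linear_vec_nth], where k=0] by simp
qed (fact C1_holder_at_add[OF _ _ assms] C1_holder_at_mult[OF _ _ assms] C1_holder_at_compose[OF _ assms] C1_holder_at_cong)+

text \<open>Stating the conclusion for every \<open>U' \<subseteq> U\<close> allows the
  neighbourhoods belonging to the finitely many matrix entries to be intersected.\<close>

lemma C1_holder_at_imp_on:
  assumes f: "C1_holder_at \<alpha> x0 f" and \<alpha>: "0 < \<alpha>" "\<alpha> \<le> 1" and W: "open W" "x0 \<in> W"
  obtains U where "open U" "x0 \<in> U" "U \<subseteq> W" "C1_holder_on \<alpha> f U"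
    "\<And>U'. U' \<subseteq> U \<Longrightarrow> C1_holder_on \<alpha> f U'"
proof -
  obtain e0 where e0: "e0 > 0" "ball x0 e0 \<subseteq> W" using W open_contains_ball by blast
  obtain e C f' where e: "e > 0" "C \<ge> 0" and
    f': "\<And>x. x \<in> ball x0 e \<Longrightarrow> (f has_derivative f' x) (at x)"
    "\<And>x y v. x \<in> ball x0 e \<Longrightarrow> y \<in> ball x0 e \<Longrightarrow> norm (f' x v - f' y v) \<le> C * norm v * dist x y powr \<alpha>"
    using f unfolding C1_holder_at_def by blast
  define U where "U = ball x0 (min e e0)"
  have fr: "frechet_derivative f (at x) = f' x" if "x \<in> U" for x
    using frechet_derivative_at[OF f'(1)[of x]] that by (auto simp: U_def)
  have H: "C1_holder_on \<alpha> f U'" if U': "U' \<subseteq> U" for U'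
    unfolding C1_holder_on_def
  proof (intro conjI allI)
    have cont: "continuous_on U' (\<lambda>x. frechet_derivative f (at x) v)" for v
      unfolding continuous_on_def
    proof
      fix x assume x: "x \<in> U'"
      have "((\<lambda>y. f' y v) \<longlongrightarrow> f' x v) (at x within U')"
      proof (rule Lim_transform_bound[of "\<lambda>y. f' y v - f' x v", THEN Lim_null[THEN iffD2]])
        show "\<forall>\<^sub>F y in at x within U'. norm (f' y v - f' x v) \<le> norm (C * norm v * dist y x powr \<alpha>)"
          using x U' f'(2)[of _ x v] e by (auto simp: eventually_at_filter U_def subset_iff intro!: always_eventually)
        have "((\<lambda>y. C * norm v * dist y x powr \<alpha>) \<longlongrightarrow> C * norm v * 0 powr \<alpha>) (at x within U')"
          using \<alpha> by (intro tendsto_intros tendsto_powr' ) (auto intro!: tendsto_eq_intros)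
        then show "((\<lambda>y. C * norm v * dist y x powr \<alpha>) \<longlongrightarrow> 0) (at x within U')" by simp
      qed
      then show "((\<lambda>x. frechet_derivative f (at x) v) \<longlongrightarrow> frechet_derivative f (at x) v) (at x within U')"
        by (rule Lim_transform_eventually[OF _ , of _ _ _ "\<lambda>y. frechet_derivative f (at y) v", THEN subst[of _ _ "\<lambda>q. (_ \<longlongrightarrow> q) _", rotated]])
          (use x U' fr in \<open>auto simp: eventually_at_filter subset_iff intro!: always_eventually\<close>)
    qed
    then show "Ck_on 1 f U'"
      using U' f'(1) by (auto simp: U_def differentiable_def subset_iff)
    fix v
    show "\<exists>C. \<forall>x\<in>U'. \<forall>y\<in>U'. norm (frechet_derivative f (at x) v - frechet_derivative f (at y) v) \<le> C * dist x y powr \<alpha>"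
      using f'(2)[of _ _ v] U' by (intro exI[of _ "C * norm v"]) (auto simp: fr subset_iff U_def)
  qed
  show thesis
    by (rule that[of U]) (use e e0 H in \<open>auto simp: U_def\<close>)
qed

section \<open>Locality of the regularity notions\<close>

lemma frechet_derivative_cong_open:
  assumes "open U" "x \<in> U" "\<And>y. y \<in> U \<Longrightarrow> f y = g y"
  shows "f differentiable (at x) \<longleftrightarrow> g differentiable (at x)"
    "frechet_derivative f (at x) = frechet_derivative g (at x)"
proof -
  have "(f has_derivative D) (at x) \<longleftrightarrow> (g has_derivative D) (at x)" for D
  proof
    show "(g has_derivative D) (at x)" if "(f has_derivative D) (at x)"
      by (rule has_derivative_transform_within_open[OF that assms(1,2)]) (rule assms(3))
    show "(f has_derivative D) (at x)" if "(g has_derivative D) (at x)"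
      by (rule has_derivative_transform_within_open[OF that assms(1,2)]) (rule assms(3)[symmetric])
  qed
  then show "f differentiable (at x) \<longleftrightarrow> g differentiable (at x)"
    "frechet_derivative f (at x) = frechet_derivative g (at x)"
    by (simp_all add: differentiable_def frechet_derivative_def)
qed

lemma Ck_on_cong:
  assumes "open U" "\<And>y. y \<in> U \<Longrightarrow> f y = g y"
  shows "Ck_on k f U \<longleftrightarrow> Ck_on k g U"
  using assms(2)
proof (induction k arbitrary: f g)
  case 0
  then show ?case by (simp cong: continuous_on_cong)
next
  case (Suc k)
  note e = frechet_derivative_cong_open[OF assms(1) _ Suc.prems]
  have "Ck_on k (\<lambda>x. frechet_derivative f (at x) v) U \<longleftrightarrow> Ck_on k (\<lambda>x. frechet_derivative g (at x) v) U" for v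
    by (rule Suc.IH) (simp add: e(2))
  then show ?case by (simp add: e(1) cong: ball_cong)
qed

lemma C1_holder_on_cong:
  assumes "open U" "\<And>y. y \<in> U \<Longrightarrow> f y = g y"
  shows "C1_holder_on \<alpha> f U \<longleftrightarrow> C1_holder_on \<alpha> g U"
proof -
  have "frechet_derivative f (at x) = frechet_derivative g (at x)" if "x \<in> U" for x
    by (rule frechet_derivative_cong_open(2)[OF assms(1) that assms(2)])
  then have "(\<forall>x\<in>U. \<forall>y\<in>U. norm (frechet_derivative f (at x) v - frechet_derivative f (at y) v) \<le> C * dist x y powr \<alpha>) \<longleftrightarrow>
    (\<forall>x\<in>U. \<forall>y\<in>U. norm (frechet_derivative g (at x) v - frechet_derivative g (at y) v) \<le> C * dist x y powr \<alpha>)" for v C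
    by simp
  moreover have "Ck_on 1 f U \<longleftrightarrow> Ck_on 1 g U" by (rule Ck_on_cong[OF assms])
  ultimately show ?thesis unfolding C1_holder_on_def by (simp only:)
qed

lemma real_analytic_on_cong:
  assumes "open U" "\<And>y. y \<in> U \<Longrightarrow> f y = g y" "real_analytic_on f U"
  shows "real_analytic_on g U"
  unfolding real_analytic_on_def
proof
  fix x0 assume x0: "x0 \<in> U"
  then obtain r c where r: "r > 0" "\<forall>x\<in>ball x0 r. ((\<lambda>\<alpha>. (\<Prod>b\<in>Basis. ((x - x0) \<bullet> b) ^ \<alpha> b) *\<^sub>R c \<alpha>) has_sum f x) multi_index"
    using assms(3) unfolding real_analytic_on_def by blast
  obtain e where e: "e > 0" "ball x0 e \<subseteq> U" using assms(1) x0 open_contains_ball by blast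
  show "\<exists>r>0. \<exists>c. \<forall>x\<in>ball x0 r. ((\<lambda>\<alpha>. (\<Prod>b\<in>Basis. ((x - x0) \<bullet> b) ^ \<alpha> b) *\<^sub>R c \<alpha>) has_sum g x) multi_index"
  proof (intro exI[of _ "min r e"] conjI exI[of _ c] ballI)
    fix x assume "x \<in> ball x0 (min r e)"
    then have "x \<in> ball x0 r" "x \<in> U" using e by auto
    then show "((\<lambda>\<alpha>. (\<Prod>b\<in>Basis. ((x - x0) \<bullet> b) ^ \<alpha> b) *\<^sub>R c \<alpha>) has_sum g x) multi_index"
      using bspec[OF r(2), of x] assms(2)[of x] by simp
  qed (use r e in auto)
qed

lemma Ck1_local:
  assumes "open U" "\<And>p. p \<in> U \<Longrightarrow> \<exists>V. open V \<and> p \<in> V \<and> Ck_on 1 f V"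
  shows "Ck_on 1 f U"
proof -
  have "f differentiable (at p) \<and> isCont (\<lambda>x. frechet_derivative f (at x) v) p" if p: "p \<in> U" for p v
  proof -
    obtain V where V: "open V" "p \<in> V" "Ck_on 1 f V" using assms(2)[OF p] by blast
    then have "continuous_on V (\<lambda>x. frechet_derivative f (at x) v)" by simp
    then show ?thesis using V by (simp add: continuous_on_eq_continuous_at)
  qed
  then show ?thesis using assms(1) by (simp add: continuous_on_eq_continuous_at)
qed

lemma Ck_on_Re:
  assumes "open U" "Ck_on k f U" shows "Ck_on k (\<lambda>x. Re (f x)) U"
  using assms(2)
proof (induction k arbitrary: f)
  case 0
  then show ?case by (simp add: continuous_on_Re)
next
  case (Suc k)
  have D: "((\<lambda>x. Re (f x)) has_derivative (\<lambda>v. Re (frechet_derivative f (at x) v))) (at x)" if "x \<in> U" for x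
    using Suc.prems that by (intro has_derivative_Re) (simp add: frechet_derivative_works)
  have fr: "frechet_derivative (\<lambda>x. Re (f x)) (at x) = (\<lambda>v. Re (frechet_derivative f (at x) v))" if "x \<in> U" for x
    using frechet_derivative_at[OF D[OF that]] by simp
  have "Ck_on k (\<lambda>x. frechet_derivative (\<lambda>x. Re (f x)) (at x) v) U" for v
    using Suc.IH[of "\<lambda>x. frechet_derivative f (at x) v"] Suc.prems
    by (subst Ck_on_cong[OF assms(1), of _ "\<lambda>x. Re (frechet_derivative f (at x) v)"]) (simp_all add: fr)
  then show ?case using D by (auto simp: differentiable_def)
qed

section \<open>Second differences of twice differentiable functions\<close>

lemma line_derivative:
  fixes g :: "'a::real_normed_vector \<Rightarrow> real"
  assumes "g differentiable (at (p + s *\<^sub>R v))"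
  shows "((\<lambda>s. g (p + s *\<^sub>R v)) has_real_derivative frechet_derivative g (at (p + s *\<^sub>R v)) v) (at s)"
proof -
  let ?D = "frechet_derivative g (at (p + s *\<^sub>R v))"
  have D: "(g has_derivative ?D) (at (p + s *\<^sub>R v))" using assms by (simp add: frechet_derivative_works)
  have "((\<lambda>s. p + s *\<^sub>R v) has_derivative (\<lambda>h. h *\<^sub>R v)) (at s)" by (auto intro!: derivative_eq_intros)
  from has_derivative_compose[OF this D] have "((\<lambda>s. g (p + s *\<^sub>R v)) has_derivative (\<lambda>h. ?D (h *\<^sub>R v))) (at s)" .
  moreover have "?D (h *\<^sub>R v) = ?D v * h" for h
    using linear_cmul[OF has_derivative_linear[OF D]] by (simp add: mult.commute)
  ultimately show ?thesis by (simp add: has_field_derivative_def)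
qed

text \<open>Taylor's formula with Lagrange remainder on both sides of \<open>p\<close>. Keeping the
  two intermediate points serves two purposes: a bound that refutes second-order smoothness, and the
  limit of four-point means of test functions.\<close>

lemma Ck2_second_difference:
  fixes f :: "'a::real_normed_vector \<Rightarrow> real"
  assumes f: "Ck_on 2 f U" and seg: "\<And>s. \<bar>s\<bar> \<le> r \<Longrightarrow> p + s *\<^sub>R v \<in> U" and r: "r > 0"
  defines "D2 \<equiv> \<lambda>x. frechet_derivative (\<lambda>y. frechet_derivative f (at y) v) (at x) v"
  shows "\<exists>s t. \<bar>s\<bar> \<le> r \<and> \<bar>t\<bar> \<le> r \<and>
    f (p + r *\<^sub>R v) + f (p - r *\<^sub>R v) - 2 * f p = r\<^sup>2 / 2 * (D2 (p + s *\<^sub>R v) + D2 (p + t *\<^sub>R v))"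
proof -
  define diff where "diff k s = (if k = 0 then f (p + s *\<^sub>R v) else if k = 1 then frechet_derivative f (at (p + s *\<^sub>R v)) v
     else D2 (p + s *\<^sub>R v))" for k :: nat and s
  have f2: "f differentiable (at x)" "(\<lambda>y. frechet_derivative f (at y) v) differentiable (at x)" if "x \<in> U" for x
    using f that by (simp_all add: numeral_2_eq_2)
  have D: "\<forall>k t. k < 2 \<and> - r \<le> t \<and> t \<le> r \<longrightarrow> DERIV (diff k) t :> diff (Suc k) t"
  proof (intro allI impI)
    fix k t assume a: "k < (2::nat) \<and> - r \<le> t \<and> t \<le> r"
    then have U: "p + t *\<^sub>R v \<in> U" by (intro seg) auto
    have "k = 0 \<or> k = 1" using a by auto
    then show "DERIV (diff k) t :> diff (Suc k) t"
      using line_derivative[OF f2(1)[OF U]] line_derivative[OF f2(2)[OF U]] by (auto simp: diff_def[abs_def] D2_def)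
  qed
  obtain s where s: "0 < s" "s < r" "f (p + r *\<^sub>R v) = (\<Sum>k<2. (diff k 0 / fact k) * (r - 0)^k) + (diff 2 s / fact 2) * (r - 0)^2"
    using Taylor[of 2 diff "\<lambda>s. f (p + s *\<^sub>R v)" "-r" r 0 r] D r by (auto simp: diff_def[abs_def])
  obtain t where t: "-r < t" "t < 0" "f (p + (-r) *\<^sub>R v) = (\<Sum>k<2. (diff k 0 / fact k) * (-r - 0)^k) + (diff 2 t / fact 2) * (-r - 0)^2"
    using Taylor[of 2 diff "\<lambda>s. f (p + s *\<^sub>R v)" "-r" r 0 "-r"] D r by (auto simp: diff_def[abs_def])
  have "f (p + r *\<^sub>R v) + f (p - r *\<^sub>R v) - 2 * f p = r\<^sup>2 / 2 * (D2 (p + s *\<^sub>R v) + D2 (p + t *\<^sub>R v))"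
    using s(3) t(3) by (simp add: diff_def numeral_2_eq_2 algebra_simps)
  then show ?thesis using s t by (intro exI[of _ s] exI[of _ t]) auto
qed

text \<open>The obstruction used against class \<open>C\<^sup>2\<close>: growth like a power below
  the second along some line violates this bound.\<close>

lemma Ck2_second_difference_bound:
  fixes f :: "'a::real_normed_vector \<Rightarrow> real"
  assumes f: "Ck_on 2 f U" and U: "open U" "p \<in> U"
  shows "\<exists>C e. e > 0 \<and> (\<forall>r. 0 < r \<and> r < e \<longrightarrow> \<bar>f (p + r *\<^sub>R v) + f (p - r *\<^sub>R v) - 2 * f p\<bar> \<le> C * r\<^sup>2)"
proof -
  define D2 where "D2 = (\<lambda>x. frechet_derivative (\<lambda>y. frechet_derivative f (at y) v) (at x) v)"
  have c: "continuous_on U D2" using f by (simp add: numeral_2_eq_2 D2_def)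
  have "continuous_on ((\<lambda>s. p + s *\<^sub>R v) -` U) (\<lambda>s. D2 (p + s *\<^sub>R v))"
    by (rule continuous_on_compose2[OF c]) (auto intro!: continuous_intros)
  moreover have "open ((\<lambda>s. p + s *\<^sub>R v) -` U)" by (intro open_vimage U) (auto intro!: continuous_intros)
  ultimately have "isCont (\<lambda>s. D2 (p + s *\<^sub>R v)) 0" using U by (auto simp: continuous_on_eq_continuous_at)
  then have "\<exists>d>0. \<forall>s. dist s 0 < d \<longrightarrow> dist (D2 (p + s *\<^sub>R v)) (D2 (p + 0 *\<^sub>R v)) < 1"
    unfolding continuous_at_eps_delta using zero_less_one by blast
  then obtain d where d: "d > 0" "\<And>s. \<bar>s\<bar> < d \<Longrightarrow> \<bar>D2 (p + s *\<^sub>R v) - D2 p\<bar> < 1"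
    by (auto simp: dist_real_def)
  have "0 \<in> (\<lambda>s. p + s *\<^sub>R v) -` U" using U by simp
  then obtain d' where d': "d' > 0" "ball 0 d' \<subseteq> (\<lambda>s. p + s *\<^sub>R v) -` U"
    using \<open>open ((\<lambda>s. p + s *\<^sub>R v) -` U)\<close> open_contains_ball by blast
  show ?thesis
  proof (rule exI[of _ "\<bar>D2 p\<bar> + 1"], rule exI[of _ "min d d'"], intro conjI allI impI)
    fix r assume r: "0 < r \<and> r < min d d'"
    have "p + s *\<^sub>R v \<in> U" if "\<bar>s\<bar> \<le> r" for s using that r d'(2) by (auto simp: subset_iff)
    from Ck2_second_difference[OF f this, of r] r obtain s t where st: "\<bar>s\<bar> \<le> r" "\<bar>t\<bar> \<le> r"
      "f (p + r *\<^sub>R v) + f (p - r *\<^sub>R v) - 2 * f p = r\<^sup>2 / 2 * (D2 (p + s *\<^sub>R v) + D2 (p + t *\<^sub>R v))"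
      unfolding D2_def by blast
    have "\<bar>D2 (p + s *\<^sub>R v) + D2 (p + t *\<^sub>R v)\<bar> \<le> 2 * (\<bar>D2 p\<bar> + 1)"
    proof -
      have "\<bar>D2 (p + s *\<^sub>R v) - D2 p\<bar> < 1" "\<bar>D2 (p + t *\<^sub>R v) - D2 p\<bar> < 1"
        using st r by (intro d(2), simp)+
      then show ?thesis by (smt (verit))
    qed
    then have "r\<^sup>2 / 2 * \<bar>D2 (p + s *\<^sub>R v) + D2 (p + t *\<^sub>R v)\<bar> \<le> r\<^sup>2 / 2 * (2 * (\<bar>D2 p\<bar> + 1))"
      by (intro mult_left_mono) auto
    then show "\<bar>f (p + r *\<^sub>R v) + f (p - r *\<^sub>R v) - 2 * f p\<bar> \<le> (\<bar>D2 p\<bar> + 1) * r\<^sup>2"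
      unfolding st(3) abs_mult by (simp add: algebra_simps)
  qed (use d d' in auto)
qed

text \<open>Up to a constant the map is the gradient of \<open>cmod z powr (\<beta> + 1)\<close>.
  For \<open>cmod w \<le> cmod z\<close> and \<open>d = cmod (z - w)\<close>, the difference splits
  into \<open>cmod z powr (\<beta> - 1)\<close> times \<open>z - w\<close> and a multiple of
  \<open>w\<close>. Each part is at most \<open>cmod z powr (\<beta> - 1) * d\<close>, which is at
  most \<open>2 * d powr \<beta>\<close> because \<open>d \<le> 2 * cmod z\<close>.\<close>

lemma powr_vector_holder:
  fixes z w :: complex
  assumes \<beta>: "0 < \<beta>" "\<beta> \<le> 1"
  shows "cmod (of_real (cmod z powr (\<beta> - 1)) * z - of_real (cmod w powr (\<beta> - 1)) * w) \<le> 4 * cmod (z - w) powr \<beta>"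
proof -
  have main: "cmod (of_real (cmod z powr (\<beta> - 1)) * z - of_real (cmod w powr (\<beta> - 1)) * w) \<le> 4 * cmod (z - w) powr \<beta>"
    if le: "cmod w \<le> cmod z" for z w :: complex
  proof (cases "z = w \<or> z = 0")
    case False
    define d where "d = cmod (z - w)"
    have d: "0 < d" "d \<le> 2 * cmod z" using False le norm_triangle_ineq4[of z w] by (auto simp: d_def)
    have z: "cmod z > 0" using False by simp
    have half: "cmod z powr (\<beta> - 1) * d \<le> 2 * d powr \<beta>"
    proof -
      have "cmod z powr (\<beta> - 1) \<le> (d / 2) powr (\<beta> - 1)"
        using d \<beta> by (intro powr_mono2') auto
      also have "\<dots> = d powr (\<beta> - 1) * 2 powr (1 - \<beta>)"
      proof -
        have "2 powr (\<beta> - 1) = inverse (2 powr (1 - \<beta>))" using powr_minus[of 2 "1 - \<beta>"] by simp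
        moreover have "(d / 2) powr (\<beta> - 1) = d powr (\<beta> - 1) / 2 powr (\<beta> - 1)" by (rule powr_divide; use d in simp)
        ultimately show ?thesis by (simp only: divide_inverse inverse_inverse_eq)
      qed
      also have "\<dots> \<le> d powr (\<beta> - 1) * 2 powr 1" using \<beta> by (intro mult_left_mono powr_mono) auto
      finally have "cmod z powr (\<beta> - 1) * d \<le> d powr (\<beta> - 1) * 2 powr 1 * d" using d by (intro mult_right_mono) auto
      also have "\<dots> = 2 * (d powr (\<beta> - 1) * d powr 1)" using d by simp
      also have "d powr (\<beta> - 1) * d powr 1 = d powr \<beta>" unfolding powr_add[symmetric] by simp
      finally show ?thesis .
    qed
    have wz: "cmod w * (cmod w powr (\<beta> - 1) - cmod z powr (\<beta> - 1)) \<le> cmod z powr (\<beta> - 1) * d"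
    proof (cases "w = 0")
      case False
      have "cmod w * cmod w powr (\<beta> - 1) = cmod w powr \<beta>" "cmod z * cmod z powr (\<beta> - 1) = cmod z powr \<beta>"
        using False z powr_add[of "cmod w" 1 "\<beta> - 1"] powr_add[of "cmod z" 1 "\<beta> - 1"] by simp_all
      moreover have "cmod w powr \<beta> \<le> cmod z powr \<beta>" using le \<beta> by (intro powr_mono2) auto
      ultimately have "cmod w * (cmod w powr (\<beta> - 1) - cmod z powr (\<beta> - 1)) \<le> cmod z powr (\<beta> - 1) * (cmod z - cmod w)"
        by (simp add: algebra_simps)
      also have "\<dots> \<le> cmod z powr (\<beta> - 1) * d" unfolding d_def by (intro mult_left_mono norm_triangle_ineq2) auto
      finally show ?thesis .
    qed (use z d in simp)
    have mono: "w = 0 \<or> cmod z powr (\<beta> - 1) \<le> cmod w powr (\<beta> - 1)"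
      using le \<beta> z by (cases "w = 0") (auto intro!: powr_mono2')
    have "of_real (cmod z powr (\<beta> - 1)) * z - of_real (cmod w powr (\<beta> - 1)) * w
      = of_real (cmod z powr (\<beta> - 1)) * (z - w) - of_real (cmod w powr (\<beta> - 1) - cmod z powr (\<beta> - 1)) * w"
      by (simp add: algebra_simps)
    then have "cmod (of_real (cmod z powr (\<beta> - 1)) * z - of_real (cmod w powr (\<beta> - 1)) * w)
      \<le> cmod z powr (\<beta> - 1) * d + \<bar>cmod w powr (\<beta> - 1) - cmod z powr (\<beta> - 1)\<bar> * cmod w"
      using norm_triangle_ineq4[of "of_real (cmod z powr (\<beta> - 1)) * (z - w)" "of_real (cmod w powr (\<beta> - 1) - cmod z powr (\<beta> - 1)) * w"]
      unfolding norm_mult norm_of_real d_def by simp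
    also have "\<bar>cmod w powr (\<beta> - 1) - cmod z powr (\<beta> - 1)\<bar> * cmod w = cmod w * (cmod w powr (\<beta> - 1) - cmod z powr (\<beta> - 1))"
      using mono by auto
    finally show ?thesis using half wz by (simp add: d_def)
  next
    case True
    then show ?thesis using le by auto
  qed
  show ?thesis
  proof (cases "cmod w \<le> cmod z")
    case False
    then show ?thesis using main[of z w] by (simp add: norm_minus_commute)
  qed (rule main)
qed

lemma cmod_powr_has_derivative:
  assumes "1 < q"
  shows "((\<lambda>w::complex. cmod w powr q) has_derivative (\<lambda>h. q * Re (cnj (of_real (cmod w powr (q - 2)) * w) * h))) (at w)"
proof (cases "w = 0")
  case False
  have "((\<lambda>w::complex. (w \<bullet> w) powr (q/2)) has_derivative (\<lambda>h. (w \<bullet> w) powr (q/2) * (0 * ln (w \<bullet> w) + (w \<bullet> h + h \<bullet> w) * (q/2) / (w \<bullet> w)))) (at w)"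
    using False by (intro has_derivative_powr) (auto intro!: derivative_eq_intros)
  moreover have "(w \<bullet> w) powr (q/2) = cmod w powr q" for w :: complex
    by (simp add: power2_norm_eq_inner[symmetric] powr_powr flip: powr_numeral)
  moreover have "cmod w powr q * (0 * ln (w \<bullet> w) + (w \<bullet> h + h \<bullet> w) * (q/2) / (w \<bullet> w)) = q * Re (cnj (of_real (cmod w powr (q - 2)) * w) * h)" for h
  proof -
    have "cmod w powr (q - 2) = cmod w powr q / (w \<bullet> w)" using False by (simp add: powr_diff power2_norm_eq_inner)
    moreover have "Re (cnj w * h) = w \<bullet> h" by (simp add: inner_complex_def)
    ultimately show ?thesis by (simp add: inner_commute mult.assoc)
  qed
  ultimately show ?thesis by simp
next
  \<comment> \<open>The formula for the derivative gives 0 here because of its factor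
    \<open>w\<close>; the actual derivative vanishes because \<open>q > 1\<close>.\<close>
  case True
  have "((\<lambda>w::complex. cmod w powr q) has_derivative (\<lambda>h. 0)) (at 0)"
    unfolding has_derivative_at
  proof (intro conjI)
    have "((\<lambda>h. cmod h powr (q - 1)) \<longlongrightarrow> 0) (at (0::complex))"
      using assms by (auto intro!: tendsto_eq_intros tendsto_powr' always_eventually)
    moreover have "\<forall>\<^sub>F h in at (0::complex). cmod h powr (q - 1) = norm (cmod (0 + h) powr q - cmod 0 powr q - 0) / norm h"
      by (auto simp: eventually_at_filter powr_diff intro!: always_eventually)
    ultimately show "((\<lambda>h. norm (cmod (0 + h) powr q - cmod 0 powr q - 0) / norm h) \<longlongrightarrow> 0) (at (0::complex))"
      by (rule Lim_transform_eventually)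
  qed simp
  then show ?thesis using True by simp
qed

section \<open>Regularity of the metric, on and off the set \<open>z$a = 0\<close>\<close>

context egg_dom
begin

lemma C1_holder_at_cmod_powr:
  assumes m: "1/2 < m"
  shows "C1_holder_at (2*m - 1) x0 (\<lambda>z::complex^'n. of_real (cmod (z$a) powr (2*m)))"
proof (rule C1_holder_atI[of 1 "8 * m" _ _ "\<lambda>x v. of_real (2*m * Re (cnj (of_real (cmod (x$a) powr (2*m - 2)) * x$a) * v$a))"])
  fix x :: "complex^'n"
  have "((\<lambda>z::complex^'n. cmod (z$a) powr (2*m)) has_derivative (\<lambda>v. 2*m * Re (cnj (of_real (cmod (x$a) powr (2*m - 2)) * x$a) * v$a))) (at x)"
    by (rule has_derivative_compose[OF bounded_linear_imp_has_derivative[OF bounded_linear_vec_nth] cmod_powr_has_derivative]) (use m in simp)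
  then show "((\<lambda>z::complex^'n. complex_of_real (cmod (z$a) powr (2*m))) has_derivative (\<lambda>v. of_real (2*m * Re (cnj (of_real (cmod (x$a) powr (2*m - 2)) * x$a) * v$a)))) (at x)"
    by (rule has_derivative_of_real)
  fix y v :: "complex^'n"
  let ?G = "\<lambda>w. of_real (cmod w powr (2*m - 2)) * w"
  have "cmod (of_real (2*m * Re (cnj (?G (x$a)) * v$a)) - of_real (2*m * Re (cnj (?G (y$a)) * v$a)))
     = 2*m * \<bar>Re (cnj (?G (x$a) - ?G (y$a)) * v$a)\<bar>"
    unfolding of_real_diff[symmetric] norm_of_real right_diff_distrib[symmetric] abs_mult
    by (simp add: algebra_simps)
  also have "\<dots> \<le> 2*m * (cmod (?G (x$a) - ?G (y$a)) * cmod (v$a))"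
  proof -
    have "\<bar>Re (cnj X * w)\<bar> \<le> cmod X * cmod w" for X w by (metis abs_Re_le_cmod norm_mult complex_mod_cnj)
    then show ?thesis using m by (intro mult_left_mono) (assumption, linarith)
  qed
  also have "\<dots> \<le> 2*m * ((4 * dist x y powr (2*m - 1)) * norm v)"
  proof -
    have "cmod (?G (x$a) - ?G (y$a)) \<le> 4 * cmod (x$a - y$a) powr (2*m - 1)"
      using powr_vector_holder[of "2*m - 1" "x$a" "y$a"] m m_lt by simp
    also have "\<dots> \<le> 4 * dist x y powr (2*m - 1)"
    proof -
      have "cmod (x$a - y$a) \<le> dist x y" unfolding dist_norm vector_minus_component[symmetric] by (rule Finite_Cartesian_Product.norm_nth_le)
      moreover have "0 \<le> 2*m - 1" using m by simp
      ultimately show ?thesis by (intro mult_left_mono powr_mono2) auto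
    qed
    finally have "cmod (?G (x$a) - ?G (y$a)) \<le> 4 * dist x y powr (2*m - 1)" .
    moreover have "cmod (v$a) \<le> norm v" by (rule Finite_Cartesian_Product.norm_nth_le)
    ultimately show ?thesis by (intro mult_left_mono mult_mono) auto
  qed
  finally show "cmod (of_real (2*m * Re (cnj (?G (x$a)) * v$a)) - of_real (2*m * Re (cnj (?G (y$a)) * v$a)))
     \<le> 8 * m * norm v * dist x y powr (2*m - 1)" by (simp add: algebra_simps)
qed auto

lemma wu_metric_hermitian: "hermitian_metric_on (wu_metric (egg a m)) (egg a m)"
  by (simp add: hermitian_metric_on_def wu_metric_egg)

lemma wu_metric_continuous: "metric_continuous_on (wu_metric (egg a m)) (egg a m)"
  unfolding metric_continuous_on_def
proof (intro allI)
  fix i j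
  have "isCont (\<lambda>z. wuH z $ i $ j) x" if "x \<in> egg a m" for x
    by (rule wuH_regular[OF regularity_isCont that]) (unfold isCont_def, intro tendsto_intros tendsto_powr', auto)
  then have "continuous_on (egg a m) (\<lambda>z. wuH z $ i $ j)" by (simp add: continuous_at_imp_continuous_on)
  then show "continuous_on (egg a m) (\<lambda>z. wu_metric (egg a m) z $ i $ j)"
    by (rule continuous_on_cong[THEN iffD1, rotated 2]) (simp_all add: wu_metric_egg)
qed

lemma wu_metric_analytic: "metric_real_analytic_on (wu_metric (egg a m)) (egg a m - egg_Z a m)"
  unfolding metric_real_analytic_on_def
proof (intro allI)
  fix i j
  have op: "open (egg a m - egg_Z a m)"
  proof -
    have "egg a m - egg_Z a m = egg a m \<inter> {z. z $ a \<noteq> 0}" by (auto simp: egg_Z_def)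
    moreover have "open {z::complex^'n. z $ a \<noteq> 0}" by (intro open_Collect_neq continuous_intros)
    ultimately show ?thesis using open_egg by auto
  qed
  have "analytic_at_pt x (\<lambda>z. wuH z $ i $ j)" if x: "x \<in> egg a m - egg_Z a m" for x
  proof -
    interpret regularity_class "analytic_at_pt x" x by (rule regularity_analytic)
    have "\<forall>\<^sub>F z in nhds x. z \<in> egg a m - egg_Z a m" using x op by (intro eventually_nhds_in_open)
    then have "\<forall>\<^sub>F z in nhds x. (cmod (z$a))\<^sup>2 > 0" by eventually_elim (auto simp: egg_Z_def)
    moreover have "analytic_at_pt x (\<lambda>z. of_real ((cmod (z$a))\<^sup>2))"
      using mult[OF coord[of a] cnj_coord[of a]] by (simp add: cmod_sq_cnj)
    ultimately have "analytic_at_pt x (\<lambda>z. of_real ((cmod (z$a))\<^sup>2 powr m))" by (rule powr[rotated])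
    then have "analytic_at_pt x (\<lambda>z. of_real (cmod (z$a) powr (2*m)))" unfolding cmod_sq_powr .
    then show ?thesis using x by (intro wuH_regular[OF regularity_analytic]) auto
  qed
  then have "real_analytic_on (\<lambda>z. wuH z $ i $ j) (egg a m - egg_Z a m)" by (rule analytic_at_pt_imp_real_analytic_on)
  then show "real_analytic_on (\<lambda>z. wu_metric (egg a m) z $ i $ j) (egg a m - egg_Z a m)"
    by (rule real_analytic_on_cong[OF op, rotated]) (simp add: wu_metric_egg)
qed

lemma wu_metric_holder:
  assumes m: "1/2 < m" and p: "p \<in> egg a m"
  shows "\<exists>U. open U \<and> p \<in> U \<and> U \<subseteq> egg a m \<and> metric_C1_holder_on (2*m - 1) (wu_metric (egg a m)) U"
proof -
  have \<alpha>: "0 < 2*m - 1" "2*m - 1 \<le> 1" using m m_lt by auto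
  have "\<exists>U. open U \<and> p \<in> U \<and> U \<subseteq> egg a m \<and> (\<forall>U'\<subseteq>U. C1_holder_on (2*m - 1) (\<lambda>z. wuH z $ i $ j) U')" for i j
  proof -
    have "C1_holder_at (2*m - 1) p (\<lambda>z. wuH z $ i $ j)"
      by (rule wuH_regular[OF regularity_C1_holder[OF \<alpha>] p C1_holder_at_cmod_powr[OF m]])
    from C1_holder_at_imp_on[OF this \<alpha> open_egg p] show ?thesis by metis
  qed
  then obtain U where U: "\<And>i j. open (U i j)" "\<And>i j. p \<in> U i j" "\<And>i j. U i j \<subseteq> egg a m"
    "\<And>i j U'. U' \<subseteq> U i j \<Longrightarrow> C1_holder_on (2*m - 1) (\<lambda>z. wuH z $ i $ j) U'" by metis
  define V where "V = (\<Inter>i. \<Inter>j. U i j)"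
  have V: "open V" "p \<in> V" "V \<subseteq> egg a m" "\<And>i j. V \<subseteq> U i j"
  proof -
    show V4: "V \<subseteq> U i j" for i j by (auto simp: V_def)
    show "V \<subseteq> egg a m" using V4[of undefined undefined] U(3)[of undefined undefined] by blast
  qed (use U(1,2) in \<open>auto simp: V_def intro!: open_INT\<close>)
  have "C1_holder_on (2*m - 1) (\<lambda>z. wu_metric (egg a m) z $ i $ j) V" for i j
    by (subst C1_holder_on_cong[OF V(1), of _ "\<lambda>z. wuH z $ i $ j"]) (use V U(4) in \<open>auto simp: wu_metric_egg subset_iff\<close>)
  then show ?thesis using V unfolding metric_C1_holder_on_def by blast
qed

lemma wu_metric_C1:
  assumes m: "1/2 < m" shows "metric_Ck_on 1 (wu_metric (egg a m)) (egg a m)"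
  unfolding metric_Ck_on_def
proof (intro allI Ck1_local open_egg)
  fix i j p assume "p \<in> egg a m"
  from wu_metric_holder[OF m this] show "\<exists>V. open V \<and> p \<in> V \<and> Ck_on 1 (\<lambda>z. wu_metric (egg a m) z $ i $ j) V"
    unfolding metric_C1_holder_on_def C1_holder_on_def by blast
qed

lemma Re_wuH_diag:
  assumes "b \<noteq> a"
  shows "Re (wuH z $ b $ b) = PP z * ((cmod (z$a))\<^sup>2 * (cmod (z$b))\<^sup>2 / (m * sg z)\<^sup>2) + QQ z * (1 + (cmod (z$b))\<^sup>2 / sg z)"
proof -
  have e1: "ell z b * cnj (ell z b) = of_real ((cmod (z$a))\<^sup>2 * (cmod (z$b))\<^sup>2 / (m * sg z)\<^sup>2)"
  proof -
    have "(cmod (ell z b))\<^sup>2 = (cmod (z$a))\<^sup>2 * (cmod (z$b))\<^sup>2 / (m * sg z)\<^sup>2"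
      using assms by (simp add: ell_def norm_divide norm_mult power_mult_distrib power_divide)
    then show ?thesis by (metis complex_norm_square)
  qed
  have "wuH z $ b $ b = of_real (PP z) * (ell z b * cnj (ell z b)) + of_real (QQ z) * (1 + z$b * cnj (z$b) / of_real (sg z))"
    using assms by (simp add: wuH_def mult.commute mult.left_commute)
  also have "\<dots> = of_real (PP z * ((cmod (z$a))\<^sup>2 * (cmod (z$b))\<^sup>2 / (m * sg z)\<^sup>2) + QQ z * (1 + (cmod (z$b))\<^sup>2 / sg z))"
    unfolding e1 by (simp add: cmod_sq_cnj)
  finally show ?thesis by (simp only: Re_complex_of_real)
qed

text \<open>Moving \<open>p\<close> parallel to the axis leaves \<open>sg\<close> unchanged. The
  entry \<open>(b, b)\<close> then grows at least like \<open>\<bar>s\<bar> powr (2*m)\<close>: this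
  is the growth of \<open>QQ\<close>, while the summand with \<open>PP\<close> is nonnegative and
  vanishes at \<open>p\<close>. Since \<open>2*m < 2\<close>, the quadratic bound for second
  differences fails.\<close>

lemma wu_metric_not_C2:
  assumes b: "b \<noteq> a" and p: "p \<in> egg_Z a m" and U: "open U" "p \<in> U" "U \<subseteq> egg a m"
  shows "\<not> metric_Ck_on 2 (wu_metric (egg a m)) U"
proof
  assume "metric_Ck_on 2 (wu_metric (egg a m)) U"
  then have "Ck_on 2 (\<lambda>z. wu_metric (egg a m) z $ b $ b) U" by (simp add: metric_Ck_on_def)
  then have "Ck_on 2 (\<lambda>z. wuH z $ b $ b) U"
    by (rule Ck_on_cong[OF U(1), THEN iffD1, rotated]) (use U(3) in \<open>auto simp: wu_metric_egg\<close>)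
  then have C2: "Ck_on 2 (\<lambda>z. Re (wuH z $ b $ b)) U" by (rule Ck_on_Re[OF U(1)])
  define f where "f z = Re (wuH z $ b $ b)" for z
  have pe: "p \<in> egg a m" and pa: "p $ a = 0" using p by (auto simp: egg_Z_def)
  define e :: "complex^'n" where "e = axis a 1"
  obtain C d where d: "d > 0" and C: "\<And>r. 0 < r \<Longrightarrow> r < d \<Longrightarrow> \<bar>f (p + r *\<^sub>R e) + f (p - r *\<^sub>R e) - 2 * f p\<bar> \<le> C * r\<^sup>2"
    using Ck2_second_difference_bound[OF C2 U(1,2), of e] unfolding f_def by blast
  obtain d' where d': "d' > 0" "ball p d' \<subseteq> U" using U open_contains_ball by blast
  have step: "f (p + s *\<^sub>R e) - f p \<ge> \<bar>s\<bar> powr (2*m)" if s: "\<bar>s\<bar> < d'" for s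
  proof -
    define z where "z = p + s *\<^sub>R e"
    have zb: "z $ j = p $ j" if "j \<noteq> a" for j using that by (simp add: z_def e_def axis_def)
    have za: "z $ a = of_real s" using pa by (simp add: z_def e_def axis_def of_real_def)
    have sgz: "sg z = sg p" unfolding sg_def using nsq_cong[of a z p] zb by simp
    have "z \<in> ball p d'" using s by (simp add: z_def e_def dist_norm norm_axis_1)
    then have ze: "z \<in> egg a m" using d' U by blast
    have s0: "sg p > 0" "sg p \<le> 1" using egg_sg[OF pe] sg_le1 by auto
    define u where "u = \<bar>s\<bar> powr (2*m)"
    have u: "0 \<le> u" "u < sg p" using ze by (auto simp: u_def egg_iff za sgz)
    have "QQ z - QQ p = 1 / (sg p - u) - 1 / sg p" using pa by (simp add: QQ_def za sgz u_def)
    also have "\<dots> = u / (sg p * (sg p - u))" using u s0 by (simp add: field_simps)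
    also have "\<dots> \<ge> u / 1"
      using u s0 mult_le_one[of "sg p" "sg p - u"] by (intro divide_left_mono) auto
    finally have Q: "QQ z - QQ p \<ge> u" by simp
    have "PP z \<ge> 0" using AA_pos[of z] s0 sgz by (simp add: PP_def)
    then have "f z \<ge> QQ z * (1 + (cmod (p$b))\<^sup>2 / sg p)"
      unfolding f_def Re_wuH_diag[OF b] zb[OF b] sgz by simp
    moreover have "f p = QQ p * (1 + (cmod (p$b))\<^sup>2 / sg p)"
      unfolding f_def Re_wuH_diag[OF b] by (simp add: pa)
    ultimately have "f z - f p \<ge> (QQ z - QQ p) * (1 + (cmod (p$b))\<^sup>2 / sg p)" by (simp add: left_diff_distrib)
    moreover have "(QQ z - QQ p) * (1 + (cmod (p$b))\<^sup>2 / sg p) \<ge> u * 1"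
      using Q u s0 by (intro mult_mono) auto
    ultimately show ?thesis by (simp add: z_def u_def)
  qed
  define q where "q = 2 - 2*m"
  have q: "q > 0" using m_lt by (simp add: q_def)
  \<comment> \<open>Small enough that \<open>C * r powr q\<close> is at most 1, whereas the lower
    bound for the second difference would require it to be at least 2.\<close>
  define r where "r = min (min d d' / 2) ((1 / (\<bar>C\<bar> + 1)) powr (1/q))"
  have r: "0 < r" "r < d" "r < d'" using d d' by (auto simp: r_def)
  have "f (p + r *\<^sub>R e) + f (p - r *\<^sub>R e) - 2 * f p \<ge> 2 * r powr (2*m)"
    using step[of r] step[of "-r"] r by simp
  then have "2 * r powr (2*m) \<le> C * r\<^sup>2" using C[of r] r by linarith
  moreover have "r\<^sup>2 = r powr (2*m) * r powr q" using r by (simp add: q_def flip: powr_add)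
  ultimately have "2 * r powr (2*m) \<le> (C * r powr q) * r powr (2*m)" by (simp add: mult_ac)
  then have "2 \<le> C * r powr q" using r by simp
  moreover have "r powr q \<le> 1 / (\<bar>C\<bar> + 1)"
  proof -
    have "r powr q \<le> ((1 / (\<bar>C\<bar> + 1)) powr (1/q)) powr q" using r q by (intro powr_mono2) (auto simp: r_def)
    then show ?thesis using q by (simp add: powr_powr)
  qed
  then have "C * r powr q \<le> \<bar>C\<bar> * (1 / (\<bar>C\<bar> + 1))" by (intro mult_mono) auto
  moreover have "\<bar>C\<bar> * (1 / (\<bar>C\<bar> + 1)) \<le> 1" by simp
  ultimately show False by linarith
qed

end

section \<open>Regularity of the boundary\<close>

context egg_dom
begin

definition rho :: "complex^'n \<Rightarrow> real" where "rho z = cmod (z$a) powr (2*m) + nq z - 1"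

lemma egg_rho: "z \<in> egg a m \<longleftrightarrow> rho z < 0"
  by (simp add: egg_iff sg_def rho_def algebra_simps)

lemma continuous_rho: "continuous_on A rho"
  unfolding rho_def nsq_def by (intro continuous_intros continuous_on_powr') auto

text \<open>A point with \<open>rho z = 0\<close> is the limit of its multiples by
  \<open>s < 1\<close>, which lie in the egg: as \<open>2*m \<ge> 1\<close>, both variable terms of
  \<open>rho\<close> shrink at least by the factor \<open>s\<close>.\<close>

lemma frontier_egg: "frontier (egg a m) = {z. rho z = 0}"
proof -
  have "closure (egg a m) \<subseteq> {z. rho z \<le> 0}"
    by (rule closure_minimal) (auto simp: egg_rho intro!: closed_Collect_le continuous_rho continuous_intros)
  moreover have "z \<in> closure (egg a m)" if z: "rho z = 0" for z
    unfolding closure_approachable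
  proof (intro allI impI)
    fix e :: real assume e: "e > 0"
    define s where "s = 1 - min (1/2) (e / (2 * (norm z + 1)))"
    have nz: "norm z + 1 > 0" by (smt (verit) norm_ge_zero)
    have s: "0 < s" "s < 1" "1 - s \<le> e / (2 * (norm z + 1))" using e nz by (auto simp: s_def)
    have "cmod ((s *\<^sub>R z)$a) powr (2*m) = s powr (2*m) * cmod (z$a) powr (2*m)" using s by (simp add: powr_mult)
    also have "\<dots> \<le> s * cmod (z$a) powr (2*m)"
      using s m_ge powr_mono'[of 1 "2*m" s] by (intro mult_right_mono) auto
    finally have 1: "cmod ((s *\<^sub>R z)$a) powr (2*m) \<le> s * cmod (z$a) powr (2*m)" .
    have "nq (s *\<^sub>R z) = s\<^sup>2 * nq z" using s by (simp add: nsq_def sum_distrib_left power_mult_distrib)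
    also have "\<dots> \<le> s * nq z" using s by (intro mult_right_mono) (auto simp: power2_eq_square mult_le_cancel_left1)
    finally have "rho (s *\<^sub>R z) \<le> s * (cmod (z$a) powr (2*m) + nq z) - 1" using 1 by (simp add: rho_def algebra_simps)
    also have "\<dots> < 0" using z s by (simp add: rho_def)
    finally have "s *\<^sub>R z \<in> egg a m" by (simp add: egg_rho)
    moreover have "dist (s *\<^sub>R z) z < e"
    proof -
      have "s *\<^sub>R z - z = (-(1 - s)) *\<^sub>R z" by (simp add: algebra_simps)
      then have "dist (s *\<^sub>R z) z = (1 - s) * norm z" using s by (simp add: dist_norm)
      also have "\<dots> \<le> e / (2 * (norm z + 1)) * norm z" using s by (intro mult_right_mono) auto
      also have "\<dots> < e"
      proof -
        have "e * norm z < e * (2 * (norm z + 1))" using e by (intro mult_strict_left_mono) (auto, smt (verit) norm_ge_zero)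
        then show ?thesis using nz by (simp add: divide_less_eq)
      qed
      finally show ?thesis .
    qed
    ultimately show "\<exists>y\<in>egg a m. dist y z < e" by blast
  qed
  ultimately show ?thesis unfolding frontier_def interior_open[OF open_egg]
    by (auto simp: egg_rho)
qed

lemma egg_C1_boundary:
  assumes m: "1/2 < m" shows "has_Ck_boundary 1 (egg a m)"
proof -
  have \<alpha>: "0 < 2*m - 1" "2*m - 1 \<le> 1" using m m_lt by auto
  have C1: "Ck_on 1 rho UNIV"
  proof (rule Ck1_local)
    fix p :: "complex^'n"
    interpret regularity_class "C1_holder_at (2*m - 1) p" p by (rule regularity_C1_holder[OF \<alpha>])
    have "C1_holder_at (2*m - 1) p (\<lambda>z. of_real (cmod (z$a) powr (2*m)) + (\<Sum>j\<in>UNIV-{a}. z$j * cnj (z$j)) + (-1))"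
      by (intro add sum mult const coord cnj_coord C1_holder_at_cmod_powr m) auto
    then obtain U where U: "open U" "p \<in> U"
      "C1_holder_on (2*m - 1) (\<lambda>z. of_real (cmod (z$a) powr (2*m)) + (\<Sum>j\<in>UNIV-{a}. z$j * cnj (z$j)) + (-1)) U"
      by (rule C1_holder_at_imp_on[OF _ \<alpha> open_UNIV UNIV_I]) (rule that; assumption)
    then have U3: "Ck_on 1 (\<lambda>z. of_real (cmod (z$a) powr (2*m)) + (\<Sum>j\<in>UNIV-{a}. z$j * cnj (z$j)) + (-1)) U"
      by (simp only: C1_holder_on_def)
    have "(\<lambda>z. Re (of_real (cmod (z$a) powr (2*m)) + (\<Sum>j\<in>UNIV-{a}. z$j * cnj (z$j)) + (-1))) = rho"
    proof (rule ext)
      fix z :: "complex^'n"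
      have "Re (w * cnj w) = (cmod w)\<^sup>2" for w by (metis Re_complex_of_real complex_norm_square)
      then show "Re (of_real (cmod (z$a) powr (2*m)) + (\<Sum>j\<in>UNIV-{a}. z$j * cnj (z$j)) + (-1)) = rho z"
        unfolding rho_def nsq_def plus_complex.sel Re_sum by simp
    qed
    with Ck_on_Re[OF U(1) U3] U(1,2) show "\<exists>V. open V \<and> p \<in> V \<and> Ck_on 1 rho V" by auto
  qed simp
  show ?thesis unfolding has_Ck_boundary_def
  proof (intro ballI exI[of _ UNIV] exI[of _ rho] conjI)
    fix z assume "z \<in> frontier (egg a m) \<inter> UNIV"
    then have z: "rho z = 0" by (simp add: frontier_egg)
    let ?D = "\<lambda>v. 2*m * Re (cnj (of_real (cmod (z$a) powr (2*m - 2)) * z$a) * v$a) + (\<Sum>j\<in>UNIV-{a}. 2 * (z$j \<bullet> v$j))"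
    have D1: "((\<lambda>z::complex^'n. cmod (z$a) powr (2*m)) has_derivative (\<lambda>v. 2*m * Re (cnj (of_real (cmod (z$a) powr (2*m - 2)) * z$a) * v$a))) (at z)"
      by (rule has_derivative_compose[OF bounded_linear_imp_has_derivative[OF bounded_linear_vec_nth] cmod_powr_has_derivative]) (use m in simp)
    have D2: "((\<lambda>z::complex^'n. \<Sum>j\<in>UNIV-{a}. (cmod (z$j))\<^sup>2) has_derivative (\<lambda>v. \<Sum>j\<in>UNIV-{a}. 2 * (z$j \<bullet> v$j))) (at z)"
      unfolding power2_norm_eq_inner
      by (intro has_derivative_sum has_derivative_eq_rhs[OF has_derivative_inner[OF bounded_linear_imp_has_derivative[OF bounded_linear_vec_nth]
            bounded_linear_imp_has_derivative[OF bounded_linear_vec_nth]]]) (auto simp: inner_commute)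
    have "(rho has_derivative (\<lambda>v. ?D v - 0)) (at z)"
      unfolding rho_def[abs_def] nsq_def by (intro has_derivative_diff has_derivative_add D1 D2 has_derivative_const)
    then have fr: "frechet_derivative rho (at z) = (\<lambda>v. ?D v)" using frechet_derivative_at by fastforce
    have 1: "Re (cnj (of_real (cmod (z$a) powr (2*m - 2)) * z$a) * z$a) = cmod (z$a) powr (2*m)"
    proof (cases "z$a = 0")
      case False
      have "cnj (z$a) * z$a = of_real ((cmod (z$a))\<^sup>2)" by (simp add: cmod_sq_cnj mult.commute)
      then have "cnj (of_real (cmod (z$a) powr (2*m - 2)) * z$a) * z$a = of_real (cmod (z$a) powr (2*m - 2) * (cmod (z$a))\<^sup>2)"
        by (simp add: mult.assoc)
      moreover have "cmod (z$a) powr (2*m - 2) * (cmod (z$a))\<^sup>2 = cmod (z$a) powr (2*m)"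
        using False by (simp flip: powr_numeral powr_add)
      ultimately show ?thesis by simp
    qed simp
    \<comment> \<open>The radial direction is transversal to the boundary: Euler's relation for the
      two homogeneous terms makes the derivative positive there.\<close>
    have "?D z = 2 * m * cmod (z$a) powr (2*m) + 2 * nq z"
      unfolding 1 by (simp add: nsq_def power2_norm_eq_inner sum_distrib_left)
    moreover have "cmod (z$a) powr (2*m) + nq z = 1" using z by (simp add: rho_def)
    moreover have "2 * m * cmod (z$a) powr (2*m) \<ge> 1 * cmod (z$a) powr (2*m)" using m by (intro mult_right_mono) auto
    ultimately have "?D z > 0" using nsq_nonneg[of a z] powr_ge_zero[of "cmod (z$a)" "2*m"] by linarith
    then show "\<exists>v. frechet_derivative rho (at z) v \<noteq> 0" unfolding fr by (intro exI[of _ z]) simp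
  qed (use C1 in \<open>auto simp: egg_rho frontier_egg\<close>)
qed

text \<open>The defining function is arbitrary, so only its sign may be used. Near
  \<open>p = axis b 1\<close> the boundary recedes like \<open>x powr (2*m)\<close> in the direction
  of \<open>ea\<close>, so even the point \<open>k * x\<^sup>2\<close> further inside is still
  outside the egg for small \<open>x\<close>. As \<open>r\<close> grows along \<open>eb\<close> with
  slope near \<open>g > 0\<close>, both values at \<open>p + x *\<^sub>R ea\<close> and
  \<open>p - x *\<^sub>R ea\<close> are at least \<open>k * x\<^sup>2 * g / 2\<close>. A large
  \<open>k\<close> contradicts the bound for second differences.\<close>

lemma egg_not_C2_boundary:
  assumes m: "1/2 < m" and b: "b \<noteq> a" shows "\<not> has_Ck_boundary 2 (egg a m)"
proof
  assume bd: "has_Ck_boundary 2 (egg a m)"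
  define p :: "complex^'n" where "p = axis b 1"
  define ea :: "complex^'n" where "ea = axis a 1"
  define eb :: "complex^'n" where "eb = axis b 1"
  have rho_ge: "rho z \<ge> cmod (z$a) powr (2*m) + (cmod (z$b))\<^sup>2 - 1" for z
    using member_le_sum[of b "UNIV-{a}" "\<lambda>j. (cmod (z$j))\<^sup>2"] b by (simp add: rho_def nsq_def)
  have nq1: "nq z = (cmod (z$b))\<^sup>2" if "\<And>j. j \<noteq> a \<Longrightarrow> j \<noteq> b \<Longrightarrow> z$j = 0" for z
    unfolding nsq_def using b that by (subst sum.remove[of _ b]) (auto intro!: sum.neutral)
  have "rho p = 0" using b nq1[of p] by (simp add: rho_def p_def axis_def)
  then have pf: "p \<in> frontier (egg a m)" by (simp add: frontier_egg)
  obtain U and r :: "complex^'n \<Rightarrow> real" where U: "open U" "p \<in> U" and C2: "Ck_on 2 r U" and D: "egg a m \<inter> U = {x \<in> U. r x < 0}"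
    "frontier (egg a m) \<inter> U = {x \<in> U. r x = 0}" and gr: "\<forall>x\<in>frontier (egg a m) \<inter> U. \<exists>v. frechet_derivative r (at x) v \<noteq> 0"
    using bspec[OF bd[unfolded has_Ck_boundary_def] pf] by (elim exE conjE) (rule that)
  have grad: "\<exists>v. frechet_derivative r (at p) v \<noteq> 0" using bspec[OF gr, of p] pf U(2) by simp
  have rp: "r p = 0" using D(2) pf U by blast
  have rneg: "r z < 0 \<longleftrightarrow> rho z < 0" if "z \<in> U" for z
  proof -
    have "z \<in> egg a m \<inter> U \<longleftrightarrow> z \<in> {x \<in> U. r x < 0}" by (simp only: D(1))
    then show ?thesis using that by (simp add: egg_rho)
  qed
  have dr: "r differentiable (at x)" and dr2: "(\<lambda>x. frechet_derivative r (at x) v) differentiable (at x)" if "x \<in> U" for x v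
    using C2 that by (simp_all add: numeral_2_eq_2)
  define L where "L = frechet_derivative r (at p)"
  have Ld: "(r has_derivative L) (at p)" unfolding L_def using dr[OF U(2)] by (simp add: frechet_derivative_works)
  have lin: "linear L" using Ld by (rule has_derivative_linear)
  have line: "((\<lambda>s. r (p + s *\<^sub>R v)) has_real_derivative L v) (at 0)" for v
    using line_derivative[of r p 0 v] dr U by (simp add: L_def)
  obtain e0 where e0: "e0 > 0" "ball p e0 \<subseteq> U" using U open_contains_ball by blast
  have near: "p + s *\<^sub>R v \<in> U" if "\<bar>s\<bar> * norm v < e0" for s v
    using that e0 by (auto simp: subset_iff dist_norm)
  have pb: "p $ b = 1" "p $ a = 0" using b by (simp_all add: p_def axis_def)
  \<comment> \<open>To first order such a direction leaves the component \<open>b\<close> on its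
    unit circle, and the exact modulus only grows. So the line stays outside the egg and
    \<open>r\<close> has a local minimum at \<open>p\<close>.\<close>
  have tang: "L v = 0" if v: "Re (v$b) = 0" for v
  proof (rule DERIV_local_min[OF line])
    show "0 < e0 / (norm v + 1)" using e0 by (smt (verit) divide_pos_pos norm_ge_zero)
    show "\<forall>s. \<bar>0 - s\<bar> < e0 / (norm v + 1) \<longrightarrow> r (p + 0 *\<^sub>R v) \<le> r (p + s *\<^sub>R v)"
    proof (intro allI impI)
      fix s assume s: "\<bar>0 - s\<bar> < e0 / (norm v + 1)"
      have nv: "norm v + 1 > 0" by (smt (verit) norm_ge_zero)
      have "\<bar>s\<bar> * norm v \<le> \<bar>s\<bar> * (norm v + 1)" by (intro mult_left_mono) auto
      also have "\<dots> < e0" using s nv by (simp add: pos_less_divide_eq)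
      finally have U': "p + s *\<^sub>R v \<in> U" by (rule near)
      have "(cmod ((p + s *\<^sub>R v)$b))\<^sup>2 = 1 + (s * Im (v$b))\<^sup>2" by (simp add: pb cmod_power2 v)
      then have "rho (p + s *\<^sub>R v) \<ge> 0" using rho_ge[of "p + s *\<^sub>R v"] powr_ge_zero[of "cmod ((p + s *\<^sub>R v)$a)" "2*m"]
        by (smt (verit) zero_le_power2)
      then have "\<not> r (p + s *\<^sub>R v) < 0" using rneg[OF U'] by simp
      then show "r (p + 0 *\<^sub>R v) \<le> r (p + s *\<^sub>R v)" by (simp add: rp)
    qed
  qed
  define g where "g = L eb"
  have Lv: "L v = Re (v$b) * g" for v
  proof -
    have "L (v - Re (v$b) *\<^sub>R eb) = 0" by (rule tang) (simp add: eb_def axis_def)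
    then show ?thesis using linear_diff[OF lin] linear_cmul[OF lin] by (simp add: g_def)
  qed
  have "g \<noteq> 0" using grad Lv unfolding L_def[symmetric] by auto
  \<comment> \<open>With a negative slope \<open>r\<close> would be positive just inside
    \<open>p\<close>, at points of the egg.\<close>
  moreover have "\<not> g < 0"
  proof
    assume "g < 0"
    then obtain d where d: "d > 0" "\<And>h. h > 0 \<Longrightarrow> h < d \<Longrightarrow> r (p + 0 *\<^sub>R eb) < r (p + (0 - h) *\<^sub>R eb)"
      using DERIV_neg_dec_left[OF line[of eb]] unfolding g_def by blast
    define h where "h = min (d/2) (min (e0/2) (1/2))"
    have h: "0 < h" "h < d" "h < e0" "h < 1" using d e0 by (auto simp: h_def)
    have U': "p + (0 - h) *\<^sub>R eb \<in> U" by (rule near) (use h in \<open>simp add: eb_def norm_axis_1\<close>)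
    have pos: "r (p + (0 - h) *\<^sub>R eb) > 0" using d(2)[OF h(1,2)] by (simp add: rp)
    let ?z = "p + (0 - h) *\<^sub>R eb"
    have zj: "?z $ a = 0" "?z $ b = of_real (1 - h)" "\<And>j. j \<noteq> a \<Longrightarrow> j \<noteq> b \<Longrightarrow> ?z $ j = 0"
      using b by (auto simp: p_def eb_def axis_def of_real_def algebra_simps)
    have "nq ?z = (cmod (?z $ b))\<^sup>2" by (rule nq1) (rule zj(3))
    then have "nq ?z = (1 - h)\<^sup>2" unfolding zj(2) norm_of_real by simp
    moreover have "(1 - h)\<^sup>2 < 1" using h by (simp add: abs_square_less_1)
    ultimately have "rho ?z < 0" using zj(1) by (simp add: rho_def)
    then show False using rneg[OF U'] pos by simp
  qed
  ultimately have g: "g > 0" by simp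
  define Db where "Db x = frechet_derivative r (at x) eb" for x
  have "isCont Db p" unfolding Db_def using dr2[OF U(2)] differentiable_imp_continuous_within by blast
  then have "\<exists>d>0. \<forall>x. dist x p < d \<longrightarrow> dist (Db x) (Db p) < g/2"
    unfolding continuous_at_eps_delta using g half_gt_zero by blast
  then obtain d1 where d1: "d1 > 0" "\<And>x. dist x p < d1 \<Longrightarrow> \<bar>Db x - g\<bar> < g/2"
    by (auto simp: dist_real_def Db_def g_def L_def)
  obtain C e1 where e1: "e1 > 0" and C: "\<And>x. 0 < x \<Longrightarrow> x < e1 \<Longrightarrow> \<bar>r (p + x *\<^sub>R ea) + r (p - x *\<^sub>R ea) - 2 * r p\<bar> \<le> C * x\<^sup>2"
    using Ck2_second_difference_bound[OF C2 U, of ea] by blast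
  \<comment> \<open>Chosen so that \<open>k * g\<close> exceeds \<open>C\<close>.\<close>
  define k where "k = (\<bar>C\<bar> + 1) / g"
  have k: "k > 0" using g by (simp add: k_def)
  define q where "q = 2 - 2*m"
  have q: "q > 0" using m_lt by (simp add: q_def)
  \<comment> \<open>In this order the entries ensure the bound with \<open>C\<close>,
    \<open>x\<^sup>2 \<le> x\<close>, that the points used lie in \<open>U\<close>, that the slope
    along \<open>eb\<close> exceeds \<open>g/2\<close> there, and
    \<open>2 * k * x\<^sup>2 \<le> x powr (2*m)\<close>.\<close>
  define x where "x = Min {e1/2, 1, e0 / (2 * (1 + k)), d1 / (2 * (1 + k)), (1 / (2*k)) powr (1/q)}"
  have x: "0 < x" "x < e1" "x \<le> 1" "x \<le> e0 / (2 * (1 + k))" "x \<le> d1 / (2 * (1 + k))" "x \<le> (1 / (2*k)) powr (1/q)"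
    using e0 e1 d1 k by (auto simp: x_def)
  have xk: "x + k * x\<^sup>2 < e0" "x + k * x\<^sup>2 < d1"
  proof -
    have "x + k * x\<^sup>2 \<le> (1 + k) * x" using x k by (simp add: power2_eq_square algebra_simps mult_left_le)
    moreover have "(1 + k) * x \<le> e0 / 2" "(1 + k) * x \<le> d1 / 2" using x(4,5) k by (simp_all add: field_simps)
    ultimately show "x + k * x\<^sup>2 < e0" "x + k * x\<^sup>2 < d1" using e0 d1 by linarith+
  qed
  have side: "r (p + s *\<^sub>R ea) \<ge> k * x\<^sup>2 * (g/2)" if s: "\<bar>s\<bar> = x" for s
  proof -
    define y where "y = p + s *\<^sub>R ea"
    have seg: "dist (y + t *\<^sub>R eb) p < e0" "dist (y + t *\<^sub>R eb) p < d1" if "\<bar>t\<bar> \<le> k * x\<^sup>2" for t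
    proof -
      have "dist (y + t *\<^sub>R eb) p \<le> norm (s *\<^sub>R ea) + norm (t *\<^sub>R eb)"
        unfolding y_def dist_norm using norm_triangle_ineq[of "s *\<^sub>R ea" "t *\<^sub>R eb"] by (simp add: algebra_simps)
      then show "dist (y + t *\<^sub>R eb) p < e0" "dist (y + t *\<^sub>R eb) p < d1"
        using xk that s by (simp_all add: ea_def eb_def norm_axis_1)
    qed
    have Us: "y + t *\<^sub>R eb \<in> U" if "\<bar>t\<bar> \<le> k * x\<^sup>2" for t
      using seg(1)[OF that] e0 by (auto simp: dist_commute)
    have kx: "k * x\<^sup>2 > 0" using k x by simp
    have "\<exists>z>- (k * x\<^sup>2). z < 0 \<and> r (y + 0 *\<^sub>R eb) - r (y + (- (k * x\<^sup>2)) *\<^sub>R eb) = (0 - (- (k * x\<^sup>2))) * Db (y + z *\<^sub>R eb)"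
      by (rule MVT2[where f="\<lambda>t. r (y + t *\<^sub>R eb)"]) (use kx in \<open>auto simp: Db_def intro!: line_derivative dr Us\<close>)
    then obtain z where z: "- (k * x\<^sup>2) < z" "z < 0" "r y - r (y - (k * x\<^sup>2) *\<^sub>R eb) = (k * x\<^sup>2) * Db (y + z *\<^sub>R eb)"
      by auto
    have "Db (y + z *\<^sub>R eb) \<ge> g/2" using d1(2)[OF seg(2)[of z]] z by (simp add: abs_if split: if_splits)
    then have 1: "r y - r (y - (k * x\<^sup>2) *\<^sub>R eb) \<ge> k * x\<^sup>2 * (g/2)" unfolding z(3) using kx by (intro mult_left_mono) auto
    have "rho (y - (k * x\<^sup>2) *\<^sub>R eb) \<ge> 0"
    proof -
      let ?w = "y - (k * x\<^sup>2) *\<^sub>R eb"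
      have wa: "cmod (?w $ a) = x" using b s by (simp add: y_def p_def ea_def eb_def axis_def)
      have wb: "?w $ b = of_real (1 - k * x\<^sup>2)" using b by (simp add: y_def p_def ea_def eb_def axis_def of_real_def algebra_simps)
      have "(cmod (?w $ b))\<^sup>2 = (1 - k * x\<^sup>2)\<^sup>2" unfolding wb norm_of_real by simp
      then have 2: "rho ?w \<ge> x powr (2*m) + (1 - k * x\<^sup>2)\<^sup>2 - 1" using rho_ge[of ?w] wa by simp
      have "x powr q \<le> ((1 / (2*k)) powr (1/q)) powr q" using x q by (intro powr_mono2) auto
      then have "x powr q \<le> 1 / (2*k)" using q k by (simp add: powr_powr)
      then have "2 * k * x powr q \<le> 1" using k by (simp add: field_simps)
      then have "2 * k * x powr q * x powr (2*m) \<le> 1 * x powr (2*m)" by (intro mult_right_mono) auto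
      moreover have "x\<^sup>2 = x powr q * x powr (2*m)" using x by (simp add: q_def flip: powr_add)
      ultimately have "2 * k * x\<^sup>2 \<le> x powr (2*m)" by (simp add: mult.assoc)
      moreover have "(1 - k * x\<^sup>2)\<^sup>2 \<ge> 1 - 2 * k * x\<^sup>2" using zero_le_power2[of "k * x\<^sup>2"] by (simp add: power2_eq_square algebra_simps)
      ultimately show ?thesis using 2 by linarith
    qed
    moreover have "y - (k * x\<^sup>2) *\<^sub>R eb \<in> U" using Us[of "- (k * x\<^sup>2)"] kx by simp
    ultimately have "r (y - (k * x\<^sup>2) *\<^sub>R eb) \<ge> 0" using rneg by force
    then show ?thesis using 1 by (simp add: y_def)
  qed
  have "r (p + x *\<^sub>R ea) \<ge> k * x\<^sup>2 * (g/2)" using side[of x] x by simp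
  moreover have "r (p - x *\<^sub>R ea) \<ge> k * x\<^sup>2 * (g/2)" using side[of "-x"] x by simp
  moreover have "\<bar>r (p + x *\<^sub>R ea) + r (p - x *\<^sub>R ea) - 2 * r p\<bar> \<le> C * x\<^sup>2" using C[of x] x by simp
  ultimately have "2 * (k * x\<^sup>2 * (g/2)) \<le> C * x\<^sup>2" using rp by linarith
  then have "(k * g) * x\<^sup>2 \<le> C * x\<^sup>2" by (simp add: mult_ac)
  then have "k * g \<le> C" using x by simp
  then show False using g by (simp add: k_def)
qed

end

section \<open>Failure of the Kaehler condition\<close>

text \<open>With \<open>t = exp (-2 * v)\<close> this is the square of
  \<open>sinh_mult_less\<close>.\<close>

lemma power_mean_strict:
  fixes m t :: real
  assumes m: "0 < m" "m < 1" and t: "0 < t" "t < 1"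
  shows "(1 - t powr m)\<^sup>2 < m\<^sup>2 * t powr (m - 1) * (1 - t)\<^sup>2"
proof -
  define v where "v = - ln t / 2"
  have v: "v > 0" "t = exp (-2 * v)" using t by (simp_all add: v_def)
  have tp: "t powr e = exp (-2 * (e * v))" for e by (simp add: v(2) powr_def)
  have 1: "1 - t powr m = 2 * exp (-(m * v)) * sinh (m * v)" unfolding tp by (rule one_minus_exp_sinh)
  have 2: "1 - t = 2 * exp (-v) * sinh v" unfolding v(2) by (rule one_minus_exp_sinh)
  have "(sinh (m * v))\<^sup>2 < (m * sinh v)\<^sup>2"
    using sinh_mult_less[OF m v(1)] m v by (intro power_strict_mono) auto
  then have "(2 * exp (-(m * v)))\<^sup>2 * (sinh (m * v))\<^sup>2 < (2 * exp (-(m * v)))\<^sup>2 * (m * sinh v)\<^sup>2"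
    by (intro mult_strict_left_mono) auto
  also have "\<dots> = m\<^sup>2 * t powr (m - 1) * (1 - t)\<^sup>2"
  proof -
    have "exp (-(m * v)) ^ 2 = exp (-2 * ((m - 1) * v)) * exp (-v) ^ 2"
      unfolding power2_eq_square exp_add[symmetric] by (simp add: algebra_simps)
    then show ?thesis unfolding 2 tp by (simp add: power_mult_distrib)
  qed
  finally show ?thesis unfolding 1 by (simp add: power_mult_distrib)
qed

section \<open>The exterior derivative of the fundamental form\<close>

context egg_dom
begin

text \<open>The scalar \<open>PP z / (m * sg z)\<close> in the entries \<open>(a, b)\<close>, as a
  function of \<open>y = (cmod (z$a))\<^sup>2\<close> and \<open>s = sg z\<close>.\<close>

definition theta :: "real \<Rightarrow> real \<Rightarrow> real" where
  "theta y s = s powr (1/m) / (m * s * (s powr (1/m) - y)\<^sup>2)"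

lemma theta_deriv:
  assumes s: "s > 0" and y: "s powr (1/m) \<noteq> y"
  defines "A \<equiv> s powr (1/m)"
  shows "(theta y has_real_derivative - A * (A + y) / (m\<^sup>2 * s\<^sup>2 * (A - y) ^ 3) - A / (m * s\<^sup>2 * (A - y)\<^sup>2)) (at s)"
proof -
  define A' where "A' = A / (m * s)"
  have DA: "((\<lambda>s. s powr (1/m)) has_real_derivative A') (at s)"
    using s by (auto intro!: derivative_eq_intros simp: A'_def A_def powr_diff)
  have DD: "((\<lambda>s. m * s * (s powr (1/m) - y)\<^sup>2) has_real_derivative m * (A - y)\<^sup>2 + m * s * (2 * (A - y) * A')) (at s)"
    by (rule derivative_eq_intros DA refl)+ (simp add: A_def)
  have d: "A - y \<noteq> 0" using y by (simp add: A_def)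
  have "(theta y has_real_derivative (A' * (m * s * (A - y)\<^sup>2) - A * (m * (A - y)\<^sup>2 + m * s * (2 * (A - y) * A')))
      / ((m * s * (A - y)\<^sup>2) * (m * s * (A - y)\<^sup>2))) (at s)"
    unfolding theta_def[abs_def] using DERIV_divide[OF DA DD] d s by (simp add: A_def)
  also have "(A' * (m * s * (A - y)\<^sup>2) - A * (m * (A - y)\<^sup>2 + m * s * (2 * (A - y) * A')))
      / ((m * s * (A - y)\<^sup>2) * (m * s * (A - y)\<^sup>2)) = - A * (A + y) / (m\<^sup>2 * s\<^sup>2 * (A - y) ^ 3) - A / (m * s\<^sup>2 * (A - y)\<^sup>2)"
  proof -
    define D where "D = A - y"
    have yD: "A + y = 2 * A - D" by (simp add: D_def)
    have D0: "D \<noteq> 0" using d by (simp add: D_def)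
    have e: "m * s * A' = A" using s by (simp add: A'_def)
    have f: "A' * (m * s * D\<^sup>2) = (m * s * A') * D\<^sup>2" "m * s * (2 * D * A') = 2 * D * (m * s * A')" by simp_all
    have n: "A' * (m * s * D\<^sup>2) - A * (m * D\<^sup>2 + m * s * (2 * D * A')) = A * D * (D - m * D - 2 * A)"
      unfolding f e by (simp add: algebra_simps power2_eq_square)
    show ?thesis unfolding D_def[symmetric] yD n using D0 s
      by (simp add: divide_simps) (simp add: algebra_simps power2_eq_square power3_eq_cube)
  qed
  finally show ?thesis .
qed

text \<open>In \<open>t = y / A\<close> both sides are homogeneous and the claim becomes
  \<open>power_mean_strict\<close>. For \<open>m = 1\<close>, the ball, the two sides would be
  equal, in accordance with its metric being Kaehler.\<close>

lemma kahler_defect: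
  assumes y: "0 < y" "y < s powr (1/m)" and s: "s > 0"
  shows "s powr (1/m) / (m * s * (s powr (1/m) - y)\<^sup>2) < m * y powr (m - 1) / (s - y powr m)\<^sup>2"
proof -
  define A where "A = s powr (1/m)"
  define t where "t = y / A"
  have A: "A > 0" "A powr m = s" using s by (simp_all add: A_def powr_powr)
  have t: "0 < t" "t < 1" using y A by (simp_all add: t_def A_def)
  have yt: "y = t * A" using A by (simp add: t_def)
  have ym: "y powr m = t powr m * s" unfolding yt using t A by (simp add: powr_mult)
  have tm: "t powr m < 1" using t powr_less_mono2[of m t 1] by simp
  have ym1: "y powr (m - 1) = t powr (m - 1) * (s / A)"
    unfolding yt using t A by (simp add: powr_mult powr_diff)
  have "s powr (1/m) / (m * s * (s powr (1/m) - y)\<^sup>2) = 1 / (m * s * A * (1 - t)\<^sup>2)"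
  proof -
    have "A - y = A * (1 - t)" by (simp add: yt algebra_simps)
    then show ?thesis unfolding A_def[symmetric] using A by (simp add: power2_eq_square)
  qed
  moreover have "m * y powr (m - 1) / (s - y powr m)\<^sup>2 = m * t powr (m - 1) / (s * A * (1 - t powr m)\<^sup>2)"
  proof -
    have "s - y powr m = s * (1 - t powr m)" by (simp add: ym algebra_simps)
    then show ?thesis unfolding ym1 using s by (simp add: power2_eq_square)
  qed
  moreover have "1 / (m * s * A * (1 - t)\<^sup>2) < m * t powr (m - 1) / (s * A * (1 - t powr m)\<^sup>2)"
  proof -
    have p: "(1 - t)\<^sup>2 > 0" "(1 - t powr m)\<^sup>2 > 0" using t tm by simp_all
    have "1 / (m * (1 - t)\<^sup>2) < m * t powr (m - 1) / (1 - t powr m)\<^sup>2"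
      using power_mean_strict[OF m_pos(1) m_lt t] p by (simp add: divide_simps power2_eq_square mult_ac)
    then have "1 / (m * (1 - t)\<^sup>2) / (s * A) < m * t powr (m - 1) / (1 - t powr m)\<^sup>2 / (s * A)"
      using s A by (intro divide_strict_right_mono) auto
    then show ?thesis by (simp add: mult_ac)
  qed
  ultimately show ?thesis by simp
qed

lemma wuH_ab: "b \<noteq> a \<Longrightarrow> wuH z $ a $ b = of_real (theta ((cmod (z$a))\<^sup>2) (sg z)) * (cnj (z$a) * z$b)"
  by (simp add: wuH_def ell_def PP_def AA_def theta_def mult_ac)

text \<open>The exterior derivative is evaluated on \<open>ea\<close>, \<open>eb\<close> and
  \<open>ib\<close>, which needs only derivatives of two matrix entries along coordinate lines. The
  result is \<open>2 * x\<close> times a positive factor times the gap in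
  \<open>kahler_defect\<close>, hence not zero when \<open>x = Re (q$a)\<close> is not zero.\<close>

lemma nowhere_kahler:
  assumes b: "b \<noteq> a" shows "nowhere_kahler_on (wu_metric (egg a m)) (egg a m)"
  unfolding nowhere_kahler_on_def
proof (intro allI impI notI)
  fix U assume U: "open U \<and> U \<noteq> {} \<and> U \<subseteq> egg a m" and K: "kahler_on (wu_metric (egg a m)) U"
  define ea :: "complex^'n" where "ea = axis a 1"
  define eb :: "complex^'n" where "eb = axis b 1"
  define ib :: "complex^'n" where "ib = axis b \<i>"
  \<comment> \<open>The final identity carries the factor \<open>Re (q$a)\<close>; if it vanishes at
    the given point, a small step along the axis makes it nonzero.\<close>
  obtain q where q: "q \<in> U" "Re (q$a) \<noteq> 0"
  proof -
    obtain p e where p: "p \<in> U" and e: "e > 0" "ball p e \<subseteq> U" using U open_contains_ball by blast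
    show thesis
    proof (cases "Re (p$a) = 0")
      case True
      have "p + (e/2) *\<^sub>R ea \<in> ball p e" using e by (simp add: dist_norm ea_def norm_axis_1)
      then have "p + (e/2) *\<^sub>R ea \<in> U" using e by blast
      moreover have "Re ((p + (e/2) *\<^sub>R ea)$a) \<noteq> 0" using True e by (simp add: ea_def axis_def)
      ultimately show thesis by (rule that)
    qed (use p that in blast)
  qed
  have qe: "q \<in> egg a m" using q U by blast
  define h where "h = wu_metric (egg a m)"
  have hU: "h z = wuH z" if "z \<in> U" for z using that U by (auto simp: h_def wu_metric_egg)
  have C1: "(\<lambda>z. h z $ i $ j) differentiable (at q)" for i j
    using K q(1) by (simp add: kahler_on_def metric_Ck_on_def h_def)
  have dre: "(\<lambda>z. Re (h z $ i $ j * c)) differentiable (at q)" for i j c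
  proof -
    have "((\<lambda>z. h z $ i $ j) has_derivative frechet_derivative (\<lambda>z. h z $ i $ j) (at q)) (at q)"
      using C1 by (simp add: frechet_derivative_works)
    from has_derivative_Re[OF has_derivative_mult_left[OF this, of c]] show ?thesis by (auto simp: differentiable_def)
  qed
  have fd: "frechet_derivative (\<lambda>z. Re (h z $ i $ j * c)) (at q) v = X"
    if X: "((\<lambda>s. Re (wuH (q + s *\<^sub>R v) $ i $ j * c)) has_real_derivative X) (at 0)" for i j c v X
  proof -
    have "((\<lambda>s. Re (h (q + s *\<^sub>R v) $ i $ j * c)) has_real_derivative frechet_derivative (\<lambda>z. Re (h z $ i $ j * c)) (at q) v) (at 0)"
      using line_derivative[of "\<lambda>z. Re (h z $ i $ j * c)" q 0 v] dre by simp
    moreover have "((\<lambda>s. Re (h (q + s *\<^sub>R v) $ i $ j * c)) has_real_derivative X) (at 0)"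
    proof (rule has_field_derivative_transform_within_open[OF X])
      show "open ((\<lambda>s. q + s *\<^sub>R v) -` U)" by (intro open_vimage) (use U in \<open>auto intro!: continuous_intros\<close>)
    qed (use q hU in auto)
    ultimately show ?thesis by (rule DERIV_unique)
  qed
  define y where "y = (cmod (q$a))\<^sup>2"
  define B where "B = (cmod (q$b))\<^sup>2"
  define s where "s = sg q"
  define A where "A = s powr (1/m)"
  define x where "x = Re (q$a)"
  have s: "s > 0" using egg_sg[OF qe] by (simp add: s_def)
  have qa: "q$a \<noteq> 0" using q(2) by auto
  have y: "0 < y" "y < A"
    using qa egg_tt[OF qe] AA_pos[of q] s by (simp_all add: y_def tt_def A_def AA_def s_def)
  have ym: "y powr m < s" using qe by (simp add: y_def cmod_sq_powr egg_iff s_def)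
  define T where "T = theta y s"
  define T' where "T' = - A * (A + y) / (m\<^sup>2 * s\<^sup>2 * (A - y) ^ 3) - A / (m * s\<^sup>2 * (A - y)\<^sup>2)"
  have DT: "(theta y has_real_derivative T') (at s)"
    unfolding T'_def A_def by (rule theta_deriv) (use s y in \<open>auto simp: A_def\<close>)
  define G' where "G' = B / (m * s)\<^sup>2 * (A * (A + y) / (A - y) ^ 3) + (1 + B / s) * (m * y powr (m - 1) / (s - y powr m)\<^sup>2)"
  have sgb: "sg (q + r *\<^sub>R axis b c) = s + B - (cmod (q$b + r *\<^sub>R c))\<^sup>2" for r c
  proof -
    have "nq (q + r *\<^sub>R axis b c) = (cmod (q$b + r *\<^sub>R c))\<^sup>2 + (\<Sum>j\<in>UNIV-{a}-{b}. (cmod (q$j))\<^sup>2)"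
      unfolding nsq_def using b by (subst sum.remove[of _ b]) (auto simp: axis_def intro!: sum.cong)
    moreover have "nq q = B + (\<Sum>j\<in>UNIV-{a}-{b}. (cmod (q$j))\<^sup>2)"
      unfolding nsq_def B_def using b by (subst sum.remove[of _ b]) auto
    ultimately show ?thesis by (simp add: sg_def s_def)
  qed
  have Dsg: "((\<lambda>r. sg (q + r *\<^sub>R axis b c)) has_real_derivative - 2 * (q$b \<bullet> c)) (at 0)" for c
  proof -
    have "((\<lambda>r. s + B - ((Re (q$b) + r * Re c)\<^sup>2 + (Im (q$b) + r * Im c)\<^sup>2)) has_real_derivative - 2 * (Re (q$b) * Re c + Im (q$b) * Im c)) (at 0)"
      by (auto intro!: derivative_eq_intros simp: algebra_simps)
    then show ?thesis unfolding sgb by (simp add: cmod_power2 inner_complex_def)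
  qed
  have DTh: "((\<lambda>r. theta y (sg (q + r *\<^sub>R axis b c))) has_real_derivative T' * (- 2 * (q$b \<bullet> c))) (at 0)" for c
    by (rule DERIV_chain2[where f="theta y", OF _ Dsg]) (use DT in \<open>simp add: s_def\<close>)
  have Hab: "wuH (q + r *\<^sub>R axis b c) $ a $ b = of_real (theta y (sg (q + r *\<^sub>R axis b c))) * (cnj (q$a) * (q$b + r *\<^sub>R c))" for r c
    unfolding wuH_ab[OF b] using b by (simp add: axis_def y_def)
  have X2: "((\<lambda>r. Re (wuH (q + r *\<^sub>R eb) $ a $ b * 1)) has_real_derivative T' * (- 2 * Re (q$b)) * Re (cnj (q$a) * q$b) + x * T) (at 0)"
  proof -
    have "((\<lambda>r. Re (cnj (q$a) * q$b) + r * x) has_real_derivative x) (at 0)" by (auto intro!: derivative_eq_intros)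
    from DERIV_mult[OF DTh[of 1] this] show ?thesis
      unfolding eb_def Hab by (simp add: T_def s_def x_def inner_complex_def algebra_simps)
  qed
  have X3: "((\<lambda>r. Re (wuH (q + r *\<^sub>R ib) $ a $ b * \<i>)) has_real_derivative T' * (- 2 * Im (q$b)) * (- Im (cnj (q$a) * q$b)) - x * T) (at 0)"
  proof -
    have "((\<lambda>r. - Im (cnj (q$a) * q$b) - r * x) has_real_derivative - x) (at 0)" by (auto intro!: derivative_eq_intros)
    from DERIV_mult[OF DTh[of \<i>] this] show ?thesis
      unfolding ib_def Hab by (simp add: T_def s_def x_def inner_complex_def algebra_simps)
  qed
  have X1: "((\<lambda>r. Re (wuH (q + r *\<^sub>R ea) $ b $ b * 1)) has_real_derivative 2 * x * G') (at 0)"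
  proof -
    define Y where "Y r = (Re (q$a) + r)\<^sup>2 + (Im (q$a))\<^sup>2" for r
    have Y0: "Y 0 = y" by (simp add: Y_def y_def cmod_power2)
    have DY: "(Y has_real_derivative 2 * x) (at 0)"
      unfolding Y_def by (auto intro!: derivative_eq_intros simp: x_def)
    define G where "G u = A / (A - u)\<^sup>2 * (u * B / (m * s)\<^sup>2) + 1 / (s - u powr m) * (1 + B / s)" for u
    have DG: "(G has_real_derivative G') (at y)"
    proof -
      have d: "A - y \<noteq> 0" "s - y powr m \<noteq> 0" using y ym by auto
      have "((\<lambda>u. A * u / (A - u)\<^sup>2) has_real_derivative (A * (A - y)\<^sup>2 - A * y * (- 2 * (A - y))) / ((A - y)\<^sup>2 * (A - y)\<^sup>2)) (at y)"
        using d by (auto intro!: derivative_eq_intros)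
      also have "(A * (A - y)\<^sup>2 - A * y * (- 2 * (A - y))) / ((A - y)\<^sup>2 * (A - y)\<^sup>2) = A * (A + y) / (A - y) ^ 3"
      proof -
        have "A * (A - y)\<^sup>2 - A * y * (- 2 * (A - y)) = (A - y) * (A * (A + y))" by (simp add: power2_eq_square algebra_simps)
        then show ?thesis using d by (simp add: power2_eq_square power3_eq_cube)
      qed
      finally have D1: "((\<lambda>u. A * u / (A - u)\<^sup>2) has_real_derivative A * (A + y) / (A - y) ^ 3) (at y)" .
      have D2: "((\<lambda>u. 1 / (s - u powr m)) has_real_derivative m * y powr (m - 1) / (s - y powr m)\<^sup>2) (at y)"
        using d y by (auto intro!: derivative_eq_intros simp: power2_eq_square)
      have "((\<lambda>u. B / (m * s)\<^sup>2 * (A * u / (A - u)\<^sup>2) + (1 + B / s) * (1 / (s - u powr m))) has_real_derivative G') (at y)"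
        unfolding G'_def by (intro DERIV_add DERIV_cmult D1 D2)
      moreover have "G = (\<lambda>u. B / (m * s)\<^sup>2 * (A * u / (A - u)\<^sup>2) + (1 + B / s) * (1 / (s - u powr m)))"
        by (rule ext) (simp add: G_def mult_ac)
      ultimately show ?thesis by simp
    qed
    have e: "Re (wuH (q + r *\<^sub>R ea) $ b $ b * 1) = G (Y r)" for r
    proof -
      have "nq (q + r *\<^sub>R ea) = nq q" by (rule nsq_cong) (simp add: ea_def axis_def)
      then have 1: "sg (q + r *\<^sub>R ea) = s" by (simp add: sg_def s_def)
      have 2: "(cmod ((q + r *\<^sub>R ea) $ a))\<^sup>2 = Y r" by (simp add: ea_def axis_def cmod_power2 Y_def)
      have 3: "(q + r *\<^sub>R ea) $ b = q $ b" using b by (simp add: ea_def axis_def)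
      show ?thesis unfolding mult_1_right Re_wuH_diag[OF b] PP_def QQ_def AA_def cmod_sq_powr[symmetric] 1 2 3
        by (simp add: G_def A_def B_def)
    qed
    show ?thesis unfolding e using DERIV_chain2[where f=G and g=Y, OF _ DY, of G'] DG by (simp add: Y0 mult.commute)
  qed
  have ff: "fundamental_form h z eb ib = Re (h z $ b $ b * 1)" "fundamental_form h z ea ib = Re (h z $ a $ b * 1)"
    "fundamental_form h z ea eb = Re (h z $ a $ b * \<i>)" for z
  proof -
    have "\<i> *s eb = axis b \<i>" "\<i> *s ea = axis a \<i>" by (simp_all add: eb_def ea_def vec_eq_iff axis_def)
    then show "fundamental_form h z eb ib = Re (h z $ b $ b * 1)" "fundamental_form h z ea ib = Re (h z $ a $ b * 1)"
      "fundamental_form h z ea eb = Re (h z $ a $ b * \<i>)"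
      unfolding fundamental_form_def by (simp_all add: ib_def eb_def herm_form_axis mult.assoc)
  qed
  have "ext_deriv2 (fundamental_form h) q ea eb ib = 0"
    using K q(1) by (simp add: kahler_on_def h_def)
  then have "2 * x * G' - (T' * (- 2 * Re (q$b)) * Re (cnj (q$a) * q$b) + x * T)
     + (T' * (- 2 * Im (q$b)) * (- Im (cnj (q$a) * q$b)) - x * T) = 0"
    unfolding ext_deriv2_def ff fd[OF X1] fd[OF X2] fd[OF X3] .
  moreover have "B = Re (q$b) * Re (q$b) + Im (q$b) * Im (q$b)" unfolding B_def cmod_power2 by (simp add: power2_eq_square)
  ultimately have "2 * x * (G' - T + T' * B) = 0" by (simp add: x_def algebra_simps)
  then have "G' - T + T' * B = 0" using q(2) by (simp add: x_def)
  \<comment> \<open>\<open>P\<close>, which comes from \<open>PP\<close> in the diagonal entry,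
    cancels against the derivative of the numerator and squared denominator in \<open>theta\<close>.
    The remaining part of \<open>T' * B\<close> supplies the factor \<open>1 + B / s\<close> also
    for \<open>T\<close>.\<close>
  moreover have "G' - T + T' * B = (1 + B / s) * (m * y powr (m - 1) / (s - y powr m)\<^sup>2 - A / (m * s * (A - y)\<^sup>2))"
  proof -
    have d: "A - y \<noteq> 0" using y by simp
    have T: "T = A / (m * s * (A - y)\<^sup>2)" by (simp add: T_def theta_def A_def)
    define P where "P = B / (m * s)\<^sup>2 * (A * (A + y) / (A - y) ^ 3)"
    have "- A * (A + y) / (m\<^sup>2 * s\<^sup>2 * (A - y) ^ 3) * B = - P"
      by (simp add: P_def power_mult_distrib)
    moreover have "A / (m * s\<^sup>2 * (A - y)\<^sup>2) * B = T * (B / s)"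
      by (simp add: power2_eq_square T)
    ultimately have t: "T' * B = - P - T * (B / s)" unfolding T'_def left_diff_distrib by (simp only:)
    have g: "G' = P + (1 + B / s) * (m * y powr (m - 1) / (s - y powr m)\<^sup>2)" by (simp add: G'_def P_def)
    show ?thesis unfolding T[symmetric] t g by (simp only: distrib_right left_diff_distrib right_diff_distrib mult_1_left) (simp add: mult.commute)
  qed
  moreover have "(1 + B / s) * (m * y powr (m - 1) / (s - y powr m)\<^sup>2 - A / (m * s * (A - y)\<^sup>2)) > 0"
  proof (rule mult_pos_pos)
    have "B / s \<ge> 0" using s by (simp add: B_def)
    then show "1 + B / s > 0" by simp
    show "m * y powr (m - 1) / (s - y powr m)\<^sup>2 - A / (m * s * (A - y)\<^sup>2) > 0"
      using kahler_defect[OF y(1) y(2)[unfolded A_def] s] by (simp add: A_def)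
  qed
  ultimately show False by linarith
qed

end

section \<open>Distributional inequalities from four-point means\<close>

text \<open>To second order this mean differs from \<open>u \<zeta>\<close> by
  \<open>r\<^sup>2\<close> times the mixed derivative in \<open>\<zeta>\<close> and
  \<open>cnj \<zeta>\<close>, with no further constant. The two pairs of points cancel the linear
  terms, and their quarter turn cancels the pure squares.\<close>

definition cross_mean :: "(complex \<Rightarrow> 'a::real_vector) \<Rightarrow> complex \<Rightarrow> real \<Rightarrow> 'a" where
  "cross_mean u \<zeta> r = (1/4) *\<^sub>R (u (\<zeta> + of_real r) + u (\<zeta> - of_real r) + u (\<zeta> + \<i> * of_real r) + u (\<zeta> - \<i> * of_real r))"

lemma cross_mean_mono:
  fixes u v :: "complex \<Rightarrow> real"
  assumes "r > 0" "\<And>\<zeta>. cmod (\<zeta> - z) = r \<Longrightarrow> u \<zeta> \<le> v \<zeta>"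
  shows "cross_mean u z r \<le> cross_mean v z r"
  unfolding cross_mean_def using assms by (intro scaleR_left_mono add_mono) (auto simp: norm_mult)

lemma cross_mean_const_add: "cross_mean (\<lambda>\<zeta>. c + u \<zeta>) z r = c + cross_mean u z r" for c :: real
  by (simp add: cross_mean_def algebra_simps)

lemma integral_translation:
  fixes f :: "complex \<Rightarrow> real"
  assumes "f \<in> borel_measurable borel"
  shows "(LINT x|lborel. f (x + c)) = (LINT x|lborel. f x)"
proof -
  have "(LINT x|lborel. f x) = (LINT x|distr lborel borel ((+) c). f x)" by (simp add: lborel_distr_plus)
  also have "\<dots> = (LINT x|lborel. f (c + x))" by (rule integral_distr) (use assms in auto)
  finally show ?thesis by (simp add: add.commute)
qed

lemma integrable_translation:
  fixes f :: "complex \<Rightarrow> real"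
  assumes "integrable lborel f"
  shows "integrable lborel (\<lambda>x. f (x + c))"
proof -
  have "integrable (distr lborel borel ((+) c)) f" using assms by (simp add: lborel_distr_plus)
  then have "integrable lborel (\<lambda>x. f (c + x))" by (subst (asm) integrable_distr_eq) (use assms in auto)
  then show ?thesis by (simp add: add.commute)
qed

lemma Re_d_z_d_zbar:
  fixes \<eta> :: "complex \<Rightarrow> real"
  assumes \<eta>: "Ck_on 2 \<eta> UNIV"
  defines "D v \<equiv> \<lambda>x. frechet_derivative \<eta> (at x) v"
  shows "Re (d_z (d_zbar (\<lambda>x. complex_of_real (\<eta> x))) \<zeta>)
    = (frechet_derivative (D 1) (at \<zeta>) 1 + frechet_derivative (D \<i>) (at \<zeta>) \<i>) / 4"
proof -
  have d1: "(\<eta> has_derivative frechet_derivative \<eta> (at x)) (at x)" for x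
    using \<eta> by (simp add: numeral_2_eq_2 frechet_derivative_works)
  have d2: "(D v has_derivative frechet_derivative (D v) (at x)) (at x)" for x v
    using \<eta> by (simp add: numeral_2_eq_2 frechet_derivative_works D_def)
  have "((\<lambda>x. complex_of_real (\<eta> x)) has_derivative (\<lambda>v. of_real (frechet_derivative \<eta> (at x) v))) (at x)" for x
    by (rule has_derivative_of_real[OF d1])
  from frechet_derivative_at[OF this]
  have "frechet_derivative (\<lambda>x. complex_of_real (\<eta> x)) (at x) v = of_real (D v x)" for x v
    unfolding D_def by metis
  then have z: "d_zbar (\<lambda>x. complex_of_real (\<eta> x)) = (\<lambda>x. (of_real (D 1 x) + \<i> * of_real (D \<i> x)) / 2)"
    by (auto simp: d_zbar_def)
  have "((\<lambda>x. (complex_of_real (D 1 x) + \<i> * of_real (D \<i> x)) / 2) has_derivative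
     (\<lambda>v. (of_real (frechet_derivative (D 1) (at \<zeta>) v) + \<i> * of_real (frechet_derivative (D \<i>) (at \<zeta>) v)) / 2)) (at \<zeta>)"
    by (intro has_derivative_add has_derivative_mult_right has_derivative_of_real d2 bounded_linear.has_derivative[OF bounded_linear_divide])
  then have "frechet_derivative (\<lambda>x. (complex_of_real (D 1 x) + \<i> * of_real (D \<i> x)) / 2) (at \<zeta>)
     = (\<lambda>v. (of_real (frechet_derivative (D 1) (at \<zeta>) v) + \<i> * of_real (frechet_derivative (D \<i>) (at \<zeta>) v)) / 2)"
    by (rule frechet_derivative_at[symmetric])
  then show ?thesis unfolding z d_z_def by simp
qed

text \<open>The difference quotient of four-point means is symmetric for Lebesgue measure, so it can
  be moved from \<open>u\<close> to the test function. There it converges boundedly to the mixed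
  derivative, while the cubic error, divided by \<open>r\<^sup>2\<close>, tends to 0.\<close>

lemma ddbar_ge_distrI:
  fixes u w :: "complex \<Rightarrow> real"
  assumes V: "open V" and u: "continuous_on V u" and w: "continuous_on V w"
    and mean: "\<And>K. compact K \<Longrightarrow> K \<subseteq> V \<Longrightarrow>
        \<exists>C r0. r0 > 0 \<and> (\<forall>\<zeta>\<in>K. \<forall>r. 0 < r \<and> r < r0 \<longrightarrow> cross_mean u \<zeta> r \<ge> u \<zeta> + r\<^sup>2 * w \<zeta> - C * r ^ 3)"
  shows "ddbar_ge_distr V u w"
  unfolding ddbar_ge_distr_def
proof (intro allI impI)
  fix \<eta> :: "complex \<Rightarrow> real" assume \<eta>': "test_function V \<eta> \<and> (\<forall>\<zeta>. \<eta> \<zeta> \<ge> 0)"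
  then have C2: "Ck_on 2 \<eta> UNIV" and \<eta>0: "\<And>\<zeta>. \<eta> \<zeta> \<ge> 0" by (auto simp: test_function_def)
  define K where "K = closure {x. \<eta> x \<noteq> 0}"
  have K: "compact K" "K \<subseteq> V" using \<eta>' by (auto simp: test_function_def K_def)
  have \<eta>K: "\<eta> x = 0" if "x \<notin> K" for x using that closure_subset[of "{x. \<eta> x \<noteq> 0}"] by (auto simp: K_def)
  have c\<eta>: "continuous_on A \<eta>" for A
  proof -
    have "\<eta> differentiable_on UNIV" using C2 by (auto simp: numeral_2_eq_2 differentiable_on_def)
    then show ?thesis using differentiable_imp_continuous_on continuous_on_subset by blast
  qed
  obtain C r0 where r0: "r0 > 0" and C: "\<And>\<zeta> r. \<zeta> \<in> K \<Longrightarrow> 0 < r \<Longrightarrow> r < r0 \<Longrightarrow> cross_mean u \<zeta> r \<ge> u \<zeta> + r\<^sup>2 * w \<zeta> - C * r ^ 3"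
    using mean[OF K] by blast
  obtain e where e: "e > 0" "\<And>x y. x \<in> K \<Longrightarrow> dist x y < e \<Longrightarrow> y \<in> V"
  proof (cases "K = {}")
    case False
    obtain e where "e > 0" "(\<Union>x\<in>K. ball x e) \<subseteq> V"
      by (rule compact_subset_open_imp_ball_epsilon_subset[OF K(1) V K(2)])
    then show thesis using that[of e] by (auto simp: subset_iff)
  qed (rule that[of 1], auto)
  define r1 where "r1 = min (r0/2) (e/2)"
  have r1: "0 < r1" "r1 < r0" "r1 < e" using r0 e by (auto simp: r1_def)
  \<comment> \<open>The support enlarged by \<open>r1\<close>. All shifted points stay in this
    compact subset of \<open>V\<close>, so that \<open>u\<close>, cut off to it as \<open>U\<close>,
    can be integrated over the whole plane.\<close>
  define K1 where "K1 = (\<lambda>p. fst p + snd p) ` (K \<times> cball (0::complex) r1)"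
  have K1c: "compact K1" unfolding K1_def
    by (intro compact_continuous_image compact_Times K compact_cball continuous_intros)
  have K1I: "x + y \<in> K1" if "x \<in> K" "norm y \<le> r1" for x y
    unfolding K1_def using that by (intro rev_image_eqI[of "(x, y)"]) auto
  have K1V: "K1 \<subseteq> V" unfolding K1_def using e(2) r1 by (auto simp: dist_norm)
  have KK1: "K \<subseteq> K1" using K1I[of _ 0] r1 by auto
  have cu: "continuous_on K1 u" using u K1V continuous_on_subset by blast
  have cw: "continuous_on K w" using w K continuous_on_subset by blast
  define U where "U x = indicator K1 x * u x" for x
  have intU: "integrable lborel (\<lambda>x. U x * g x)" if "continuous_on UNIV g" for g
  proof -
    have "integrable lborel (\<lambda>x. indicator K1 x *\<^sub>R (u x * g x))"
      by (rule borel_integrable_compact[OF K1c]) (intro continuous_intros cu continuous_on_subset[OF that], auto)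
    then show ?thesis by (simp add: U_def mult.assoc)
  qed
  define L where "L x = Re (d_z (d_zbar (\<lambda>x. complex_of_real (\<eta> x))) x)" for x
  define D2 where "D2 v x = frechet_derivative (\<lambda>y. frechet_derivative \<eta> (at y) v) (at x) v" for v x
  have L: "L x = (D2 1 x + D2 \<i> x) / 4" for x unfolding L_def Re_d_z_d_zbar[OF C2] D2_def ..
  have cD2: "continuous_on UNIV (D2 v)" for v using C2 by (simp add: numeral_2_eq_2 D2_def)
  define q where "q r x = (cross_mean \<eta> x r - \<eta> x) / r\<^sup>2" for r x
  have sd: "\<exists>s t s' t'. \<bar>s\<bar> \<le> r \<and> \<bar>t\<bar> \<le> r \<and> \<bar>s'\<bar> \<le> r \<and> \<bar>t'\<bar> \<le> r \<and>
     q r x = (D2 1 (x + s *\<^sub>R 1) + D2 1 (x + t *\<^sub>R 1) + D2 \<i> (x + s' *\<^sub>R \<i>) + D2 \<i> (x + t' *\<^sub>R \<i>)) / 8" if r: "r > 0" for r x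
  proof -
    obtain s t where 1: "\<bar>s\<bar> \<le> r" "\<bar>t\<bar> \<le> r" "\<eta> (x + r *\<^sub>R 1) + \<eta> (x - r *\<^sub>R 1) - 2 * \<eta> x = r\<^sup>2 / 2 * (D2 1 (x + s *\<^sub>R 1) + D2 1 (x + t *\<^sub>R 1))"
      using Ck2_second_difference[OF C2 _ r, of x 1] unfolding D2_def by auto
    obtain s' t' where 2: "\<bar>s'\<bar> \<le> r" "\<bar>t'\<bar> \<le> r" "\<eta> (x + r *\<^sub>R \<i>) + \<eta> (x - r *\<^sub>R \<i>) - 2 * \<eta> x = r\<^sup>2 / 2 * (D2 \<i> (x + s' *\<^sub>R \<i>) + D2 \<i> (x + t' *\<^sub>R \<i>))"
      using Ck2_second_difference[OF C2 _ r, of x \<i>] unfolding D2_def by auto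
    have ri: "r *\<^sub>R \<i> = \<i> * of_real r" "r *\<^sub>R 1 = complex_of_real r" by (simp_all add: scaleR_conv_of_real mult.commute)
    have "cross_mean \<eta> x r - \<eta> x = ((\<eta> (x + r *\<^sub>R 1) + \<eta> (x - r *\<^sub>R 1) - 2 * \<eta> x) + (\<eta> (x + r *\<^sub>R \<i>) + \<eta> (x - r *\<^sub>R \<i>) - 2 * \<eta> x)) / 4"
      unfolding cross_mean_def ri by simp
    also have "\<dots> = r\<^sup>2 * ((D2 1 (x + s *\<^sub>R 1) + D2 1 (x + t *\<^sub>R 1) + D2 \<i> (x + s' *\<^sub>R \<i>) + D2 \<i> (x + t' *\<^sub>R \<i>)) / 8)"
      unfolding 1(3) 2(3) by (simp add: algebra_simps)
    finally have "q r x = (D2 1 (x + s *\<^sub>R 1) + D2 1 (x + t *\<^sub>R 1) + D2 \<i> (x + s' *\<^sub>R \<i>) + D2 \<i> (x + t' *\<^sub>R \<i>)) / 8"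
      unfolding q_def using r by simp
    then show ?thesis using 1(1,2) 2(1,2) by blast
  qed
  have near: "\<exists>d>0. \<forall>r. 0 < r \<and> r < d \<longrightarrow> \<bar>q r x - L x\<bar> < \<epsilon>" if "\<epsilon> > 0" for \<epsilon> x
  proof -
    have "\<exists>d>0. \<forall>s. \<bar>s\<bar> < d \<longrightarrow> \<bar>D2 v (x + s *\<^sub>R v) - D2 v x\<bar> < \<epsilon>" if v: "norm v = 1" for v
    proof -
      have "isCont (D2 v) x" using cD2 by (simp add: continuous_on_eq_continuous_at)
      then obtain d where "d > 0" "\<And>y. dist y x < d \<Longrightarrow> dist (D2 v y) (D2 v x) < \<epsilon>"
        using \<open>\<epsilon> > 0\<close> unfolding continuous_at_eps_delta by blast
      then show ?thesis using v by (intro exI[of _ d]) (auto simp: dist_norm)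
    qed
    from this[of 1] this[of \<i>] obtain d d' where d: "d > 0" "\<And>s. \<bar>s\<bar> < d \<Longrightarrow> \<bar>D2 1 (x + s *\<^sub>R 1) - D2 1 x\<bar> < \<epsilon>"
      and d': "d' > 0" "\<And>s. \<bar>s\<bar> < d' \<Longrightarrow> \<bar>D2 \<i> (x + s *\<^sub>R \<i>) - D2 \<i> x\<bar> < \<epsilon>" by auto
    show ?thesis
    proof (intro exI[of _ "min d d'"] conjI allI impI)
      fix r assume r: "0 < r \<and> r < min d d'"
      obtain s t s' t' where st: "\<bar>s\<bar> \<le> r" "\<bar>t\<bar> \<le> r" "\<bar>s'\<bar> \<le> r" "\<bar>t'\<bar> \<le> r" and
        q: "q r x = (D2 1 (x + s *\<^sub>R 1) + D2 1 (x + t *\<^sub>R 1) + D2 \<i> (x + s' *\<^sub>R \<i>) + D2 \<i> (x + t' *\<^sub>R \<i>)) / 8"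
        using sd[of r x] r by blast
      have "\<bar>D2 1 (x + s *\<^sub>R 1) - D2 1 x\<bar> < \<epsilon>" "\<bar>D2 1 (x + t *\<^sub>R 1) - D2 1 x\<bar> < \<epsilon>"
        "\<bar>D2 \<i> (x + s' *\<^sub>R \<i>) - D2 \<i> x\<bar> < \<epsilon>" "\<bar>D2 \<i> (x + t' *\<^sub>R \<i>) - D2 \<i> x\<bar> < \<epsilon>"
        using st r by (intro d(2) d'(2); simp)+
      moreover have "\<bar>a - A\<bar> < e \<Longrightarrow> \<bar>b - A\<bar> < e \<Longrightarrow> \<bar>c - B\<bar> < e \<Longrightarrow> \<bar>d - B\<bar> < e \<Longrightarrow> \<bar>(a + b + c + d) / 8 - (A + B) / 4\<bar> < e"
        for a b c d A B e :: real by (simp add: abs_less_iff field_simps)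
      ultimately show "\<bar>q r x - L x\<bar> < \<epsilon>" unfolding q L by blast
    qed (use d d' in auto)
  qed
  define rs where "rs n = r1 / (real n + 2)" for n
  have rs: "0 < rs n" "rs n < r1" for n using r1 by (auto simp: rs_def field_simps add_pos_nonneg)
  have rs0: "rs \<longlonglongrightarrow> 0" unfolding rs_def by real_asymp
  have qL: "(\<lambda>n. q (rs n) x) \<longlonglongrightarrow> L x" for x
  proof (rule LIMSEQ_I)
    fix \<epsilon> :: real assume "\<epsilon> > 0"
    then obtain d where d: "d > 0" "\<And>r. 0 < r \<Longrightarrow> r < d \<Longrightarrow> \<bar>q r x - L x\<bar> < \<epsilon>"
      using near[OF \<open>\<epsilon> > 0\<close>, of x] by (elim exE conjE) (rule_tac d=d in that; simp)
    obtain N where "\<And>n. n \<ge> N \<Longrightarrow> \<bar>rs n\<bar> < d" using LIMSEQ_D[OF rs0 d(1)] by auto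
    then show "\<exists>no. \<forall>n\<ge>no. norm (q (rs n) x - L x) < \<epsilon>" using d(2) rs by (intro exI[of _ N]) (auto simp: abs_less_iff)
  qed
  have \<eta>K1: "\<eta> (x + y) = 0" if "x \<notin> K1" "norm y \<le> r1" for x y
    using K1I[of "x + y" "- y"] that by (intro \<eta>K) auto
  have qK1: "q r x = 0" if "x \<notin> K1" "0 < r" "r \<le> r1" for x r
    using \<eta>K1[OF that(1), of "of_real r"] \<eta>K1[OF that(1), of "- of_real r"] \<eta>K1[OF that(1), of "\<i> * of_real r"]
      \<eta>K1[OF that(1), of "- (\<i> * of_real r)"] \<eta>K1[OF that(1), of 0] that
    by (simp add: q_def cross_mean_def norm_mult)
  have LK1: "L x = 0" if "x \<notin> K1" for x
  proof -
    have "(\<lambda>n. q (rs n) x) = (\<lambda>_. 0)" using qK1[OF that] rs by (auto simp: less_imp_le)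
    then show ?thesis using qL[of x] by (simp add: LIMSEQ_const_iff)
  qed
  \<comment> \<open>Contains the intermediate points of the Taylor remainders centred in
    \<open>K1\<close>; a bound for the second derivatives here gives the dominating
    function.\<close>
  define K2 where "K2 = (\<lambda>p. fst p + snd p) ` (K1 \<times> cball (0::complex) r1)"
  have K2c: "compact K2" unfolding K2_def
    by (intro compact_continuous_image compact_Times K1c compact_cball continuous_intros)
  have "\<exists>B. \<forall>x\<in>K2. \<bar>D2 v x\<bar> \<le> B" for v
    using compact_imp_bounded[OF compact_continuous_image[OF continuous_on_subset[OF cD2] K2c], of v] by (auto simp: bounded_iff)
  then obtain B B' where B: "\<And>x. x \<in> K2 \<Longrightarrow> \<bar>D2 1 x\<bar> \<le> B" "\<And>x. x \<in> K2 \<Longrightarrow> \<bar>D2 \<i> x\<bar> \<le> B'" by metis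
  have qb: "\<bar>q r x\<bar> \<le> \<bar>B\<bar> + \<bar>B'\<bar>" if xr: "x \<in> K1" "0 < r" "r \<le> r1" for x r
  proof -
    obtain s t s' t' where st: "\<bar>s\<bar> \<le> r" "\<bar>t\<bar> \<le> r" "\<bar>s'\<bar> \<le> r" "\<bar>t'\<bar> \<le> r" and
      q: "q r x = (D2 1 (x + s *\<^sub>R 1) + D2 1 (x + t *\<^sub>R 1) + D2 \<i> (x + s' *\<^sub>R \<i>) + D2 \<i> (x + t' *\<^sub>R \<i>)) / 8"
      using sd[OF xr(2), of x] by (elim exE conjE) (rule that; assumption)
    have i: "x + k *\<^sub>R v \<in> K2" if "\<bar>k\<bar> \<le> r" "norm v = 1" for k v
      unfolding K2_def using \<open>x \<in> K1\<close> \<open>r \<le> r1\<close> that by (intro rev_image_eqI[of "(x, k *\<^sub>R v)"]) auto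
    have "\<bar>D2 1 (x + s *\<^sub>R 1)\<bar> \<le> B" "\<bar>D2 1 (x + t *\<^sub>R 1)\<bar> \<le> B" "\<bar>D2 \<i> (x + s' *\<^sub>R \<i>)\<bar> \<le> B'" "\<bar>D2 \<i> (x + t' *\<^sub>R \<i>)\<bar> \<le> B'"
      using st by (intro B i; simp)+
    moreover have "\<bar>a\<bar> \<le> B \<Longrightarrow> \<bar>b\<bar> \<le> B \<Longrightarrow> \<bar>c\<bar> \<le> B' \<Longrightarrow> \<bar>d\<bar> \<le> B' \<Longrightarrow> \<bar>(a + b + c + d) / 8\<bar> \<le> \<bar>B\<bar> + \<bar>B'\<bar>"
      for a b c d B B' :: real by (simp add: abs_le_iff field_simps)
    ultimately show ?thesis unfolding q by blast
  qed
  have cq: "continuous_on UNIV (q r)" for r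
    unfolding q_def cross_mean_def divide_inverse
    by (intro continuous_intros continuous_on_compose2[OF c\<eta>[of UNIV]]) auto
  have lim: "(\<lambda>n. LINT x|lborel. U x * q (rs n) x) \<longlonglongrightarrow> (LINT x|lborel. U x * L x)"
  proof (rule integral_dominated_convergence[where w="\<lambda>x. \<bar>U x * (\<bar>B\<bar> + \<bar>B'\<bar>)\<bar>"])
    have cL: "continuous_on UNIV L" unfolding L by (intro continuous_intros cD2) auto
    show "(\<lambda>x. U x * L x) \<in> borel_measurable lborel" using intU[OF cL] by (rule borel_measurable_integrable)
    show "(\<lambda>x. U x * q (rs n) x) \<in> borel_measurable lborel" for n using intU[OF cq] by (rule borel_measurable_integrable)
    show "integrable lborel (\<lambda>x. \<bar>U x * (\<bar>B\<bar> + \<bar>B'\<bar>)\<bar>)" by (intro integrable_abs intU continuous_intros)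
    show "AE x in lborel. (\<lambda>n. U x * q (rs n) x) \<longlonglongrightarrow> U x * L x" by (intro AE_I2 tendsto_mult tendsto_const qL)
    show "AE x in lborel. norm (U x * q (rs n) x) \<le> \<bar>U x * (\<bar>B\<bar> + \<bar>B'\<bar>)\<bar>" for n
    proof (rule AE_I2)
      fix x show "norm (U x * q (rs n) x) \<le> \<bar>U x * (\<bar>B\<bar> + \<bar>B'\<bar>)\<bar>"
      proof (cases "x \<in> K1")
        case True
        from qb[OF this rs(1) less_imp_le[OF rs(2)]] show ?thesis by (auto simp: abs_mult intro!: mult_left_mono)
      qed (simp add: U_def)
    qed
  qed
  define W where "W x = \<eta> x * (indicator K x * w x)" for x
  have intW: "integrable lborel W"
  proof -
    have "integrable lborel (\<lambda>x. indicator K x *\<^sub>R (\<eta> x * w x))"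
      by (rule borel_integrable_compact[OF K(1)]) (intro continuous_intros cw c\<eta>)
    then show ?thesis by (simp add: W_def[abs_def] mult_ac)
  qed
  have int\<eta>: "integrable lborel \<eta>"
  proof -
    have "integrable lborel (\<lambda>x. indicator K x *\<^sub>R \<eta> x)"
      by (rule borel_integrable_compact[OF K(1)]) (intro c\<eta>)
    moreover have "(\<lambda>x. indicator K x *\<^sub>R \<eta> x) = \<eta>"
    proof
      fix x show "indicator K x *\<^sub>R \<eta> x = \<eta> x" by (cases "x \<in> K") (simp_all add: \<eta>K)
    qed
    ultimately show ?thesis by simp
  qed
  \<comment> \<open>Translation invariance carries the four shifts over to \<open>U\<close>. On the
    support of \<open>\<eta>\<close> the hypothesis \<open>mean\<close> then applies, and
    nonnegativity of \<open>\<eta>\<close> preserves its direction.\<close>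
  have ineq: "(LINT x|lborel. U x * q r x) \<ge> (LINT x|lborel. W x) - C * r * (LINT x|lborel. \<eta> x)" if r: "0 < r" "r < r1" for r
  proof -
    have shift: "(LINT x|lborel. U x * \<eta> (x + c)) = (LINT x|lborel. U (x - c) * \<eta> x)"
      and ishift: "integrable lborel (\<lambda>x. U (x - c) * \<eta> x)" for c
    proof -
      have i: "integrable lborel (\<lambda>x. U x * \<eta> (x + c))"
        by (intro intU continuous_on_compose2[OF c\<eta>[of UNIV]] continuous_intros) auto
      from integral_translation[OF borel_measurable_integrable[OF i, simplified], of "-c"]
      show "(LINT x|lborel. U x * \<eta> (x + c)) = (LINT x|lborel. U (x - c) * \<eta> x)" by simp
      from integrable_translation[OF i, of "-c"] show "integrable lborel (\<lambda>x. U (x - c) * \<eta> x)" by simp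
    qed
    have i\<eta>: "integrable lborel (\<lambda>x. U x * \<eta> (x + c))" for c
      by (intro intU continuous_on_compose2[OF c\<eta>[of UNIV]] continuous_intros) auto
    let ?r = "complex_of_real r" and ?i = "\<i> * complex_of_real r"
    have e1: "U x * q r x = (1 / (4 * r\<^sup>2)) * ((U x * \<eta> (x + ?r) + U x * \<eta> (x + (- ?r))) + (U x * \<eta> (x + ?i) + U x * \<eta> (x + (- ?i))) - 4 * (U x * \<eta> (x + 0)))" for x
      using r by (simp add: q_def cross_mean_def field_simps)
    have "(LINT x|lborel. U x * q r x) = (1 / (4 * r\<^sup>2)) * (((LINT x|lborel. U x * \<eta> (x + ?r)) + (LINT x|lborel. U x * \<eta> (x + (- ?r))))
        + ((LINT x|lborel. U x * \<eta> (x + ?i)) + (LINT x|lborel. U x * \<eta> (x + (- ?i)))) - 4 * (LINT x|lborel. U x * \<eta> (x + 0)))"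
      unfolding e1 integral_mult_right_zero
      by (subst Bochner_Integration.integral_diff Bochner_Integration.integral_add,
          (intro Bochner_Integration.integrable_add Bochner_Integration.integrable_diff integrable_mult_right i\<eta>)+)+
        (simp only: integral_mult_right_zero)
    also have "\<dots> = (1 / (4 * r\<^sup>2)) * (((LINT x|lborel. U (x - ?r) * \<eta> x) + (LINT x|lborel. U (x - (- ?r)) * \<eta> x))
        + ((LINT x|lborel. U (x - ?i) * \<eta> x) + (LINT x|lborel. U (x - (- ?i)) * \<eta> x)) - 4 * (LINT x|lborel. U (x - 0) * \<eta> x))"
      unfolding shift ..
    also have "\<dots> = (LINT x|lborel. (1 / (4 * r\<^sup>2)) * ((U (x - ?r) * \<eta> x + U (x - (- ?r)) * \<eta> x) + (U (x - ?i) * \<eta> x + U (x - (- ?i)) * \<eta> x) - 4 * (U (x - 0) * \<eta> x)))"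
      unfolding integral_mult_right_zero
      by (subst Bochner_Integration.integral_diff Bochner_Integration.integral_add,
          (intro Bochner_Integration.integrable_add Bochner_Integration.integrable_diff integrable_mult_right ishift)+)+
        (simp only: integral_mult_right_zero)
    finally have e2: "(LINT x|lborel. U x * q r x) = \<dots>" .
    have "(LINT x|lborel. W x - C * r * \<eta> x) \<le> (LINT x|lborel. (1 / (4 * r\<^sup>2)) * ((U (x - ?r) * \<eta> x + U (x - (- ?r)) * \<eta> x) + (U (x - ?i) * \<eta> x + U (x - (- ?i)) * \<eta> x) - 4 * (U (x - 0) * \<eta> x)))"
    proof (rule integral_mono)
      show "integrable lborel (\<lambda>x. W x - C * r * \<eta> x)"
        by (intro Bochner_Integration.integrable_diff integrable_mult_right intW int\<eta>)
      show "integrable lborel (\<lambda>x. (1 / (4 * r\<^sup>2)) * ((U (x - ?r) * \<eta> x + U (x - (- ?r)) * \<eta> x) + (U (x - ?i) * \<eta> x + U (x - (- ?i)) * \<eta> x) - 4 * (U (x - 0) * \<eta> x)))"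
        by (intro integrable_mult_right Bochner_Integration.integrable_diff Bochner_Integration.integrable_add ishift)
      fix x
      show "W x - C * r * \<eta> x \<le> (1 / (4 * r\<^sup>2)) * ((U (x - ?r) * \<eta> x + U (x - (- ?r)) * \<eta> x) + (U (x - ?i) * \<eta> x + U (x - (- ?i)) * \<eta> x) - 4 * (U (x - 0) * \<eta> x))"
      proof (cases "x \<in> K")
        case True
        have Uu: "U (x + y) = u (x + y)" if "norm y \<le> r1" for y using K1I[OF True that] by (simp add: U_def)
        have "u x + r\<^sup>2 * w x - C * r ^ 3 \<le> cross_mean u x r" using C[OF True] r r1 by simp
        then have "(r\<^sup>2 * w x - C * r ^ 3) / r\<^sup>2 \<le> (cross_mean u x r - u x) / r\<^sup>2" by (intro divide_right_mono) auto
        moreover have "(r\<^sup>2 * w x - C * r ^ 3) / r\<^sup>2 = w x - C * r" using r by (simp add: power2_eq_square power3_eq_cube diff_divide_distrib)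
        ultimately have "\<eta> x * (w x - C * r) \<le> \<eta> x * ((cross_mean u x r - u x) / r\<^sup>2)"
          using \<eta>0[of x] by (intro mult_left_mono) auto
        moreover have "U (x - ?r) = u (x - ?r)" "U (x - (- ?r)) = u (x + ?r)" "U (x - ?i) = u (x - ?i)" "U (x - (- ?i)) = u (x + ?i)" "U (x - 0) = u x"
          using Uu[of "- ?r"] Uu[of ?r] Uu[of "- ?i"] Uu[of ?i] Uu[of 0] r r1 by (simp_all add: norm_mult)
        ultimately show ?thesis using True r
          by (simp add: W_def cross_mean_def field_simps)
      qed (simp add: \<eta>K W_def)
    qed
    then show ?thesis unfolding e2 using intW int\<eta> by (simp add: Bochner_Integration.integral_diff)
  qed
  have "(LINT x|lborel. W x) - C * 0 * (LINT x|lborel. \<eta> x) \<le> (LINT x|lborel. U x * L x)"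
  proof (rule LIMSEQ_le[OF _ lim])
    show "(\<lambda>n. (LINT x|lborel. W x) - C * rs n * (LINT x|lborel. \<eta> x)) \<longlonglongrightarrow> (LINT x|lborel. W x) - C * 0 * (LINT x|lborel. \<eta> x)"
      by (intro tendsto_intros rs0)
    show "\<exists>N. \<forall>n\<ge>N. (LINT x|lborel. W x) - C * rs n * (LINT x|lborel. \<eta> x) \<le> (LINT x|lborel. U x * q (rs n) x)"
      using ineq rs by blast
  qed
  moreover have "(LINT \<zeta>:V|lborel. w \<zeta> * \<eta> \<zeta>) = (LINT x|lborel. W x)"
    unfolding set_lebesgue_integral_def
    by (rule Bochner_Integration.integral_cong) (use K \<eta>K in \<open>auto simp: W_def indicator_def\<close>)
  moreover have "(LINT \<zeta>:V|lborel. u \<zeta> * L \<zeta>) = (LINT x|lborel. U x * L x)"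
    unfolding set_lebesgue_integral_def
    by (rule Bochner_Integration.integral_cong) (use K1V LK1 in \<open>auto simp: U_def indicator_def\<close>)
  ultimately show "(LINT \<zeta>:V|lborel. w \<zeta> * \<eta> \<zeta>) \<le> (LINT \<zeta>:V|lborel. u \<zeta> * Re (d_z (d_zbar (\<lambda>x. complex_of_real (\<eta> x))) \<zeta>))"
    unfolding L_def by simp
qed

section \<open>Second-order expansions of families\<close>

text \<open>The index runs through a family of discs, and both the constant and the radius serve the
  whole family. This is the uniformity in the base point that \<open>ddbar_ge_distrI\<close> asks
  for.\<close>

definition bigO_unif :: "'i set \<Rightarrow> nat \<Rightarrow> ('i \<Rightarrow> complex \<Rightarrow> complex) \<Rightarrow> bool" where
  "bigO_unif I k f \<longleftrightarrow> (\<exists>C r0. C \<ge> 0 \<and> r0 > 0 \<and> (\<forall>i\<in>I. \<forall>\<zeta>. cmod \<zeta> \<le> r0 \<longrightarrow> cmod (f i \<zeta>) \<le> C * cmod \<zeta> ^ k))"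

lemma bigO_unifI:
  assumes "C \<ge> 0" "r0 > 0" "\<And>i \<zeta>. i \<in> I \<Longrightarrow> cmod \<zeta> \<le> r0 \<Longrightarrow> cmod (f i \<zeta>) \<le> C * cmod \<zeta> ^ k"
  shows "bigO_unif I k f"
  unfolding bigO_unif_def using assms by blast

lemma bigO_unif_le:
  assumes f: "bigO_unif I k f" and le: "\<exists>r1>0. \<forall>i\<in>I. \<forall>\<zeta>. cmod \<zeta> \<le> r1 \<longrightarrow> cmod (g i \<zeta>) \<le> B * cmod (f i \<zeta>)"
  shows "bigO_unif I k g"
proof -
  obtain C r0 where C: "C \<ge> 0" "r0 > 0" "\<And>i \<zeta>. i \<in> I \<Longrightarrow> cmod \<zeta> \<le> r0 \<Longrightarrow> cmod (f i \<zeta>) \<le> C * cmod \<zeta> ^ k"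
    using f unfolding bigO_unif_def by blast
  obtain r1 where r1: "r1 > 0" "\<And>i \<zeta>. i \<in> I \<Longrightarrow> cmod \<zeta> \<le> r1 \<Longrightarrow> cmod (g i \<zeta>) \<le> B * cmod (f i \<zeta>)"
    using le by blast
  show ?thesis
  proof (rule bigO_unifI[of "\<bar>B\<bar> * C" "min r0 r1"])
    fix i \<zeta> assume i: "i \<in> I" and z: "cmod \<zeta> \<le> min r0 r1"
    have "cmod (g i \<zeta>) \<le> B * cmod (f i \<zeta>)" using r1 i z by simp
    also have "\<dots> \<le> \<bar>B\<bar> * cmod (f i \<zeta>)" by (intro mult_right_mono) auto
    also have "\<dots> \<le> \<bar>B\<bar> * (C * cmod \<zeta> ^ k)" using C(3)[OF i] z by (intro mult_left_mono) auto
    finally show "cmod (g i \<zeta>) \<le> \<bar>B\<bar> * C * cmod \<zeta> ^ k" by (simp add: mult.assoc)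
  qed (use C r1 in auto)
qed

lemma bigO_unif_cong:
  assumes "bigO_unif I k f" "\<And>i \<zeta>. i \<in> I \<Longrightarrow> f i \<zeta> = g i \<zeta>"
  shows "bigO_unif I k g"
  by (rule bigO_unif_le[OF assms(1), where B=1]) (use assms(2) in \<open>auto intro!: exI[of _ 1]\<close>)

lemma bigO_unif_add:
  assumes "bigO_unif I k f" "bigO_unif I k g"
  shows "bigO_unif I k (\<lambda>i \<zeta>. f i \<zeta> + g i \<zeta>)"
proof -
  obtain C r0 where C: "C \<ge> 0" "r0 > 0" "\<And>i \<zeta>. i \<in> I \<Longrightarrow> cmod \<zeta> \<le> r0 \<Longrightarrow> cmod (f i \<zeta>) \<le> C * cmod \<zeta> ^ k"
    using assms(1) unfolding bigO_unif_def by blast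
  obtain D r1 where D: "D \<ge> 0" "r1 > 0" "\<And>i \<zeta>. i \<in> I \<Longrightarrow> cmod \<zeta> \<le> r1 \<Longrightarrow> cmod (g i \<zeta>) \<le> D * cmod \<zeta> ^ k"
    using assms(2) unfolding bigO_unif_def by blast
  show ?thesis
  proof (rule bigO_unifI[of "C + D" "min r0 r1"])
    fix i \<zeta> assume i: "i \<in> I" and z: "cmod \<zeta> \<le> min r0 r1"
    have "cmod (f i \<zeta> + g i \<zeta>) \<le> cmod (f i \<zeta>) + cmod (g i \<zeta>)" by (rule norm_triangle_ineq)
    also have "\<dots> \<le> C * cmod \<zeta> ^ k + D * cmod \<zeta> ^ k" using C(3)[OF i] D(3)[OF i] z by (intro add_mono) auto
    finally show "cmod (f i \<zeta> + g i \<zeta>) \<le> (C + D) * cmod \<zeta> ^ k" by (simp add: algebra_simps)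
  qed (use C D in auto)
qed

lemma bigO_unif_mult:
  assumes "bigO_unif I k f" "bigO_unif I l g"
  shows "bigO_unif I (k + l) (\<lambda>i \<zeta>. f i \<zeta> * g i \<zeta>)"
proof -
  obtain C r0 where C: "C \<ge> 0" "r0 > 0" "\<And>i \<zeta>. i \<in> I \<Longrightarrow> cmod \<zeta> \<le> r0 \<Longrightarrow> cmod (f i \<zeta>) \<le> C * cmod \<zeta> ^ k"
    using assms(1) unfolding bigO_unif_def by blast
  obtain D r1 where D: "D \<ge> 0" "r1 > 0" "\<And>i \<zeta>. i \<in> I \<Longrightarrow> cmod \<zeta> \<le> r1 \<Longrightarrow> cmod (g i \<zeta>) \<le> D * cmod \<zeta> ^ l"
    using assms(2) unfolding bigO_unif_def by blast
  show ?thesis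
  proof (rule bigO_unifI[of "C * D" "min r0 r1"])
    fix i \<zeta> assume i: "i \<in> I" and z: "cmod \<zeta> \<le> min r0 r1"
    have "cmod (f i \<zeta> * g i \<zeta>) \<le> (C * cmod \<zeta> ^ k) * (D * cmod \<zeta> ^ l)"
      unfolding norm_mult using C D i z by (intro mult_mono) auto
    then show "cmod (f i \<zeta> * g i \<zeta>) \<le> C * D * cmod \<zeta> ^ (k + l)" by (simp add: power_add mult_ac)
  qed (use C D in auto)
qed

lemma bigO_unif_mono:
  assumes "bigO_unif I k f" "l \<le> k"
  shows "bigO_unif I l f"
proof -
  obtain C r0 where C: "C \<ge> 0" "r0 > 0" "\<And>i \<zeta>. i \<in> I \<Longrightarrow> cmod \<zeta> \<le> r0 \<Longrightarrow> cmod (f i \<zeta>) \<le> C * cmod \<zeta> ^ k"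
    using assms(1) unfolding bigO_unif_def by blast
  show ?thesis
  proof (rule bigO_unifI[of C "min r0 1"])
    fix i \<zeta> assume i: "i \<in> I" and z: "cmod \<zeta> \<le> min r0 1"
    have "cmod (f i \<zeta>) \<le> C * cmod \<zeta> ^ k" using C(3)[OF i] z by simp
    also have "\<dots> \<le> C * cmod \<zeta> ^ l" using z C(1) assms(2) by (intro mult_left_mono power_decreasing) auto
    finally show "cmod (f i \<zeta>) \<le> C * cmod \<zeta> ^ l" .
  qed (use C in auto)
qed

lemma bigO_unif_zero: "bigO_unif I k (\<lambda>i \<zeta>. 0)"
  by (rule bigO_unifI[of 0 1]) auto

lemma bigO_unif_id: "bigO_unif I (Suc 0) (\<lambda>i \<zeta>. \<zeta>)"
  by (rule bigO_unifI[of 1 1]) auto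

lemma bigO_unif_cnj: "bigO_unif I k f \<Longrightarrow> bigO_unif I k (\<lambda>i \<zeta>. cnj (f i \<zeta>))"
  by (simp add: bigO_unif_def)

abbreviation "ubounded I c \<equiv> bigO_unif I 0 (\<lambda>i \<zeta>. c i)"

lemma uboundedI: "(\<And>i. i \<in> I \<Longrightarrow> cmod (c i) \<le> B) \<Longrightarrow> ubounded I c"
  by (rule bigO_unifI[of "\<bar>B\<bar>" 1]) (auto intro: order_trans[OF _ abs_ge_self])

lemma ubounded_mult: "ubounded I c \<Longrightarrow> ubounded I d \<Longrightarrow> ubounded I (\<lambda>i. c i * d i)"
  using bigO_unif_mult[of I 0 "\<lambda>i \<zeta>. c i" 0 "\<lambda>i \<zeta>. d i"] by simp

lemma bigO_unif_cmult: "ubounded I c \<Longrightarrow> bigO_unif I k f \<Longrightarrow> bigO_unif I k (\<lambda>i \<zeta>. c i * f i \<zeta>)"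
  using bigO_unif_mult[of I 0 "\<lambda>i \<zeta>. c i" k f] by simp

text \<open>The coefficients of \<open>\<zeta>\<close>, \<open>cnj \<zeta>\<close> and \<open>\<zeta> * cnj \<zeta>\<close> are \<open>A\<close>, \<open>A'\<close> and \<open>E\<close>; those of \<open>\<zeta>\<^sup>2\<close> and
  \<open>(cnj \<zeta>)\<^sup>2\<close> do not contribute to four-point means and stay anonymous.\<close>

definition has_jet :: "'i set \<Rightarrow> ('i \<Rightarrow> complex \<Rightarrow> complex) \<Rightarrow> ('i \<Rightarrow> complex) \<Rightarrow> ('i \<Rightarrow> complex) \<Rightarrow> ('i \<Rightarrow> complex) \<Rightarrow> ('i \<Rightarrow> complex) \<Rightarrow> bool" where
  "has_jet I u u0 A A' E \<longleftrightarrow> ubounded I u0 \<and> ubounded I A \<and> ubounded I A' \<and> ubounded I E \<and>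
     (\<exists>B B'. ubounded I B \<and> ubounded I B' \<and>
       bigO_unif I 3 (\<lambda>i \<zeta>. u i \<zeta> - (u0 i + (A i * \<zeta> + A' i * cnj \<zeta>) + (B i * \<zeta>\<^sup>2 + E i * (\<zeta> * cnj \<zeta>) + B' i * (cnj \<zeta>)\<^sup>2))))"

section \<open>Calculus of second-order jets\<close>

lemma has_jet_const: "ubounded I c \<Longrightarrow> has_jet I (\<lambda>i \<zeta>. c i) c (\<lambda>_. 0) (\<lambda>_. 0) (\<lambda>_. 0)"
  unfolding has_jet_def by (auto intro!: bigO_unif_zero exI[of _ "\<lambda>_. 0"])

lemma has_jet_cong:
  assumes "has_jet I u u0 A A' E" "\<And>i \<zeta>. i \<in> I \<Longrightarrow> u i \<zeta> = v i \<zeta>" "\<And>i. i \<in> I \<Longrightarrow> u0 i = v0 i"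
    "\<And>i. i \<in> I \<Longrightarrow> A i = F i" "\<And>i. i \<in> I \<Longrightarrow> A' i = F' i" "\<And>i. i \<in> I \<Longrightarrow> E i = G i"
  shows "has_jet I v v0 F F' G"
proof -
  obtain B B' where *: "ubounded I u0" "ubounded I A" "ubounded I A'" "ubounded I E" "ubounded I B" "ubounded I B'"
    "bigO_unif I 3 (\<lambda>i \<zeta>. u i \<zeta> - (u0 i + (A i * \<zeta> + A' i * cnj \<zeta>) + (B i * \<zeta>\<^sup>2 + E i * (\<zeta> * cnj \<zeta>) + B' i * (cnj \<zeta>)\<^sup>2)))"
    using assms(1) unfolding has_jet_def by blast
  have "ubounded I v0" "ubounded I F" "ubounded I F'" "ubounded I G"
    by (rule bigO_unif_cong[OF *(1)] bigO_unif_cong[OF *(2)] bigO_unif_cong[OF *(3)] bigO_unif_cong[OF *(4)], simp add: assms)+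
  moreover have "bigO_unif I 3 (\<lambda>i \<zeta>. v i \<zeta> - (v0 i + (F i * \<zeta> + F' i * cnj \<zeta>) + (B i * \<zeta>\<^sup>2 + G i * (\<zeta> * cnj \<zeta>) + B' i * (cnj \<zeta>)\<^sup>2)))"
    by (rule bigO_unif_cong[OF *(7)]) (simp add: assms)
  ultimately show ?thesis unfolding has_jet_def using *(5,6) by blast
qed

lemma has_jet_perturb:
  assumes "has_jet I u u0 A A' E" "bigO_unif I 3 (\<lambda>i \<zeta>. v i \<zeta> - u i \<zeta>)"
  shows "has_jet I v u0 A A' E"
proof -
  obtain B B' where *: "ubounded I u0" "ubounded I A" "ubounded I A'" "ubounded I E" "ubounded I B" "ubounded I B'"
    "bigO_unif I 3 (\<lambda>i \<zeta>. u i \<zeta> - (u0 i + (A i * \<zeta> + A' i * cnj \<zeta>) + (B i * \<zeta>\<^sup>2 + E i * (\<zeta> * cnj \<zeta>) + B' i * (cnj \<zeta>)\<^sup>2)))"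
    using assms(1) unfolding has_jet_def by blast
  have "bigO_unif I 3 (\<lambda>i \<zeta>. v i \<zeta> - (u0 i + (A i * \<zeta> + A' i * cnj \<zeta>) + (B i * \<zeta>\<^sup>2 + E i * (\<zeta> * cnj \<zeta>) + B' i * (cnj \<zeta>)\<^sup>2)))"
    by (rule bigO_unif_cong[OF bigO_unif_add[OF *(7) assms(2)]]) simp
  with * show ?thesis unfolding has_jet_def by blast
qed

lemma has_jet_add:
  assumes "has_jet I u u0 A A' E" "has_jet I v v0 F F' G"
  shows "has_jet I (\<lambda>i \<zeta>. u i \<zeta> + v i \<zeta>) (\<lambda>i. u0 i + v0 i) (\<lambda>i. A i + F i) (\<lambda>i. A' i + F' i) (\<lambda>i. E i + G i)"
proof -
  obtain B B' where *: "ubounded I u0" "ubounded I A" "ubounded I A'" "ubounded I E" "ubounded I B" "ubounded I B'"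
    "bigO_unif I 3 (\<lambda>i \<zeta>. u i \<zeta> - (u0 i + (A i * \<zeta> + A' i * cnj \<zeta>) + (B i * \<zeta>\<^sup>2 + E i * (\<zeta> * cnj \<zeta>) + B' i * (cnj \<zeta>)\<^sup>2)))"
    using assms(1) unfolding has_jet_def by blast
  obtain H H' where **: "ubounded I v0" "ubounded I F" "ubounded I F'" "ubounded I G" "ubounded I H" "ubounded I H'"
    "bigO_unif I 3 (\<lambda>i \<zeta>. v i \<zeta> - (v0 i + (F i * \<zeta> + F' i * cnj \<zeta>) + (H i * \<zeta>\<^sup>2 + G i * (\<zeta> * cnj \<zeta>) + H' i * (cnj \<zeta>)\<^sup>2)))"
    using assms(2) unfolding has_jet_def by blast
  have "bigO_unif I 3 (\<lambda>i \<zeta>. u i \<zeta> + v i \<zeta> - (u0 i + v0 i + ((A i + F i) * \<zeta> + (A' i + F' i) * cnj \<zeta>) + ((B i + H i) * \<zeta>\<^sup>2 + (E i + G i) * (\<zeta> * cnj \<zeta>) + (B' i + H' i) * (cnj \<zeta>)\<^sup>2)))"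
    by (rule bigO_unif_cong[OF bigO_unif_add[OF *(7) **(7)]]) (simp add: algebra_simps)
  then show ?thesis unfolding has_jet_def using * ** by (intro conjI exI[of _ "\<lambda>i. B i + H i"] exI[of _ "\<lambda>i. B' i + H' i"] bigO_unif_add)
qed

lemma has_jet_sum:
  assumes "finite J" "\<And>j. j \<in> J \<Longrightarrow> has_jet I (u j) (u0 j) (A j) (A' j) (E j)"
  shows "has_jet I (\<lambda>i \<zeta>. \<Sum>j\<in>J. u j i \<zeta>) (\<lambda>i. \<Sum>j\<in>J. u0 j i) (\<lambda>i. \<Sum>j\<in>J. A j i) (\<lambda>i. \<Sum>j\<in>J. A' j i) (\<lambda>i. \<Sum>j\<in>J. E j i)"
  using assms
proof (induction J rule: finite_induct)
  case empty
  then show ?case using has_jet_const[OF bigO_unif_zero] by simp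
next
  case (insert x J)
  then show ?case using has_jet_add[of I "u x" "u0 x" "A x" "A' x" "E x"] by simp
qed

lemma has_jet_cnj:
  assumes "has_jet I u u0 A A' E"
  shows "has_jet I (\<lambda>i \<zeta>. cnj (u i \<zeta>)) (\<lambda>i. cnj (u0 i)) (\<lambda>i. cnj (A' i)) (\<lambda>i. cnj (A i)) (\<lambda>i. cnj (E i))"
proof -
  obtain B B' where *: "ubounded I u0" "ubounded I A" "ubounded I A'" "ubounded I E" "ubounded I B" "ubounded I B'"
    "bigO_unif I 3 (\<lambda>i \<zeta>. u i \<zeta> - (u0 i + (A i * \<zeta> + A' i * cnj \<zeta>) + (B i * \<zeta>\<^sup>2 + E i * (\<zeta> * cnj \<zeta>) + B' i * (cnj \<zeta>)\<^sup>2)))"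
    using assms(1) unfolding has_jet_def by blast
  have "bigO_unif I 3 (\<lambda>i \<zeta>. cnj (u i \<zeta>) - (cnj (u0 i) + (cnj (A' i) * \<zeta> + cnj (A i) * cnj \<zeta>) + (cnj (B' i) * \<zeta>\<^sup>2 + cnj (E i) * (\<zeta> * cnj \<zeta>) + cnj (B i) * (cnj \<zeta>)\<^sup>2)))"
    by (rule bigO_unif_cong[OF bigO_unif_cnj[OF *(7)]]) (simp add: algebra_simps)
  then show ?thesis unfolding has_jet_def using *
    by (intro conjI exI[of _ "\<lambda>i. cnj (B i)"] exI[of _ "\<lambda>i. cnj (B' i)"] bigO_unif_cnj)
qed

lemma has_jet_mult:
  assumes "has_jet I u u0 A A' E" "has_jet I v v0 F F' G"
  shows "has_jet I (\<lambda>i \<zeta>. u i \<zeta> * v i \<zeta>) (\<lambda>i. u0 i * v0 i) (\<lambda>i. u0 i * F i + v0 i * A i)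
    (\<lambda>i. u0 i * F' i + v0 i * A' i) (\<lambda>i. u0 i * G i + v0 i * E i + (A i * F' i + A' i * F i))"
proof -
  obtain B B' where *: "ubounded I u0" "ubounded I A" "ubounded I A'" "ubounded I E" "ubounded I B" "ubounded I B'"
    "bigO_unif I 3 (\<lambda>i \<zeta>. u i \<zeta> - (u0 i + (A i * \<zeta> + A' i * cnj \<zeta>) + (B i * \<zeta>\<^sup>2 + E i * (\<zeta> * cnj \<zeta>) + B' i * (cnj \<zeta>)\<^sup>2)))"
    using assms(1) unfolding has_jet_def by blast
  obtain H H' where **: "ubounded I v0" "ubounded I F" "ubounded I F'" "ubounded I G" "ubounded I H" "ubounded I H'"
    "bigO_unif I 3 (\<lambda>i \<zeta>. v i \<zeta> - (v0 i + (F i * \<zeta> + F' i * cnj \<zeta>) + (H i * \<zeta>\<^sup>2 + G i * (\<zeta> * cnj \<zeta>) + H' i * (cnj \<zeta>)\<^sup>2)))"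
    using assms(2) unfolding has_jet_def by blast
  define L M where "L i \<zeta> = A i * \<zeta> + A' i * cnj \<zeta>" and "M i \<zeta> = F i * \<zeta> + F' i * cnj \<zeta>" for i \<zeta>
  define Q S where "Q i \<zeta> = B i * \<zeta>\<^sup>2 + E i * (\<zeta> * cnj \<zeta>) + B' i * (cnj \<zeta>)\<^sup>2"
    and "S i \<zeta> = H i * \<zeta>\<^sup>2 + G i * (\<zeta> * cnj \<zeta>) + H' i * (cnj \<zeta>)\<^sup>2" for i \<zeta>
  define R where "R i \<zeta> = u i \<zeta> - (u0 i + L i \<zeta> + Q i \<zeta>)" for i \<zeta>
  define T where "T i \<zeta> = v i \<zeta> - (v0 i + M i \<zeta> + S i \<zeta>)" for i \<zeta>
  have R: "bigO_unif I 3 R" using *(7) by (simp add: R_def[abs_def] L_def Q_def)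
  have T: "bigO_unif I 3 T" using **(7) by (simp add: T_def[abs_def] M_def S_def)
  have z2: "bigO_unif I 2 (\<lambda>i \<zeta>. \<zeta>\<^sup>2)" "bigO_unif I 2 (\<lambda>i \<zeta>. (cnj \<zeta>)\<^sup>2)" "bigO_unif I 2 (\<lambda>i \<zeta>. \<zeta> * cnj \<zeta>)"
    using bigO_unif_mult[OF bigO_unif_id bigO_unif_id, of I] bigO_unif_mult[OF bigO_unif_cnj[OF bigO_unif_id] bigO_unif_cnj[OF bigO_unif_id], of I]
      bigO_unif_mult[OF bigO_unif_id bigO_unif_cnj[OF bigO_unif_id], of I] by (simp_all add: power2_eq_square numeral_2_eq_2)
  have L1: "bigO_unif I 1 L" "bigO_unif I 1 M" unfolding L_def[abs_def] M_def[abs_def] One_nat_def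
    by (intro bigO_unif_add bigO_unif_cmult bigO_unif_id bigO_unif_cnj * **)+
  have Q2: "bigO_unif I 2 Q" "bigO_unif I 2 S" unfolding Q_def[abs_def] S_def[abs_def]
    by (intro bigO_unif_add bigO_unif_cmult z2 * **)+
  have LL: "bigO_unif I 3 (\<lambda>i \<zeta>. L i \<zeta> * S i \<zeta>)" "bigO_unif I 3 (\<lambda>i \<zeta>. Q i \<zeta> * M i \<zeta>)"
    using bigO_unif_mult[OF L1(1) Q2(2)] bigO_unif_mult[OF Q2(1) L1(2)] by (simp_all add: eval_nat_numeral)
  have QQ: "bigO_unif I 3 (\<lambda>i \<zeta>. Q i \<zeta> * S i \<zeta>)"
    using bigO_unif_mono[OF bigO_unif_mult[OF Q2(1) Q2(2)], of 3] by simp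
  have pu: "bigO_unif I 0 (\<lambda>i \<zeta>. u0 i + L i \<zeta> + Q i \<zeta>)" "bigO_unif I 0 (\<lambda>i \<zeta>. v0 i + M i \<zeta> + S i \<zeta>)"
    using bigO_unif_mono[OF L1(1), of 0] bigO_unif_mono[OF L1(2), of 0] bigO_unif_mono[OF Q2(1), of 0] bigO_unif_mono[OF Q2(2), of 0]
    by (intro bigO_unif_add * **; simp)+
  have RR: "bigO_unif I 3 (\<lambda>i \<zeta>. (u0 i + L i \<zeta> + Q i \<zeta>) * T i \<zeta>)" "bigO_unif I 3 (\<lambda>i \<zeta>. R i \<zeta> * (v0 i + M i \<zeta> + S i \<zeta>))"
    using bigO_unif_mult[OF pu(1) T] bigO_unif_mult[OF R pu(2)] by simp_all
  have RT: "bigO_unif I 3 (\<lambda>i \<zeta>. R i \<zeta> * T i \<zeta>)" using bigO_unif_mono[OF bigO_unif_mult[OF R T], of 3] by simp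
  let ?B = "\<lambda>i. u0 i * H i + v0 i * B i + A i * F i"
  let ?B' = "\<lambda>i. u0 i * H' i + v0 i * B' i + A' i * F' i"
  have "bigO_unif I 3 (\<lambda>i \<zeta>. u i \<zeta> * v i \<zeta> - (u0 i * v0 i + ((u0 i * F i + v0 i * A i) * \<zeta> + (u0 i * F' i + v0 i * A' i) * cnj \<zeta>) +
      (?B i * \<zeta>\<^sup>2 + (u0 i * G i + v0 i * E i + (A i * F' i + A' i * F i)) * (\<zeta> * cnj \<zeta>) + ?B' i * (cnj \<zeta>)\<^sup>2)))"
  proof (rule bigO_unif_cong[OF bigO_unif_add[OF bigO_unif_add[OF bigO_unif_add[OF LL] QQ] bigO_unif_add[OF bigO_unif_add[OF RR] RT]]])
    fix i \<zeta>
    have u: "u i \<zeta> = u0 i + L i \<zeta> + Q i \<zeta> + R i \<zeta>" and v: "v i \<zeta> = v0 i + M i \<zeta> + S i \<zeta> + T i \<zeta>" by (simp_all add: R_def T_def)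
    show "L i \<zeta> * S i \<zeta> + Q i \<zeta> * M i \<zeta> + Q i \<zeta> * S i \<zeta> + ((u0 i + L i \<zeta> + Q i \<zeta>) * T i \<zeta> + R i \<zeta> * (v0 i + M i \<zeta> + S i \<zeta>) + R i \<zeta> * T i \<zeta>)
      = u i \<zeta> * v i \<zeta> - (u0 i * v0 i + ((u0 i * F i + v0 i * A i) * \<zeta> + (u0 i * F' i + v0 i * A' i) * cnj \<zeta>) +
      (?B i * \<zeta>\<^sup>2 + (u0 i * G i + v0 i * E i + (A i * F' i + A' i * F i)) * (\<zeta> * cnj \<zeta>) + ?B' i * (cnj \<zeta>)\<^sup>2))"
      unfolding u v by (simp add: L_def M_def Q_def S_def algebra_simps power2_eq_square)
  qed
  then show ?thesis unfolding has_jet_def using * **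
    by (intro conjI exI[of _ ?B] exI[of _ ?B'] bigO_unif_add ubounded_mult)
qed

lemma has_jet_cmult:
  assumes "ubounded I c" "has_jet I u u0 A A' E"
  shows "has_jet I (\<lambda>i \<zeta>. c i * u i \<zeta>) (\<lambda>i. c i * u0 i) (\<lambda>i. c i * A i) (\<lambda>i. c i * A' i) (\<lambda>i. c i * E i)"
  using has_jet_mult[OF has_jet_const[OF assms(1)] assms(2)] by simp

lemma has_jet_vanishing:
  assumes "has_jet I u u0 A A' E" "\<And>i. i \<in> I \<Longrightarrow> u0 i = 0"
  shows "bigO_unif I 1 u"
proof -
  obtain B B' where *: "ubounded I u0" "ubounded I A" "ubounded I A'" "ubounded I E" "ubounded I B" "ubounded I B'"
    "bigO_unif I 3 (\<lambda>i \<zeta>. u i \<zeta> - (u0 i + (A i * \<zeta> + A' i * cnj \<zeta>) + (B i * \<zeta>\<^sup>2 + E i * (\<zeta> * cnj \<zeta>) + B' i * (cnj \<zeta>)\<^sup>2)))"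
    using assms(1) unfolding has_jet_def by blast
  have z2: "bigO_unif I 2 (\<lambda>i \<zeta>. \<zeta>\<^sup>2)" "bigO_unif I 2 (\<lambda>i \<zeta>. (cnj \<zeta>)\<^sup>2)" "bigO_unif I 2 (\<lambda>i \<zeta>. \<zeta> * cnj \<zeta>)"
    using bigO_unif_mult[OF bigO_unif_id bigO_unif_id, of I] bigO_unif_mult[OF bigO_unif_cnj[OF bigO_unif_id] bigO_unif_cnj[OF bigO_unif_id], of I]
      bigO_unif_mult[OF bigO_unif_id bigO_unif_cnj[OF bigO_unif_id], of I] by (simp_all add: power2_eq_square numeral_2_eq_2)
  have L: "bigO_unif I 1 (\<lambda>i \<zeta>. A i * \<zeta> + A' i * cnj \<zeta>)" unfolding One_nat_def
    by (intro bigO_unif_add bigO_unif_cmult bigO_unif_id bigO_unif_cnj *)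
  have Q: "bigO_unif I 2 (\<lambda>i \<zeta>. B i * \<zeta>\<^sup>2 + E i * (\<zeta> * cnj \<zeta>) + B' i * (cnj \<zeta>)\<^sup>2)"
    by (intro bigO_unif_add bigO_unif_cmult z2 *)
  have two: "bigO_unif I 2 (\<lambda>i \<zeta>. u i \<zeta> - (u0 i + (A i * \<zeta> + A' i * cnj \<zeta>)))"
    by (rule bigO_unif_cong[OF bigO_unif_add[OF Q bigO_unif_mono[OF *(7), of 2]]]) auto
  have one: "bigO_unif I 1 (\<lambda>i \<zeta>. u i \<zeta> - u0 i)"
    by (rule bigO_unif_cong[OF bigO_unif_add[OF L bigO_unif_mono[OF two, of 1]]]) auto
  show ?thesis
    by (rule bigO_unif_cong[OF one]) (simp add: assms(2))
qed

section \<open>Jets of holomorphic families and of logarithms\<close>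

lemma higher_deriv_bound:
  assumes R: "R > 0" and hol: "f holomorphic_on ball 0 R"
    and bd: "\<And>\<zeta>. cmod \<zeta> < R \<Longrightarrow> cmod (f \<zeta>) \<le> M" and x: "cmod x \<le> R/2"
  shows "cmod ((deriv ^^ n) f x) \<le> fact n * M / (R/4) ^ n"
proof (rule Cauchy_inequality)
  have sub: "cball x (R/4) \<subseteq> ball 0 R"
  proof
    fix y assume "y \<in> cball x (R/4)"
    then have "cmod y \<le> cmod x + R/4" using norm_triangle_sub[of y x] by (simp add: dist_norm norm_minus_commute)
    then show "y \<in> ball 0 R" using x R by simp
  qed
  then show "f holomorphic_on ball x (R/4)" using hol by (meson ball_subset_cball holomorphic_on_subset order_trans)
  show "continuous_on (cball x (R/4)) f" using hol sub holomorphic_on_imp_continuous_on holomorphic_on_subset by blast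
  show "0 < R / 4" using R by simp
  show "cmod (f y) \<le> M" if "cmod (x - y) = R / 4" for y
  proof -
    have "y \<in> ball 0 R" using sub that by (auto simp: dist_norm)
    then show ?thesis using bd by simp
  qed
qed

text \<open>Cauchy's estimates turn one bound on a common disc into uniform bounds for the Taylor
  coefficients and for the third derivative in the remainder.\<close>

lemma has_jet_holomorphic:
  assumes R: "R > 0" and hol: "\<And>i. i \<in> I \<Longrightarrow> f i holomorphic_on ball 0 R"
    and bd: "\<And>i \<zeta>. i \<in> I \<Longrightarrow> cmod \<zeta> < R \<Longrightarrow> cmod (f i \<zeta>) \<le> M"
  shows "has_jet I f (\<lambda>i. f i 0) (\<lambda>i. deriv (f i) 0) (\<lambda>_. 0) (\<lambda>_. 0)"
proof -
  have ineq: "cmod ((deriv ^^ n) (f i) x) \<le> fact n * M / (R/4) ^ n" if "i \<in> I" "cmod x \<le> R/2" for n i x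
    by (rule higher_deriv_bound[OF R hol[OF that(1)] bd[OF that(1)] that(2)])
  have t: "cmod (f i \<zeta> - (f i 0 + deriv (f i) 0 * \<zeta> + (deriv ^^ 2) (f i) 0 / 2 * \<zeta>\<^sup>2)) \<le> (\<bar>6 * M / (R/4) ^ 3\<bar> / 2) * cmod \<zeta> ^ 3"
    if i: "i \<in> I" and z: "cmod \<zeta> \<le> R/2" for i \<zeta>
  proof -
    have "cmod ((deriv ^^ 0) (f i) \<zeta> - (\<Sum>k\<le>2. (deriv ^^ k) (f i) 0 * (\<zeta> - 0) ^ k / fact k))
       \<le> \<bar>6 * M / (R/4) ^ 3\<bar> * cmod (\<zeta> - 0) ^ Suc 2 / fact 2"
    proof (rule complex_Taylor[where S="cball 0 (R/2)"])
      show "((deriv ^^ k) (f i) has_field_derivative (deriv ^^ Suc k) (f i) x) (at x within cball 0 (R/2))" if "x \<in> cball 0 (R/2)" for k x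
      proof -
        have "(deriv ^^ k) (f i) holomorphic_on ball 0 R" using hol[OF i] by (intro holomorphic_higher_deriv) auto
        then have "((deriv ^^ k) (f i) has_field_derivative deriv ((deriv ^^ k) (f i)) x) (at x)"
          by (rule holomorphic_derivI) (use that R in auto)
        then show ?thesis by (simp add: has_field_derivative_at_within)
      qed
      show "cmod ((deriv ^^ Suc 2) (f i) x) \<le> \<bar>6 * M / (R/4) ^ 3\<bar>" if "x \<in> cball 0 (R/2)" for x
      proof -
        have "cmod ((deriv ^^ 3) (f i) x) \<le> fact 3 * M / (R/4) ^ 3" using ineq[OF i, of x 3] that by simp
        moreover have "fact 3 = (6::real)" by (simp add: fact_numeral)
        ultimately have "cmod ((deriv ^^ 3) (f i) x) \<le> \<bar>6 * M / (R/4) ^ 3\<bar>" by (metis abs_ge_self order_trans)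
        moreover have "Suc 2 = (3::nat)" by simp
        ultimately show ?thesis by (simp only:)
      qed
    qed (use R z in auto)
    then show ?thesis by (simp add: numeral_2_eq_2 atMost_Suc power3_eq_cube algebra_simps)
  qed
  show ?thesis unfolding has_jet_def
  proof (intro conjI exI)
    show "bigO_unif I 3 (\<lambda>i \<zeta>. f i \<zeta> - (f i 0 + (deriv (f i) 0 * \<zeta> + 0 * cnj \<zeta>) + ((deriv ^^ 2) (f i) 0 / 2 * \<zeta>\<^sup>2 + 0 * (\<zeta> * cnj \<zeta>) + 0 * (cnj \<zeta>)\<^sup>2)))"
      by (rule bigO_unifI[of "\<bar>6 * M / (R/4) ^ 3\<bar> / 2" "R/2"]) (use t R in auto)
    show "ubounded I (\<lambda>i. f i 0)" by (rule uboundedI[of _ _ M]) (use bd R in auto)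
    show "ubounded I (\<lambda>i. deriv (f i) 0)" by (rule uboundedI[of _ _ "M / (R/4)"]) (use ineq[of _ 0 1] R in auto)
    show "ubounded I (\<lambda>i. (deriv ^^ 2) (f i) 0 / 2)"
    proof (rule uboundedI)
      fix i assume "i \<in> I"
      then have "cmod ((deriv ^^ 2) (f i) 0) \<le> fact 2 * M / (R / 4)\<^sup>2" using ineq[of i 0 2] R by simp
      moreover have "cmod ((deriv ^^ 2) (f i) 0 / 2) = cmod ((deriv ^^ 2) (f i) 0) / 2" by (simp add: norm_divide)
      ultimately show "cmod ((deriv ^^ 2) (f i) 0 / 2) \<le> (fact 2 * M / (R / 4)\<^sup>2) / 2" by (metis divide_right_mono zero_le_numeral)
    qed
  qed (auto intro: bigO_unif_zero)
qed

lemma ln_one_plus_quadratic: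
  fixes x :: real
  assumes "\<bar>x\<bar> \<le> 1/2"
  shows "\<bar>ln (1 + x) - x + x\<^sup>2/2\<bar> \<le> 2 * \<bar>x\<bar> ^ 3"
proof -
  have "norm ((ln (1 + x) - x + x\<^sup>2/2) - (ln (1 + 0) - 0 + 0\<^sup>2/2)) \<le> 2 * x\<^sup>2 * norm (x - 0)"
  proof (rule field_differentiable_bound[where f="\<lambda>t. ln (1 + t) - t + t\<^sup>2/2" and f'="\<lambda>t. t\<^sup>2 / (1 + t)" and S="cball 0 \<bar>x\<bar>"])
    fix t :: real assume t: "t \<in> cball 0 \<bar>x\<bar>"
    then have t1: "\<bar>t\<bar> \<le> \<bar>x\<bar>" "1 + t \<ge> 1/2" using assms by auto
    show "((\<lambda>t. ln (1 + t) - t + t\<^sup>2/2) has_field_derivative t\<^sup>2 / (1 + t)) (at t within cball 0 \<bar>x\<bar>)"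
      using t1 by (auto intro!: derivative_eq_intros simp: field_simps power2_eq_square)
    have "t\<^sup>2 / (1 + t) \<le> t\<^sup>2 / (1/2)" using t1 by (intro divide_left_mono) auto
    also have "\<dots> \<le> 2 * x\<^sup>2" using t1(1) abs_le_square_iff[of t x] by simp
    finally show "norm (t\<^sup>2 / (1 + t)) \<le> 2 * x\<^sup>2" using t1 by simp
  qed auto
  then show ?thesis by (simp add: power3_eq_cube power2_eq_square abs_mult_self_eq)
qed

lemma bigO_unif_small:
  assumes "bigO_unif I 1 f" "\<epsilon> > 0"
  shows "\<exists>r0>0. \<forall>i\<in>I. \<forall>\<zeta>. cmod \<zeta> \<le> r0 \<longrightarrow> cmod (f i \<zeta>) \<le> \<epsilon>"
proof -
  obtain C r0 where C: "C \<ge> 0" "r0 > 0" "\<And>i \<zeta>. i \<in> I \<Longrightarrow> cmod \<zeta> \<le> r0 \<Longrightarrow> cmod (f i \<zeta>) \<le> C * cmod \<zeta>"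
    using assms(1) unfolding bigO_unif_def by auto
  have "cmod (f i \<zeta>) \<le> \<epsilon>" if "i \<in> I" "cmod \<zeta> \<le> min r0 (\<epsilon> / (C + 1))" for i \<zeta>
  proof -
    have "cmod (f i \<zeta>) \<le> (C + 1) * cmod \<zeta>" using C(3)[OF that(1)] that(2) by (smt (verit) mult_right_mono norm_ge_zero)
    also have "\<dots> \<le> (C + 1) * (\<epsilon> / (C + 1))" using that(2) C(1) by (intro mult_left_mono) auto
    also have "\<dots> = \<epsilon>" using C(1) by simp
    finally show ?thesis .
  qed
  moreover have "min r0 (\<epsilon> / (C + 1)) > 0" using C assms(2) by simp
  ultimately show ?thesis by blast
qed

text \<open>From the expansion of \<open>ln (1 + x)\<close> to second order: the square of the
  linear part has mixed coefficient \<open>2 * A * A'\<close>, and half of it is subtracted.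
  Vanishing at the centre gives a radius, common to the family, on which the argument stays
  small.\<close>

lemma has_jet_ln:
  fixes \<delta> :: "'i \<Rightarrow> complex \<Rightarrow> real"
  assumes j: "has_jet I (\<lambda>i \<zeta>. of_real (\<delta> i \<zeta>)) u0 A A' E" and 0: "\<And>i. i \<in> I \<Longrightarrow> u0 i = 0"
  shows "has_jet I (\<lambda>i \<zeta>. of_real (ln (1 + \<delta> i \<zeta>))) (\<lambda>_. 0) A A' (\<lambda>i. E i - A i * A' i)"
    and "\<exists>r0>0. \<forall>i\<in>I. \<forall>\<zeta>. cmod \<zeta> \<le> r0 \<longrightarrow> \<bar>\<delta> i \<zeta>\<bar> \<le> 1/2"
proof -
  have o1: "bigO_unif I 1 (\<lambda>i \<zeta>. of_real (\<delta> i \<zeta>))" using has_jet_vanishing[OF j 0] by simp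
  show ex: "\<exists>r0>0. \<forall>i\<in>I. \<forall>\<zeta>. cmod \<zeta> \<le> r0 \<longrightarrow> \<bar>\<delta> i \<zeta>\<bar> \<le> 1/2" using bigO_unif_small[OF o1, of "1/2"] by simp
  then obtain r1 where rpos: "r1 > 0" and small: "\<And>i \<zeta>. i \<in> I \<Longrightarrow> cmod \<zeta> \<le> r1 \<Longrightarrow> \<bar>\<delta> i \<zeta>\<bar> \<le> 1/2" by blast
  have sq: "has_jet I (\<lambda>i \<zeta>. (-1/2) * (of_real (\<delta> i \<zeta>) * of_real (\<delta> i \<zeta>))) (\<lambda>i. (-1/2) * (u0 i * u0 i)) (\<lambda>i. (-1/2) * (u0 i * A i + u0 i * A i))
      (\<lambda>i. (-1/2) * (u0 i * A' i + u0 i * A' i)) (\<lambda>i. (-1/2) * (u0 i * E i + u0 i * E i + (A i * A' i + A' i * A i)))"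
    by (rule has_jet_cmult[OF _ has_jet_mult[OF j j]]) (rule uboundedI[of _ _ 1], simp)
  have "has_jet I (\<lambda>i \<zeta>. of_real (\<delta> i \<zeta>) + (-1/2) * (of_real (\<delta> i \<zeta>) * of_real (\<delta> i \<zeta>))) (\<lambda>_. 0) A A' (\<lambda>i. E i - A i * A' i)"
    by (rule has_jet_cong[OF has_jet_add[OF j sq]]) (simp_all add: 0)
  then show "has_jet I (\<lambda>i \<zeta>. of_real (ln (1 + \<delta> i \<zeta>))) (\<lambda>_. 0) A A' (\<lambda>i. E i - A i * A' i)"
  proof (rule has_jet_perturb)
    have o3: "bigO_unif I 3 (\<lambda>i \<zeta>. of_real (\<delta> i \<zeta>) * (of_real (\<delta> i \<zeta>) * of_real (\<delta> i \<zeta>)))"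
      using bigO_unif_mult[OF o1 bigO_unif_mult[OF o1 o1]] by (simp add: eval_nat_numeral)
    show "bigO_unif I 3 (\<lambda>i \<zeta>. of_real (ln (1 + \<delta> i \<zeta>)) - (of_real (\<delta> i \<zeta>) + (-1/2) * (of_real (\<delta> i \<zeta>) * of_real (\<delta> i \<zeta>))))"
    proof (rule bigO_unif_le[OF o3, of _ 2], intro exI[of _ r1] conjI rpos ballI allI impI)
      fix i \<zeta> assume "i \<in> I" "cmod \<zeta> \<le> r1"
      then have b: "\<bar>ln (1 + \<delta> i \<zeta>) - \<delta> i \<zeta> + (\<delta> i \<zeta>)\<^sup>2/2\<bar> \<le> 2 * \<bar>\<delta> i \<zeta>\<bar> ^ 3" by (intro ln_one_plus_quadratic small)
      have e: "complex_of_real (ln (1 + \<delta> i \<zeta>)) - (of_real (\<delta> i \<zeta>) + (-1/2) * (of_real (\<delta> i \<zeta>) * of_real (\<delta> i \<zeta>)))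
        = of_real (ln (1 + \<delta> i \<zeta>) - \<delta> i \<zeta> + (\<delta> i \<zeta>)\<^sup>2/2)" by (simp add: power2_eq_square)
      show "cmod (of_real (ln (1 + \<delta> i \<zeta>)) - (of_real (\<delta> i \<zeta>) + (-1/2) * (of_real (\<delta> i \<zeta>) * of_real (\<delta> i \<zeta>))))
        \<le> 2 * cmod (of_real (\<delta> i \<zeta>) * (of_real (\<delta> i \<zeta>) * of_real (\<delta> i \<zeta>)))"
        unfolding e norm_of_real using b by (simp add: norm_mult power3_eq_cube)
    qed
  qed
qed

text \<open>Opposite points cancel the linear terms, and since \<open>\<i>\<^sup>2 = -1\<close> the
  two pairs cancel the anonymous coefficients of the pure squares.\<close>

lemma has_jet_cross_mean:
  fixes u :: "'i \<Rightarrow> complex \<Rightarrow> real"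
  assumes "has_jet I (\<lambda>i \<zeta>. of_real (u i \<zeta>)) (\<lambda>i. of_real (u0 i)) A A' (\<lambda>i. of_real (E i))"
  shows "\<exists>C r0. r0 > 0 \<and> (\<forall>i\<in>I. \<forall>r. 0 < r \<and> r < r0 \<longrightarrow> \<bar>cross_mean (u i) 0 r - (u0 i + E i * r\<^sup>2)\<bar> \<le> C * r ^ 3)"
proof -
  obtain B B' where o: "bigO_unif I 3 (\<lambda>i \<zeta>. of_real (u i \<zeta>) - (of_real (u0 i) + (A i * \<zeta> + A' i * cnj \<zeta>) + (B i * \<zeta>\<^sup>2 + of_real (E i) * (\<zeta> * cnj \<zeta>) + B' i * (cnj \<zeta>)\<^sup>2)))"
    using assms unfolding has_jet_def by blast
  define P where "P i \<zeta> = of_real (u0 i) + (A i * \<zeta> + A' i * cnj \<zeta>) + (B i * \<zeta>\<^sup>2 + of_real (E i) * (\<zeta> * cnj \<zeta>) + B' i * (cnj \<zeta>)\<^sup>2)" for i \<zeta>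
  obtain C r0 where C: "r0 > 0" "\<And>i \<zeta>. i \<in> I \<Longrightarrow> cmod \<zeta> \<le> r0 \<Longrightarrow> cmod (of_real (u i \<zeta>) - P i \<zeta>) \<le> C * cmod \<zeta> ^ 3"
    using o unfolding bigO_unif_def P_def by blast
  show ?thesis
  proof (rule exI[where x=C], rule exI[where x=r0], intro conjI ballI allI impI C(1))
    fix i r assume i: "i \<in> I" and r: "0 < r \<and> r < r0"
    let ?R = "\<lambda>\<zeta>. complex_of_real (u i \<zeta>) - P i \<zeta>"
    have P: "P i (of_real r) + P i (- of_real r) + P i (\<i> * of_real r) + P i (- (\<i> * of_real r)) = 4 * of_real (u0 i + E i * r\<^sup>2)"
      by (simp add: P_def algebra_simps power2_eq_square)
    have c: "complex_of_real (cross_mean (u i) 0 r - (u0 i + E i * r\<^sup>2)) = (?R (of_real r) + ?R (- of_real r) + ?R (\<i> * of_real r) + ?R (- (\<i> * of_real r))) / 4"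
      using P by (simp add: cross_mean_def field_simps)
    have b: "cmod (?R \<zeta>) \<le> C * r ^ 3" if "cmod \<zeta> = r" for \<zeta> using C(2)[OF i, of \<zeta>] that r by simp
    have "\<bar>cross_mean (u i) 0 r - (u0 i + E i * r\<^sup>2)\<bar> = cmod (?R (of_real r) + ?R (- of_real r) + ?R (\<i> * of_real r) + ?R (- (\<i> * of_real r))) / 4"
      using arg_cong[OF c, of cmod] by (simp only: norm_of_real norm_divide norm_numeral)
    also have "\<dots> \<le> (C * r ^ 3 + C * r ^ 3 + C * r ^ 3 + C * r ^ 3) / 4"
      by (intro divide_right_mono norm_triangle_le add_mono b) (use r in \<open>auto simp: norm_mult\<close>)
    finally show "\<bar>cross_mean (u i) 0 r - (u0 i + E i * r\<^sup>2)\<bar> \<le> C * r ^ 3" by simp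
  qed
qed

section \<open>Holomorphic curvature\<close>

lemma Bernoulli_powr:
  fixes r q :: real
  assumes "r \<ge> 0" "q \<ge> 1"
  shows "r powr q \<ge> 1 + q * (r - 1)"
proof (cases "r = 0")
  case False
  have "r powr q - 1 powr q \<ge> q * (r - 1)"
  proof (rule convex_on_imp_above_tangent[OF powr_convex])
    show "((\<lambda>x. x powr q) has_real_derivative q) (at 1 within {0<..})"
      by (auto intro!: derivative_eq_intros)
  qed (use assms False in \<open>auto simp: interior_open\<close>)
  then show ?thesis by simp
qed (use assms in simp)

lemma Bernoulli_powr_concave:
  fixes r q :: real
  assumes "r \<ge> 0" "0 < q" "q \<le> 1"
  shows "r powr q \<le> 1 + q * (r - 1)"
proof -
  have "1 + 1/q * (r powr q - 1) \<le> (r powr q) powr (1/q)" by (rule Bernoulli_powr) (use assms in auto)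
  also have "\<dots> = r" using assms by (simp add: powr_powr)
  finally have "r powr q - 1 \<le> q * (r - 1)" using assms by (simp add: field_simps)
  then show ?thesis by simp
qed

text \<open>The tangent plane of a convex function lies below its graph. At \<open>p = 0\<close> the
  affine part is 0, which is a valid support even for \<open>q = 1\<close>, where the function is
  not differentiable. A real-affine function thus replaces a possibly singular one.\<close>

lemma powr_norm_tangent:
  fixes p F :: complex
  assumes "q \<ge> 1"
  shows "cmod p powr q + Re (of_real (q * cmod p powr (q - 2)) * cnj p * (F - p)) \<le> cmod F powr q"
proof (cases "p = 0")
  case False
  define s where "s = cmod p"
  have s: "s > 0" using False by (simp add: s_def)
  have "(cmod F / s) powr q \<ge> 1 + q * (cmod F / s - 1)" by (rule Bernoulli_powr) (use assms s in auto)
  then have "s powr q * (1 + q * (cmod F / s - 1)) \<le> s powr q * (cmod F / s) powr q" by (rule mult_left_mono) simp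
  also have "\<dots> = cmod F powr q" using s by (simp add: powr_divide)
  finally have 1: "s powr q * (1 + q * (cmod F / s - 1)) \<le> cmod F powr q" .
  have e: "s powr q = s powr (q - 2) * (s * s)" using s powr_add[of s "q - 2" 2] by (simp add: power2_eq_square)
  have "Re (cnj p * F) \<le> s * cmod F" using complex_Re_le_cmod[of "cnj p * F"] by (simp add: norm_mult s_def)
  then have 2: "q * s powr (q - 2) * (Re (cnj p * F) - s * s) \<le> q * s powr (q - 2) * (s * cmod F - s * s)"
    using assms by (intro mult_left_mono) auto
  have pp: "Re (cnj p * p) = s * s" by (simp add: s_def cmod_def power2_eq_square)
  have "Re (of_real (q * s powr (q - 2)) * cnj p * (F - p)) = q * s powr (q - 2) * (Re (cnj p * F) - Re (cnj p * p))"
    by (simp add: algebra_simps)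
  then have "s powr q + Re (of_real (q * s powr (q - 2)) * cnj p * (F - p)) \<le> s powr q + q * s powr (q - 2) * (s * cmod F - s * s)"
    using 2 pp by simp
  also have "\<dots> = s powr q * (1 + q * (cmod F / s - 1))" unfolding e using s by (simp add: field_simps)
  finally show ?thesis using 1 by (simp add: s_def)
qed simp

lemma weighted_Cauchy_Schwarz:
  fixes A B :: complex
  assumes "(cmod A)\<^sup>2 \<le> P * P'" "(cmod B)\<^sup>2 \<le> Q * Q'" "P \<ge> 0" "P' \<ge> 0" "Q \<ge> 0" "Q' \<ge> 0"
  shows "(cmod (A + B))\<^sup>2 \<le> (P + Q) * (P' + Q')"
proof -
  have "(cmod A * cmod B)\<^sup>2 \<le> (P * P') * (Q * Q')" unfolding power_mult_distrib using assms by (intro mult_mono) auto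
  also have "\<dots> = (P * Q') * (Q * P')" by simp
  also have "\<dots> \<le> ((P * Q' + Q * P') / 2)\<^sup>2"
    using sum_squares_ge_zero[of "P * Q' - Q * P'" 0] by (simp add: power2_eq_square field_simps)
  finally have "cmod A * cmod B \<le> (P * Q' + Q * P') / 2" by (rule power2_le_imp_le) (use assms in auto)
  moreover have "(cmod (A + B))\<^sup>2 \<le> (cmod A + cmod B)\<^sup>2" by (intro power_mono norm_triangle_ineq) auto
  ultimately show ?thesis using assms by (simp add: power2_eq_square algebra_simps)
qed

section \<open>The dual norm and its smooth majorant\<close>

context egg_dom begin

text \<open>The dual norm of the functional \<open>v \<mapsto> ip v e\<close> for the ball metric,
  by Cauchy-Schwarz against the vector that represents it. Nonnegativity is that of
  \<open>BB z\<close> at this vector.\<close>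

lemma BB_dual:
  assumes sz: "sg z > 0"
  shows "(cmod (ip v e))\<^sup>2 \<le> BB z v * (sg z * (nq e - (cmod (ip e z))\<^sup>2))" "nq e - (cmod (ip e z))\<^sup>2 \<ge> 0"
proof -
  define s where "s = sg z"
  have s: "s > 0" "nq z = 1 - s" using sz by (simp_all add: s_def sg_def)
  define c where "c = ip e z"
  \<comment> \<open>Up to the factor \<open>s\<close> this vector represents the functional in the
    inner product belonging to \<open>BB z\<close>.\<close>
  define f where "f = e - c *s z"
  have ez: "ip z e = cnj c" by (simp add: c_def cnj_hin)
  have zz: "ip z z = 1 - of_real s" by (simp add: ip_self s_def)
  have fz: "ip f z = of_real s * c" by (simp add: f_def hin_diff_left hin_scale_left zz algebra_simps flip: c_def)
  have vf: "ip v f = ip v e - cnj c * ip v z" by (simp add: f_def hin_diff_right hin_scale_right)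
  have ff: "nq f = nq e - (1 + s) * (cmod c)\<^sup>2"
  proof -
    have "nq f = nq e + nq (c *s z) - 2 * Re (ip e (c *s z))"
      using nsq_add[of a e "- (c *s z)"] by (simp add: f_def hin_minus_right)
    also have "ip e (c *s z) = of_real ((cmod c)\<^sup>2)" by (simp add: hin_scale_right c_def cmod_sq_cnj mult.commute)
    finally show ?thesis by (simp add: nsq_scale s algebra_simps)
  qed
  have BBf: "BB z f = (nq e - (cmod c)\<^sup>2) / s"
    unfolding BB_def fz ff s_def[symmetric] using s by (simp add: norm_mult power_mult_distrib field_simps power2_eq_square)
  have "BB z f \<ge> 0" using sz by (simp add: BB_def)
  then show pos: "nq e - (cmod (ip e z))\<^sup>2 \<ge> 0" using BBf s by (simp add: c_def zero_le_divide_iff)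
  have "(cmod (ip v f / of_real s + ip v z * cnj (ip f z) / of_real (s\<^sup>2)))\<^sup>2 \<le>
     (nq v / s + (cmod (ip v z))\<^sup>2 / s\<^sup>2) * (nq f / s + (cmod (ip f z))\<^sup>2 / s\<^sup>2)"
  proof (rule weighted_Cauchy_Schwarz)
    show "(cmod (ip v f / of_real s))\<^sup>2 \<le> nq v / s * (nq f / s)"
      using hin_Cauchy_Schwarz[of a v f] s by (simp add: norm_divide power_divide power2_eq_square divide_right_mono)
    show "(cmod (ip v z * cnj (ip f z) / of_real (s\<^sup>2)))\<^sup>2 \<le> (cmod (ip v z))\<^sup>2 / s\<^sup>2 * ((cmod (ip f z))\<^sup>2 / s\<^sup>2)"
      by (simp add: norm_mult norm_divide power2_eq_square mult_ac)
  qed (use s in auto)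
  also have "\<dots> = BB z v * BB z f" by (simp add: BB_def s_def)
  also have "ip v f / of_real s + ip v z * cnj (ip f z) / of_real (s\<^sup>2) = ip v e / of_real s"
    unfolding vf fz using s by (simp add: field_simps power2_eq_square)
  finally have "(cmod (ip v e))\<^sup>2 / s\<^sup>2 \<le> BB z v * ((nq e - (cmod c)\<^sup>2) / s)" by (simp add: norm_divide power_divide BBf)
  then have "(cmod (ip v e))\<^sup>2 / s\<^sup>2 * s\<^sup>2 \<le> BB z v * ((nq e - (cmod c)\<^sup>2) / s) * s\<^sup>2" by (intro mult_right_mono) auto
  then show "(cmod (ip v e))\<^sup>2 \<le> BB z v * (sg z * (nq e - (cmod (ip e z))\<^sup>2))"
    using s by (simp add: c_def s_def[symmetric] power2_eq_square mult_ac)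
qed

text \<open>The squared norm of the covector \<open>v \<mapsto> d1 * v$a + hin a v d\<close> dual to the form \<open>wuQ z\<close>.\<close>

definition dual_sq :: "complex \<Rightarrow> complex^'n \<Rightarrow> complex^'n \<Rightarrow> real" where
  "dual_sq d1 d z = (cmod d1)\<^sup>2 * (AA z - (cmod (z$a))\<^sup>2)\<^sup>2 / AA z + (sg z - cmod (z$a) powr (2*m)) *
     (nq d - (cmod (ip z d))\<^sup>2 - 2 / m * Re (d1 * z$a * cnj (ip z d)) + (cmod d1)\<^sup>2 * (cmod (z$a))\<^sup>2 * nq z / (m\<^sup>2 * sg z))"

text \<open>\<open>wuQ\<close> is diagonal in the shifted component \<open>v1\<close> and the
  remaining coordinates, so its dual norm is the sum of the two dual norms. The second claim is the
  sign that allows other factors of \<open>dual_sq\<close> to be replaced by larger ones.\<close>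

lemma wuQ_dual:
  assumes z: "z \<in> egg a m"
  shows "(cmod (d1 * v$a + ip v d))\<^sup>2 \<le> wuQ z v * dual_sq d1 d z"
    and "nq d - (cmod (ip z d))\<^sup>2 - 2 / m * Re (d1 * z$a * cnj (ip z d)) + (cmod d1)\<^sup>2 * (cmod (z$a))\<^sup>2 * nq z / (m\<^sup>2 * sg z) \<ge> 0"
proof -
  define s where "s = sg z"
  have sz: "sg z > 0" "s > 0" "nq z = 1 - s" using egg_sg[OF z] by (simp_all add: s_def sg_def)
  \<comment> \<open>Expressing \<open>v$a\<close> through \<open>v1\<close> changes the remaining
    part of the covector from \<open>d\<close> to \<open>e\<close>.\<close>
  define g where "g = d1 * z$a / of_real (m * s)"
  define e where "e = d - cnj g *s z"
  define X where "X = ip z d"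
  have ve: "ip v e = ip v d - g * ip v z" by (simp add: e_def hin_diff_right hin_scale_right)
  have ez: "ip e z = cnj (X - of_real (1 - s) * g)"
    by (simp add: e_def hin_diff_left hin_scale_left X_def cnj_hin ip_self s_def mult.commute)
  have ne: "nq e = nq d + (cmod g)\<^sup>2 * (1 - s) - 2 * Re (g * cnj X)"
  proof -
    have "nq e = nq d + nq (cnj g *s z) - 2 * Re (ip d (cnj g *s z))"
      using nsq_add[of a d "- (cnj g *s z)"] by (simp add: e_def hin_minus_right)
    moreover have "ip d (cnj g *s z) = g * cnj X" by (simp add: hin_scale_right X_def cnj_hin)
    ultimately show ?thesis by (simp add: nsq_scale sz)
  qed
  have g2: "(cmod g)\<^sup>2 = (cmod d1)\<^sup>2 * (cmod (z$a))\<^sup>2 / (m\<^sup>2 * s\<^sup>2)"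
    by (simp add: g_def norm_divide norm_mult power_divide power_mult_distrib)
  have Xg: "(cmod (X - of_real (1 - s) * g))\<^sup>2 = (cmod X)\<^sup>2 + (1 - s)\<^sup>2 * (cmod g)\<^sup>2 - 2 * (1 - s) * Re (g * cnj X)"
  proof -
    have "Re (X * cnj (of_real (1 - s) * g)) = (1 - s) * Re (g * cnj X)"
      by (simp add: algebra_simps)
    then show ?thesis unfolding complex_norm_sq_diff by (simp add: norm_mult power_mult_distrib del: of_real_diff)
  qed
  have gX: "Re (g * cnj X) = Re (d1 * z$a * cnj X) / (m * s)"
    unfolding g_def times_divide_eq_left by (simp only: Re_divide_of_real)
  have S: "nq e - (cmod (ip e z))\<^sup>2 = nq d - (cmod X)\<^sup>2 - 2 / m * Re (d1 * z$a * cnj X) + (cmod d1)\<^sup>2 * (cmod (z$a))\<^sup>2 * nq z / (m\<^sup>2 * s)"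
    unfolding ne ez complex_mod_cnj Xg gX g2 sz(3) using sz(2) m_pos(1) by (simp add: field_simps power2_eq_square)
  note D = BB_dual(1)[OF sz(1), of v e] BB_dual(2)[OF sz(1), of e]
  show "nq d - (cmod (ip z d))\<^sup>2 - 2 / m * Re (d1 * z$a * cnj (ip z d)) + (cmod d1)\<^sup>2 * (cmod (z$a))\<^sup>2 * nq z / (m\<^sup>2 * sg z) \<ge> 0"
    using D(2) unfolding S unfolding X_def s_def .
  define t where "t = tt z"
  have t: "t < 1" "t \<ge> 0" "t powr m < 1" using egg_tt[OF z] egg_ttm[OF z] tt_nonneg[OF sz(1)] by (simp_all add: t_def)
  have A: "AA z > 0" using AA_pos sz by simp
  have tA: "AA z * (1 - t) = AA z - (cmod (z$a))\<^sup>2" using A by (simp add: t_def tt_def field_simps)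
  have ts: "s * (1 - t powr m) = s - cmod (z$a) powr (2*m)" using tt_powr[OF sz(1)] sz by (simp add: t_def s_def field_simps)
  define v1 where "v1 = v$a + z$a * ip v z / of_real (m * s)"
  have "(cmod (d1 * v1 + ip v e))\<^sup>2 \<le> ((cmod v1)\<^sup>2 / (AA z * (1 - t)\<^sup>2) + BB z v / (1 - t powr m))
    * ((cmod d1)\<^sup>2 * (AA z * (1 - t)\<^sup>2) + (1 - t powr m) * (s * (nq e - (cmod (ip e z))\<^sup>2)))"
  proof (rule weighted_Cauchy_Schwarz)
    show "(cmod (d1 * v1))\<^sup>2 \<le> (cmod v1)\<^sup>2 / (AA z * (1 - t)\<^sup>2) * ((cmod d1)\<^sup>2 * (AA z * (1 - t)\<^sup>2))"
      using A t by (simp add: norm_mult power_mult_distrib)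
    show "(cmod (ip v e))\<^sup>2 \<le> BB z v / (1 - t powr m) * ((1 - t powr m) * (s * (nq e - (cmod (ip e z))\<^sup>2)))"
      using D(1) t by (simp add: s_def)
    show "0 \<le> BB z v / (1 - t powr m)" using t sz by (simp add: BB_def)
    show "0 \<le> (1 - t powr m) * (s * (nq e - (cmod (ip e z))\<^sup>2))" using D(2) t sz by simp
  qed (use A in auto)
  also have "(cmod v1)\<^sup>2 / (AA z * (1 - t)\<^sup>2) + BB z v / (1 - t powr m) = wuQ z v"
    by (simp add: wuQ_def v1_def t_def s_def)
  also have "d1 * v1 + ip v e = d1 * v$a + ip v d"
    by (simp add: v1_def ve g_def algebra_simps)
  also have "(cmod d1)\<^sup>2 * (AA z * (1 - t)\<^sup>2) + (1 - t powr m) * (s * (nq e - (cmod (ip e z))\<^sup>2)) = dual_sq d1 d z"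
  proof -
    have "AA z * (1 - t)\<^sup>2 = (AA z * (1 - t))\<^sup>2 / AA z" using A by (simp add: power2_eq_square)
    then have 1: "AA z * (1 - t)\<^sup>2 = (AA z - (cmod (z$a))\<^sup>2)\<^sup>2 / AA z" by (simp only: tA)
    have 2: "(1 - t powr m) * (s * Y) = (s - cmod (z$a) powr (2*m)) * Y" for Y by (simp add: ts[symmetric])
    show ?thesis unfolding 1 2 S unfolding dual_sq_def X_def s_def by simp
  qed
  finally show "(cmod (d1 * v$a + ip v d))\<^sup>2 \<le> wuQ z v * dual_sq d1 d z" .
qed

text \<open>Only the terms up to first order in \<open>w\<close> have to be exact: on a disc centred
  on the axis \<open>w\<close> vanishes to second order, so \<open>w\<^sup>2\<close> falls into the
  cubic error, and its constants may be coarse.\<close>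

lemma AA_bounds:
  assumes w: "0 \<le> w" "w \<le> 1/4" "w = nq z"
  shows "AA z \<le> 1 - w / m + w\<^sup>2" "1 / AA z \<le> 1 + w / m + 9 * w\<^sup>2" "AA z > 0"
proof -
  define q where "q = 1 / m"
  have q: "1 \<le> q" "q \<le> 2" using m_ge m_lt by (simp_all add: q_def field_simps)
  have A: "AA z = (1 - w) powr q" by (simp add: AA_def sg_def w(3) q_def)
  have "(1 - w) powr q = (1 - w) * (1 - w) powr (q - 1)" using w by (simp add: powr_diff)
  moreover have "(1 - w) powr (q - 1) \<le> 1 + (q - 1) * ((1 - w) - 1)"
    using Bernoulli_powr_concave[of "1 - w" "q - 1"] w q by (cases "q = 1") auto
  ultimately have "AA z \<le> (1 - w) * (1 - (q - 1) * w)" using w A by (simp add: mult_left_mono)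
  also have "\<dots> = 1 - w * q + (q - 1) * w\<^sup>2" by (simp add: algebra_simps power2_eq_square)
  also have "\<dots> \<le> 1 - w * q + w\<^sup>2" using q mult_right_mono[of "q - 1" 1 "w\<^sup>2"] by simp
  finally show "AA z \<le> 1 - w / m + w\<^sup>2" by (simp add: q_def)
  define t where "t = q * w"
  have t: "0 \<le> t" "t \<le> 1/2" "t \<le> 2 * w" using q w mult_mono[of q 2 w "1/4"] mult_right_mono[of q 2 w] by (auto simp: t_def)
  have lower: "1 - t \<le> AA z" using Bernoulli_powr[of "1 - w" q] w q by (simp add: A t_def)
  then show "AA z > 0" using t by simp
  have "1 / AA z \<le> 1 / (1 - t)" using lower t by (intro divide_left_mono) auto
  also have "\<dots> \<le> 1 + t + 2 * t\<^sup>2"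
  proof -
    have "0 \<le> t\<^sup>2 * (1 - 2 * t)" using t by simp
    then have "1 \<le> (1 + t + 2 * t\<^sup>2) * (1 - t)" by (simp add: algebra_simps power2_eq_square)
    then show ?thesis using t by (simp add: field_simps)
  qed
  finally have "1 / AA z \<le> 1 + t + 2 * t\<^sup>2" .
  moreover have "t\<^sup>2 \<le> (2 * w)\<^sup>2" using t by (intro power_mono) auto
  moreover have "t = w / m" "(2 * w)\<^sup>2 = 4 * w\<^sup>2" "w\<^sup>2 \<ge> 0" by (simp_all add: t_def q_def power2_eq_square)
  ultimately show "1 / AA z \<le> 1 + w / m + 9 * w\<^sup>2" by linarith
qed

text \<open>The singular power occurs in \<open>dual_sq\<close> with a negative sign in front of a
  nonnegative factor, so its tangent plane \<open>l\<close> from below gives an upper bound.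
  Together with \<open>AA_bounds\<close> this yields a majorant that is polynomial in the
  coordinates and their conjugates and is exact at the axis point with first component
  \<open>p\<close>.\<close>

lemma dual_sq_le:
  fixes z d :: "complex^'n" and p d1 :: complex
  assumes z: "z \<in> egg a m" and w: "nq z \<le> 1/4"
  defines "y \<equiv> (cmod (z$a))\<^sup>2" and "w \<equiv> nq z" and "l \<equiv> cmod p powr (2*m) + Re (of_real (2 * m * cmod p powr (2*m-2)) * cnj p * (z$a - p))"
  shows "dual_sq d1 d z \<le> (cmod d1)\<^sup>2 * ((1 - y)\<^sup>2 - w / m * (1 - y\<^sup>2) + 11 * w\<^sup>2) + (1 - w - l) *
     (nq d - (cmod (ip z d))\<^sup>2 - 2 / m * Re (d1 * z$a * cnj (ip z d)) + (cmod d1)\<^sup>2 * y / m\<^sup>2 * (w + 2 * w\<^sup>2))"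
proof -
  have w0: "w \<ge> 0" "w \<le> 1/4" using assms by auto
  have y: "0 \<le> y" "y \<le> 1" using egg_cmod_a[OF z] by (auto simp: y_def power_le_one)
  note B = AA_bounds[OF w0 w_def[THEN meta_eq_to_obj_eq]]
  have "(AA z - y)\<^sup>2 / AA z = AA z - 2 * y + y\<^sup>2 * (1 / AA z)" using B(3) by (simp add: field_simps power2_eq_square)
  also have "\<dots> \<le> (1 - w / m + w\<^sup>2) - 2 * y + y\<^sup>2 * (1 + w / m + 9 * w\<^sup>2)"
    using B(1,2) by (intro add_mono diff_right_mono mult_left_mono) auto
  also have "\<dots> = (1 - y)\<^sup>2 - w / m * (1 - y\<^sup>2) + (1 + 9 * y\<^sup>2) * w\<^sup>2" by (simp add: algebra_simps power2_eq_square)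
  also have "\<dots> \<le> (1 - y)\<^sup>2 - w / m * (1 - y\<^sup>2) + 11 * w\<^sup>2"
  proof -
    have "y\<^sup>2 \<le> 1" using y by (simp add: power_le_one)
    then have "(1 + 9 * y\<^sup>2) * w\<^sup>2 \<le> 11 * w\<^sup>2" by (intro mult_right_mono) auto
    then show ?thesis by simp
  qed
  finally have 1: "(AA z - y)\<^sup>2 / AA z \<le> (1 - y)\<^sup>2 - w / m * (1 - y\<^sup>2) + 11 * w\<^sup>2" .
  define S where "S = nq d - (cmod (ip z d))\<^sup>2 - 2 / m * Re (d1 * z$a * cnj (ip z d))"
  have sg: "sg z = 1 - w" by (simp add: sg_def w_def)
  have S0: "S + (cmod d1)\<^sup>2 * y * w / (m\<^sup>2 * (1 - w)) \<ge> 0"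
    using wuQ_dual(2)[OF z, of d d1] by (simp add: S_def y_def sg w_def)
  have S1: "S + (cmod d1)\<^sup>2 * y * w / (m\<^sup>2 * (1 - w)) \<le> S + (cmod d1)\<^sup>2 * y / m\<^sup>2 * (w + 2 * w\<^sup>2)"
  proof -
    have "0 \<le> w\<^sup>2 * (1 - 2 * w)" using w0 by simp
    then have "w \<le> (w + 2 * w\<^sup>2) * (1 - w)" by (simp add: algebra_simps power2_eq_square)
    then have "w / (1 - w) \<le> w + 2 * w\<^sup>2" using w0 by (simp add: field_simps)
    then have "(cmod d1)\<^sup>2 * y / m\<^sup>2 * (w / (1 - w)) \<le> (cmod d1)\<^sup>2 * y / m\<^sup>2 * (w + 2 * w\<^sup>2)"
      using y by (intro mult_left_mono) auto
    then show ?thesis by simp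
  qed
  have l: "l \<le> cmod (z$a) powr (2*m)" unfolding l_def using powr_norm_tangent[of "2*m" p "z$a"] m_ge by simp
  have e: "sg z - cmod (z$a) powr (2*m) \<ge> 0" using z by (simp add: egg_iff)
  have "dual_sq d1 d z = (cmod d1)\<^sup>2 * ((AA z - y)\<^sup>2 / AA z) + (sg z - cmod (z$a) powr (2*m)) * (S + (cmod d1)\<^sup>2 * y * w / (m\<^sup>2 * (1 - w)))"
    by (simp add: dual_sq_def S_def y_def sg flip: w_def)
  also have "\<dots> \<le> (cmod d1)\<^sup>2 * ((1 - y)\<^sup>2 - w / m * (1 - y\<^sup>2) + 11 * w\<^sup>2) + (1 - w - l) * (S + (cmod d1)\<^sup>2 * y / m\<^sup>2 * (w + 2 * w\<^sup>2))"
    using 1 S0 S1 l e sg by (intro add_mono mult_left_mono mult_mono) auto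
  finally show ?thesis by (simp add: S_def)
qed

end

text \<open>The left side is a cubic form in \<open>\<alpha>\<close> and \<open>\<beta>\<close>, in
  which the terms with \<open>x\<close> cancel to leave \<open>-2\<close> at
  \<open>\<alpha> ^ 3\<close>. As both variables are nonnegative, it suffices to compare its four
  coefficients with \<open>-1/2\<close>, \<open>-3/2\<close>, \<open>-3/2\<close> and
  \<open>-1/2\<close>; this is the origin of the curvature constant.\<close>

lemma curvature_inequality:
  fixes \<alpha> \<beta> u x y :: real
  assumes "\<alpha> \<ge> 0" "\<beta> \<ge> 0" "1 \<le> u" "u \<le> 2" "0 \<le> x" "x \<le> 1" "0 \<le> y" "y \<le> 1"
  shows "(\<alpha> + \<beta>) * (- 2 * (1 - 2 * x) * \<alpha>\<^sup>2 + \<alpha> * \<beta> * (- u * (1 + x) - 2 * (1 - x) * u + x * u\<^sup>2 + 2 * y) - (2 - y) * \<beta>\<^sup>2)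
     - \<alpha> * (x * (2 * \<alpha> + u * \<beta>)\<^sup>2 + 2 * y * \<beta> * (2 * \<alpha> + u * \<beta>) / u) \<le> - (1/2) * (\<alpha> + \<beta>) ^ 3"
proof -
  have y: "y / 2 \<le> y / u" using assms by (intro divide_left_mono) auto
  have xu: "x * u\<^sup>2 \<le> 2 * (x * u)" "x \<le> x * u" "x * u \<le> u"
    using mult_left_mono[of u 2 "x * u"] mult_left_mono[of 1 u x] mult_right_mono[of x 1 u] assms
    by (simp_all add: power2_eq_square mult_ac)
  have u: "y * \<beta> * (2 * \<alpha> + u * \<beta>) / u = 2 * \<alpha> * \<beta> * (y / u) + y * \<beta>\<^sup>2" using assms by (simp add: field_simps power2_eq_square)
  have c1: "- 2 + 4 * x - 3 * u - 3 * x * u + x * u\<^sup>2 + 2 * y - 4 * (y / u) \<le> - 3/2"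
    unfolding mult.assoc using assms y xu by linarith
  have c2: "- 3 * u + x * u - 2 + y \<le> - 3/2"
    using assms xu by linarith
  have "(\<alpha> + \<beta>) * (- 2 * (1 - 2 * x) * \<alpha>\<^sup>2 + \<alpha> * \<beta> * (- u * (1 + x) - 2 * (1 - x) * u + x * u\<^sup>2 + 2 * y) - (2 - y) * \<beta>\<^sup>2)
     - \<alpha> * (x * (2 * \<alpha> + u * \<beta>)\<^sup>2 + 2 * y * \<beta> * (2 * \<alpha> + u * \<beta>) / u)
   = - 2 * \<alpha> ^ 3 + \<alpha>\<^sup>2 * \<beta> * (- 2 + 4 * x - 3 * u - 3 * x * u + x * u\<^sup>2 + 2 * y - 4 * (y / u))
     + \<alpha> * \<beta>\<^sup>2 * (- 3 * u + x * u - 2 + y) - (2 - y) * \<beta> ^ 3"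
  proof -
    have e: "2 * y * \<beta> * (2 * \<alpha> + u * \<beta>) / u = 2 * (2 * \<alpha> * \<beta> * (y / u) + y * \<beta>\<^sup>2)" using u by simp
    show ?thesis unfolding e by algebra
  qed
  also have "\<dots> \<le> - (1/2) * \<alpha> ^ 3 + \<alpha>\<^sup>2 * \<beta> * (- 3/2) + \<alpha> * \<beta>\<^sup>2 * (- 3/2) - (1/2) * \<beta> ^ 3"
    using assms c1 c2 by (intro add_mono diff_mono mult_left_mono mult_right_mono) auto
  also have "\<dots> = - (1/2) * (\<alpha> + \<beta>) ^ 3" by (simp add: algebra_simps power2_eq_square power3_eq_cube)
  finally show ?thesis .
qed

section \<open>The curvature estimate at a point of the axis\<close>

lemma has_jet_diff:
  assumes "has_jet I u u0 A A' E" "has_jet I v v0 F F' G"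
  shows "has_jet I (\<lambda>i \<zeta>. u i \<zeta> - v i \<zeta>) (\<lambda>i. u0 i - v0 i) (\<lambda>i. A i - F i) (\<lambda>i. A' i - F' i) (\<lambda>i. E i - G i)"
proof -
  have "ubounded I (\<lambda>i. -1)" by (rule uboundedI[of _ _ 1]) simp
  from has_jet_add[OF assms(1) has_jet_cmult[OF this assms(2)]] show ?thesis by simp
qed

lemma ubounded_power: "ubounded I c \<Longrightarrow> ubounded I (\<lambda>i. c i ^ n)"
  by (induction n) (auto intro: ubounded_mult uboundedI[of _ _ 1])

text \<open>\<open>q\<close> and \<open>nb\<close> are the squared lengths of the two parts of the
  derivative of a disc, while \<open>\<alpha>\<close> and \<open>\<beta>\<close> are their
  contributions to the squared speed. In these variables the second-order coefficient and the
  squared gradient of the majorant depend on \<open>m\<close> only through \<open>u\<close>,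
  \<open>y\<close> and \<open>\<kappa>\<close>.\<close>

lemma curvature_jet_identities:
  fixes \<alpha> \<beta> x y m u \<kappa> :: real
  assumes x: "x < 1" and m: "m > 0" and u: "u > 0" and y: "1 - y = u * (m * (1 - x))"
  defines "q \<equiv> \<alpha> * (1 - x)\<^sup>2" and "nb \<equiv> \<beta> * (1 - y)" and "D2 \<equiv> \<alpha> / (1 - x)\<^sup>2"
  shows "D2 * (- 2 * (1 - 2 * x) * q - nb * (1 - x\<^sup>2) / m) + (1 - y) * (- \<beta>\<^sup>2 - 2 / m * \<alpha> * \<beta> + D2 * x * nb / m\<^sup>2) - \<beta> / (1 - y) * nb + 2 * y * \<alpha> * \<beta>
     = - 2 * (1 - 2 * x) * \<alpha>\<^sup>2 + \<alpha> * \<beta> * (- u * (1 + x) - 2 * (1 - x) * u + x * u\<^sup>2 + 2 * y) - (2 - y) * \<beta>\<^sup>2" (is ?A)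
    and "q * (2 * D2 * (1 - x) + (1 - y) * \<beta> / (m * (1 - x)\<^sup>2) + m * \<kappa> * (\<beta> / (1 - y)))\<^sup>2 = \<alpha> * (2 * \<alpha> + u * \<beta> + \<kappa> * \<beta> / u)\<^sup>2" (is ?B)
proof -
  define X where "X = 1 - x"
  define V where "V = 1 - y"
  have X: "X > 0" "X \<noteq> 0" using x by (simp_all add: X_def)
  have V: "V = u * m * X" using y by (simp add: V_def X_def mult.assoc)
  have V0: "V \<noteq> 0" using V X m u by simp
  have q: "D2 * q = \<alpha>\<^sup>2" using X by (simp add: D2_def q_def power2_eq_square flip: X_def)
  have x2: "1 - x\<^sup>2 = X * (1 + x)" by (simp add: X_def power2_eq_square algebra_simps)
  have 1: "D2 * (nb * (1 - x\<^sup>2) / m) = \<alpha> * \<beta> * (u * (1 + x))"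
    unfolding x2 D2_def nb_def V_def[symmetric] X_def[symmetric] V using X m by (simp add: field_simps power2_eq_square)
  have 2: "V * (2 / m * \<alpha> * \<beta>) = \<alpha> * \<beta> * (2 * X * u)" unfolding V using m by simp
  have 3: "V * (D2 * x * nb / m\<^sup>2) = \<alpha> * \<beta> * (x * u\<^sup>2)"
    unfolding D2_def nb_def V_def[symmetric] X_def[symmetric] V using X m by (simp add: field_simps power2_eq_square)
  have 4: "\<beta> / V * nb = \<beta>\<^sup>2" unfolding nb_def V_def[symmetric] using V0 by (simp add: power2_eq_square)
  have "D2 * (- 2 * (1 - 2 * x) * q - nb * (1 - x\<^sup>2) / m) + V * (- \<beta>\<^sup>2 - 2 / m * \<alpha> * \<beta> + D2 * x * nb / m\<^sup>2) - \<beta> / V * nb + 2 * y * \<alpha> * \<beta>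
    = - 2 * (1 - 2 * x) * (D2 * q) - D2 * (nb * (1 - x\<^sup>2) / m) - V * \<beta>\<^sup>2 - V * (2 / m * \<alpha> * \<beta>) + V * (D2 * x * nb / m\<^sup>2) - \<beta> / V * nb + 2 * y * \<alpha> * \<beta>"
    by (simp add: ring_distribs)
  also have "\<dots> = - 2 * (1 - 2 * x) * \<alpha>\<^sup>2 - \<alpha> * \<beta> * (u * (1 + x)) - V * \<beta>\<^sup>2 - \<alpha> * \<beta> * (2 * X * u) + \<alpha> * \<beta> * (x * u\<^sup>2) - \<beta>\<^sup>2 + 2 * y * \<alpha> * \<beta>"
    unfolding q 1 2 3 4 ..
  finally show ?A by (simp add: V_def X_def algebra_simps)
  have "(2 * D2 * X + V * \<beta> / (m * X\<^sup>2) + m * \<kappa> * (\<beta> / V)) * X = 2 * \<alpha> + u * \<beta> + \<kappa> * \<beta> / u"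
    unfolding D2_def X_def[symmetric] V using X m u by (simp add: field_simps power2_eq_square)
  moreover have "q * T\<^sup>2 = \<alpha> * (T * X)\<^sup>2" for T by (simp add: q_def X_def power_mult_distrib mult_ac)
  ultimately show ?B by (simp add: V_def X_def)
qed

context egg_dom begin

lemma wuQ_nonneg: assumes "z \<in> egg a m" shows "wuQ z v \<ge> 0"
  using wuQ_pos[OF assms, of v] wuQ_scale[of z 0 v] by (cases "v = 0") auto

lemma egg_cmod_nth: assumes "z \<in> egg a m" shows "cmod (z $ j) < 1"
proof (cases "j = a")
  case False
  have "(cmod (z$j))\<^sup>2 \<le> nq z" unfolding nsq_def using False by (intro member_le_sum) auto
  then have "(cmod (z$j))\<^sup>2 < 1\<^sup>2" using egg_nq[OF assms] by simp
  then show ?thesis by (rule power2_less_imp_less) simp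
qed (use egg_cmod_a[OF assms] in simp)

text \<open>Exactly the data that the uniform constants depend on: a common radius, a distance of
  the centre from the boundary and a lower bound for the squared speed at the centre.\<close>

definition centered_discs :: "real \<Rightarrow> real \<Rightarrow> real \<Rightarrow> (complex \<Rightarrow> complex^'n) set" where
  "centered_discs R \<delta> \<mu> = {\<phi>. holomorphic_map_on \<phi> (ball 0 R) \<and> \<phi> ` ball 0 R \<subseteq> egg a m \<and> (\<exists>p. \<phi> 0 = jn p 0)
     \<and> (cmod (\<phi> 0 $ a))\<^sup>2 \<le> 1 - \<delta> \<and> wuQ (\<phi> 0) (vderiv \<phi> 0) \<ge> \<mu>}"

text \<open>The covector given by \<open>d1\<close> and \<open>d\<close> is the metric dual of the
  derivative at 0, so both its value on that derivative and its squared dual norm equal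
  \<open>\<Lambda>\<close>. Along the disc this gives a minorant of the logarithm of the squared
  speed that is exact at 0; its mixed coefficient \<open>- E2\<close> is at least
  \<open>\<Lambda> / 2\<close>.\<close>

lemma centered_discs_log_mean:
  assumes R: "R > 0" and \<delta>: "\<delta> > 0" and \<mu>: "\<mu> > 0"
  shows "\<exists>C r0. r0 > 0 \<and> (\<forall>\<phi>\<in>centered_discs R \<delta> \<mu>. \<forall>r. 0 < r \<and> r < r0 \<longrightarrow>
     ln (wuQ (\<phi> 0) (vderiv \<phi> 0)) + r\<^sup>2 * (1/2 * wuQ (\<phi> 0) (vderiv \<phi> 0)) - C * r ^ 3
       \<le> cross_mean (\<lambda>\<zeta>. ln (wuQ (\<phi> \<zeta>) (vderiv \<phi> \<zeta>))) 0 r)"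
proof -
  define I where "I = centered_discs R \<delta> \<mu>"
  define p where "p \<phi> = \<phi> 0 $ a" for \<phi> :: "complex \<Rightarrow> complex^'n"
  define b where "b \<phi> = vderiv \<phi> 0" for \<phi> :: "complex \<Rightarrow> complex^'n"
  define a1 where "a1 \<phi> = b \<phi> $ a" for \<phi>
  define x where "x \<phi> = (cmod (p \<phi>))\<^sup>2" for \<phi>
  define y where "y \<phi> = cmod (p \<phi>) powr (2*m)" for \<phi>
  define \<kappa> where "\<kappa> \<phi> = cmod (p \<phi>) powr (2*m-2)" for \<phi>
  define q where "q \<phi> = (cmod (a1 \<phi>))\<^sup>2" for \<phi>
  define nb where "nb \<phi> = nq (b \<phi>)" for \<phi>
  define c where "c \<phi> = 1 / (1 - y \<phi>)" for \<phi>
  define \<alpha> where "\<alpha> \<phi> = q \<phi> / (1 - x \<phi>)\<^sup>2" for \<phi>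
  define \<beta> where "\<beta> \<phi> = nb \<phi> / (1 - y \<phi>)" for \<phi>
  define \<Lambda> where "\<Lambda> \<phi> = \<alpha> \<phi> + \<beta> \<phi>" for \<phi>
  define d1 where "d1 \<phi> = cnj (a1 \<phi>) / of_real ((1 - x \<phi>)\<^sup>2)" for \<phi>
  define d where "d \<phi> = of_real (c \<phi>) *s b \<phi>" for \<phi>
  define D2 where "D2 \<phi> = q \<phi> / (1 - x \<phi>) ^ 4" for \<phi>
  define h where "h \<phi> = of_real (m * \<kappa> \<phi>) * cnj (p \<phi>)" for \<phi>
  have \<phi>: "holomorphic_map_on \<phi> (ball 0 R)" "\<And>\<zeta>. cmod \<zeta> < R \<Longrightarrow> \<phi> \<zeta> \<in> egg a m" "\<phi> 0 = jn (p \<phi>) 0"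
      "x \<phi> \<le> 1 - \<delta>" "wuQ (\<phi> 0) (b \<phi>) \<ge> \<mu>" if "\<phi> \<in> I" for \<phi>
    using that by (auto simp: I_def centered_discs_def p_def b_def x_def)
  have x: "0 \<le> x \<phi>" "x \<phi> < 1" "1 - x \<phi> \<ge> \<delta>" "1 - x \<phi> \<noteq> 0" if "\<phi> \<in> I" for \<phi> using \<phi>(4)[OF that] \<delta> by (auto simp: x_def)
  have yx: "y \<phi> = x \<phi> powr m" for \<phi> by (simp add: y_def x_def cmod_sq_powr)
  \<comment> \<open>Concave Bernoulli bounds \<open>1 - y\<close> from below by
    \<open>m * (1 - x)\<close>. The upper bound combines \<open>x \<le> x powr m\<close> with
    \<open>2 * m \<ge> 1\<close>. Together they give the range from 1 to 2 of the ratio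
    \<open>u\<close> below.\<close>
  have y: "0 \<le> y \<phi>" "y \<phi> < 1" "1 - y \<phi> \<ge> \<delta> / 2" "m * (1 - x \<phi>) \<le> 1 - y \<phi>" "1 - y \<phi> \<le> 2 * (m * (1 - x \<phi>))" "1 - y \<phi> \<noteq> 0" if i: "\<phi> \<in> I" for \<phi>
  proof -
    show "0 \<le> y \<phi>" by (simp add: y_def)
    have "y \<phi> \<le> 1 + m * (x \<phi> - 1)" unfolding yx by (rule Bernoulli_powr_concave) (use x[OF i] m_lt in auto)
    then show 1: "m * (1 - x \<phi>) \<le> 1 - y \<phi>" by (simp add: algebra_simps)
    have "1/2 * \<delta> \<le> m * (1 - x \<phi>)" using m_ge x[OF i] \<delta> by (intro mult_mono) auto
    then show "1 - y \<phi> \<ge> \<delta> / 2" using 1 by simp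
    then show "y \<phi> < 1" "1 - y \<phi> \<noteq> 0" using \<delta> by auto
    have "x \<phi> powr 1 \<le> x \<phi> powr m" using x[OF i] m_lt powr_mono'[of m 1 "x \<phi>"] by simp
    then have "1 - y \<phi> \<le> 1 - x \<phi>" using x[OF i] by (simp add: yx)
    also have "\<dots> \<le> (2 * m) * (1 - x \<phi>)" using m_ge x[OF i] mult_right_mono[of 1 "2 * m" "1 - x \<phi>"] by simp
    finally show "1 - y \<phi> \<le> 2 * (m * (1 - x \<phi>))" by simp
  qed
  have \<kappa>x: "\<kappa> \<phi> * x \<phi> = y \<phi>" for \<phi>
  proof (cases "p \<phi> = 0")
    case False
    then have "cmod (p \<phi>) powr (2*m) = cmod (p \<phi>) powr (2*m-2) * cmod (p \<phi>) powr 2" unfolding powr_add[symmetric] by simp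
    then show ?thesis using False by (simp add: \<kappa>_def x_def y_def)
  qed (simp add: \<kappa>_def x_def y_def)
  have \<Lambda>: "wuQ (\<phi> 0) (b \<phi>) = \<Lambda> \<phi>" if "\<phi> \<in> I" for \<phi>
    using wuQ_axis[OF \<phi>(3)[OF that]] by (simp add: \<Lambda>_def \<alpha>_def \<beta>_def q_def nb_def x_def y_def a1_def)
  have \<Lambda>\<mu>: "\<Lambda> \<phi> \<ge> \<mu>" "\<Lambda> \<phi> > 0" if "\<phi> \<in> I" for \<phi> using \<phi>(5)[OF that] \<Lambda>[OF that] \<mu> by auto
  have \<alpha>\<beta>: "\<alpha> \<phi> \<ge> 0" "\<beta> \<phi> \<ge> 0" if "\<phi> \<in> I" for \<phi> using y[OF that] by (auto simp: \<alpha>_def \<beta>_def q_def nb_def)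

  have holj: "(\<lambda>\<zeta>. \<phi> \<zeta> $ j) holomorphic_on ball 0 R" if "\<phi> \<in> I" for \<phi> j using \<phi>(1)[OF that] by (simp add: holomorphic_map_on_def)
  have bdj: "cmod (\<phi> \<zeta> $ j) \<le> 1" if "\<phi> \<in> I" "cmod \<zeta> < R" for \<phi> \<zeta> j using egg_cmod_nth[OF \<phi>(2)[OF that]] by (simp add: less_imp_le)
  have Gj: "has_jet I (\<lambda>\<phi> \<zeta>. \<phi> \<zeta> $ j) (\<lambda>\<phi>. \<phi> 0 $ j) (\<lambda>\<phi>. b \<phi> $ j) (\<lambda>_. 0) (\<lambda>_. 0)" for j
    using has_jet_holomorphic[OF R, of I "\<lambda>\<phi> \<zeta>. \<phi> \<zeta> $ j" 1] holj bdj by (simp add: b_def vderiv_def)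
  have bj: "ubounded I (\<lambda>\<phi>. b \<phi> $ j)" for j using Gj[of j] by (simp add: has_jet_def)
  have F: "has_jet I (\<lambda>\<phi> \<zeta>. \<phi> \<zeta> $ a) p a1 (\<lambda>_. 0) (\<lambda>_. 0)" using Gj[of a] by (simp add: p_def[abs_def] a1_def[abs_def])
  have up: "ubounded I p" "ubounded I (\<lambda>\<phi>. cnj (p \<phi>))" "ubounded I a1" "ubounded I (\<lambda>\<phi>. cnj (a1 \<phi>))"
    using F has_jet_cnj[OF F] by (simp_all add: has_jet_def)
  have uc: "ubounded I (\<lambda>\<phi>. of_real (c \<phi>))"
  proof (rule uboundedI[of _ _ "2 / \<delta>"])
    fix \<phi> assume i: "\<phi> \<in> I"
    have "1 / (1 - y \<phi>) \<le> 1 / (\<delta> / 2)" using y[OF i] \<delta> by (intro divide_left_mono) auto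
    then show "cmod (of_real (c \<phi>)) \<le> 2 / \<delta>" using y[OF i] unfolding c_def norm_of_real by simp
  qed
  have ux: "ubounded I (\<lambda>\<phi>. of_real (1 / (1 - x \<phi>)))"
  proof (rule uboundedI[of _ _ "1 / \<delta>"])
    fix \<phi> assume i: "\<phi> \<in> I"
    have "1 / (1 - x \<phi>) \<le> 1 / \<delta>" using x[OF i] \<delta> by (intro divide_left_mono) auto
    then show "cmod (of_real (1 / (1 - x \<phi>))) \<le> 1 / \<delta>" using x[OF i] unfolding norm_of_real by simp
  qed
  have ud1: "ubounded I d1" "ubounded I (\<lambda>\<phi>. cnj (d1 \<phi>))"
  proof -
    show "ubounded I d1"
      by (rule bigO_unif_cong[OF ubounded_mult[OF up(4) ubounded_power[OF ux, of 2]]]) (simp add: d1_def power_divide)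
    then show "ubounded I (\<lambda>\<phi>. cnj (d1 \<phi>))" by (rule bigO_unif_cnj)
  qed
  have uconst: "ubounded I (\<lambda>_. k)" for k by (rule uboundedI[of _ _ "cmod k"]) simp
  have D2: "of_real (D2 \<phi>) = d1 \<phi> * cnj (d1 \<phi>)" "(cmod (d1 \<phi>))\<^sup>2 = D2 \<phi>" if "\<phi> \<in> I" for \<phi>
  proof -
    have "cmod (d1 \<phi>) = cmod (a1 \<phi>) / (1 - x \<phi>)\<^sup>2" unfolding d1_def norm_divide norm_of_real by simp
    then show "(cmod (d1 \<phi>))\<^sup>2 = D2 \<phi>" by (simp add: D2_def power_divide q_def flip: power_mult)
    then show "of_real (D2 \<phi>) = d1 \<phi> * cnj (d1 \<phi>)" by (metis complex_norm_square)
  qed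
  have uD2: "ubounded I (\<lambda>\<phi>. of_real (D2 \<phi>))" by (rule bigO_unif_cong[OF ubounded_mult[OF ud1]]) (simp add: D2)
  \<comment> \<open>\<open>\<kappa>\<close> is unbounded as \<open>p\<close> tends to 0, but
    together with \<open>cnj p\<close> it leaves the exponent \<open>2*m - 1\<close>, which is not
    negative.\<close>
  have uh: "ubounded I h"
  proof (rule uboundedI[of _ _ "1"])
    fix \<phi> assume i: "\<phi> \<in> I"
    show "cmod (h \<phi>) \<le> 1"
    proof (cases "p \<phi> = 0")
      case False
      have "cmod (h \<phi>) = m * (cmod (p \<phi>) powr (2*m-2) * cmod (p \<phi>) powr 1)" using m_pos(1) by (simp add: h_def \<kappa>_def norm_mult)
      also have "\<dots> = m * cmod (p \<phi>) powr (2*m-1)" using False by (simp only: flip: powr_add) simp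
      also have "\<dots> \<le> 1 * 1"
      proof (rule mult_mono)
        have "cmod (p \<phi>) \<le> 1" using bdj[OF i, of 0 a] R by (simp add: p_def)
        then show "cmod (p \<phi>) powr (2*m-1) \<le> 1" using m_ge by (intro powr_le1) auto
      qed (use m_lt in auto)
      finally show ?thesis by simp
    qed (simp add: h_def)
  qed
  \<comment> \<open>At the centre all components other than \<open>a\<close> vanish. So
    \<open>X\<close> vanishes to first order and \<open>W\<close> to second order, and
    \<open>W\<^sup>2\<close> contributes nothing to the jets.\<close>
  define X where "X \<phi> \<zeta> = ip (\<phi> \<zeta>) (d \<phi>)" for \<phi> and \<zeta> :: complex
  define W where "W \<phi> \<zeta> = nq (\<phi> \<zeta>)" for \<phi> :: "complex \<Rightarrow> complex^'n" and \<zeta> :: complex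
  have \<phi>0: "\<phi> 0 $ j = 0" if "\<phi> \<in> I" "j \<noteq> a" for \<phi> j using \<phi>(3)[OF that(1)] that(2) by simp
  have X: "has_jet I X (\<lambda>_. 0) (\<lambda>\<phi>. of_real (\<beta> \<phi>)) (\<lambda>_. 0) (\<lambda>_. 0)"
  proof (rule has_jet_cong)
    have "ubounded I (\<lambda>\<phi>. cnj (d \<phi> $ j))" for j
      by (rule bigO_unif_cong[OF bigO_unif_cnj[OF ubounded_mult[OF uc bj[of j]]]]) (simp add: d_def)
    then show "has_jet I (\<lambda>\<phi> \<zeta>. \<Sum>j\<in>UNIV-{a}. cnj (d \<phi> $ j) * \<phi> \<zeta> $ j) (\<lambda>\<phi>. \<Sum>j\<in>UNIV-{a}. cnj (d \<phi> $ j) * \<phi> 0 $ j)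
      (\<lambda>\<phi>. \<Sum>j\<in>UNIV-{a}. cnj (d \<phi> $ j) * b \<phi> $ j) (\<lambda>\<phi>. \<Sum>j\<in>UNIV-{a}. cnj (d \<phi> $ j) * 0) (\<lambda>\<phi>. \<Sum>j\<in>UNIV-{a}. cnj (d \<phi> $ j) * 0)"
      by (intro has_jet_sum has_jet_cmult Gj) auto
    fix \<phi> assume i: "\<phi> \<in> I"
    show "(\<Sum>j\<in>UNIV-{a}. cnj (d \<phi> $ j) * \<phi> \<zeta> $ j) = X \<phi> \<zeta>" for \<zeta> by (simp add: X_def hin_def mult.commute)
    show "(\<Sum>j\<in>UNIV-{a}. cnj (d \<phi> $ j) * \<phi> 0 $ j) = 0" using \<phi>0[OF i] by (intro sum.neutral) auto
    have "(\<Sum>j\<in>UNIV-{a}. cnj (d \<phi> $ j) * b \<phi> $ j) = ip (b \<phi>) (d \<phi>)" by (simp add: hin_def mult.commute)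
    also have "\<dots> = of_real (\<beta> \<phi>)" by (simp add: d_def hin_scale_right hin_self \<beta>_def c_def nb_def)
    finally show "(\<Sum>j\<in>UNIV-{a}. cnj (d \<phi> $ j) * b \<phi> $ j) = of_real (\<beta> \<phi>)" .
  qed simp_all
  have W: "has_jet I (\<lambda>\<phi> \<zeta>. of_real (W \<phi> \<zeta>)) (\<lambda>_. 0) (\<lambda>_. 0) (\<lambda>_. 0) (\<lambda>\<phi>. of_real (nb \<phi>))"
  proof (rule has_jet_cong[OF has_jet_sum[OF _ has_jet_mult[OF Gj has_jet_cnj[OF Gj]], of "UNIV - {a}" "\<lambda>j. j" "\<lambda>j. j"]])
    fix \<phi> assume i: "\<phi> \<in> I"
    show "(\<Sum>j\<in>UNIV-{a}. \<phi> \<zeta> $ j * cnj (\<phi> \<zeta> $ j)) = of_real (W \<phi> \<zeta>)" for \<zeta> by (simp add: W_def hin_def flip: hin_self)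
    show "(\<Sum>j\<in>UNIV-{a}. \<phi> 0 $ j * cnj 0 + cnj (\<phi> 0 $ j) * b \<phi> $ j) = 0" using \<phi>0[OF i] by (intro sum.neutral) auto
    show "(\<Sum>j\<in>UNIV-{a}. \<phi> 0 $ j * cnj (b \<phi> $ j) + cnj (\<phi> 0 $ j) * 0) = 0" using \<phi>0[OF i] by (intro sum.neutral) auto
    show "(\<Sum>j\<in>UNIV-{a}. \<phi> 0 $ j * cnj (\<phi> 0 $ j)) = 0" using \<phi>0[OF i] by (intro sum.neutral) auto
    have "(\<Sum>j\<in>UNIV-{a}. \<phi> 0 $ j * cnj 0 + cnj (\<phi> 0 $ j) * 0 + (b \<phi> $ j * cnj (b \<phi> $ j) + 0 * cnj 0)) = ip (b \<phi>) (b \<phi>)"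
      unfolding hin_def by (intro sum.cong) auto
    then show "(\<Sum>j\<in>UNIV-{a}. \<phi> 0 $ j * cnj 0 + cnj (\<phi> 0 $ j) * 0 + (b \<phi> $ j * cnj (b \<phi> $ j) + 0 * cnj 0)) = of_real (nb \<phi>)"
      by (simp add: hin_self nb_def)
  qed auto
  define Y where "Y \<phi> \<zeta> = (cmod (\<phi> \<zeta> $ a))\<^sup>2" for \<phi> :: "complex \<Rightarrow> complex^'n" and \<zeta> :: complex
  have One: "has_jet I (\<lambda>_ _. 1) (\<lambda>_. 1) (\<lambda>_. 0) (\<lambda>_. 0) (\<lambda>_. 0)" using has_jet_const[OF uconst[of 1]] .
  have xc: "complex_of_real (x \<phi>) = p \<phi> * cnj (p \<phi>)" for \<phi> unfolding x_def by (rule complex_norm_square)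
  have qc: "complex_of_real (q \<phi>) = a1 \<phi> * cnj (a1 \<phi>)" for \<phi> unfolding q_def by (rule complex_norm_square)
  have Y: "has_jet I (\<lambda>\<phi> \<zeta>. of_real (Y \<phi> \<zeta>)) (\<lambda>\<phi>. of_real (x \<phi>)) (\<lambda>\<phi>. cnj (p \<phi>) * a1 \<phi>) (\<lambda>\<phi>. p \<phi> * cnj (a1 \<phi>)) (\<lambda>\<phi>. of_real (q \<phi>))"
    by (rule has_jet_cong[OF has_jet_mult[OF F has_jet_cnj[OF F]]]) (simp_all add: Y_def complex_norm_square xc qc del: of_real_power)
  have Y1: "has_jet I (\<lambda>\<phi> \<zeta>. of_real ((1 - Y \<phi> \<zeta>)\<^sup>2)) (\<lambda>\<phi>. of_real ((1 - x \<phi>)\<^sup>2)) (\<lambda>\<phi>. of_real (- 2 * (1 - x \<phi>)) * (cnj (p \<phi>) * a1 \<phi>))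
     (\<lambda>\<phi>. of_real (- 2 * (1 - x \<phi>)) * (p \<phi> * cnj (a1 \<phi>))) (\<lambda>\<phi>. of_real (- 2 * (1 - 2 * x \<phi>) * q \<phi>))"
    by (rule has_jet_cong[OF has_jet_mult[OF has_jet_diff[OF One Y] has_jet_diff[OF One Y]]])
       (simp_all add: power2_eq_square algebra_simps xc qc)
  have WY: "has_jet I (\<lambda>\<phi> \<zeta>. of_real (W \<phi> \<zeta> * (1 - (Y \<phi> \<zeta>)\<^sup>2))) (\<lambda>_. 0) (\<lambda>_. 0) (\<lambda>_. 0) (\<lambda>\<phi>. of_real (nb \<phi> * (1 - (x \<phi>)\<^sup>2)))"
    by (rule has_jet_cong[OF has_jet_mult[OF W has_jet_diff[OF One has_jet_mult[OF Y Y]]]]) (simp_all add: power2_eq_square mult_ac)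
  have WW: "has_jet I (\<lambda>\<phi> \<zeta>. of_real ((W \<phi> \<zeta>)\<^sup>2)) (\<lambda>_. 0) (\<lambda>_. 0) (\<lambda>_. 0) (\<lambda>_. 0)"
    by (rule has_jet_cong[OF has_jet_mult[OF W W]]) (simp_all add: power2_eq_square)
  define T1 where "T1 \<phi> \<zeta> = (1 - Y \<phi> \<zeta>)\<^sup>2 - W \<phi> \<zeta> / m * (1 - (Y \<phi> \<zeta>)\<^sup>2) + 11 * (W \<phi> \<zeta>)\<^sup>2" for \<phi> \<zeta>
  have T1: "has_jet I (\<lambda>\<phi> \<zeta>. of_real (D2 \<phi> * T1 \<phi> \<zeta>)) (\<lambda>\<phi>. of_real (D2 \<phi> * (1 - x \<phi>)\<^sup>2)) (\<lambda>\<phi>. of_real (- 2 * D2 \<phi> * (1 - x \<phi>)) * (cnj (p \<phi>) * a1 \<phi>))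
     (\<lambda>\<phi>. of_real (- 2 * D2 \<phi> * (1 - x \<phi>)) * (p \<phi> * cnj (a1 \<phi>))) (\<lambda>\<phi>. of_real (D2 \<phi> * (- 2 * (1 - 2 * x \<phi>) * q \<phi> - nb \<phi> * (1 - (x \<phi>)\<^sup>2) / m)))"
    by (rule has_jet_cong[OF has_jet_cmult[OF uD2 has_jet_add[OF has_jet_diff[OF Y1 has_jet_cmult[OF uconst[of "1 / of_real m"] WY]] has_jet_cmult[OF uconst[of 11] WW]]]])
       (simp_all add: T1_def algebra_simps diff_divide_distrib)
  \<comment> \<open>The majorant of \<open>sg z - cmod (z$a) powr (2*m)\<close> obtained from the
    tangent plane at the centre. \<open>T1\<close> and \<open>S\<close> likewise replace the other
    factors of \<open>dual_sq\<close>.\<close>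
  define L where "L \<phi> \<zeta> = 1 - W \<phi> \<zeta> - (y \<phi> + Re (of_real (2 * m * \<kappa> \<phi>) * cnj (p \<phi>) * (\<phi> \<zeta> $ a - p \<phi>)))" for \<phi> \<zeta>
  have uy: "ubounded I (\<lambda>\<phi>. of_real (y \<phi>))" by (rule uboundedI[of _ _ 1]) (use y in \<open>auto simp: less_imp_le\<close>)
  have Re2: "complex_of_real (Re (of_real (2 * r) * z * v)) = (of_real r * z) * v + cnj ((of_real r * z) * v)" for r z v
    unfolding complex_add_cnj by (simp add: algebra_simps)
  have L: "has_jet I (\<lambda>\<phi> \<zeta>. of_real (L \<phi> \<zeta>)) (\<lambda>\<phi>. of_real (1 - y \<phi>)) (\<lambda>\<phi>. of_real (- m * \<kappa> \<phi>) * (cnj (p \<phi>) * a1 \<phi>))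
     (\<lambda>\<phi>. of_real (- m * \<kappa> \<phi>) * (p \<phi> * cnj (a1 \<phi>))) (\<lambda>\<phi>. of_real (- nb \<phi>))"
  proof -
    have 1: "has_jet I (\<lambda>\<phi> \<zeta>. h \<phi> * (\<phi> \<zeta> $ a - p \<phi>)) (\<lambda>\<phi>. 0) (\<lambda>\<phi>. h \<phi> * a1 \<phi>) (\<lambda>_. 0) (\<lambda>_. 0)"
      by (rule has_jet_cong[OF has_jet_cmult[OF uh has_jet_diff[OF F has_jet_const[OF up(1)]]]]) simp_all
    have Lc: "complex_of_real (L \<phi> \<zeta>) = 1 - of_real (W \<phi> \<zeta>) - (of_real (y \<phi>) + (h \<phi> * (\<phi> \<zeta> $ a - p \<phi>) + cnj (h \<phi> * (\<phi> \<zeta> $ a - p \<phi>))))" for \<phi> \<zeta>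
      by (simp only: L_def of_real_diff of_real_add of_real_1 mult.assoc[of 2 m] Re2 h_def)
    show ?thesis
      by (rule has_jet_cong[OF has_jet_diff[OF has_jet_diff[OF One W] has_jet_add[OF has_jet_const[OF uy] has_jet_add[OF 1 has_jet_cnj[OF 1]]]]])
         (simp_all add: Lc h_def mult_ac)
  qed
  define S where "S \<phi> \<zeta> = nq (d \<phi>) - (cmod (X \<phi> \<zeta>))\<^sup>2 - 2 / m * Re (d1 \<phi> * \<phi> \<zeta> $ a * cnj (X \<phi> \<zeta>)) + D2 \<phi> * Y \<phi> \<zeta> / m\<^sup>2 * (W \<phi> \<zeta> + 2 * (W \<phi> \<zeta>)\<^sup>2)" for \<phi> \<zeta>
  have nd: "nq (d \<phi>) = c \<phi> * \<beta> \<phi>" for \<phi> by (simp add: d_def nsq_scale c_def \<beta>_def nb_def power2_eq_square norm_divide del: of_real_divide)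
  have und: "ubounded I (\<lambda>\<phi>. of_real (nq (d \<phi>)))"
  proof -
    have "ubounded I (\<lambda>\<phi>. of_real (\<beta> \<phi>))" using X by (simp add: has_jet_def)
    then show ?thesis by (rule bigO_unif_cong[OF ubounded_mult[OF uc]]) (simp add: nd)
  qed
  define \<gamma> where "\<gamma> \<phi> = \<beta> \<phi> / (m * (1 - x \<phi>)\<^sup>2)" for \<phi>
  have S: "has_jet I (\<lambda>\<phi> \<zeta>. of_real (S \<phi> \<zeta>)) (\<lambda>\<phi>. of_real (c \<phi> * \<beta> \<phi>)) (\<lambda>\<phi>. of_real (- \<gamma> \<phi>) * (cnj (p \<phi>) * a1 \<phi>))
     (\<lambda>\<phi>. of_real (- \<gamma> \<phi>) * (p \<phi> * cnj (a1 \<phi>))) (\<lambda>\<phi>. of_real (- (\<beta> \<phi>)\<^sup>2 - 2 / m * \<alpha> \<phi> * \<beta> \<phi> + D2 \<phi> * x \<phi> * nb \<phi> / m\<^sup>2))"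
  proof -
    have XX: "has_jet I (\<lambda>\<phi> \<zeta>. of_real ((cmod (X \<phi> \<zeta>))\<^sup>2)) (\<lambda>_. 0) (\<lambda>_. 0) (\<lambda>_. 0) (\<lambda>\<phi>. of_real ((\<beta> \<phi>)\<^sup>2))"
      by (rule has_jet_cong[OF has_jet_mult[OF X has_jet_cnj[OF X]]]) (simp_all add: complex_norm_square power2_eq_square[of "complex_of_real (\<beta> _)"] cmod_sq_cnj)
    have FX: "has_jet I (\<lambda>\<phi> \<zeta>. d1 \<phi> * \<phi> \<zeta> $ a * cnj (X \<phi> \<zeta>)) (\<lambda>_. 0) (\<lambda>_. 0) (\<lambda>\<phi>. of_real (m * \<gamma> \<phi>) * (p \<phi> * cnj (a1 \<phi>))) (\<lambda>\<phi>. of_real (\<alpha> \<phi> * \<beta> \<phi>))"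
      by (rule has_jet_cong[OF has_jet_cmult[OF ud1(1) has_jet_mult[OF F has_jet_cnj[OF X]]]])
         (simp_all add: d1_def \<gamma>_def \<alpha>_def qc mult_ac)
    have YW: "has_jet I (\<lambda>\<phi> \<zeta>. of_real (Y \<phi> \<zeta> * (W \<phi> \<zeta> + 2 * (W \<phi> \<zeta>)\<^sup>2))) (\<lambda>_. 0) (\<lambda>_. 0) (\<lambda>_. 0) (\<lambda>\<phi>. of_real (x \<phi> * nb \<phi>))"
      by (rule has_jet_cong[OF has_jet_mult[OF Y has_jet_add[OF W has_jet_cmult[OF uconst[of 2] WW]]]]) simp_all
    have Rec: "complex_of_real (2 / m * Re v) = (1 / of_real m) * (v + cnj v)" for v
      unfolding complex_add_cnj by simp
    have Sc: "complex_of_real (S \<phi> \<zeta>) = of_real (nq (d \<phi>)) - of_real ((cmod (X \<phi> \<zeta>))\<^sup>2) - (1 / of_real m) * (d1 \<phi> * \<phi> \<zeta> $ a * cnj (X \<phi> \<zeta>) + cnj (d1 \<phi> * \<phi> \<zeta> $ a * cnj (X \<phi> \<zeta>)))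
        + of_real (D2 \<phi>) * (1 / of_real (m\<^sup>2)) * of_real (Y \<phi> \<zeta> * (W \<phi> \<zeta> + 2 * (W \<phi> \<zeta>)\<^sup>2))" for \<phi> \<zeta>
      unfolding Rec[symmetric] by (simp add: S_def)
    show ?thesis
      by (rule has_jet_cong[OF has_jet_add[OF has_jet_diff[OF has_jet_diff[OF has_jet_const[OF und] XX] has_jet_cmult[OF uconst[of "1 / of_real m"] has_jet_add[OF FX has_jet_cnj[OF FX]]]]
           has_jet_cmult[OF ubounded_mult[OF uD2 uconst[of "1 / of_real (m\<^sup>2)"]] YW]]])
         (simp_all add: Sc nd mult_ac \<gamma>_def)
  qed
  define Z where "Z \<phi> = 2 * D2 \<phi> * (1 - x \<phi>) + (1 - y \<phi>) * \<beta> \<phi> / (m * (1 - x \<phi>)\<^sup>2) + m * \<kappa> \<phi> * (\<beta> \<phi> / (1 - y \<phi>))" for \<phi>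
  define NE where "NE \<phi> = D2 \<phi> * (- 2 * (1 - 2 * x \<phi>) * q \<phi> - nb \<phi> * (1 - (x \<phi>)\<^sup>2) / m) + (1 - y \<phi>) * (- (\<beta> \<phi>)\<^sup>2 - 2 / m * \<alpha> \<phi> * \<beta> \<phi> + D2 \<phi> * x \<phi> * nb \<phi> / m\<^sup>2) - \<beta> \<phi> / (1 - y \<phi>) * nb \<phi> + 2 * y \<phi> * \<alpha> \<phi> * \<beta> \<phi>" for \<phi>
  have N: "has_jet I (\<lambda>\<phi> \<zeta>. of_real (D2 \<phi> * T1 \<phi> \<zeta> + L \<phi> \<zeta> * S \<phi> \<zeta>)) (\<lambda>\<phi>. of_real (\<Lambda> \<phi>)) (\<lambda>\<phi>. of_real (- Z \<phi>) * (cnj (p \<phi>) * a1 \<phi>))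
     (\<lambda>\<phi>. of_real (- Z \<phi>) * (p \<phi> * cnj (a1 \<phi>))) (\<lambda>\<phi>. of_real (NE \<phi>))"
  proof (rule has_jet_cong[OF has_jet_add[OF T1 has_jet_mult[OF L S]]])
    fix \<phi> assume i: "\<phi> \<in> I"
    show "complex_of_real (D2 \<phi> * (1 - x \<phi>)\<^sup>2) + of_real (1 - y \<phi>) * of_real (c \<phi> * \<beta> \<phi>) = of_real (\<Lambda> \<phi>)"
    proof -
      have "D2 \<phi> * (1 - x \<phi>)\<^sup>2 + (1 - y \<phi>) * (c \<phi> * \<beta> \<phi>) = \<Lambda> \<phi>"
        using x(4)[OF i] y(6)[OF i] by (simp add: D2_def c_def \<Lambda>_def \<alpha>_def power2_eq_square power4_eq_xxxx)
      then show ?thesis by (simp only: flip: of_real_add of_real_mult)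
    qed
    have Zc: "- 2 * D2 \<phi> * (1 - x \<phi>) + ((1 - y \<phi>) * - \<gamma> \<phi> + c \<phi> * \<beta> \<phi> * (- m * \<kappa> \<phi>)) = - Z \<phi>"
      by (simp add: Z_def \<gamma>_def c_def algebra_simps)
    have comb: "of_real r1 * v + (of_real r2 * (of_real r3 * v) + of_real r4 * (of_real r5 * v)) = of_real (r1 + (r2 * r3 + r4 * r5)) * v" for r1 r2 r3 r4 r5 :: real and v :: complex
      by (simp add: algebra_simps)
    show "of_real (- 2 * D2 \<phi> * (1 - x \<phi>)) * (cnj (p \<phi>) * a1 \<phi>) + (of_real (1 - y \<phi>) * (of_real (- \<gamma> \<phi>) * (cnj (p \<phi>) * a1 \<phi>)) + of_real (c \<phi> * \<beta> \<phi>) * (of_real (- m * \<kappa> \<phi>) * (cnj (p \<phi>) * a1 \<phi>)))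
      = of_real (- Z \<phi>) * (cnj (p \<phi>) * a1 \<phi>)" unfolding comb Zc ..
    show "of_real (- 2 * D2 \<phi> * (1 - x \<phi>)) * (p \<phi> * cnj (a1 \<phi>)) + (of_real (1 - y \<phi>) * (of_real (- \<gamma> \<phi>) * (p \<phi> * cnj (a1 \<phi>))) + of_real (c \<phi> * \<beta> \<phi>) * (of_real (- m * \<kappa> \<phi>) * (p \<phi> * cnj (a1 \<phi>))))
      = of_real (- Z \<phi>) * (p \<phi> * cnj (a1 \<phi>))" unfolding comb Zc ..
    have pa: "(r1 * (cnj (p \<phi>) * a1 \<phi>)) * (r2 * (p \<phi> * cnj (a1 \<phi>))) = r1 * r2 * of_real (x \<phi> * q \<phi>)"
       "(r1 * (p \<phi> * cnj (a1 \<phi>))) * (r2 * (cnj (p \<phi>) * a1 \<phi>)) = r1 * r2 * of_real (x \<phi> * q \<phi>)" for r1 r2 by (simp_all add: xc qc mult_ac)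
    have "2 * (m * \<kappa> \<phi> * \<gamma> \<phi> * (x \<phi> * q \<phi>)) = 2 * (\<kappa> \<phi> * x \<phi>) * \<alpha> \<phi> * \<beta> \<phi>"
      by (simp add: \<gamma>_def \<alpha>_def mult_ac)
    then have "D2 \<phi> * (- 2 * (1 - 2 * x \<phi>) * q \<phi> - nb \<phi> * (1 - (x \<phi>)\<^sup>2) / m) + ((1 - y \<phi>) * (- (\<beta> \<phi>)\<^sup>2 - 2 / m * \<alpha> \<phi> * \<beta> \<phi> + D2 \<phi> * x \<phi> * nb \<phi> / m\<^sup>2)
        + c \<phi> * \<beta> \<phi> * - nb \<phi> + ((- m * \<kappa> \<phi>) * (- \<gamma> \<phi>) * (x \<phi> * q \<phi>) + (- m * \<kappa> \<phi>) * (- \<gamma> \<phi>) * (x \<phi> * q \<phi>))) = NE \<phi>"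
      unfolding \<kappa>x by (simp add: NE_def c_def mult_ac)
    then show "of_real (D2 \<phi> * (- 2 * (1 - 2 * x \<phi>) * q \<phi> - nb \<phi> * (1 - (x \<phi>)\<^sup>2) / m)) + (of_real (1 - y \<phi>) * of_real (- (\<beta> \<phi>)\<^sup>2 - 2 / m * \<alpha> \<phi> * \<beta> \<phi> + D2 \<phi> * x \<phi> * nb \<phi> / m\<^sup>2)
        + of_real (c \<phi> * \<beta> \<phi>) * of_real (- nb \<phi>) + (of_real (- m * \<kappa> \<phi>) * (cnj (p \<phi>) * a1 \<phi>) * (of_real (- \<gamma> \<phi>) * (p \<phi> * cnj (a1 \<phi>))) + of_real (- m * \<kappa> \<phi>) * (p \<phi> * cnj (a1 \<phi>)) * (of_real (- \<gamma> \<phi>) * (cnj (p \<phi>) * a1 \<phi>)))) = complex_of_real (NE \<phi>)"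
      unfolding pa by (simp only: flip: of_real_add of_real_mult)
  qed simp
  \<comment> \<open>The mixed coefficient of the logarithm of the majorant, normalised at the
    centre: second-order term minus squared gradient, as in \<open>has_jet_ln\<close>.\<close>
  define E2 where "E2 \<phi> = NE \<phi> / \<Lambda> \<phi> - x \<phi> * (q \<phi> * (Z \<phi>)\<^sup>2) / (\<Lambda> \<phi>)\<^sup>2" for \<phi>
  have E2: "E2 \<phi> \<le> - (1/2) * \<Lambda> \<phi>" if i: "\<phi> \<in> I" for \<phi>
  proof -
    define u where "u = (1 - y \<phi>) / (m * (1 - x \<phi>))"
    have mx: "m * (1 - x \<phi>) > 0" using x[OF i] by simp
    have u: "1 \<le> u" "u \<le> 2" "1 - y \<phi> = u * (m * (1 - x \<phi>))"
      unfolding u_def using y(4,5)[OF i] mx x(4)[OF i] by (simp_all add: pos_divide_le_eq)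
    have qn: "q \<phi> = \<alpha> \<phi> * (1 - x \<phi>)\<^sup>2" "nb \<phi> = \<beta> \<phi> * (1 - y \<phi>)" "D2 \<phi> = \<alpha> \<phi> / (1 - x \<phi>)\<^sup>2"
      using x(4)[OF i] y(6)[OF i] by (simp_all add: \<alpha>_def \<beta>_def D2_def flip: power_add)
    note id = curvature_jet_identities[OF x(2)[OF i] m_pos(1) _ u(3), of "\<alpha> \<phi>" "\<beta> \<phi>", folded qn]
    have NE: "NE \<phi> = - 2 * (1 - 2 * x \<phi>) * (\<alpha> \<phi>)\<^sup>2 + \<alpha> \<phi> * \<beta> \<phi> * (- u * (1 + x \<phi>) - 2 * (1 - x \<phi>) * u + x \<phi> * u\<^sup>2 + 2 * y \<phi>) - (2 - y \<phi>) * (\<beta> \<phi>)\<^sup>2"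
      unfolding NE_def by (rule id(1)) (use u in simp)
    have "q \<phi> * (Z \<phi>)\<^sup>2 = \<alpha> \<phi> * (2 * \<alpha> \<phi> + u * \<beta> \<phi> + \<kappa> \<phi> * \<beta> \<phi> / u)\<^sup>2"
      unfolding Z_def by (rule id(2)) (use u in simp)
    \<comment> \<open>When the square is expanded, \<open>\<kappa>\<close> enters the mixed term
      only as \<open>\<kappa> * x = y\<close>. The term with \<open>\<kappa>\<^sup>2\<close>, which
      could be large, has the favourable sign and is dropped.\<close>
    moreover have "\<alpha> \<phi> * (x \<phi> * (2 * \<alpha> \<phi> + u * \<beta> \<phi>)\<^sup>2 + 2 * y \<phi> * \<beta> \<phi> * (2 * \<alpha> \<phi> + u * \<beta> \<phi>) / u) \<le> x \<phi> * (\<alpha> \<phi> * (2 * \<alpha> \<phi> + u * \<beta> \<phi> + \<kappa> \<phi> * \<beta> \<phi> / u)\<^sup>2)"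
    proof -
      have "x \<phi> * (2 * \<alpha> \<phi> + u * \<beta> \<phi> + \<kappa> \<phi> * \<beta> \<phi> / u)\<^sup>2 = x \<phi> * (2 * \<alpha> \<phi> + u * \<beta> \<phi>)\<^sup>2 + 2 * (\<kappa> \<phi> * x \<phi>) * \<beta> \<phi> * (2 * \<alpha> \<phi> + u * \<beta> \<phi>) / u + x \<phi> * (\<kappa> \<phi> * \<beta> \<phi> / u)\<^sup>2"
        by (simp add: power2_eq_square algebra_simps add_divide_distrib)
      then have "x \<phi> * (2 * \<alpha> \<phi> + u * \<beta> \<phi>)\<^sup>2 + 2 * y \<phi> * \<beta> \<phi> * (2 * \<alpha> \<phi> + u * \<beta> \<phi>) / u \<le> x \<phi> * (2 * \<alpha> \<phi> + u * \<beta> \<phi> + \<kappa> \<phi> * \<beta> \<phi> / u)\<^sup>2"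
        using x(1)[OF i] by (simp add: \<kappa>x)
      from mult_left_mono[OF this \<alpha>\<beta>(1)[OF i]] show ?thesis by (simp add: mult_ac)
    qed
    moreover have "\<Lambda> \<phi> * NE \<phi> - \<alpha> \<phi> * (x \<phi> * (2 * \<alpha> \<phi> + u * \<beta> \<phi>)\<^sup>2 + 2 * y \<phi> * \<beta> \<phi> * (2 * \<alpha> \<phi> + u * \<beta> \<phi>) / u) \<le> - (1/2) * (\<Lambda> \<phi>) ^ 3"
      unfolding NE \<Lambda>_def by (intro curvature_inequality \<alpha>\<beta>[OF i] u less_imp_le x(1,2)[OF i] y(1,2)[OF i])
    ultimately have "\<Lambda> \<phi> * NE \<phi> - x \<phi> * (q \<phi> * (Z \<phi>)\<^sup>2) \<le> - (1/2) * (\<Lambda> \<phi>) ^ 3" by simp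
    then have "(\<Lambda> \<phi> * NE \<phi> - x \<phi> * (q \<phi> * (Z \<phi>)\<^sup>2)) / (\<Lambda> \<phi>)\<^sup>2 \<le> - (1/2) * (\<Lambda> \<phi>) ^ 3 / (\<Lambda> \<phi>)\<^sup>2" by (rule divide_right_mono) simp
    also have "(\<Lambda> \<phi> * NE \<phi> - x \<phi> * (q \<phi> * (Z \<phi>)\<^sup>2)) / (\<Lambda> \<phi>)\<^sup>2 = E2 \<phi>"
      using \<Lambda>\<mu>(2)[OF i] by (simp add: E2_def diff_divide_distrib power2_eq_square)
    also have "- (1/2) * (\<Lambda> \<phi>) ^ 3 / (\<Lambda> \<phi>)\<^sup>2 = - (1/2) * \<Lambda> \<phi>" using \<Lambda>\<mu>(2)[OF i] by (simp add: power2_eq_square power3_eq_cube)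
    finally show ?thesis .
  qed
  have u\<Lambda>: "ubounded I (\<lambda>\<phi>. of_real (1 / \<Lambda> \<phi>))"
  proof (rule uboundedI[of _ _ "1 / \<mu>"])
    fix \<phi> assume i: "\<phi> \<in> I"
    have "1 / \<Lambda> \<phi> \<le> 1 / \<mu>" using \<Lambda>\<mu>[OF i] \<mu> by (intro divide_left_mono) auto
    then show "cmod (of_real (1 / \<Lambda> \<phi>)) \<le> 1 / \<mu>" using \<Lambda>\<mu>[OF i] unfolding norm_of_real by simp
  qed
  define \<delta>2 where "\<delta>2 \<phi> \<zeta> = (D2 \<phi> * T1 \<phi> \<zeta> + L \<phi> \<zeta> * S \<phi> \<zeta>) / \<Lambda> \<phi> - 1" for \<phi> \<zeta>
  have J2: "has_jet I (\<lambda>\<phi> \<zeta>. of_real (\<delta>2 \<phi> \<zeta>)) (\<lambda>_. 0) (\<lambda>\<phi>. of_real (- Z \<phi> / \<Lambda> \<phi>) * (cnj (p \<phi>) * a1 \<phi>))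
     (\<lambda>\<phi>. of_real (- Z \<phi> / \<Lambda> \<phi>) * (p \<phi> * cnj (a1 \<phi>))) (\<lambda>\<phi>. of_real (NE \<phi> / \<Lambda> \<phi>))"
    by (rule has_jet_cong[OF has_jet_diff[OF has_jet_cmult[OF u\<Lambda> N] One]]) (use \<Lambda>\<mu> in \<open>force simp: \<delta>2_def\<close>)+
  \<comment> \<open>A holomorphic function with value 1 at the centre. The logarithm of its squared
    modulus is harmonic nearby, so it adds nothing to the mixed coefficient.\<close>
  define K where "K \<phi> \<zeta> = (d1 \<phi> * vderiv \<phi> \<zeta> $ a + ip (vderiv \<phi> \<zeta>) (d \<phi>)) / of_real (\<Lambda> \<phi>)" for \<phi> \<zeta>
  obtain k where K: "has_jet I K (\<lambda>_. 1) k (\<lambda>_. 0) (\<lambda>_. 0)"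
  proof -
    have V: "has_jet I (\<lambda>\<phi> \<zeta>. vderiv \<phi> \<zeta> $ j) (\<lambda>\<phi>. vderiv \<phi> 0 $ j) (\<lambda>\<phi>. deriv (\<lambda>\<zeta>. vderiv \<phi> \<zeta> $ j) 0) (\<lambda>_. 0) (\<lambda>_. 0)" for j
    proof (rule has_jet_holomorphic[of "R/2" I _ "4 / R"])
      fix \<phi> assume i: "\<phi> \<in> I"
      have "deriv (\<lambda>\<zeta>. \<phi> \<zeta> $ j) holomorphic_on ball 0 (R/2)"
        using R by (intro holomorphic_on_subset[OF holomorphic_deriv[OF holj[OF i] open_ball]]) auto
      then show "(\<lambda>\<zeta>. vderiv \<phi> \<zeta> $ j) holomorphic_on ball 0 (R/2)" by (simp add: vderiv_def)
      show "cmod (vderiv \<phi> \<zeta> $ j) \<le> 4 / R" if "cmod \<zeta> < R/2" for \<zeta>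
        using higher_deriv_bound[OF R holj[OF i] bdj[OF i], of \<zeta> 1 j] that R by (simp add: vderiv_def)
    qed (use R in simp)
    have ud: "ubounded I (\<lambda>\<phi>. cnj (d \<phi> $ j))" for j
      by (rule bigO_unif_cong[OF bigO_unif_cnj[OF ubounded_mult[OF uc bj[of j]]]]) (simp add: d_def)
    have "has_jet I (\<lambda>\<phi> \<zeta>. of_real (1 / \<Lambda> \<phi>) * (d1 \<phi> * vderiv \<phi> \<zeta> $ a + (\<Sum>j\<in>UNIV-{a}. cnj (d \<phi> $ j) * vderiv \<phi> \<zeta> $ j)))
       (\<lambda>\<phi>. of_real (1 / \<Lambda> \<phi>) * (d1 \<phi> * vderiv \<phi> 0 $ a + (\<Sum>j\<in>UNIV-{a}. cnj (d \<phi> $ j) * vderiv \<phi> 0 $ j)))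
       (\<lambda>\<phi>. of_real (1 / \<Lambda> \<phi>) * (d1 \<phi> * deriv (\<lambda>\<zeta>. vderiv \<phi> \<zeta> $ a) 0 + (\<Sum>j\<in>UNIV-{a}. cnj (d \<phi> $ j) * deriv (\<lambda>\<zeta>. vderiv \<phi> \<zeta> $ j) 0)))
       (\<lambda>\<phi>. of_real (1 / \<Lambda> \<phi>) * (d1 \<phi> * 0 + (\<Sum>j\<in>UNIV-{a}. cnj (d \<phi> $ j) * 0))) (\<lambda>\<phi>. of_real (1 / \<Lambda> \<phi>) * (d1 \<phi> * 0 + (\<Sum>j\<in>UNIV-{a}. cnj (d \<phi> $ j) * 0)))"
      by (intro has_jet_cmult has_jet_add has_jet_sum V u\<Lambda> ud ud1) auto
    then show thesis
    proof (rule that[OF has_jet_cong])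
      fix \<phi> assume i: "\<phi> \<in> I"
      have s: "(\<Sum>j\<in>UNIV-{a}. cnj (d \<phi> $ j) * vderiv \<phi> \<zeta> $ j) = ip (vderiv \<phi> \<zeta>) (d \<phi>)" for \<zeta> by (simp add: hin_def mult.commute)
      show "of_real (1 / \<Lambda> \<phi>) * (d1 \<phi> * vderiv \<phi> \<zeta> $ a + (\<Sum>j\<in>UNIV-{a}. cnj (d \<phi> $ j) * vderiv \<phi> \<zeta> $ j)) = K \<phi> \<zeta>" for \<zeta>
        unfolding s K_def by simp
      have "d1 \<phi> * a1 \<phi> = of_real (\<alpha> \<phi>)" by (simp add: d1_def \<alpha>_def qc mult.commute)
      moreover have "ip (b \<phi>) (d \<phi>) = of_real (\<beta> \<phi>)" by (simp add: d_def hin_scale_right hin_self \<beta>_def c_def nb_def)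
      ultimately have "d1 \<phi> * vderiv \<phi> 0 $ a + ip (vderiv \<phi> 0) (d \<phi>) = of_real (\<Lambda> \<phi>)" by (simp add: a1_def b_def \<Lambda>_def)
      then show "of_real (1 / \<Lambda> \<phi>) * (d1 \<phi> * vderiv \<phi> 0 $ a + (\<Sum>j\<in>UNIV-{a}. cnj (d \<phi> $ j) * vderiv \<phi> 0 $ j)) = 1"
        unfolding s using \<Lambda>\<mu>[OF i] by simp
    qed (rule refl | simp)+
  qed
  define \<delta>1 where "\<delta>1 \<phi> \<zeta> = (cmod (K \<phi> \<zeta>))\<^sup>2 - 1" for \<phi> \<zeta>
  have J1: "has_jet I (\<lambda>\<phi> \<zeta>. of_real (\<delta>1 \<phi> \<zeta>)) (\<lambda>_. 0) k (\<lambda>\<phi>. cnj (k \<phi>)) (\<lambda>\<phi>. k \<phi> * cnj (k \<phi>))"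
    by (rule has_jet_cong[OF has_jet_diff[OF has_jet_mult[OF K has_jet_cnj[OF K]] One]]) (simp_all add: \<delta>1_def cmod_sq_cnj)
  have J: "has_jet I (\<lambda>\<phi> \<zeta>. of_real (ln (1 + \<delta>1 \<phi> \<zeta>) - ln (1 + \<delta>2 \<phi> \<zeta>))) (\<lambda>_. of_real 0) (\<lambda>\<phi>. k \<phi> - of_real (- Z \<phi> / \<Lambda> \<phi>) * (cnj (p \<phi>) * a1 \<phi>))
     (\<lambda>\<phi>. cnj (k \<phi>) - of_real (- Z \<phi> / \<Lambda> \<phi>) * (p \<phi> * cnj (a1 \<phi>))) (\<lambda>\<phi>. of_real (- E2 \<phi>))"
  proof (rule has_jet_cong[OF has_jet_diff[OF has_jet_ln(1)[OF J1 refl] has_jet_ln(1)[OF J2 refl]]])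
    fix \<phi> assume i: "\<phi> \<in> I"
    have "(of_real (- Z \<phi> / \<Lambda> \<phi>) * (cnj (p \<phi>) * a1 \<phi>)) * (of_real (- Z \<phi> / \<Lambda> \<phi>) * (p \<phi> * cnj (a1 \<phi>))) = complex_of_real (x \<phi> * (q \<phi> * (Z \<phi>)\<^sup>2) / (\<Lambda> \<phi>)\<^sup>2)"
      by (simp add: xc qc power2_eq_square mult_ac)
    then show "k \<phi> * cnj (k \<phi>) - k \<phi> * cnj (k \<phi>) - (of_real (NE \<phi> / \<Lambda> \<phi>) - of_real (- Z \<phi> / \<Lambda> \<phi>) * (cnj (p \<phi>) * a1 \<phi>) * (of_real (- Z \<phi> / \<Lambda> \<phi>) * (p \<phi> * cnj (a1 \<phi>)))) = of_real (- E2 \<phi>)"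
      by (simp only: E2_def of_real_diff of_real_minus diff_self) simp
  qed simp_all
  obtain C r0 where r0: "r0 > 0" and C: "\<And>\<phi> r. \<phi> \<in> I \<Longrightarrow> 0 < r \<Longrightarrow> r < r0 \<Longrightarrow>
      \<bar>cross_mean (\<lambda>\<zeta>. ln (1 + \<delta>1 \<phi> \<zeta>) - ln (1 + \<delta>2 \<phi> \<zeta>)) 0 r - (0 + - E2 \<phi> * r\<^sup>2)\<bar> \<le> C * r ^ 3"
    using has_jet_cross_mean[OF J] by blast
  obtain r1 where r1: "r1 > 0" "\<And>\<phi> \<zeta>. \<phi> \<in> I \<Longrightarrow> cmod \<zeta> \<le> r1 \<Longrightarrow> \<bar>\<delta>1 \<phi> \<zeta>\<bar> \<le> 1/2" using has_jet_ln(2)[OF J1 refl] by blast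
  obtain r2 where r2: "r2 > 0" "\<And>\<phi> \<zeta>. \<phi> \<in> I \<Longrightarrow> cmod \<zeta> \<le> r2 \<Longrightarrow> \<bar>\<delta>2 \<phi> \<zeta>\<bar> \<le> 1/2" using has_jet_ln(2)[OF J2 refl] by blast
  obtain r3 where r3: "r3 > 0" "\<And>\<phi> \<zeta>. \<phi> \<in> I \<Longrightarrow> cmod \<zeta> \<le> r3 \<Longrightarrow> \<bar>W \<phi> \<zeta>\<bar> \<le> 1/4"
    using bigO_unif_small[OF has_jet_vanishing[OF W refl], of "1/4"] by auto
  \<comment> \<open>The duality inequality with the majorant inserted. It also shows that the
    squared speed is positive near the centre, so that its logarithm is meaningful.\<close>
  have lb: "ln (\<Lambda> \<phi>) + (ln (1 + \<delta>1 \<phi> \<zeta>) - ln (1 + \<delta>2 \<phi> \<zeta>)) \<le> ln (wuQ (\<phi> \<zeta>) (vderiv \<phi> \<zeta>))"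
    if i: "\<phi> \<in> I" and z: "cmod \<zeta> \<le> r1" "cmod \<zeta> \<le> r2" "cmod \<zeta> \<le> r3" "cmod \<zeta> < R" for \<phi> \<zeta>
  proof -
    define l where "l = wuQ (\<phi> \<zeta>) (vderiv \<phi> \<zeta>)"
    have e: "\<phi> \<zeta> \<in> egg a m" using \<phi>(2)[OF i z(4)] .
    have w: "nq (\<phi> \<zeta>) \<le> 1/4" using r3(2)[OF i z(3)] by (simp add: W_def)
    have l0: "l \<ge> 0" unfolding l_def by (rule wuQ_nonneg[OF e])
    have pos: "1 + \<delta>1 \<phi> \<zeta> > 0" "1 + \<delta>2 \<phi> \<zeta> > 0" using r1(2)[OF i z(1)] r2(2)[OF i z(2)] by auto
    have "(\<Lambda> \<phi>)\<^sup>2 * (1 + \<delta>1 \<phi> \<zeta>) = (cmod (d1 \<phi> * vderiv \<phi> \<zeta> $ a + ip (vderiv \<phi> \<zeta>) (d \<phi>)))\<^sup>2"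
      using \<Lambda>\<mu>(2)[OF i] by (simp add: \<delta>1_def K_def norm_divide power_divide)
    also have "\<dots> \<le> l * dual_sq (d1 \<phi>) (d \<phi>) (\<phi> \<zeta>)" unfolding l_def by (rule wuQ_dual(1)[OF e])
    also have "\<dots> \<le> l * (D2 \<phi> * T1 \<phi> \<zeta> + L \<phi> \<zeta> * S \<phi> \<zeta>)"
      using dual_sq_le[OF e w, of "d1 \<phi>" "d \<phi>" "p \<phi>"] l0
      by (intro mult_left_mono) (simp_all add: T1_def L_def S_def Y_def W_def X_def y_def \<kappa>_def D2(2)[OF i])
    also have "\<dots> = l * (\<Lambda> \<phi> * (1 + \<delta>2 \<phi> \<zeta>))" using \<Lambda>\<mu>(2)[OF i] by (simp add: \<delta>2_def)
    finally have "\<Lambda> \<phi> * (\<Lambda> \<phi> * (1 + \<delta>1 \<phi> \<zeta>)) \<le> \<Lambda> \<phi> * (l * (1 + \<delta>2 \<phi> \<zeta>))" by (simp add: power2_eq_square mult_ac)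
    then have le: "\<Lambda> \<phi> * (1 + \<delta>1 \<phi> \<zeta>) \<le> l * (1 + \<delta>2 \<phi> \<zeta>)" using \<Lambda>\<mu>(2)[OF i] by simp
    then have "0 < l * (1 + \<delta>2 \<phi> \<zeta>)" using mult_pos_pos[OF \<Lambda>\<mu>(2)[OF i] pos(1)] by linarith
    then have "l > 0" using pos(2) by (simp add: zero_less_mult_iff)
    have "ln (\<Lambda> \<phi> * (1 + \<delta>1 \<phi> \<zeta>)) \<le> ln (l * (1 + \<delta>2 \<phi> \<zeta>))" using le \<Lambda>\<mu>(2)[OF i] pos \<open>l > 0\<close> by simp
    then show ?thesis using \<Lambda>\<mu>(2)[OF i] pos \<open>l > 0\<close> by (simp add: ln_mult l_def)
  qed
  show ?thesis unfolding I_def[symmetric]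
  proof (rule exI[where x=C], rule exI[where x="min (min r0 r1) (min (min r2 r3) R)"], intro conjI ballI allI impI)
    fix \<phi> r assume i: "\<phi> \<in> I" and r: "0 < r \<and> r < min (min r0 r1) (min (min r2 r3) R)"
    let ?G = "\<lambda>\<zeta>. ln (1 + \<delta>1 \<phi> \<zeta>) - ln (1 + \<delta>2 \<phi> \<zeta>)"
    have "E2 \<phi> * r\<^sup>2 \<le> (- (1/2) * \<Lambda> \<phi>) * r\<^sup>2" using E2[OF i] by (rule mult_right_mono) simp
    moreover have "- E2 \<phi> * r\<^sup>2 - C * r ^ 3 \<le> cross_mean ?G 0 r" using C[OF i, of r] r by auto
    moreover have "ln (\<Lambda> \<phi>) + cross_mean ?G 0 r \<le> cross_mean (\<lambda>\<zeta>. ln (wuQ (\<phi> \<zeta>) (vderiv \<phi> \<zeta>))) 0 r"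
    proof -
      have "cross_mean (\<lambda>\<zeta>. ln (\<Lambda> \<phi>) + ?G \<zeta>) 0 r \<le> cross_mean (\<lambda>\<zeta>. ln (wuQ (\<phi> \<zeta>) (vderiv \<phi> \<zeta>))) 0 r"
        by (intro cross_mean_mono lb[OF i]) (use r in auto)
      then show ?thesis by (simp only: cross_mean_const_add)
    qed
    ultimately show "ln (wuQ (\<phi> 0) (vderiv \<phi> 0)) + r\<^sup>2 * (1/2 * wuQ (\<phi> 0) (vderiv \<phi> 0)) - C * r ^ 3 \<le> cross_mean (\<lambda>\<zeta>. ln (wuQ (\<phi> \<zeta>) (vderiv \<phi> \<zeta>))) 0 r"
      using \<Lambda>[OF i] by (simp add: b_def mult.commute)
  qed (use r0 r1 r2 r3 R in auto)
qed
end

section \<open>From the axis to arbitrary discs\<close>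

context egg_dom begin

lemma continuous_on_wuQ_curve:
  assumes \<phi>: "holomorphic_map_on \<phi> V" "open V" "\<phi> ` V \<subseteq> egg a m"
  shows "continuous_on V (\<lambda>\<zeta>. wuQ (\<phi> \<zeta>) (vderiv \<phi> \<zeta>))" and "continuous_on V (\<lambda>\<zeta>. tt (\<phi> \<zeta>))"
proof -
  have c: "continuous_on V (\<lambda>\<zeta>. \<phi> \<zeta> $ j)" for j
    using \<phi>(1) by (auto simp: holomorphic_map_on_def intro: holomorphic_on_imp_continuous_on)
  have cv: "continuous_on V (\<lambda>\<zeta>. vderiv \<phi> \<zeta> $ j)" for j
    using holomorphic_deriv[of "\<lambda>\<zeta>. \<phi> \<zeta> $ j" V] \<phi>(1,2) by (auto simp: holomorphic_map_on_def vderiv_def intro: holomorphic_on_imp_continuous_on)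
  have cs: "continuous_on V (\<lambda>\<zeta>. sg (\<phi> \<zeta>))" unfolding sg_def nsq_def by (intro continuous_intros c)
  have ci: "continuous_on V (\<lambda>\<zeta>. ip (vderiv \<phi> \<zeta>) (\<phi> \<zeta>))" unfolding hin_def by (intro continuous_intros c cv)
  have s: "sg (\<phi> \<zeta>) > 0" "AA (\<phi> \<zeta>) > 0" "tt (\<phi> \<zeta>) < 1" "tt (\<phi> \<zeta>) powr m < 1" if "\<zeta> \<in> V" for \<zeta>
    using egg_sg egg_tt egg_ttm AA_pos \<phi>(3) that by blast+
  have ne: "sg (\<phi> \<zeta>) \<noteq> 0" "AA (\<phi> \<zeta>) \<noteq> 0" "tt (\<phi> \<zeta>) \<noteq> 1" "tt (\<phi> \<zeta>) powr m \<noteq> 1" if "\<zeta> \<in> V" for \<zeta>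
    using s[OF that] by auto
  have cA: "continuous_on V (\<lambda>\<zeta>. AA (\<phi> \<zeta>))" unfolding AA_def by (intro continuous_on_powr cs continuous_on_const) (simp add: ne)
  show ct: "continuous_on V (\<lambda>\<zeta>. tt (\<phi> \<zeta>))" unfolding tt_def
    by (intro continuous_on_divide continuous_on_power continuous_on_norm c cA) (simp add: ne)
  have ctm: "continuous_on V (\<lambda>\<zeta>. tt (\<phi> \<zeta>) powr m)"
    by (intro continuous_on_powr' ct continuous_intros) (use s tt_nonneg in auto)
  have cB: "continuous_on V (\<lambda>\<zeta>. BB (\<phi> \<zeta>) (vderiv \<phi> \<zeta>))" unfolding BB_def nsq_def
    by (intro continuous_on_add continuous_on_divide continuous_on_power continuous_on_norm continuous_on_sum cs ci cv) (simp_all add: ne)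
  show "continuous_on V (\<lambda>\<zeta>. wuQ (\<phi> \<zeta>) (vderiv \<phi> \<zeta>))" unfolding wuQ_def
    by (intro continuous_on_add continuous_on_divide continuous_on_power continuous_on_norm continuous_on_mult continuous_on_diff continuous_on_of_real continuous_on_const
        c cv cs ci cA ct ctm cB) (simp_all add: ne)
qed

text \<open>Compactness of \<open>K\<close> supplies a lower bound for the squared speed and a bound
  of \<open>tt\<close> away from 1. Each disc is recentred at its point and moved to the axis by an
  automorphism, which preserves \<open>wuQ\<close> and \<open>tt\<close>. One class of centred discs
  therefore gives constants valid on all of \<open>K\<close>.\<close>

lemma wuQ_log_mean:
  assumes \<phi>: "holomorphic_map_on \<phi> V" "open V" "\<phi> ` V \<subseteq> egg a m" "\<And>\<zeta>. \<zeta> \<in> V \<Longrightarrow> vderiv \<phi> \<zeta> \<noteq> 0"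
    and K: "compact K" "K \<subseteq> V"
  shows "\<exists>C r0. r0 > 0 \<and> (\<forall>z\<in>K. \<forall>r. 0 < r \<and> r < r0 \<longrightarrow>
     cross_mean (\<lambda>\<zeta>. ln (wuQ (\<phi> \<zeta>) (vderiv \<phi> \<zeta>))) z r \<ge> ln (wuQ (\<phi> z) (vderiv \<phi> z)) + r\<^sup>2 * (1/2 * wuQ (\<phi> z) (vderiv \<phi> z)) - C * r ^ 3)"
proof (cases "K = {}")
  case False
  obtain R where R: "R > 0" "(\<Union>x\<in>K. ball x R) \<subseteq> V"
    by (rule compact_subset_open_imp_ball_epsilon_subset[OF K(1) \<phi>(2) K(2)])
  have cQ: "continuous_on K (\<lambda>\<zeta>. wuQ (\<phi> \<zeta>) (vderiv \<phi> \<zeta>))"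
    using continuous_on_wuQ_curve(1)[OF \<phi>(1-3)] K(2) continuous_on_subset by blast
  have sV: "sg (\<phi> \<zeta>) > 0" "\<phi> \<zeta> \<in> egg a m" if "\<zeta> \<in> V" for \<zeta> using \<phi>(3) that egg_sg by blast+
  have ct: "continuous_on K (\<lambda>\<zeta>. tt (\<phi> \<zeta>))"
    using continuous_on_wuQ_curve(2)[OF \<phi>(1-3)] K(2) continuous_on_subset by blast
  obtain z0 where z0: "z0 \<in> K" "\<And>z. z \<in> K \<Longrightarrow> wuQ (\<phi> z0) (vderiv \<phi> z0) \<le> wuQ (\<phi> z) (vderiv \<phi> z)"
    using continuous_attains_inf[OF K(1) False cQ] by blast
  obtain z1 where z1: "z1 \<in> K" "\<And>z. z \<in> K \<Longrightarrow> tt (\<phi> z) \<le> tt (\<phi> z1)"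
    using continuous_attains_sup[OF K(1) False ct] by blast
  define \<mu> where "\<mu> = wuQ (\<phi> z0) (vderiv \<phi> z0)"
  define \<delta> where "\<delta> = 1 - tt (\<phi> z1)"
  have \<mu>: "\<mu> > 0" unfolding \<mu>_def using z0(1) K(2) sV \<phi>(4) by (intro wuQ_pos) auto
  have \<delta>: "\<delta> > 0" unfolding \<delta>_def using egg_tt[of "\<phi> z1"] z1(1) K(2) sV by auto
  obtain C r0 where r0: "r0 > 0" and C: "\<And>\<phi> r. \<phi> \<in> centered_discs R \<delta> \<mu> \<Longrightarrow> 0 < r \<Longrightarrow> r < r0 \<Longrightarrow>
     ln (wuQ (\<phi> 0) (vderiv \<phi> 0)) + r\<^sup>2 * (1/2 * wuQ (\<phi> 0) (vderiv \<phi> 0)) - C * r ^ 3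
       \<le> cross_mean (\<lambda>\<zeta>. ln (wuQ (\<phi> \<zeta>) (vderiv \<phi> \<zeta>))) 0 r"
    using centered_discs_log_mean[OF R(1) \<delta> \<mu>] by blast
  show ?thesis
  proof (rule exI[where x=C], rule exI[where x="min r0 R"], intro conjI ballI allI impI)
    fix z r assume z: "z \<in> K" and r: "0 < r \<and> r < min r0 R"
    define \<psi> where "\<psi> \<zeta> = \<phi> (z + \<zeta>)" for \<zeta>
    have V: "z + \<zeta> \<in> V" if "cmod \<zeta> < R" for \<zeta> using R(2) z that by (force simp: dist_norm)
    have d: "((\<lambda>w. \<psi> w $ j) has_field_derivative vderiv \<phi> (z + \<zeta>) $ j) (at \<zeta>)" if "\<zeta> \<in> ball 0 R" for \<zeta> j
    proof -
      have "((\<lambda>w. \<phi> w $ j) has_field_derivative vderiv \<phi> (z + \<zeta>) $ j) (at (z + \<zeta>))"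
        using that by (intro holomorphic_map_derivative[OF \<phi>(1,2)] V) simp
      then show ?thesis unfolding \<psi>_def by (simp add: DERIV_shift add.commute)
    qed
    have \<psi>: "holomorphic_map_on \<psi> (ball 0 R)" "\<And>\<zeta>. \<zeta> \<in> ball 0 R \<Longrightarrow> vderiv \<psi> \<zeta> = vderiv \<phi> (z + \<zeta>)"
      by (rule holomorphic_mapI_deriv[OF open_ball], rule d, assumption+)+
    have s\<psi>: "sg (\<psi> \<zeta>) > 0" "\<psi> \<zeta> \<in> egg a m" if "\<zeta> \<in> ball 0 R" for \<zeta> unfolding \<psi>_def using sV V that by auto
    have sz: "sg (\<phi> z) > 0" using sV z K(2) by auto
    have c: "holomorphic_map_on (\<lambda>\<zeta>. psi (\<phi> z) (\<psi> \<zeta>)) (ball 0 R)"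
      "\<And>\<zeta>. \<zeta> \<in> ball 0 R \<Longrightarrow> vderiv (\<lambda>\<zeta>. psi (\<phi> z) (\<psi> \<zeta>)) \<zeta> = dpsi (\<phi> z) (\<psi> \<zeta>) (vderiv \<psi> \<zeta>)"
      by (rule psi_comp[OF _ open_ball sz s\<psi>(1)], rule \<psi>(1), assumption+)+
    let ?\<chi> = "\<lambda>\<zeta>. psi (\<phi> z) (\<psi> \<zeta>)"
    have q: "wuQ (?\<chi> \<zeta>) (vderiv ?\<chi> \<zeta>) = wuQ (\<phi> (z + \<zeta>)) (vderiv \<phi> (z + \<zeta>))" if "\<zeta> \<in> ball 0 R" for \<zeta>
      unfolding c(2)[OF that] wuQ_psi[OF sz s\<psi>(1)[OF that]] \<psi>(2)[OF that] by (simp add: \<psi>_def)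
    have q0: "wuQ (?\<chi> 0) (vderiv ?\<chi> 0) = wuQ (\<phi> z) (vderiv \<phi> z)" using q[of 0] R by simp
    have "?\<chi> \<in> centered_discs R \<delta> \<mu>"
      unfolding centered_discs_def
    proof (intro CollectI conjI)
      show "holomorphic_map_on ?\<chi> (ball 0 R)" by (rule c(1))
      show "?\<chi> ` ball 0 R \<subseteq> egg a m" using psi_egg[OF sz s\<psi>(2)] by blast
      show p: "\<exists>p. ?\<chi> 0 = jn p 0" using sg_psi_self[OF sz] by (simp add: \<psi>_def)
      show "\<mu> \<le> wuQ (?\<chi> 0) (vderiv ?\<chi> 0)" unfolding q0 \<mu>_def using z0(2)[OF z] .
      obtain p where p: "?\<chi> 0 = jn p 0" using p by blast
      have "tt (jn p 0) = tt (\<phi> z)" using tt_psi[OF sz sz] p by (simp add: \<psi>_def)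
      moreover have "tt (jn p 0) = (cmod p)\<^sup>2" by (simp add: tt_def AA_def sg_def nsq_def)
      ultimately have "(cmod (?\<chi> 0 $ a))\<^sup>2 = tt (\<phi> z)" using p by simp
      then show "(cmod (?\<chi> 0 $ a))\<^sup>2 \<le> 1 - \<delta>" using z1(2)[OF z] by (simp add: \<delta>_def)
    qed
    then have "ln (wuQ (\<phi> z) (vderiv \<phi> z)) + r\<^sup>2 * (1/2 * wuQ (\<phi> z) (vderiv \<phi> z)) - C * r ^ 3
       \<le> cross_mean (\<lambda>\<zeta>. ln (wuQ (?\<chi> \<zeta>) (vderiv ?\<chi> \<zeta>))) 0 r" using C[of ?\<chi> r] r unfolding q0 by simp
    also have "\<dots> = cross_mean (\<lambda>\<zeta>. ln (wuQ (\<phi> \<zeta>) (vderiv \<phi> \<zeta>))) z r"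
      using r q by (simp add: cross_mean_def norm_mult)
    finally show "ln (wuQ (\<phi> z) (vderiv \<phi> z)) + r\<^sup>2 * (1/2 * wuQ (\<phi> z) (vderiv \<phi> z)) - C * r ^ 3
       \<le> cross_mean (\<lambda>\<zeta>. ln (wuQ (\<phi> \<zeta>) (vderiv \<phi> \<zeta>))) z r" .
  qed (use r0 R in auto)
qed (auto intro: exI[of _ 1])

lemma wu_metric_curvature: "hol_curvature_bounded_by_neg (wu_metric (egg a m)) (egg a m) (1/2)"
  unfolding hol_curvature_bounded_by_neg_def
proof (intro allI impI, elim conjE)
  fix S V and \<phi> :: "complex \<Rightarrow> complex^'n"
  assume S: "S \<subseteq> egg a m" and lp: "local_param S V \<phi>"
  then have \<phi>: "holomorphic_map_on \<phi> V" "open V" "\<And>\<zeta>. \<zeta> \<in> V \<Longrightarrow> vderiv \<phi> \<zeta> \<noteq> 0"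
    by (auto simp: local_param_def)
  have im: "\<phi> ` V \<subseteq> egg a m" using lp S unfolding local_param_def homeomorphism_def by blast
  have ind: "induced_metric (wu_metric (egg a m)) \<phi> \<zeta> = wuQ (\<phi> \<zeta>) (vderiv \<phi> \<zeta>)" if "\<zeta> \<in> V" for \<zeta>
    using im that wu_metric_egg(1)[of "\<phi> \<zeta>"] wuH_form[of "\<phi> \<zeta>"] by (auto simp: induced_metric_def)
  let ?l = "\<lambda>\<zeta>. wuQ (\<phi> \<zeta>) (vderiv \<phi> \<zeta>)"
  have c: "continuous_on V ?l" by (rule continuous_on_wuQ_curve(1)[OF \<phi>(1,2) im])
  have pos: "?l \<zeta> > 0" if "\<zeta> \<in> V" for \<zeta> using im that \<phi>(3) by (intro wuQ_pos) auto
  have "ddbar_ge_distr V (\<lambda>\<zeta>. ln (?l \<zeta>)) (\<lambda>\<zeta>. 1/2 * ?l \<zeta>)"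
  proof (rule ddbar_ge_distrI[OF \<phi>(2)])
    show "continuous_on V (\<lambda>\<zeta>. ln (?l \<zeta>))" by (intro continuous_on_ln c) (use pos in force)
    show "continuous_on V (\<lambda>\<zeta>. 1/2 * ?l \<zeta>)" by (intro continuous_intros c)
  qed (rule wuQ_log_mean[OF \<phi>(1,2) im \<phi>(3)])
  then show "ddbar_ge_distr V (\<lambda>\<zeta>. ln (induced_metric (wu_metric (egg a m)) \<phi> \<zeta>)) (\<lambda>\<zeta>. 1/2 * induced_metric (wu_metric (egg a m)) \<phi> \<zeta>)"
  proof -
    have e: "(LINT \<zeta>:V|lborel. f (induced_metric (wu_metric (egg a m)) \<phi> \<zeta>) * g \<zeta>) = (LINT \<zeta>:V|lborel. f (?l \<zeta>) * g \<zeta>)"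
      for f g :: "_ \<Rightarrow> real" by (rule set_lebesgue_integral_cong) (use \<phi>(2) ind in auto)
    assume "ddbar_ge_distr V (\<lambda>\<zeta>. ln (?l \<zeta>)) (\<lambda>\<zeta>. 1/2 * ?l \<zeta>)"
    then show ?thesis unfolding ddbar_ge_distr_def e[of ln] e[of "\<lambda>t. 1/2 * t"] .
  qed
qed

end

theorem theorem1p2:
  fixes a :: "'n::finite"
  assumes "CARD('n) \<ge> 2"
  shows
    "(\<forall>m::real. 1/2 < m \<and> m < 1 \<longrightarrow>
        has_Ck_boundary 1 (egg a m) \<and> \<not> has_Ck_boundary 2 (egg a m) \<and>
        hermitian_metric_on (wu_metric (egg a m)) (egg a m) \<and>
        metric_Ck_on 1 (wu_metric (egg a m)) (egg a m) \<and>
        metric_real_analytic_on (wu_metric (egg a m)) (egg a m - egg_Z a m) \<and>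
        (\<forall>p\<in>egg_Z a m.
           (\<exists>U. open U \<and> p \<in> U \<and> U \<subseteq> egg a m \<and>
                metric_C1_holder_on (2 * m - 1) (wu_metric (egg a m)) U) \<and>
           \<not> (\<exists>U. open U \<and> p \<in> U \<and> U \<subseteq> egg a m \<and>
                metric_Ck_on 2 (wu_metric (egg a m)) U)))
     \<and>
     (hermitian_metric_on (wu_metric (egg a (1/2))) (egg a (1/2)) \<and>
        metric_continuous_on (wu_metric (egg a (1/2))) (egg a (1/2)) \<and>
        metric_real_analytic_on (wu_metric (egg a (1/2))) (egg a (1/2) - egg_Z a (1/2)))
     \<and>
     ((\<forall>m::real. 1/2 \<le> m \<and> m < 1 \<longrightarrow> nowhere_kahler_on (wu_metric (egg a m)) (egg a m)) \<and>
      (\<exists>c>0. \<forall>m::real. 1/2 \<le> m \<and> m < 1 \<longrightarrow>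
         hol_curvature_bounded_by_neg (wu_metric (egg a m)) (egg a m) c))"
proof -
  have dom: "egg_dom m" if "1/2 \<le> m" "m < 1" for m using that by (rule egg_dom.intro)
  \<comment> \<open>The dimension supplies a coordinate other than \<open>a\<close>, in which both
    the failure of second-order smoothness and the failure of the Kaehler condition are
    detected.\<close>
  obtain b where b: "b \<noteq> a"
  proof -
    have "UNIV \<noteq> {a}" using assms by (metis card.empty card.insert card_1_singleton_iff One_nat_def Suc_1 Suc_n_not_le_n)
    then show thesis using that by blast
  qed
  show ?thesis
  proof (intro conjI allI impI ballI exI[of _ "1/2::real"]; (elim conjE)?)
    fix m :: real assume "1/2 < m" "m < 1"
    then interpret egg_dom a m by (simp add: egg_dom.intro)
    show "has_Ck_boundary 1 (egg a m)" "metric_Ck_on 1 (wu_metric (egg a m)) (egg a m)"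
      using \<open>1/2 < m\<close> by (rule egg_C1_boundary wu_metric_C1)+
    show "\<not> has_Ck_boundary 2 (egg a m)" using \<open>1/2 < m\<close> b by (rule egg_not_C2_boundary)
    show "hermitian_metric_on (wu_metric (egg a m)) (egg a m)" by (rule wu_metric_hermitian)
    show "metric_real_analytic_on (wu_metric (egg a m)) (egg a m - egg_Z a m)" by (rule wu_metric_analytic)
    fix p assume p: "p \<in> egg_Z a m"
    show "\<exists>U. open U \<and> p \<in> U \<and> U \<subseteq> egg a m \<and> metric_C1_holder_on (2 * m - 1) (wu_metric (egg a m)) U"
      using \<open>1/2 < m\<close> p by (intro wu_metric_holder) (auto simp: egg_Z_def)
    show "\<not> (\<exists>U. open U \<and> p \<in> U \<and> U \<subseteq> egg a m \<and> metric_Ck_on 2 (wu_metric (egg a m)) U)"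
      using wu_metric_not_C2[OF b p] by blast
  next
    interpret egg_dom a "1/2" by (simp add: egg_dom.intro)
    show "hermitian_metric_on (wu_metric (egg a (1/2))) (egg a (1/2))" by (rule wu_metric_hermitian)
    show "metric_continuous_on (wu_metric (egg a (1/2))) (egg a (1/2))" by (rule wu_metric_continuous)
    show "metric_real_analytic_on (wu_metric (egg a (1/2))) (egg a (1/2) - egg_Z a (1/2))" by (rule wu_metric_analytic)
  next
    fix m :: real assume "1/2 \<le> m" "m < 1"
    then interpret egg_dom a m by (simp add: egg_dom.intro)
    show "nowhere_kahler_on (wu_metric (egg a m)) (egg a m)" using b by (rule nowhere_kahler)
    show "hol_curvature_bounded_by_neg (wu_metric (egg a m)) (egg a m) (1/2)" by (rule wu_metric_curvature)
  qed simp
qed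

end
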